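(* Let $n\geq 1$ and $q\in(0,1)$. Let $(X,A)$, $(Y,B)$, $(Z,C)$ be the $C^*$-correspondences, and $(\psi_X,\psi_A):(X,A)\to(Z,C)$, $(\omega_Y,\omega_B):(Y,B)\to(Z,C)$ the morphisms of $C^*$-correspondences, described in the context. Then the $C^*$-algebra $C(S^{2n}_{q,\beta})$ of the $2n$-dimensional mirror quantum sphere satisfies $$C(S^{2n}_{q,\beta})\cong\mathcal{O}_{X\oplus_Z Y},$$ where $X\oplus_Z Y$ is the restricted direct sum $C^*$-correspondence over $A\oplus_C B$.
   Context: General notions. For a right Hilbert $A$-module $X$, $\mathcal{L}(X)$ is the algebra of adjointable operators, $\theta_{\xi,\eta}(\zeta)=\xi\langle\eta,\zeta\rangle$, and $\mathcal{K}(X)=\overline{\operatorname{span}}\{\theta_{\xi,\eta}\}$. A $C^*$-correspondence $(X,A)$ is a right Hilbert $A$-module $X$ with a $*$-homomorphism $\phi_X:A\to\mathcal{L}(X)$. Put $J_X=\{a\in A:\phi_X(a)\in\mathcal{K}(X),\ ab=0\ \forall b\in\ker\phi_X\}$. A covariant representation of $(X,A)$ on a $C^*$-algebra $D$ is a pair of a linear map $\rho_X:X\to D$ and a $*$-homomorphism $\rho_A:A\to D$ with $\rho_X(\xi)^*\rho_X(\eta)=\rho_A(\langle\xi,\eta\rangle)$, $\rho_X(\phi_X(a)\xi)=\rho_A(a)\rho_X(\xi)$, and $\rho_A(a)=\rho_X^+(\phi_X(a))$ for $a\in J_X$, where $\rho_X^+:\mathcal{K}(X)\to D$ is the $*$-homomorphism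 with $\rho_X^+(\theta_{\xi,\eta})=\rho_X(\xi)\rho_X(\eta)^*$. $\mathcal{O}_X$ is the $C^*$-algebra generated by the universal covariant representation $(\pi_X,\pi_A)$. A morphism $(\psi_X,\psi_A):(X,A)\to(Z,C)$ is a pair of a linear map and a $*$-homomorphism with $\langle\psi_X(\xi),\psi_X(\eta)\rangle=\psi_A(\langle\xi,\eta\rangle)$, $\psi_X(\phi_X(a)\xi)=\phi_Z(\psi_A(a))\psi_X(\xi)$, $\psi_A(J_X)\subset J_Z$, and $\phi_Z(\psi_A(a))=\psi_X^+(\phi_X(a))$ for $a\in J_X$, where $\psi_X^+(\theta_{\xi,\eta})=\theta_{\psi_X(\xi),\psi_X(\eta)}$. Given morphisms $(\psi_X,\psi_A):(X,A)\to(Z,C)$, $(\omega_Y,\omega_B):(Y,B)\to(Z,C)$, let $A\oplus_C B=\{(a,b)\in A\oplus B:\psi_A(a)=\omega_B(b)\}$ and $X\oplus_Z Y=\{(\xi,\eta)\in X\oplus Y:\psi_X(\xi)=\omega_Y(\eta)\}$, a $C^*$-correspondence over $A\oplus_C B$ with coordinatewise right action, inner product and left action. The correspondence $(X,A)$: $X=\operatorname{span}\{w_{i,j}:1\le i\le n,\ i\le j\le n+1\}$ (the $w_{i,j}$ a basis), $A=\operatorname{span}\{P_1,\dots,P_{n+1}\}\cong\mathbb{C}^{n+1}$ with $P_i$ mutually orthogonal nonzero projections, $\langle w_{i,j},w_{k,l}\rangle=\delta_{i,k}\delta_{j,l}P_j$, $w_{i,j}P_k=\delta_{j,k}w_{i,j}$,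 $\phi_X(P_k)w_{i,j}=\delta_{i,k}w_{i,j}$. The correspondence $(Z,C)$: $Z=\operatorname{span}\{z_{i,j}:1\le i\le j\le n\}$, $C=\operatorname{span}\{S_1,\dots,S_n\}\cong\mathbb{C}^n$, with the same formulas: $\langle z_{i,j},z_{k,l}\rangle=\delta_{i,k}\delta_{j,l}S_j$, $z_{i,j}S_k=\delta_{j,k}z_{i,j}$, $\phi_Z(S_k)z_{i,j}=\delta_{i,k}z_{i,j}$. The correspondence $(Y,B)$: $B$ is the (commutative) $C^*$-algebra generated by mutually orthogonal nonzero projections $R_1,\dots,R_{n+1}$ and mutually orthogonal nonzero projections $Q_j$, $j\ge1$, with $Q_j\le R_n$. $Y$ is the closed span of $\{x_{i,j}:1\le i\le n-1,\ i\le j\le n+1\}\cup\{x_{i,n,j}:1\le i\le n-1,\ j\ge1\}\cup\{y,y'\}\cup\{y_i:i\ge1\}$, with inner products $\langle x_{i,j},x_{k,l}\rangle=\delta_{i,k}\delta_{j,l}R_j$, $\langle x_{i,j},x_{k,n,l}\rangle=\delta_{i,k}\delta_{j,n}Q_l$, $\langle x_{i,n,j},x_{k,n,l}\rangle=\delta_{i,k}\delta_{j,l}Q_j$, $\langle y,y\rangle=R_n$, $\langle y,y'\rangle=Q_1$, $\langle y,y_i\rangle=Q_{i+1}$, $\langle y',y'\rangle=Q_1$, $\langle y',y_i\rangle=0$, $\langle y_i,y_j\rangle=\delta_{i,j}Q_{i+1}$, and each $x_{i,j}$ and $x_{i,n,j}$ orthogonal to $y,y'$ and all $y_k$; right action $x_{i,j}R_k=\delta_{j,k}x_{i,j}$,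 $x_{i,j}Q_k=\delta_{j,n}x_{i,n,k}$, $x_{i,n,j}R_k=\delta_{n,k}x_{i,n,j}$, $x_{i,n,j}Q_k=\delta_{j,k}x_{i,n,j}$, $yR_k=\delta_{n,k}y$, $yQ_1=y'$, $yQ_k=y_{k-1}$ for $k\ge2$, $y'R_k=\delta_{n,k}y'$, $y'Q_k=\delta_{1,k}y'$, $y_iR_k=\delta_{n,k}y_i$, $y_iQ_k=\delta_{i+1,k}y_i$; left action $\phi_Y(R_k)x_{i,j}=\delta_{i,k}x_{i,j}$, $\phi_Y(R_k)x_{i,n,j}=\delta_{i,k}x_{i,n,j}$, $\phi_Y(R_k)y=\delta_{n,k}(y-y')+\delta_{n+1,k}y'$, $\phi_Y(R_k)y'=\delta_{n+1,k}y'$, $\phi_Y(R_k)y_i=\delta_{n,k}y_i$, $\phi_Y(Q_k)x_{i,j}=0$, $\phi_Y(Q_k)x_{i,n,j}=0$, $\phi_Y(Q_k)y=y_k$, $\phi_Y(Q_k)y'=0$, $\phi_Y(Q_k)y_i=\delta_{i,k}y_i$. The morphisms: $\psi_X(w_{i,j})=z_{i,j}$ for $j\le n$, $\psi_X(w_{i,n+1})=0$, $\psi_A(P_i)=S_i$ for $i\le n$, $\psi_A(P_{n+1})=0$; and $\omega_Y(x_{i,j})=z_{i,j}$ for $j\le n$, $\omega_Y(x_{i,n+1})=0$, $\omega_Y(x_{i,n,j})=0$, $\omega_Y(y)=z_{n,n}$, $\omega_Y(y')=\omega_Y(y_i)=0$, $\omega_B(R_i)=S_i$ for $i\le n$, $\omega_B(R_{n+1})=0$,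 $\omega_B(Q_j)=0$. The mirror quantum sphere: the quantum disc and odd quantum sphere algebras are identified with $C(\mathbb{D}^{2n}_q)=\mathcal{O}_X$ and $C(S^{2n-1}_q)=\mathcal{O}_Z$ (these are graph $C^*$-algebras, independent of $q$ up to isomorphism). The natural surjection $\pi:C(\mathbb{D}^{2n}_q)\to C(S^{2n-1}_q)$ is the $*$-homomorphism with $\pi(\pi_X(w_{i,j}))=\pi_Z(z_{i,j})$ for $j\le n$, $\pi(\pi_X(w_{i,n+1}))=0$, $\pi(\pi_A(P_i))=\pi_C(S_i)$ for $i\le n$, $\pi(\pi_A(P_{n+1}))=0$. The flip $\beta\in\operatorname{Aut}(\mathcal{O}_Z)$ is given by $\beta(\pi_Z(z_{n,n}))=\pi_Z(z_{n,n})^*$, $\beta(\pi_Z(z_{i,j}))=\pi_Z(z_{i,j})$ for $(i,j)\ne(n,n)$, $\beta(\pi_C(S_i))=\pi_C(S_i)$. Then $C(S^{2n}_{q,\beta})=\{(x,y)\in C(\mathbb{D}^{2n}_q)\oplus C(\mathbb{D}^{2n}_q):\pi(x)=\beta(\pi(y))\}$. *)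

theory Defs
  imports "HOL-Analysis.Analysis"
begin

section \<open>Complex vector spaces and \<open>C\<^sup>*\<close>-algebras with explicit carriers\<close>

record 'v cspace =
  carrier :: "'v set"
  vadd :: "'v \<Rightarrow> 'v \<Rightarrow> 'v"  (infixl "\<oplus>\<index>" 65)
  vzero :: 'v  ("\<zero>\<index>")
  vscale :: "complex \<Rightarrow> 'v \<Rightarrow> 'v"  (infixr "\<odot>\<index>" 75)

record 'a cstar = "'a cspace" +
  amult :: "'a \<Rightarrow> 'a \<Rightarrow> 'a"  (infixl "\<otimes>\<index>" 70)
  star :: "'a \<Rightarrow> 'a"
  nrm :: "'a \<Rightarrow> real"

locale complex_space =
  fixes V :: "('v, 'm) cspace_scheme" (structure)
  assumes zero_closed: "\<zero> \<in> carrier V"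
    and add_closed: "\<lbrakk>u \<in> carrier V; v \<in> carrier V\<rbrakk> \<Longrightarrow> u \<oplus> v \<in> carrier V"
    and scale_closed: "v \<in> carrier V \<Longrightarrow> c \<odot> v \<in> carrier V"
    and add_assoc: "\<lbrakk>u \<in> carrier V; v \<in> carrier V; w \<in> carrier V\<rbrakk>
                      \<Longrightarrow> (u \<oplus> v) \<oplus> w = u \<oplus> (v \<oplus> w)"
    and add_comm: "\<lbrakk>u \<in> carrier V; v \<in> carrier V\<rbrakk> \<Longrightarrow> u \<oplus> v = v \<oplus> u"
    and add_zero: "v \<in> carrier V \<Longrightarrow> v \<oplus> \<zero> = v"
    and scale_add_right: "\<lbrakk>u \<in> carrier V; v \<in> carrier V\<rbrakk>
                      \<Longrightarrow> c \<odot> (u \<oplus> v) = c \<odot> u \<oplus> c \<odot> v"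
    and scale_add_left: "v \<in> carrier V \<Longrightarrow> (c + d) \<odot> v = c \<odot> v \<oplus> d \<odot> v"
    and scale_scale: "v \<in> carrier V \<Longrightarrow> c \<odot> (d \<odot> v) = (c * d) \<odot> v"
    and scale_one: "v \<in> carrier V \<Longrightarrow> 1 \<odot> v = v"
    and scale_zero: "v \<in> carrier V \<Longrightarrow> 0 \<odot> v = \<zero>"

definition vdiff :: "('v, 'm) cspace_scheme \<Rightarrow> 'v \<Rightarrow> 'v \<Rightarrow> 'v" where
  "vdiff V u v = u \<oplus>\<^bsub>V\<^esub> (- 1) \<odot>\<^bsub>V\<^esub> v"

definition linear_map :: "('v, 'm) cspace_scheme \<Rightarrow> ('w, 'k) cspace_scheme \<Rightarrow> ('v \<Rightarrow> 'w) \<Rightarrow> bool" where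
  "linear_map V W f \<longleftrightarrow> f \<in> carrier V \<rightarrow> carrier W \<and>
     (\<forall>u\<in>carrier V. \<forall>v\<in>carrier V. f (u \<oplus>\<^bsub>V\<^esub> v) = f u \<oplus>\<^bsub>W\<^esub> f v) \<and>
     (\<forall>c. \<forall>v\<in>carrier V. f (c \<odot>\<^bsub>V\<^esub> v) = c \<odot>\<^bsub>W\<^esub> f v)"

definition subspace_of :: "'v set \<Rightarrow> ('v, 'm) cspace_scheme \<Rightarrow> bool" where
  "subspace_of S V \<longleftrightarrow> S \<subseteq> carrier V \<and> \<zero>\<^bsub>V\<^esub> \<in> S \<and>
     (\<forall>u\<in>S. \<forall>v\<in>S. u \<oplus>\<^bsub>V\<^esub> v \<in> S) \<and> (\<forall>c. \<forall>v\<in>S. c \<odot>\<^bsub>V\<^esub> v \<in> S)"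

definition lin_span :: "('v, 'm) cspace_scheme \<Rightarrow> 'v set \<Rightarrow> 'v set" where
  "lin_span V S = \<Inter>{W. subspace_of W V \<and> S \<subseteq> W}"

text \<open>In the next three definitions the second argument is the norm on \<open>V\<close>.\<close>

definition converges_to ::
    "('v, 'm) cspace_scheme \<Rightarrow> ('v \<Rightarrow> real) \<Rightarrow> (nat \<Rightarrow> 'v) \<Rightarrow> 'v \<Rightarrow> bool" where
  "converges_to V N s l \<longleftrightarrow> (\<lambda>k. N (vdiff V (s k) l)) \<longlonglongrightarrow> 0"

definition complete_norm :: "('v, 'm) cspace_scheme \<Rightarrow> ('v \<Rightarrow> real) \<Rightarrow> bool" where
  "complete_norm V N \<longleftrightarrow> (\<forall>s. (\<forall>k. s k \<in> carrier V) \<longrightarrow>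
     (\<forall>e>0. \<exists>M. \<forall>j\<ge>M. \<forall>k\<ge>M. N (vdiff V (s j) (s k)) < e) \<longrightarrow>
     (\<exists>l\<in>carrier V. converges_to V N s l))"

definition norm_closure :: "('v, 'm) cspace_scheme \<Rightarrow> ('v \<Rightarrow> real) \<Rightarrow> 'v set \<Rightarrow> 'v set" where
  "norm_closure V N S = {v \<in> carrier V. \<exists>s. (\<forall>k. s k \<in> S) \<and> converges_to V N s v}"

locale cstar_algebra = complex_space A for A :: "('a, 'm) cstar_scheme" (structure) +
  assumes mult_closed: "\<lbrakk>a \<in> carrier A; b \<in> carrier A\<rbrakk> \<Longrightarrow> a \<otimes> b \<in> carrier A"
    and mult_assoc: "\<lbrakk>a \<in> carrier A; b \<in> carrier A; c \<in> carrier A\<rbrakk>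
                      \<Longrightarrow> (a \<otimes> b) \<otimes> c = a \<otimes> (b \<otimes> c)"
    and mult_add_right: "\<lbrakk>a \<in> carrier A; b \<in> carrier A; c \<in> carrier A\<rbrakk>
                      \<Longrightarrow> a \<otimes> (b \<oplus> c) = a \<otimes> b \<oplus> a \<otimes> c"
    and mult_add_left: "\<lbrakk>a \<in> carrier A; b \<in> carrier A; c \<in> carrier A\<rbrakk>
                      \<Longrightarrow> (a \<oplus> b) \<otimes> c = a \<otimes> c \<oplus> b \<otimes> c"
    and mult_scale_right: "\<lbrakk>a \<in> carrier A; b \<in> carrier A\<rbrakk> \<Longrightarrow> a \<otimes> (t \<odot> b) = t \<odot> (a \<otimes> b)"
    and mult_scale_left: "\<lbrakk>a \<in> carrier A; b \<in> carrier A\<rbrakk> \<Longrightarrow> (t \<odot> a) \<otimes> b = t \<odot> (a \<otimes> b)"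
    and star_closed: "a \<in> carrier A \<Longrightarrow> star A a \<in> carrier A"
    and star_star: "a \<in> carrier A \<Longrightarrow> star A (star A a) = a"
    and star_add: "\<lbrakk>a \<in> carrier A; b \<in> carrier A\<rbrakk> \<Longrightarrow> star A (a \<oplus> b) = star A a \<oplus> star A b"
    and star_scale: "a \<in> carrier A \<Longrightarrow> star A (t \<odot> a) = cnj t \<odot> star A a"
    and star_mult: "\<lbrakk>a \<in> carrier A; b \<in> carrier A\<rbrakk> \<Longrightarrow> star A (a \<otimes> b) = star A b \<otimes> star A a"
    and nrm_nonneg: "a \<in> carrier A \<Longrightarrow> 0 \<le> nrm A a"
    and nrm_eq_zero: "a \<in> carrier A \<Longrightarrow> nrm A a = 0 \<longleftrightarrow> a = \<zero>"
    and nrm_triangle: "\<lbrakk>a \<in> carrier A; b \<in> carrier A\<rbrakk> \<Longrightarrow> nrm A (a \<oplus> b) \<le> nrm A a + nrm A b"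
    and nrm_scale: "a \<in> carrier A \<Longrightarrow> nrm A (t \<odot> a) = cmod t * nrm A a"
    and nrm_mult: "\<lbrakk>a \<in> carrier A; b \<in> carrier A\<rbrakk> \<Longrightarrow> nrm A (a \<otimes> b) \<le> nrm A a * nrm A b"
    and cstar_identity: "a \<in> carrier A \<Longrightarrow> nrm A (star A a \<otimes> a) = (nrm A a)\<^sup>2"
    and nrm_complete: "complete_norm A (nrm A)"

definition star_hom :: "('a, 'm) cstar_scheme \<Rightarrow> ('b, 'k) cstar_scheme \<Rightarrow> ('a \<Rightarrow> 'b) \<Rightarrow> bool" where
  "star_hom A B f \<longleftrightarrow> linear_map A B f \<and>
     (\<forall>a\<in>carrier A. \<forall>b\<in>carrier A. f (a \<otimes>\<^bsub>A\<^esub> b) = f a \<otimes>\<^bsub>B\<^esub> f b) \<and>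
     (\<forall>a\<in>carrier A. f (star A a) = star B (f a))"

definition star_iso :: "('a, 'm) cstar_scheme \<Rightarrow> ('b, 'k) cstar_scheme \<Rightarrow> ('a \<Rightarrow> 'b) \<Rightarrow> bool" where
  "star_iso A B f \<longleftrightarrow> star_hom A B f \<and> bij_betw f (carrier A) (carrier B)"

definition cstar_isomorphic ::
    "('a, 'm) cstar_scheme \<Rightarrow> ('b, 'k) cstar_scheme \<Rightarrow> bool"  (infix "\<cong>\<^sub>C" 50) where
  "A \<cong>\<^sub>C B \<longleftrightarrow> (\<exists>f. star_iso A B f)"

definition cstar_generated :: "('a, 'm) cstar_scheme \<Rightarrow> 'a set \<Rightarrow> 'a set" where
  "cstar_generated A S = \<Inter>{B. S \<subseteq> B \<and> subspace_of B A \<and>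
     (\<forall>a\<in>B. \<forall>b\<in>B. a \<otimes>\<^bsub>A\<^esub> b \<in> B) \<and> (\<forall>a\<in>B. star A a \<in> B) \<and>
     norm_closure A (nrm A) B \<subseteq> B}"

definition cstar_pullback ::
    "'a cstar \<Rightarrow> 'b cstar \<Rightarrow> ('a \<Rightarrow> 'c) \<Rightarrow> ('b \<Rightarrow> 'c) \<Rightarrow> ('a \<times> 'b) cstar" where
  "cstar_pullback A B f g =
     \<lparr>carrier = {(a, b). a \<in> carrier A \<and> b \<in> carrier B \<and> f a = g b},
      vadd = (\<lambda>(a, b) (a', b'). (a \<oplus>\<^bsub>A\<^esub> a', b \<oplus>\<^bsub>B\<^esub> b')),
      vzero = (\<zero>\<^bsub>A\<^esub>, \<zero>\<^bsub>B\<^esub>),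
      vscale = (\<lambda>c (a, b). (c \<odot>\<^bsub>A\<^esub> a, c \<odot>\<^bsub>B\<^esub> b)),
      amult = (\<lambda>(a, b) (a', b'). (a \<otimes>\<^bsub>A\<^esub> a', b \<otimes>\<^bsub>B\<^esub> b')),
      star = (\<lambda>(a, b). (star A a, star B b)),
      nrm = (\<lambda>(a, b). max (nrm A a) (nrm B b))\<rparr>"

definition projection :: "('a, 'm) cstar_scheme \<Rightarrow> 'a \<Rightarrow> bool" where
  "projection A p \<longleftrightarrow> p \<in> carrier A \<and> p \<otimes>\<^bsub>A\<^esub> p = p \<and> star A p = p"

definition orthogonal_projections :: "('a, 'm) cstar_scheme \<Rightarrow> 'i set \<Rightarrow> ('i \<Rightarrow> 'a) \<Rightarrow> bool" where
  "orthogonal_projections A I p \<longleftrightarrow>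
     (\<forall>i\<in>I. projection A (p i) \<and> p i \<noteq> \<zero>\<^bsub>A\<^esub>) \<and>
     (\<forall>i\<in>I. \<forall>j\<in>I. i \<noteq> j \<longrightarrow> p i \<otimes>\<^bsub>A\<^esub> p j = \<zero>\<^bsub>A\<^esub>)"


section \<open>\<open>C\<^sup>*\<close>-correspondences\<close>

text \<open>The space underlying the record is the module \<open>X\<close>; \<open>coef\<close> is the coefficient algebra
  \<open>A\<close>, and \<open>lact\<close> is the left action \<open>\<phi>\<^sub>X\<close>.\<close>

record ('x, 'a) corr = "'x cspace" +
  coef :: "'a cstar"
  ract :: "'x \<Rightarrow> 'a \<Rightarrow> 'x"
  ip :: "'x \<Rightarrow> 'x \<Rightarrow> 'a"
  lact :: "'a \<Rightarrow> 'x \<Rightarrow> 'x"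

definition mod_norm :: "('x, 'a) corr \<Rightarrow> 'x \<Rightarrow> real" where
  "mod_norm X \<xi> = sqrt (nrm (coef X) (ip X \<xi> \<xi>))"

locale hilbert_module =
  complex_space X + coef: cstar_algebra "coef X" for X :: "('x, 'a) corr" (structure) +
  assumes ract_closed: "\<lbrakk>\<xi> \<in> carrier X; a \<in> carrier (coef X)\<rbrakk> \<Longrightarrow> ract X \<xi> a \<in> carrier X"
    and ract_mult: "\<lbrakk>\<xi> \<in> carrier X; a \<in> carrier (coef X); b \<in> carrier (coef X)\<rbrakk>
                      \<Longrightarrow> ract X (ract X \<xi> a) b = ract X \<xi> (a \<otimes>\<^bsub>coef X\<^esub> b)"
    and ract_add_left: "\<lbrakk>\<xi> \<in> carrier X; \<eta> \<in> carrier X; a \<in> carrier (coef X)\<rbrakk>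
                      \<Longrightarrow> ract X (\<xi> \<oplus> \<eta>) a = ract X \<xi> a \<oplus> ract X \<eta> a"
    and ract_add_right: "\<lbrakk>\<xi> \<in> carrier X; a \<in> carrier (coef X); b \<in> carrier (coef X)\<rbrakk>
                      \<Longrightarrow> ract X \<xi> (a \<oplus>\<^bsub>coef X\<^esub> b) = ract X \<xi> a \<oplus> ract X \<xi> b"
    and ract_scale_left: "\<lbrakk>\<xi> \<in> carrier X; a \<in> carrier (coef X)\<rbrakk>
                      \<Longrightarrow> ract X (c \<odot> \<xi>) a = c \<odot> ract X \<xi> a"
    and ract_scale_right: "\<lbrakk>\<xi> \<in> carrier X; a \<in> carrier (coef X)\<rbrakk>
                      \<Longrightarrow> ract X \<xi> (c \<odot>\<^bsub>coef X\<^esub> a) = c \<odot> ract X \<xi> a"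
    and ip_closed: "\<lbrakk>\<xi> \<in> carrier X; \<eta> \<in> carrier X\<rbrakk> \<Longrightarrow> ip X \<xi> \<eta> \<in> carrier (coef X)"
    and ip_add_right: "\<lbrakk>\<xi> \<in> carrier X; \<eta> \<in> carrier X; \<zeta> \<in> carrier X\<rbrakk>
                      \<Longrightarrow> ip X \<xi> (\<eta> \<oplus> \<zeta>) = ip X \<xi> \<eta> \<oplus>\<^bsub>coef X\<^esub> ip X \<xi> \<zeta>"
    and ip_scale_right: "\<lbrakk>\<xi> \<in> carrier X; \<eta> \<in> carrier X\<rbrakk>
                      \<Longrightarrow> ip X \<xi> (c \<odot> \<eta>) = c \<odot>\<^bsub>coef X\<^esub> ip X \<xi> \<eta>"
    and ip_ract_right: "\<lbrakk>\<xi> \<in> carrier X; \<eta> \<in> carrier X; a \<in> carrier (coef X)\<rbrakk>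
                      \<Longrightarrow> ip X \<xi> (ract X \<eta> a) = ip X \<xi> \<eta> \<otimes>\<^bsub>coef X\<^esub> a"
    and ip_star: "\<lbrakk>\<xi> \<in> carrier X; \<eta> \<in> carrier X\<rbrakk> \<Longrightarrow> star (coef X) (ip X \<xi> \<eta>) = ip X \<eta> \<xi>"
    and ip_positive: "\<xi> \<in> carrier X
                      \<Longrightarrow> \<exists>b\<in>carrier (coef X). ip X \<xi> \<xi> = star (coef X) b \<otimes>\<^bsub>coef X\<^esub> b"
    and ip_definite: "\<lbrakk>\<xi> \<in> carrier X; ip X \<xi> \<xi> = \<zero>\<^bsub>coef X\<^esub>\<rbrakk> \<Longrightarrow> \<xi> = \<zero>"
    and mod_norm_complete: "complete_norm X (mod_norm X)"

text \<open>Operators on \<open>X\<close> are extensional functions (undefined outside the carrier), so that HOL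
  equality of operators is equality on \<open>X\<close>.\<close>

definition is_adjoint :: "('x, 'a) corr \<Rightarrow> ('x \<Rightarrow> 'x) \<Rightarrow> ('x \<Rightarrow> 'x) \<Rightarrow> bool" where
  "is_adjoint X T S \<longleftrightarrow> S \<in> carrier X \<rightarrow>\<^sub>E carrier X \<and>
     (\<forall>\<xi>\<in>carrier X. \<forall>\<eta>\<in>carrier X. ip X (T \<xi>) \<eta> = ip X \<xi> (S \<eta>))"

definition adjointables :: "('x, 'a) corr \<Rightarrow> ('x \<Rightarrow> 'x) cstar"  ("\<L>") where
  "\<L> X =
     \<lparr>carrier = {T \<in> carrier X \<rightarrow>\<^sub>E carrier X. \<exists>S. is_adjoint X T S},
      vadd = (\<lambda>S T. \<lambda>\<xi>\<in>carrier X. S \<xi> \<oplus>\<^bsub>X\<^esub> T \<xi>),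
      vzero = (\<lambda>\<xi>\<in>carrier X. \<zero>\<^bsub>X\<^esub>),
      vscale = (\<lambda>c T. \<lambda>\<xi>\<in>carrier X. c \<odot>\<^bsub>X\<^esub> T \<xi>),
      amult = (\<lambda>S T. \<lambda>\<xi>\<in>carrier X. S (T \<xi>)),
      star = (\<lambda>T. SOME S. is_adjoint X T S),
      nrm = (\<lambda>T. Sup {mod_norm X (T \<xi>) | \<xi>. \<xi> \<in> carrier X \<and> mod_norm X \<xi> \<le> 1})\<rparr>"

definition theta :: "('x, 'a) corr \<Rightarrow> 'x \<Rightarrow> 'x \<Rightarrow> 'x \<Rightarrow> 'x" where
  "theta X \<xi> \<eta> = (\<lambda>\<zeta>\<in>carrier X. ract X \<xi> (ip X \<eta> \<zeta>))"

definition compacts :: "('x, 'a) corr \<Rightarrow> ('x \<Rightarrow> 'x) cstar"  ("\<K>") where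
  "\<K> X = (\<L> X)\<lparr>carrier := norm_closure (\<L> X) (nrm (\<L> X))
     (lin_span (\<L> X) {theta X \<xi> \<eta> | \<xi> \<eta>. \<xi> \<in> carrier X \<and> \<eta> \<in> carrier X})\<rparr>"

locale cstar_correspondence = hilbert_module X for X :: "('x, 'a) corr" (structure) +
  assumes lact_star_hom: "star_hom (coef X) (\<L> X) (lact X)"

definition katsura_ideal :: "('x, 'a) corr \<Rightarrow> 'a set" where
  "katsura_ideal X = {a \<in> carrier (coef X). lact X a \<in> carrier (\<K> X) \<and>
     (\<forall>b\<in>carrier (coef X). lact X b = \<zero>\<^bsub>\<L> X\<^esub> \<longrightarrow> a \<otimes>\<^bsub>coef X\<^esub> b = \<zero>\<^bsub>coef X\<^esub>)}"

definition corr_morphism ::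
    "('x, 'a) corr \<Rightarrow> ('z, 'c) corr \<Rightarrow> ('x \<Rightarrow> 'z) \<Rightarrow> ('a \<Rightarrow> 'c) \<Rightarrow> bool" where
  "corr_morphism X Z \<psi>X \<psi>A \<longleftrightarrow>
     linear_map X Z \<psi>X \<and> star_hom (coef X) (coef Z) \<psi>A \<and>
     (\<forall>\<xi>\<in>carrier X. \<forall>\<eta>\<in>carrier X. ip Z (\<psi>X \<xi>) (\<psi>X \<eta>) = \<psi>A (ip X \<xi> \<eta>)) \<and>
     (\<forall>a\<in>carrier (coef X). \<forall>\<xi>\<in>carrier X. \<psi>X (lact X a \<xi>) = lact Z (\<psi>A a) (\<psi>X \<xi>)) \<and>
     \<psi>A ` katsura_ideal X \<subseteq> katsura_ideal Z \<and>
     (\<exists>\<psi>plus. star_hom (\<K> X) (\<K> Z) \<psi>plus \<and>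
        (\<forall>\<xi>\<in>carrier X. \<forall>\<eta>\<in>carrier X. \<psi>plus (theta X \<xi> \<eta>) = theta Z (\<psi>X \<xi>) (\<psi>X \<eta>)) \<and>
        (\<forall>a\<in>katsura_ideal X. lact Z (\<psi>A a) = \<psi>plus (lact X a)))"

definition covariant_rep ::
    "('x, 'a) corr \<Rightarrow> 'd cstar \<Rightarrow> ('x \<Rightarrow> 'd) \<Rightarrow> ('a \<Rightarrow> 'd) \<Rightarrow> bool" where
  "covariant_rep X D \<rho>X \<rho>A \<longleftrightarrow>
     cstar_algebra D \<and> linear_map X D \<rho>X \<and> star_hom (coef X) D \<rho>A \<and>
     (\<forall>\<xi>\<in>carrier X. \<forall>\<eta>\<in>carrier X. star D (\<rho>X \<xi>) \<otimes>\<^bsub>D\<^esub> \<rho>X \<eta> = \<rho>A (ip X \<xi> \<eta>)) \<and>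
     (\<forall>a\<in>carrier (coef X). \<forall>\<xi>\<in>carrier X. \<rho>X (lact X a \<xi>) = \<rho>A a \<otimes>\<^bsub>D\<^esub> \<rho>X \<xi>) \<and>
     (\<exists>\<rho>plus. star_hom (\<K> X) D \<rho>plus \<and>
        (\<forall>\<xi>\<in>carrier X. \<forall>\<eta>\<in>carrier X.
           \<rho>plus (theta X \<xi> \<eta>) = \<rho>X \<xi> \<otimes>\<^bsub>D\<^esub> star D (\<rho>X \<eta>)) \<and>
        (\<forall>a\<in>katsura_ideal X. \<rho>A a = \<rho>plus (lact X a)))"

text \<open>HOL cannot quantify over the \<open>C\<^sup>*\<close>-algebras of all types, so the universal property is
  tested on algebras whose elements are sequences of noncommutative *-polynomials (sums of
  scalar multiples of words, the Boolean marking an adjoint) in the elements of \<open>X\<close> and \<open>A\<close>.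
  This loses nothing: the \<open>C\<^sup>*\<close>-algebra generated by any covariant representation
  of \<open>(X, A)\<close> consists of limits of sequences of such polynomials evaluated in it, and
  choosing one sequence for each element gives an isomorphic algebra of this type.\<close>

type_synonym ('x, 'a) star_poly_seq = "nat \<Rightarrow> (complex \<times> (('x + 'a) \<times> bool) list) list"

text \<open>\<open>D\<close>, with the canonical maps \<open>\<pi>X\<close> and \<open>\<pi>A\<close>, is (a model of) \<open>\<O>\<^sub>X\<close>.\<close>

definition cuntz_pimsner ::
    "('x, 'a) corr \<Rightarrow> 'd cstar \<Rightarrow> ('x \<Rightarrow> 'd) \<Rightarrow> ('a \<Rightarrow> 'd) \<Rightarrow> bool" where
  "cuntz_pimsner X D \<pi>X \<pi>A \<longleftrightarrow>
     covariant_rep X D \<pi>X \<pi>A \<and>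
     cstar_generated D (\<pi>X ` carrier X \<union> \<pi>A ` carrier (coef X)) = carrier D \<and>
     (\<forall>(E :: ('x, 'a) star_poly_seq cstar) \<rho>X \<rho>A. covariant_rep X E \<rho>X \<rho>A \<longrightarrow>
        (\<exists>h. star_hom D E h \<and> (\<forall>\<xi>\<in>carrier X. h (\<pi>X \<xi>) = \<rho>X \<xi>) \<and>
             (\<forall>a\<in>carrier (coef X). h (\<pi>A a) = \<rho>A a)))"

definition restricted_sum ::
    "('x, 'a) corr \<Rightarrow> ('y, 'b) corr \<Rightarrow> ('x \<Rightarrow> 'z) \<Rightarrow> ('a \<Rightarrow> 'c) \<Rightarrow> ('y \<Rightarrow> 'z) \<Rightarrow> ('b \<Rightarrow> 'c)
       \<Rightarrow> ('x \<times> 'y, 'a \<times> 'b) corr" where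
  "restricted_sum X Y \<psi>X \<psi>A \<omega>Y \<omega>B =
     (let XY = {(\<xi>, \<eta>). \<xi> \<in> carrier X \<and> \<eta> \<in> carrier Y \<and> \<psi>X \<xi> = \<omega>Y \<eta>} in
     \<lparr>carrier = XY,
      vadd = (\<lambda>(\<xi>, \<eta>) (\<xi>', \<eta>'). (\<xi> \<oplus>\<^bsub>X\<^esub> \<xi>', \<eta> \<oplus>\<^bsub>Y\<^esub> \<eta>')),
      vzero = (\<zero>\<^bsub>X\<^esub>, \<zero>\<^bsub>Y\<^esub>),
      vscale = (\<lambda>c (\<xi>, \<eta>). (c \<odot>\<^bsub>X\<^esub> \<xi>, c \<odot>\<^bsub>Y\<^esub> \<eta>)),
      coef = cstar_pullback (coef X) (coef Y) \<psi>A \<omega>B,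
      ract = (\<lambda>(\<xi>, \<eta>) (a, b). (ract X \<xi> a, ract Y \<eta> b)),
      ip = (\<lambda>(\<xi>, \<eta>) (\<xi>', \<eta>'). (ip X \<xi> \<xi>', ip Y \<eta> \<eta>')),
      lact = (\<lambda>(a, b). \<lambda>(\<xi>, \<eta>)\<in>XY. (lact X a \<xi>, lact Y b \<eta>))\<rparr>)"


section \<open>The correspondences of the quantum disc, the quantum sphere and the mirror sphere\<close>

text \<open>With \<open>m = n + 1\<close> this describes \<open>(X, A)\<close>, with \<open>m = n\<close> it describes \<open>(Z, C)\<close>.
  The inner products force the \<open>w i j\<close> to be linearly independent.\<close>

definition triangular_corr ::
    "nat \<Rightarrow> nat \<Rightarrow> ('x, 'a) corr \<Rightarrow> (nat \<Rightarrow> 'a) \<Rightarrow> (nat \<Rightarrow> nat \<Rightarrow> 'x) \<Rightarrow> bool" where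
  "triangular_corr n m X P w \<longleftrightarrow>
     cstar_correspondence X \<and>
     orthogonal_projections (coef X) {1..m} P \<and>
     carrier (coef X) = lin_span (coef X) (P ` {1..m}) \<and>
     (\<forall>i\<in>{1..n}. \<forall>j\<in>{i..m}. w i j \<in> carrier X) \<and>
     carrier X = lin_span X {w i j | i j. i \<in> {1..n} \<and> j \<in> {i..m}} \<and>
     (\<forall>i\<in>{1..n}. \<forall>j\<in>{i..m}. \<forall>k\<in>{1..n}. \<forall>l\<in>{k..m}.
        ip X (w i j) (w k l) = (if i = k \<and> j = l then P j else \<zero>\<^bsub>coef X\<^esub>)) \<and>
     (\<forall>i\<in>{1..n}. \<forall>j\<in>{i..m}. \<forall>k\<in>{1..m}.
        ract X (w i j) (P k) = (if j = k then w i j else \<zero>\<^bsub>X\<^esub>) \<and>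
        lact X (P k) (w i j) = (if i = k then w i j else \<zero>\<^bsub>X\<^esub>))"

text \<open>\<open>x i j\<close>, \<open>xn i j\<close>, \<open>y\<close>, \<open>y'\<close>, \<open>ys i\<close> stand for \<open>x\<^sub>i\<^sub>,\<^sub>j\<close>, \<open>x\<^sub>i\<^sub>,\<^sub>n\<^sub>,\<^sub>j\<close>, \<open>y\<close>, \<open>y'\<close>, \<open>y\<^sub>i\<close>;
  \<open>Q\<close>, \<open>ys\<close> and the last index of \<open>xn\<close> are only used at indices \<open>\<ge> 1\<close>.\<close>

definition mirror_corr ::
    "nat \<Rightarrow> ('y, 'b) corr \<Rightarrow> (nat \<Rightarrow> 'b) \<Rightarrow> (nat \<Rightarrow> 'b) \<Rightarrow> (nat \<Rightarrow> nat \<Rightarrow> 'y) \<Rightarrow>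
     (nat \<Rightarrow> nat \<Rightarrow> 'y) \<Rightarrow> 'y \<Rightarrow> 'y \<Rightarrow> (nat \<Rightarrow> 'y) \<Rightarrow> bool" where
  "mirror_corr n Y R Q x xn y y' ys \<longleftrightarrow>
     cstar_correspondence Y \<and>
     \<comment> \<open>the algebra \<open>B\<close>\<close>
     orthogonal_projections (coef Y) {1..n+1} R \<and>
     orthogonal_projections (coef Y) {1..} Q \<and>
     (\<forall>j\<ge>1. Q j \<otimes>\<^bsub>coef Y\<^esub> R n = Q j) \<and>
     cstar_generated (coef Y) (R ` {1..n+1} \<union> Q ` {1..}) = carrier (coef Y) \<and>
     \<comment> \<open>the module \<open>Y\<close>\<close>
     (\<forall>i\<in>{1..<n}. \<forall>j\<in>{i..n+1}. x i j \<in> carrier Y) \<and>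
     (\<forall>i\<in>{1..<n}. \<forall>j\<ge>1. xn i j \<in> carrier Y) \<and>
     y \<in> carrier Y \<and> y' \<in> carrier Y \<and> (\<forall>i\<ge>1. ys i \<in> carrier Y) \<and>
     carrier Y = norm_closure Y (mod_norm Y) (lin_span Y
       ({x i j | i j. i \<in> {1..<n} \<and> j \<in> {i..n+1}} \<union>
        {xn i j | i j. i \<in> {1..<n} \<and> j \<ge> 1} \<union> {y, y'} \<union> {ys i | i. i \<ge> 1})) \<and>
     \<comment> \<open>inner products\<close>
     (\<forall>i\<in>{1..<n}. \<forall>j\<in>{i..n+1}. \<forall>k\<in>{1..<n}. \<forall>l\<in>{k..n+1}.
        ip Y (x i j) (x k l) = (if i = k \<and> j = l then R j else \<zero>\<^bsub>coef Y\<^esub>)) \<and>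
     (\<forall>i\<in>{1..<n}. \<forall>j\<in>{i..n+1}. \<forall>k\<in>{1..<n}. \<forall>l\<ge>1.
        ip Y (x i j) (xn k l) = (if i = k \<and> j = n then Q l else \<zero>\<^bsub>coef Y\<^esub>)) \<and>
     (\<forall>i\<in>{1..<n}. \<forall>j\<ge>1. \<forall>k\<in>{1..<n}. \<forall>l\<ge>1.
        ip Y (xn i j) (xn k l) = (if i = k \<and> j = l then Q j else \<zero>\<^bsub>coef Y\<^esub>)) \<and>
     ip Y y y = R n \<and> ip Y y y' = Q 1 \<and> ip Y y' y' = Q 1 \<and>
     (\<forall>i\<ge>1. ip Y y (ys i) = Q (i + 1)) \<and>
     (\<forall>i\<ge>1. ip Y y' (ys i) = \<zero>\<^bsub>coef Y\<^esub>) \<and>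
     (\<forall>i\<ge>1. \<forall>j\<ge>1. ip Y (ys i) (ys j) = (if i = j then Q (i + 1) else \<zero>\<^bsub>coef Y\<^esub>)) \<and>
     (\<forall>i\<in>{1..<n}. \<forall>j\<in>{i..n+1}.
        ip Y (x i j) y = \<zero>\<^bsub>coef Y\<^esub> \<and> ip Y (x i j) y' = \<zero>\<^bsub>coef Y\<^esub> \<and>
        (\<forall>k\<ge>1. ip Y (x i j) (ys k) = \<zero>\<^bsub>coef Y\<^esub>)) \<and>
     (\<forall>i\<in>{1..<n}. \<forall>j\<ge>1.
        ip Y (xn i j) y = \<zero>\<^bsub>coef Y\<^esub> \<and> ip Y (xn i j) y' = \<zero>\<^bsub>coef Y\<^esub> \<and>
        (\<forall>k\<ge>1. ip Y (xn i j) (ys k) = \<zero>\<^bsub>coef Y\<^esub>)) \<and>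
     \<comment> \<open>right action\<close>
     (\<forall>i\<in>{1..<n}. \<forall>j\<in>{i..n+1}.
        (\<forall>k\<in>{1..n+1}. ract Y (x i j) (R k) = (if j = k then x i j else \<zero>\<^bsub>Y\<^esub>)) \<and>
        (\<forall>k\<ge>1. ract Y (x i j) (Q k) = (if j = n then xn i k else \<zero>\<^bsub>Y\<^esub>))) \<and>
     (\<forall>i\<in>{1..<n}. \<forall>j\<ge>1.
        (\<forall>k\<in>{1..n+1}. ract Y (xn i j) (R k) = (if n = k then xn i j else \<zero>\<^bsub>Y\<^esub>)) \<and>
        (\<forall>k\<ge>1. ract Y (xn i j) (Q k) = (if j = k then xn i j else \<zero>\<^bsub>Y\<^esub>))) \<and>
     (\<forall>k\<in>{1..n+1}. ract Y y (R k) = (if n = k then y else \<zero>\<^bsub>Y\<^esub>)) \<and>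
     ract Y y (Q 1) = y' \<and> (\<forall>k\<ge>2. ract Y y (Q k) = ys (k - 1)) \<and>
     (\<forall>k\<in>{1..n+1}. ract Y y' (R k) = (if n = k then y' else \<zero>\<^bsub>Y\<^esub>)) \<and>
     (\<forall>k\<ge>1. ract Y y' (Q k) = (if 1 = k then y' else \<zero>\<^bsub>Y\<^esub>)) \<and>
     (\<forall>i\<ge>1.
        (\<forall>k\<in>{1..n+1}. ract Y (ys i) (R k) = (if n = k then ys i else \<zero>\<^bsub>Y\<^esub>)) \<and>
        (\<forall>k\<ge>1. ract Y (ys i) (Q k) = (if i + 1 = k then ys i else \<zero>\<^bsub>Y\<^esub>))) \<and>
     \<comment> \<open>left action\<close>
     (\<forall>i\<in>{1..<n}. \<forall>j\<in>{i..n+1}.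
        (\<forall>k\<in>{1..n+1}. lact Y (R k) (x i j) = (if i = k then x i j else \<zero>\<^bsub>Y\<^esub>)) \<and>
        (\<forall>k\<ge>1. lact Y (Q k) (x i j) = \<zero>\<^bsub>Y\<^esub>)) \<and>
     (\<forall>i\<in>{1..<n}. \<forall>j\<ge>1.
        (\<forall>k\<in>{1..n+1}. lact Y (R k) (xn i j) = (if i = k then xn i j else \<zero>\<^bsub>Y\<^esub>)) \<and>
        (\<forall>k\<ge>1. lact Y (Q k) (xn i j) = \<zero>\<^bsub>Y\<^esub>)) \<and>
     (\<forall>k\<in>{1..n+1}.
        lact Y (R k) y = (if n = k then vdiff Y y y' else \<zero>\<^bsub>Y\<^esub>)
                           \<oplus>\<^bsub>Y\<^esub> (if n + 1 = k then y' else \<zero>\<^bsub>Y\<^esub>) \<and>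
        lact Y (R k) y' = (if n + 1 = k then y' else \<zero>\<^bsub>Y\<^esub>) \<and>
        (\<forall>i\<ge>1. lact Y (R k) (ys i) = (if n = k then ys i else \<zero>\<^bsub>Y\<^esub>))) \<and>
     (\<forall>k\<ge>1.
        lact Y (Q k) y = ys k \<and> lact Y (Q k) y' = \<zero>\<^bsub>Y\<^esub> \<and>
        (\<forall>i\<ge>1. lact Y (Q k) (ys i) = (if i = k then ys i else \<zero>\<^bsub>Y\<^esub>)))"

text \<open>The mirror sphere algebra, with \<open>OX\<close> in the role of the quantum disc algebra.\<close>

definition mirror_sphere :: "'o cstar \<Rightarrow> ('o \<Rightarrow> 'p) \<Rightarrow> ('p \<Rightarrow> 'p) \<Rightarrow> ('o \<times> 'o) cstar" where
  "mirror_sphere OX \<pi> \<beta> = cstar_pullback OX OX \<pi> (\<lambda>v. \<beta> (\<pi> v))"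

end

theory Submission
  imports Defs
begin

text \<open>
  Over \<open>W = X \<oplus>\<^sub>Z Y\<close> all modules have finite frames, so covariance of a representation reads
  \<open>\<rho>(a) = \<rho>(a) \<Sum>\<^sub>k \<rho>(w\<^sub>k) \<rho>(w\<^sub>k)\<^sup>*\<close> on the Katsura ideal, and homomorphisms out of the Cuntz--Pimsner
  algebras are given by finitely many relations; no gauge-invariant uniqueness theorem is needed.
  Sending \<open>(\<xi>, \<eta>)\<close> to \<open>\<xi>\<close> gives \<open>h\<^sub>1 : \<O>\<^sub>W \<rightarrow> \<O>\<^sub>X\<close>. Sending \<open>y\<close> to \<open>(w\<^sub>n\<^sub>,\<^sub>n + w\<^sub>n\<^sub>,\<^sub>n\<^sub>+\<^sub>1)\<^sup>*\<close> gives a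
  representation of \<open>Y\<close> in \<open>\<O>\<^sub>X\<close> and hence \<open>h\<^sub>2 : \<O>\<^sub>W \<rightarrow> \<O>\<^sub>X\<close>, and \<open>\<pi> h\<^sub>1 = \<beta> \<pi> h\<^sub>2\<close>.
  Let \<open>f = (P\<^sub>n\<^sub>+\<^sub>1, 0)\<close> and \<open>g = (0, R\<^sub>n\<^sub>+\<^sub>1)\<close>. The quotients of \<open>\<O>\<^sub>W\<close> by the ideals generated by \<open>g\<close>,
  by \<open>f\<close> and by both satisfy the relations of \<open>\<O>\<^sub>X\<close>, \<open>\<O>\<^sub>X\<close> and \<open>\<O>\<^sub>Z\<close>; therefore these ideals are
  the kernels of \<open>h\<^sub>1\<close>, \<open>h\<^sub>2\<close> and \<open>\<pi> h\<^sub>1\<close>, and \<open>h\<^sub>1\<close>, \<open>h\<^sub>2\<close> are onto. Since \<open>g \<O>\<^sub>W f = 0\<close>, the first two ideals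
  are orthogonal, so \<open>(h\<^sub>1, h\<^sub>2)\<close> is injective, and since the third is their sum, it is onto the
  pullback.
\<close>

text \<open>The flip turns the loop at vertex n around, so y has to act as the adjoint of t = w_nn +
  w_n,n+1. An element b of B then acts on y through t b t*, that is b y = y b' with b' = t b t*, and
  B must be stable under b -> t b t*. This map sends R_{n+1} to Q_1 and Q_k to Q_{k+1}. So Q_k
  stands for t^k P_{n+1} t*^k, which explains why B is infinite-dimensional and where the rules for
  y, y' and y_k come from. The same shift is behind g O_W f = 0: moving g to the right through the
  generators produces only 0 or some Q_k, and all of these kill f. The kernels are identified by
  explicit inverses, defined on generators, from the disc and sphere algebras into quotients of O_W.
  This requires that quotients of C*-algebras are C*-algebras and that *-homomorphisms are
  contractive. Neither spectra nor states are used for this: the one analytic tool is the square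
  root of 1 - b^2, obtained by iteration, which completes a self-adjoint contraction b to an element
  u = b + i c with u* u = 1. The spectrum of B is used only through explicit characters.\<close>

section \<open>Complex vector spaces\<close>

context complex_space
begin

declare zero_closed [simp, intro] add_closed [simp, intro] scale_closed [simp, intro]
  add_zero [simp] scale_one [simp] scale_zero [simp]

lemma add_left_comm:
  assumes "u \<in> carrier V" "v \<in> carrier V" "w \<in> carrier V"
  shows "u \<oplus> (v \<oplus> w) = v \<oplus> (u \<oplus> w)"
  using assms by (metis add_assoc add_comm)

lemmas add_ac = add_assoc add_comm add_left_comm

lemma zero_add [simp]: "v \<in> carrier V \<Longrightarrow> \<zero> \<oplus> v = v"
  by (metis add_comm add_zero zero_closed)

lemma scale_zero_right [simp]: "c \<odot> \<zero> = \<zero>"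
  by (metis mult_zero_right scale_scale scale_zero zero_closed)

lemma add_neg [simp]: "v \<in> carrier V \<Longrightarrow> v \<oplus> (- 1) \<odot> v = \<zero>"
  using scale_add_left[of v 1 "- 1"] by simp

lemma neg_add [simp]: "v \<in> carrier V \<Longrightarrow> (- 1) \<odot> v \<oplus> v = \<zero>"
  using scale_add_left[of v "- 1" 1] by simp

lemma add_neg_cancel [simp]:
  "\<lbrakk>v \<in> carrier V; w \<in> carrier V\<rbrakk> \<Longrightarrow> v \<oplus> ((- 1) \<odot> v \<oplus> w) = w"
  by (metis add_neg add_assoc scale_closed zero_add)

lemma neg_add_cancel [simp]:
  "\<lbrakk>v \<in> carrier V; w \<in> carrier V\<rbrakk> \<Longrightarrow> (- 1) \<odot> v \<oplus> (v \<oplus> w) = w"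
  by (metis neg_add add_assoc scale_closed zero_add)

lemma vdiff_closed [simp, intro]:
  "\<lbrakk>u \<in> carrier V; v \<in> carrier V\<rbrakk> \<Longrightarrow> vdiff V u v \<in> carrier V"
  by (simp add: vdiff_def)

lemma vdiff_self [simp]: "u \<in> carrier V \<Longrightarrow> vdiff V u u = \<zero>"
  by (simp add: vdiff_def)

lemma vdiff_zero [simp]: "u \<in> carrier V \<Longrightarrow> vdiff V u \<zero> = u"
  by (simp add: vdiff_def)

lemma vdiff_add_cancel [simp]:
  "\<lbrakk>u \<in> carrier V; v \<in> carrier V\<rbrakk> \<Longrightarrow> v \<oplus> vdiff V u v = u"
  by (simp add: vdiff_def add_ac)

lemma vdiff_add_cancel2 [simp]:
  "\<lbrakk>u \<in> carrier V; v \<in> carrier V\<rbrakk> \<Longrightarrow> vdiff V u v \<oplus> v = u"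
  by (simp add: vdiff_def add_ac)

lemma add_left_imp_eq:
  assumes "u \<in> carrier V" "v \<in> carrier V" "w \<in> carrier V" "u \<oplus> v = u \<oplus> w"
  shows "v = w"
  by (metis assms neg_add_cancel)

lemma vdiff_eq_zero_iff:
  "\<lbrakk>u \<in> carrier V; v \<in> carrier V\<rbrakk> \<Longrightarrow> vdiff V u v = \<zero> \<longleftrightarrow> u = v"
  by (metis add_zero vdiff_add_cancel vdiff_self)

lemma vdiff_trans:
  "\<lbrakk>u \<in> carrier V; v \<in> carrier V; w \<in> carrier V\<rbrakk>
     \<Longrightarrow> vdiff V u v \<oplus> vdiff V v w = vdiff V u w"
  by (simp add: vdiff_def add_ac)

lemma vdiff_swap:
  "\<lbrakk>u \<in> carrier V; v \<in> carrier V\<rbrakk> \<Longrightarrow> vdiff V v u = (- 1) \<odot> vdiff V u v"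
  by (simp add: vdiff_def scale_add_right scale_scale add_comm)

lemma vdiff_add_add:
  "\<lbrakk>u \<in> carrier V; v \<in> carrier V; u' \<in> carrier V; v' \<in> carrier V\<rbrakk>
     \<Longrightarrow> vdiff V (u \<oplus> v) (u' \<oplus> v') = vdiff V u u' \<oplus> vdiff V v v'"
  by (simp add: vdiff_def scale_add_right add_ac)

lemma vdiff_scale:
  "\<lbrakk>u \<in> carrier V; v \<in> carrier V\<rbrakk> \<Longrightarrow> vdiff V (c \<odot> u) (c \<odot> v) = c \<odot> vdiff V u v"
  by (simp add: vdiff_def scale_add_right scale_scale mult.commute)

lemma vdiff_scale_left:
  "u \<in> carrier V \<Longrightarrow> vdiff V (c \<odot> u) (d \<odot> u) = (c - d) \<odot> u"
  using scale_add_left[of u c "- d"] by (simp add: vdiff_def scale_scale)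

lemma vdiff_eqI: "\<lbrakk>v \<oplus> w = u; v \<in> carrier V; w \<in> carrier V\<rbrakk> \<Longrightarrow> vdiff V u v = w"
  by (metis add_closed add_left_imp_eq vdiff_add_cancel vdiff_closed)

lemma add_half: "u \<in> carrier V \<Longrightarrow> u \<oplus> u = 2 \<odot> u"
  using scale_add_left[of u 1 1] by simp

lemma scale_cancel:
  assumes "c \<noteq> 0" "u \<in> carrier V" "v \<in> carrier V" "c \<odot> u = c \<odot> v"
  shows "u = v"
proof -
  have "(1/c) \<odot> (c \<odot> u) = (1/c) \<odot> (c \<odot> v)" using assms by simp
  then show ?thesis using assms(1-3) by (simp add: scale_scale)
qed

lemma lin_span_induct:
  assumes "v \<in> lin_span V S" "subspace_of T V" "S \<subseteq> T"
  shows "v \<in> T"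
  using assms by (auto simp: lin_span_def)

lemma subspace_UNIV: "subspace_of (carrier V) V"
  by (auto simp: subspace_of_def)

end

lemma linear_map_closed [intro]: "\<lbrakk>linear_map V W f; v \<in> carrier V\<rbrakk> \<Longrightarrow> f v \<in> carrier W"
  by (auto simp: linear_map_def)

lemma linear_map_add: "\<lbrakk>linear_map V W f; u \<in> carrier V; v \<in> carrier V\<rbrakk>
    \<Longrightarrow> f (u \<oplus>\<^bsub>V\<^esub> v) = f u \<oplus>\<^bsub>W\<^esub> f v"
  by (auto simp: linear_map_def)

lemma linear_map_scale: "\<lbrakk>linear_map V W f; v \<in> carrier V\<rbrakk>
    \<Longrightarrow> f (c \<odot>\<^bsub>V\<^esub> v) = c \<odot>\<^bsub>W\<^esub> f v"
  by (auto simp: linear_map_def)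

lemma linear_map_zero:
  assumes "linear_map V W f" "complex_space V" "complex_space W"
  shows "f \<zero>\<^bsub>V\<^esub> = \<zero>\<^bsub>W\<^esub>"
proof -
  interpret V: complex_space V by fact
  interpret W: complex_space W by fact
  have "f (0 \<odot>\<^bsub>V\<^esub> \<zero>\<^bsub>V\<^esub>) = 0 \<odot>\<^bsub>W\<^esub> f \<zero>\<^bsub>V\<^esub>"
    by (rule linear_map_scale[OF assms(1)]) simp
  then show ?thesis using assms(1) by (simp add: linear_map_closed)
qed

lemma linear_map_vdiff:
  assumes "linear_map V W f" "complex_space V" "u \<in> carrier V" "v \<in> carrier V"
  shows "f (vdiff V u v) = vdiff W (f u) (f v)"
proof -
  interpret V: complex_space V by fact
  show ?thesis using assms(1,3,4)
    by (simp add: vdiff_def linear_map_add linear_map_scale)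
qed

lemma linear_map_comp:
  "\<lbrakk>linear_map U V f; linear_map V W g\<rbrakk> \<Longrightarrow> linear_map U W (\<lambda>x. g (f x))"
  by (auto simp: linear_map_def Pi_iff)

subsection \<open>Finite sums\<close>

text \<open>A fold over a list makes sense for any record, without its axioms; sums of operators in
  \<open>\<L> X\<close> are used in this way.\<close>

definition vsum :: "('v, 'm) cspace_scheme \<Rightarrow> ('i \<Rightarrow> 'v) \<Rightarrow> 'i list \<Rightarrow> 'v" where
  "vsum V f ks = foldr (\<lambda>k s. f k \<oplus>\<^bsub>V\<^esub> s) ks \<zero>\<^bsub>V\<^esub>"

lemma vsum_Nil [simp]: "vsum V f [] = \<zero>\<^bsub>V\<^esub>"
  and vsum_Cons [simp]: "vsum V f (k # ks) = f k \<oplus>\<^bsub>V\<^esub> vsum V f ks"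
  by (simp_all add: vsum_def)

lemma vsum_cong: "(\<And>k. k \<in> set ks \<Longrightarrow> f k = g k) \<Longrightarrow> vsum V f ks = vsum V g ks"
  by (induction ks) auto

lemma vsum_map: "vsum V f (map g ks) = vsum V (\<lambda>k. f (g k)) ks"
  by (induction ks) auto

context complex_space
begin

lemma vsum_closed [simp, intro]:
  "(\<And>k. k \<in> set ks \<Longrightarrow> f k \<in> carrier V) \<Longrightarrow> vsum V f ks \<in> carrier V"
  by (induction ks) auto

lemma vsum_zero: "(\<And>k. k \<in> set ks \<Longrightarrow> f k = \<zero>) \<Longrightarrow> vsum V f ks = \<zero>"
  by (induction ks) auto

lemma vsum_add:
  "\<lbrakk>\<And>k. k \<in> set ks \<Longrightarrow> f k \<in> carrier V; \<And>k. k \<in> set ks \<Longrightarrow> g k \<in> carrier V\<rbrakk>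
     \<Longrightarrow> vsum V (\<lambda>k. f k \<oplus> g k) ks = vsum V f ks \<oplus> vsum V g ks"
  by (induction ks) (auto simp: add_ac)

lemma vsum_scale:
  "(\<And>k. k \<in> set ks \<Longrightarrow> f k \<in> carrier V)
     \<Longrightarrow> vsum V (\<lambda>k. c \<odot> f k) ks = c \<odot> vsum V f ks"
  by (induction ks) (auto simp: scale_add_right)

lemma vsum_append:
  "\<lbrakk>\<And>k. k \<in> set ks \<Longrightarrow> f k \<in> carrier V; \<And>k. k \<in> set ls \<Longrightarrow> f k \<in> carrier V\<rbrakk>
     \<Longrightarrow> vsum V f (ks @ ls) = vsum V f ks \<oplus> vsum V f ls"
  by (induction ks) (auto simp: add_ac)

lemma vsum_single:
  assumes "distinct ks" "l \<in> set ks" "f l \<in> carrier V"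
    "\<And>k. \<lbrakk>k \<in> set ks; k \<noteq> l\<rbrakk> \<Longrightarrow> f k = \<zero>"
  shows "vsum V f ks = f l"
  using assms
proof (induction ks)
  case (Cons a ks)
  show ?case
  proof (cases "a = l")
    case True
    then have "vsum V f ks = \<zero>" using Cons.prems by (intro vsum_zero) auto
    then show ?thesis using True Cons.prems by simp
  next
    case False
    then show ?thesis using Cons by auto
  qed
qed simp

end

lemma linear_map_vsum:
  assumes "linear_map V W F" "complex_space V" "complex_space W"
    "\<And>k. k \<in> set ks \<Longrightarrow> f k \<in> carrier V"
  shows "F (vsum V f ks) = vsum W (\<lambda>k. F (f k)) ks"
proof -
  interpret V: complex_space V by fact
  show ?thesis using assms(4)
    by (induction ks) (auto simp: linear_map_add[OF assms(1)] linear_map_zero[OF assms(1-3)])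
qed

section \<open>Star algebras\<close>

text \<open>The norm-free part of \<open>cstar_algebra\<close>. Pullbacks are only shown to satisfy
  these axioms, and images and quotients acquire the identities before a norm is examined.\<close>

locale star_algebra = complex_space A for A :: "('a, 'm) cstar_scheme" (structure) +
  assumes mult_closed [simp, intro]: "\<lbrakk>a \<in> carrier A; b \<in> carrier A\<rbrakk> \<Longrightarrow> a \<otimes> b \<in> carrier A"
    and mult_assoc: "\<lbrakk>a \<in> carrier A; b \<in> carrier A; c \<in> carrier A\<rbrakk>
                      \<Longrightarrow> (a \<otimes> b) \<otimes> c = a \<otimes> (b \<otimes> c)"
    and mult_add_right: "\<lbrakk>a \<in> carrier A; b \<in> carrier A; c \<in> carrier A\<rbrakk>
                      \<Longrightarrow> a \<otimes> (b \<oplus> c) = a \<otimes> b \<oplus> a \<otimes> c"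
    and mult_add_left: "\<lbrakk>a \<in> carrier A; b \<in> carrier A; c \<in> carrier A\<rbrakk>
                      \<Longrightarrow> (a \<oplus> b) \<otimes> c = a \<otimes> c \<oplus> b \<otimes> c"
    and mult_scale_right: "\<lbrakk>a \<in> carrier A; b \<in> carrier A\<rbrakk> \<Longrightarrow> a \<otimes> (t \<odot> b) = t \<odot> (a \<otimes> b)"
    and mult_scale_left: "\<lbrakk>a \<in> carrier A; b \<in> carrier A\<rbrakk> \<Longrightarrow> (t \<odot> a) \<otimes> b = t \<odot> (a \<otimes> b)"
    and star_closed [simp, intro]: "a \<in> carrier A \<Longrightarrow> star A a \<in> carrier A"
    and star_star [simp]: "a \<in> carrier A \<Longrightarrow> star A (star A a) = a"
    and star_add: "\<lbrakk>a \<in> carrier A; b \<in> carrier A\<rbrakk> \<Longrightarrow> star A (a \<oplus> b) = star A a \<oplus> star A b"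
    and star_scale: "a \<in> carrier A \<Longrightarrow> star A (t \<odot> a) = cnj t \<odot> star A a"
    and star_mult: "\<lbrakk>a \<in> carrier A; b \<in> carrier A\<rbrakk> \<Longrightarrow> star A (a \<otimes> b) = star A b \<otimes> star A a"
begin

lemma zero_mult [simp]: "a \<in> carrier A \<Longrightarrow> \<zero> \<otimes> a = \<zero>"
  using mult_scale_left[of \<zero> a 0] by simp

lemma mult_zero [simp]: "a \<in> carrier A \<Longrightarrow> a \<otimes> \<zero> = \<zero>"
  using mult_scale_right[of a \<zero> 0] by simp

lemma star_zero [simp]: "star A \<zero> = \<zero>"
  using star_scale[of \<zero> 0] by simp

lemma star_vdiff:
  "\<lbrakk>a \<in> carrier A; b \<in> carrier A\<rbrakk> \<Longrightarrow> star A (vdiff A a b) = vdiff A (star A a) (star A b)"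
  by (simp add: vdiff_def star_add star_scale)

lemma mult_vdiff:
  "\<lbrakk>a \<in> carrier A; b \<in> carrier A; c \<in> carrier A\<rbrakk>
     \<Longrightarrow> a \<otimes> vdiff A b c = vdiff A (a \<otimes> b) (a \<otimes> c)"
  by (simp add: vdiff_def mult_add_right mult_scale_right)

lemma vdiff_mult:
  "\<lbrakk>a \<in> carrier A; b \<in> carrier A; c \<in> carrier A\<rbrakk>
     \<Longrightarrow> vdiff A a b \<otimes> c = vdiff A (a \<otimes> c) (b \<otimes> c)"
  by (simp add: vdiff_def mult_add_left mult_scale_left)

lemmas ring_rules = mult_assoc mult_add_right mult_add_left mult_scale_right mult_scale_left
  star_add star_scale star_mult scale_add_right scale_scale

lemma mult_vsum:
  "\<lbrakk>a \<in> carrier A; \<And>k. k \<in> set ks \<Longrightarrow> f k \<in> carrier A\<rbrakk>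
     \<Longrightarrow> a \<otimes> vsum A f ks = vsum A (\<lambda>k. a \<otimes> f k) ks"
  by (induction ks) (auto simp: mult_add_right)

lemma vsum_mult:
  "\<lbrakk>a \<in> carrier A; \<And>k. k \<in> set ks \<Longrightarrow> f k \<in> carrier A\<rbrakk>
     \<Longrightarrow> vsum A f ks \<otimes> a = vsum A (\<lambda>k. f k \<otimes> a) ks"
  by (induction ks) (auto simp: mult_add_left)

lemma star_vsum:
  "(\<And>k. k \<in> set ks \<Longrightarrow> f k \<in> carrier A)
     \<Longrightarrow> star A (vsum A f ks) = vsum A (\<lambda>k. star A (f k)) ks"
  by (induction ks) (auto simp: star_add)

end

sublocale cstar_algebra \<subseteq> star_algebra A
  by unfold_locales
    (simp_all add: mult_closed mult_assoc mult_add_right mult_add_left mult_scale_right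
      mult_scale_left star_closed star_star star_add star_scale star_mult)

lemma star_homD:
  assumes "star_hom A B f"
  shows star_hom_linear: "linear_map A B f"
    and star_hom_closed: "a \<in> carrier A \<Longrightarrow> f a \<in> carrier B"
    and star_hom_add: "\<lbrakk>a \<in> carrier A; b \<in> carrier A\<rbrakk> \<Longrightarrow> f (a \<oplus>\<^bsub>A\<^esub> b) = f a \<oplus>\<^bsub>B\<^esub> f b"
    and star_hom_scale: "a \<in> carrier A \<Longrightarrow> f (c \<odot>\<^bsub>A\<^esub> a) = c \<odot>\<^bsub>B\<^esub> f a"
    and star_hom_mult: "\<lbrakk>a \<in> carrier A; b \<in> carrier A\<rbrakk> \<Longrightarrow> f (a \<otimes>\<^bsub>A\<^esub> b) = f a \<otimes>\<^bsub>B\<^esub> f b"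
    and star_hom_star: "a \<in> carrier A \<Longrightarrow> f (star A a) = star B (f a)"
  using assms by (auto simp: star_hom_def linear_map_def)

lemma star_homI:
  assumes "\<And>a. a \<in> carrier A \<Longrightarrow> f a \<in> carrier B"
    and "\<And>a b. \<lbrakk>a \<in> carrier A; b \<in> carrier A\<rbrakk> \<Longrightarrow> f (a \<oplus>\<^bsub>A\<^esub> b) = f a \<oplus>\<^bsub>B\<^esub> f b"
    and "\<And>a c. a \<in> carrier A \<Longrightarrow> f (c \<odot>\<^bsub>A\<^esub> a) = c \<odot>\<^bsub>B\<^esub> f a"
    and "\<And>a b. \<lbrakk>a \<in> carrier A; b \<in> carrier A\<rbrakk> \<Longrightarrow> f (a \<otimes>\<^bsub>A\<^esub> b) = f a \<otimes>\<^bsub>B\<^esub> f b"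
    and "\<And>a. a \<in> carrier A \<Longrightarrow> f (star A a) = star B (f a)"
  shows "star_hom A B f"
  using assms by (auto simp: star_hom_def linear_map_def)

lemma star_hom_comp:
  "\<lbrakk>star_hom A B f; star_hom B C g\<rbrakk> \<Longrightarrow> star_hom A C (\<lambda>x. g (f x))"
  by (rule star_homI) (simp_all add: star_homD)

lemma star_hom_zero:
  "\<lbrakk>star_hom A B f; complex_space A; complex_space B\<rbrakk> \<Longrightarrow> f \<zero>\<^bsub>A\<^esub> = \<zero>\<^bsub>B\<^esub>"
  by (simp add: star_hom_linear linear_map_zero)

lemma star_hom_vdiff:
  "\<lbrakk>star_hom A B f; complex_space A; u \<in> carrier A; v \<in> carrier A\<rbrakk>
     \<Longrightarrow> f (vdiff A u v) = vdiff B (f u) (f v)"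
  by (simp add: star_hom_linear linear_map_vdiff)

lemma star_hom_vsum:
  "\<lbrakk>star_hom A B F; complex_space A; complex_space B; \<And>k. k \<in> set ks \<Longrightarrow> f k \<in> carrier A\<rbrakk>
     \<Longrightarrow> F (vsum A f ks) = vsum B (\<lambda>k. F (f k)) ks"
  by (rule linear_map_vsum) (auto simp: star_hom_linear)

context star_algebra
begin

text \<open>Stands in for functional calculus. When b and c commute and b^2 + c^2 is a projection,
  the C*-identity bounds the norm of u by 1, and then those of b and c, which are recovered from u
  and its adjoint.\<close>

lemma cartesian_parts:
  assumes b: "b \<in> carrier A" "star A b = b" and c: "c \<in> carrier A" "star A c = c"
    and u: "u = b \<oplus> \<i> \<odot> c"
  shows "b = (1/2) \<odot> (u \<oplus> star A u)" "c = (- \<i>/2) \<odot> vdiff A u (star A u)"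
    and "b \<otimes> c = c \<otimes> b \<Longrightarrow> star A u \<otimes> u = b \<otimes> b \<oplus> c \<otimes> c"
proof -
  have su: "star A u = b \<oplus> (- \<i>) \<odot> c" using b c u by (simp add: star_add star_scale)
  have ii: "\<i> \<odot> x \<oplus> (- \<i>) \<odot> x = \<zero>" if "x \<in> carrier A" for x
    using that scale_add_left[of x \<i> "- \<i>"] by simp
  have cancel: "(x \<oplus> \<i> \<odot> y) \<oplus> ((- \<i>) \<odot> y \<oplus> z) = x \<oplus> z"
    if xyz: "x \<in> carrier A" "y \<in> carrier A" "z \<in> carrier A" for x y z
  proof -
    have "(x \<oplus> \<i> \<odot> y) \<oplus> ((- \<i>) \<odot> y \<oplus> z) = (x \<oplus> (\<i> \<odot> y \<oplus> (- \<i>) \<odot> y)) \<oplus> z"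
      using xyz by (simp add: add_assoc)
    then show ?thesis using xyz by (simp only: ii) simp
  qed
  have "u \<oplus> star A u = (b \<oplus> \<i> \<odot> c) \<oplus> ((- \<i>) \<odot> c \<oplus> b)"
    using b c by (simp only: su) (simp only: u add_comm scale_closed)
  also have "\<dots> = 2 \<odot> b" using b c by (simp only: cancel add_half)
  finally show "b = (1/2) \<odot> (u \<oplus> star A u)" using b by (simp add: scale_scale)
  have "vdiff A u (star A u) = vdiff A b b \<oplus> vdiff A (\<i> \<odot> c) ((- \<i>) \<odot> c)"
    using b c by (simp only: su) (simp only: u vdiff_add_add scale_closed)
  also have "\<dots> = (2 * \<i>) \<odot> c" using b c by (simp only: vdiff_scale_left) simp
  finally show "c = (- \<i>/2) \<odot> vdiff A u (star A u)" using c by (simp add: scale_scale)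
  assume comm: "b \<otimes> c = c \<otimes> b"
  have "star A u \<otimes> u = (b \<otimes> b \<oplus> \<i> \<odot> (b \<otimes> c)) \<oplus> ((- \<i>) \<odot> (b \<otimes> c) \<oplus> c \<otimes> c)"
    using b c comm by (simp only: su) (simp add: u ring_rules add_ac)
  also have "\<dots> = b \<otimes> b \<oplus> c \<otimes> c" using b c by (intro cancel) auto
  finally show "star A u \<otimes> u = b \<otimes> b \<oplus> c \<otimes> c" .
qed

end

section \<open>Norm estimates in \<open>C\<^sup>*\<close>-algebras\<close>

context cstar_algebra
begin

declare nrm_nonneg [simp]

lemma nrm_zero [simp]: "nrm A \<zero> = 0"
  by (simp add: nrm_eq_zero)

lemma star_mult_self_zero:
  assumes "a \<in> carrier A" "star A a \<otimes> a = \<zero>"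
  shows "a = \<zero>"
  using cstar_identity[OF assms(1)] assms nrm_eq_zero by simp

lemma nrm_star [simp]:
  assumes "a \<in> carrier A"
  shows "nrm A (star A a) = nrm A a"
proof -
  have *: "nrm A b \<le> nrm A (star A b)" if "b \<in> carrier A" for b
  proof (cases "nrm A b = 0")
    case False
    have "nrm A b * nrm A b = nrm A (star A b \<otimes> b)"
      using that by (simp add: cstar_identity power2_eq_square)
    also have "\<dots> \<le> nrm A (star A b) * nrm A b"
      using that by (intro nrm_mult) auto
    finally show ?thesis using False nrm_nonneg[OF that] by auto
  qed (use that in auto)
  from *[OF assms] *[of "star A a"] assms show ?thesis by auto
qed

lemma nrm_neg [simp]: "a \<in> carrier A \<Longrightarrow> nrm A ((- 1) \<odot> a) = nrm A a"
  by (simp add: nrm_scale)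

lemma nrm_vdiff_le: "\<lbrakk>a \<in> carrier A; b \<in> carrier A\<rbrakk> \<Longrightarrow> nrm A (vdiff A a b) \<le> nrm A a + nrm A b"
  using nrm_triangle[of a "(- 1) \<odot> b"] by (simp add: vdiff_def)

lemma nrm_vdiff_commute:
  "\<lbrakk>a \<in> carrier A; b \<in> carrier A\<rbrakk> \<Longrightarrow> nrm A (vdiff A a b) = nrm A (vdiff A b a)"
  by (metis vdiff_swap nrm_neg vdiff_closed)

lemma nrm_vdiff_triangle:
  "\<lbrakk>a \<in> carrier A; b \<in> carrier A; c \<in> carrier A\<rbrakk>
     \<Longrightarrow> nrm A (vdiff A a c) \<le> nrm A (vdiff A a b) + nrm A (vdiff A b c)"
  by (metis vdiff_trans nrm_triangle vdiff_closed)

lemma nrm_le_vdiff: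
  "\<lbrakk>a \<in> carrier A; b \<in> carrier A\<rbrakk> \<Longrightarrow> nrm A a \<le> nrm A b + nrm A (vdiff A a b)"
  by (metis vdiff_add_cancel nrm_triangle vdiff_closed)

lemma nrm_half_sum_le:
  assumes "a \<in> carrier A" "b \<in> carrier A" "nrm A a \<le> 1" "nrm A b \<le> 1"
  shows "nrm A ((1/2) \<odot> (a \<oplus> b)) \<le> 1"
  using nrm_triangle[OF assms(1,2)] assms by (simp add: nrm_scale)

text \<open>The equation p* p = p encodes a self-adjoint idempotent, and the C*-identity reads N^2 =
  N for its norm N.\<close>

lemma projection_nrm_le:
  assumes "p \<in> carrier A" "star A p \<otimes> p = p"
  shows "nrm A p \<le> 1"
  using cstar_identity[OF assms(1)] assms nrm_nonneg[OF assms(1)]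
  by (auto simp: power2_eq_square)

lemma projection_nrm_eq:
  assumes "p \<in> carrier A" "star A p \<otimes> p = p" "p \<noteq> \<zero>"
  shows "nrm A p = 1"
  using cstar_identity[OF assms(1)] assms nrm_eq_zero[OF assms(1)]
  by (simp add: power2_eq_square)

section \<open>Convergent sequences and closed sets\<close>

abbreviation conv :: "(nat \<Rightarrow> 'a) \<Rightarrow> 'a \<Rightarrow> bool" where
  "conv s l \<equiv> converges_to A (nrm A) s l"

lemma conv_less:
  assumes "conv s l" "e > 0"
  obtains M where "\<And>k. k \<ge> M \<Longrightarrow> nrm A (vdiff A (s k) l) < e"
proof -
  obtain M where "\<forall>k\<ge>M. norm (nrm A (vdiff A (s k) l) - 0) < e"
    using assms unfolding converges_to_def LIMSEQ_iff by blast
  then have "\<And>k. k \<ge> M \<Longrightarrow> nrm A (vdiff A (s k) l) < e" by auto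
  then show ?thesis by (rule that)
qed

lemma conv_const: "l \<in> carrier A \<Longrightarrow> conv (\<lambda>_. l) l"
  by (simp add: converges_to_def)

lemma conv_add:
  assumes "\<And>k. s k \<in> carrier A" "\<And>k. t k \<in> carrier A" "l \<in> carrier A" "m \<in> carrier A"
    "conv s l" "conv t m"
  shows "conv (\<lambda>k. s k \<oplus> t k) (l \<oplus> m)"
  unfolding converges_to_def
proof (rule Lim_null_comparison)
  show "\<forall>\<^sub>F k in sequentially. norm (nrm A (vdiff A (s k \<oplus> t k) (l \<oplus> m)))
      \<le> nrm A (vdiff A (s k) l) + nrm A (vdiff A (t k) m)"
    using assms by (auto simp: vdiff_add_add nrm_triangle)
  show "(\<lambda>k. nrm A (vdiff A (s k) l) + nrm A (vdiff A (t k) m)) \<longlonglongrightarrow> 0"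
    using tendsto_add[OF assms(5,6)[unfolded converges_to_def]] by simp
qed

lemma conv_scale:
  assumes "\<And>k. s k \<in> carrier A" "l \<in> carrier A" "conv s l"
  shows "conv (\<lambda>k. c \<odot> s k) (c \<odot> l)"
  using assms tendsto_mult_left[OF assms(3)[unfolded converges_to_def], of "cmod c"]
  by (simp add: converges_to_def vdiff_scale nrm_scale)

lemma conv_star:
  assumes "\<And>k. s k \<in> carrier A" "l \<in> carrier A" "conv s l"
  shows "conv (\<lambda>k. star A (s k)) (star A l)"
  using assms by (simp add: converges_to_def flip: star_vdiff)

lemma conv_nrm:
  assumes "\<And>k. s k \<in> carrier A" "l \<in> carrier A" "conv s l"
  shows "(\<lambda>k. nrm A (s k)) \<longlonglongrightarrow> nrm A l"
proof -
  have "(\<lambda>k. nrm A (s k) - nrm A l) \<longlonglongrightarrow> 0"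
  proof (rule Lim_null_comparison)
    show "\<forall>\<^sub>F k in sequentially. norm (nrm A (s k) - nrm A l) \<le> nrm A (vdiff A (s k) l)"
    proof (intro always_eventually allI)
      fix k
      show "norm (nrm A (s k) - nrm A l) \<le> nrm A (vdiff A (s k) l)"
        using nrm_le_vdiff[of "s k" l] nrm_le_vdiff[of l "s k"] nrm_vdiff_commute[of l "s k"]
          assms(1,2) by (auto simp: abs_le_iff)
    qed
  qed (use assms(3) in \<open>simp add: converges_to_def\<close>)
  then show ?thesis by (simp add: LIM_zero_cancel)
qed

lemma conv_mult:
  assumes "\<And>k. s k \<in> carrier A" "\<And>k. t k \<in> carrier A" "l \<in> carrier A" "m \<in> carrier A"
    "conv s l" "conv t m"
  shows "conv (\<lambda>k. s k \<otimes> t k) (l \<otimes> m)"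
  unfolding converges_to_def
proof (rule Lim_null_comparison)
  show "\<forall>\<^sub>F k in sequentially. norm (nrm A (vdiff A (s k \<otimes> t k) (l \<otimes> m)))
      \<le> nrm A (vdiff A (s k) l) * nrm A (t k) + nrm A l * nrm A (vdiff A (t k) m)"
  proof (intro always_eventually allI)
    fix k
    have "vdiff A (s k \<otimes> t k) (l \<otimes> m) = vdiff A (s k) l \<otimes> t k \<oplus> l \<otimes> vdiff A (t k) m"
      using assms(1-4) by (simp add: vdiff_mult mult_vdiff vdiff_trans)
    then have "nrm A (vdiff A (s k \<otimes> t k) (l \<otimes> m))
        \<le> nrm A (vdiff A (s k) l \<otimes> t k) + nrm A (l \<otimes> vdiff A (t k) m)"
      using assms(1-4) by (simp add: nrm_triangle)
    also have "\<dots> \<le> nrm A (vdiff A (s k) l) * nrm A (t k) + nrm A l * nrm A (vdiff A (t k) m)"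
      using assms(1-4) by (intro add_mono nrm_mult) auto
    finally show "norm (nrm A (vdiff A (s k \<otimes> t k) (l \<otimes> m)))
        \<le> nrm A (vdiff A (s k) l) * nrm A (t k) + nrm A l * nrm A (vdiff A (t k) m)"
      using assms(1-4) by simp
  qed
  have "(\<lambda>k. nrm A (vdiff A (s k) l) * nrm A (t k) + nrm A l * nrm A (vdiff A (t k) m))
      \<longlonglongrightarrow> 0 * nrm A m + nrm A l * 0"
    by (intro tendsto_intros conv_nrm assms assms(5,6)[unfolded converges_to_def])
  then show "(\<lambda>k. nrm A (vdiff A (s k) l) * nrm A (t k) + nrm A l * nrm A (vdiff A (t k) m))
      \<longlonglongrightarrow> 0" by simp
qed

lemma conv_unique:
  assumes "\<And>k. s k \<in> carrier A" "l \<in> carrier A" "m \<in> carrier A" "conv s l" "conv s m"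
  shows "l = m"
proof -
  have "(\<lambda>k. nrm A (vdiff A (s k) (s k))) \<longlonglongrightarrow> nrm A (vdiff A l m)"
  proof (rule conv_nrm)
    show "conv (\<lambda>k. vdiff A (s k) (s k)) (vdiff A l m)"
      unfolding vdiff_def using assms by (intro conv_add conv_scale) auto
  qed (use assms in auto)
  then have "nrm A (vdiff A l m) = 0"
    using assms(1) by (simp add: LIMSEQ_const_iff)
  then show ?thesis using assms by (simp add: nrm_eq_zero vdiff_eq_zero_iff)
qed

lemma Cauchy_convergent:
  assumes "\<And>k. s k \<in> carrier A"
    and "\<And>e. e > 0 \<Longrightarrow> \<exists>M. \<forall>j\<ge>M. \<forall>k\<ge>M. nrm A (vdiff A (s j) (s k)) < e"
  obtains l where "l \<in> carrier A" "conv s l"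
  using nrm_complete assms unfolding complete_norm_def by blast

text \<open>Comparison with a convergent real sequence. It serves the square root iteration and,
  with a geometric sequence, the completeness of quotients.\<close>

lemma Cauchy_convergent_bound:
  assumes s: "\<And>k. s k \<in> carrier A"
    and le: "\<And>j k. nrm A (vdiff A (s j) (s k)) \<le> \<bar>t j - t k\<bar>" and "convergent t"
  obtains l where "l \<in> carrier A" "conv s l"
proof -
  have C: "Cauchy t" using assms(3) by (simp add: convergent_Cauchy)
  show ?thesis
  proof (rule Cauchy_convergent[OF s])
    fix e :: real assume "e > 0"
    then obtain M where "\<forall>j\<ge>M. \<forall>k\<ge>M. \<bar>t j - t k\<bar> < e"
      using C unfolding Cauchy_def dist_real_def by blast
    then show "\<exists>M. \<forall>j\<ge>M. \<forall>k\<ge>M. nrm A (vdiff A (s j) (s k)) < e"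
      using le by (meson order_le_less_trans)
  qed (rule that)
qed

lemma norm_closure_iff:
  assumes "S \<subseteq> carrier A"
  shows "v \<in> norm_closure A (nrm A) S \<longleftrightarrow>
    v \<in> carrier A \<and> (\<forall>e>0. \<exists>u\<in>S. nrm A (vdiff A u v) < e)"
proof safe
  assume "v \<in> norm_closure A (nrm A) S"
  then obtain s where s: "v \<in> carrier A" "\<And>k. s k \<in> S" "conv s v"
    by (auto simp: norm_closure_def)
  then show "v \<in> carrier A" by simp
  fix e :: real assume "e > 0"
  then obtain k where "nrm A (vdiff A (s k) v) < e" using conv_less[OF s(3)] by (meson order_refl)
  then show "\<exists>u\<in>S. nrm A (vdiff A u v) < e" using s(2) by blast
next
  assume v: "v \<in> carrier A" and *: "\<forall>e>0. \<exists>u\<in>S. nrm A (vdiff A u v) < e"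
  have "\<forall>k. \<exists>u\<in>S. nrm A (vdiff A u v) < inverse (real (Suc k))" using * by simp
  then obtain s where s: "\<And>k. s k \<in> S" "\<And>k. nrm A (vdiff A (s k) v) < inverse (real (Suc k))"
    by metis
  have "conv s v" unfolding converges_to_def
  proof (rule Lim_null_comparison)
    show "\<forall>\<^sub>F k in sequentially. norm (nrm A (vdiff A (s k) v)) \<le> inverse (real (Suc k))"
      using s assms v by (auto intro!: always_eventually simp: less_imp_le subset_iff)
  qed (rule LIMSEQ_inverse_real_of_nat)
  then show "v \<in> norm_closure A (nrm A) S" using s v by (auto simp: norm_closure_def)
qed

definition closed_set :: "'a set \<Rightarrow> bool" where
  "closed_set S \<longleftrightarrow> (\<forall>s l. (\<forall>k. s k \<in> S) \<longrightarrow> l \<in> carrier A \<longrightarrow> conv s l \<longrightarrow> l \<in> S)"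

lemma closed_setI:
  "(\<And>s l. \<lbrakk>\<And>k. s k \<in> S; l \<in> carrier A; conv s l\<rbrakk> \<Longrightarrow> l \<in> S) \<Longrightarrow> closed_set S"
  by (auto simp: closed_set_def)

lemma closed_setD: "\<lbrakk>closed_set S; \<And>k. s k \<in> S; l \<in> carrier A; conv s l\<rbrakk> \<Longrightarrow> l \<in> S"
  by (auto simp: closed_set_def)

lemma closed_set_iff: "closed_set S \<longleftrightarrow> norm_closure A (nrm A) S \<subseteq> S"
  by (auto simp: closed_set_def norm_closure_def)

lemma norm_closure_superset: "S \<subseteq> carrier A \<Longrightarrow> S \<subseteq> norm_closure A (nrm A) S"
proof
  fix x assume "S \<subseteq> carrier A" "x \<in> S"
  then show "x \<in> norm_closure A (nrm A) S"
    by (auto simp: norm_closure_def intro!: exI[of _ "\<lambda>_. x"] conv_const)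
qed

lemma norm_closure_subset: "norm_closure A (nrm A) S \<subseteq> carrier A"
  by (auto simp: norm_closure_def)

lemma closed_norm_closure:
  assumes "S \<subseteq> carrier A"
  shows "closed_set (norm_closure A (nrm A) S)"
  unfolding closed_set_iff
proof
  let ?C = "norm_closure A (nrm A) S"
  fix v assume v: "v \<in> norm_closure A (nrm A) ?C"
  have vA: "v \<in> carrier A" using v norm_closure_subset by auto
  show "v \<in> ?C"
    unfolding norm_closure_iff[OF assms]
  proof (intro conjI allI impI vA)
    fix e :: real assume "e > 0"
    then obtain u where u: "u \<in> ?C" "nrm A (vdiff A u v) < e/2"
      using v norm_closure_iff[OF norm_closure_subset] half_gt_zero by blast
    then obtain t where t: "t \<in> S" "nrm A (vdiff A t u) < e/2"
      using \<open>e > 0\<close> norm_closure_iff[OF assms] half_gt_zero by blast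
    have "nrm A (vdiff A t v) < e"
      using nrm_vdiff_triangle[of t u v] u t assms norm_closure_subset[of S] vA by fastforce
    then show "\<exists>u\<in>S. nrm A (vdiff A u v) < e" using t by blast
  qed
qed

section \<open>Closed and generated *-subalgebras\<close>

definition star_subalgebra :: "'a set \<Rightarrow> bool" where
  "star_subalgebra U \<longleftrightarrow> subspace_of U A \<and> (\<forall>a\<in>U. \<forall>b\<in>U. a \<otimes> b \<in> U) \<and> (\<forall>a\<in>U. star A a \<in> U)"

lemma cstar_generated_induct:
  assumes "a \<in> cstar_generated A S" "star_subalgebra T" "closed_set T" "S \<subseteq> T"
  shows "a \<in> T"
  using assms unfolding cstar_generated_def star_subalgebra_def closed_set_iff by blast

lemma subspace_norm_closure:
  assumes "subspace_of U A"
  shows "subspace_of (norm_closure A (nrm A) U) A"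
proof -
  have U: "U \<subseteq> carrier A" using assms by (simp add: subspace_of_def)
  show ?thesis unfolding subspace_of_def
  proof (intro conjI ballI allI)
    show "norm_closure A (nrm A) U \<subseteq> carrier A" by (rule norm_closure_subset)
    show "\<zero> \<in> norm_closure A (nrm A) U"
      using assms norm_closure_superset[OF U] by (auto simp: subspace_of_def)
  next
    fix u v assume "u \<in> norm_closure A (nrm A) U" "v \<in> norm_closure A (nrm A) U"
    then obtain s t where st: "\<And>k. s k \<in> U" "\<And>k. t k \<in> U" "conv s u" "conv t v"
      "u \<in> carrier A" "v \<in> carrier A" by (auto simp: norm_closure_def)
    have "conv (\<lambda>k. s k \<oplus> t k) (u \<oplus> v)" using st U by (intro conv_add) auto
    moreover have "\<And>k. s k \<oplus> t k \<in> U" using st assms by (auto simp: subspace_of_def)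
    ultimately show "u \<oplus> v \<in> norm_closure A (nrm A) U"
      using st by (auto simp: norm_closure_def intro!: exI[of _ "\<lambda>k. s k \<oplus> t k"])
  next
    fix c u assume "u \<in> norm_closure A (nrm A) U"
    then obtain s where st: "\<And>k. s k \<in> U" "conv s u" "u \<in> carrier A" by (auto simp: norm_closure_def)
    have "conv (\<lambda>k. c \<odot> s k) (c \<odot> u)" using st U by (intro conv_scale) auto
    moreover have "\<And>k. c \<odot> s k \<in> U" using st assms by (auto simp: subspace_of_def)
    ultimately show "c \<odot> u \<in> norm_closure A (nrm A) U"
      using st by (auto simp: norm_closure_def intro!: exI[of _ "\<lambda>k. c \<odot> s k"])
  qed
qed

lemma star_subalgebra_norm_closure:
  assumes "star_subalgebra U"
  shows "star_subalgebra (norm_closure A (nrm A) U)"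
proof -
  have U: "U \<subseteq> carrier A" using assms by (simp add: subspace_of_def star_subalgebra_def)
  show ?thesis unfolding star_subalgebra_def
  proof (intro conjI ballI allI)
    show "subspace_of (norm_closure A (nrm A) U) A"
      using assms by (intro subspace_norm_closure) (simp add: star_subalgebra_def)
  next
    fix u v assume "u \<in> norm_closure A (nrm A) U" "v \<in> norm_closure A (nrm A) U"
    then obtain s t where st: "\<And>k. s k \<in> U" "\<And>k. t k \<in> U" "conv s u" "conv t v"
      "u \<in> carrier A" "v \<in> carrier A" by (auto simp: norm_closure_def)
    have "conv (\<lambda>k. s k \<otimes> t k) (u \<otimes> v)" using st U by (intro conv_mult) auto
    moreover have "\<And>k. s k \<otimes> t k \<in> U" using st assms by (auto simp: star_subalgebra_def)
    ultimately show "u \<otimes> v \<in> norm_closure A (nrm A) U"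
      using st by (auto simp: norm_closure_def intro!: exI[of _ "\<lambda>k. s k \<otimes> t k"])
  next
    fix u assume "u \<in> norm_closure A (nrm A) U"
    then obtain s where st: "\<And>k. s k \<in> U" "conv s u" "u \<in> carrier A" by (auto simp: norm_closure_def)
    have "conv (\<lambda>k. star A (s k)) (star A u)" using st U by (intro conv_star) auto
    moreover have "\<And>k. star A (s k) \<in> U" using st assms by (auto simp: star_subalgebra_def)
    ultimately show "star A u \<in> norm_closure A (nrm A) U"
      using st by (auto simp: norm_closure_def intro!: exI[of _ "\<lambda>k. star A (s k)"])
  qed
qed

lemma cstar_generated_subset_closure:
  assumes "star_subalgebra U" "S \<subseteq> U"
  shows "cstar_generated A S \<subseteq> norm_closure A (nrm A) U"
proof
  fix a assume a: "a \<in> cstar_generated A S"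
  have U: "U \<subseteq> carrier A" using assms by (simp add: subspace_of_def star_subalgebra_def)
  show "a \<in> norm_closure A (nrm A) U"
    using a star_subalgebra_norm_closure[OF assms(1)] closed_norm_closure[OF U]
    by (rule cstar_generated_induct) (use assms(2) norm_closure_superset[OF U] in blast)
qed

subsection \<open>Square roots\<close>

text \<open>The fixed point iteration for \<open>y = (a + y\<^sup>2) / 2\<close>, that is for \<open>(1 - y)\<^sup>2 = 1 - a\<close>, started at
  \<open>0\<close>; it is dominated by the same iteration for \<open>a = 1\<close> in the real numbers.\<close>

fun sqrt_iter :: "'a \<Rightarrow> nat \<Rightarrow> 'a" where
  "sqrt_iter a 0 = \<zero>"
| "sqrt_iter a (Suc m) = (1/2) \<odot> (a \<oplus> sqrt_iter a m \<otimes> sqrt_iter a m)"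

fun real_iter :: "nat \<Rightarrow> real" where
  "real_iter 0 = 0"
| "real_iter (Suc m) = (1 + (real_iter m)\<^sup>2) / 2"

lemma real_iter_bounds: "0 \<le> real_iter m \<and> real_iter m \<le> 1"
proof (induction m)
  case (Suc m)
  then have "(real_iter m)\<^sup>2 \<le> 1" by (simp add: power_le_one)
  then show ?case by simp
qed simp

lemma real_iter_mono: "real_iter m \<le> real_iter (Suc m)"
proof -
  have "0 \<le> (1 - real_iter m)\<^sup>2" by simp
  then show ?thesis by (simp add: power2_eq_square algebra_simps)
qed

lemma real_iter_convergent: "convergent real_iter"
proof (rule Bseq_monoseq_convergent)
  show "Bseq real_iter" using real_iter_bounds by (intro BseqI'[of _ 1]) (auto simp: abs_le_iff)
  show "monoseq real_iter" using real_iter_mono by (intro mono_SucI1) auto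
qed

lemma sqrt_iter_closed [simp]: "a \<in> carrier A \<Longrightarrow> sqrt_iter a m \<in> carrier A"
  by (induction m) auto

lemma sqrt_iter_star: "\<lbrakk>a \<in> carrier A; star A a = a\<rbrakk> \<Longrightarrow> star A (sqrt_iter a m) = sqrt_iter a m"
  by (induction m) (auto simp: star_scale star_add star_mult)

lemma sqrt_iter_commute:
  assumes "a \<in> carrier A" "b \<in> carrier A" "a \<otimes> b = b \<otimes> a"
  shows "sqrt_iter a m \<otimes> b = b \<otimes> sqrt_iter a m"
proof (induction m)
  case (Suc m)
  let ?y = "sqrt_iter a m"
  have "?y \<otimes> ?y \<otimes> b = b \<otimes> (?y \<otimes> ?y)"
    using Suc assms by (metis mult_assoc sqrt_iter_closed)
  then show ?case using assms
    by (simp add: mult_scale_left mult_scale_right mult_add_left mult_add_right)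
qed (use assms in simp)

text \<open>Successive iterates commute, so y'' - y' = (y' - y)(y' + y)/2. The real iteration
  satisfies the same identity, and the bounds follow by induction, factor by factor.\<close>

lemma sqrt_iter_bounds:
  assumes a: "a \<in> carrier A" "nrm A a \<le> 1"
  shows "nrm A (sqrt_iter a m) \<le> real_iter m"
    and "nrm A (vdiff A (sqrt_iter a (Suc m)) (sqrt_iter a m)) \<le> real_iter (Suc m) - real_iter m"
proof -
  show le: "nrm A (sqrt_iter a m) \<le> real_iter m" for m
  proof (induction m)
    case (Suc m)
    have "nrm A (a \<oplus> sqrt_iter a m \<otimes> sqrt_iter a m)
        \<le> nrm A a + nrm A (sqrt_iter a m) * nrm A (sqrt_iter a m)"
      using a nrm_triangle[of a "sqrt_iter a m \<otimes> sqrt_iter a m"]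
        nrm_mult[of "sqrt_iter a m" "sqrt_iter a m"] by auto
    also have "\<dots> \<le> 1 + real_iter m * real_iter m"
      using a Suc by (intro add_mono mult_mono) (auto simp: real_iter_bounds)
    finally show ?case using a by (simp add: nrm_scale power2_eq_square)
  qed simp
  show "nrm A (vdiff A (sqrt_iter a (Suc m)) (sqrt_iter a m)) \<le> real_iter (Suc m) - real_iter m"
  proof (induction m)
    case 0
    then show ?case using a by (simp add: nrm_scale)
  next
    case (Suc m)
    let ?y = "sqrt_iter a m" and ?z = "sqrt_iter a (Suc m)"
    have c: "?y \<in> carrier A" "?z \<in> carrier A" using a sqrt_iter_closed by blast+
    have comm: "?y \<otimes> ?z = ?z \<otimes> ?y"
      using a c by (intro sqrt_iter_commute sqrt_iter_commute[symmetric]) auto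
    have "vdiff A (sqrt_iter a (Suc (Suc m))) ?z
        = (1/2) \<odot> vdiff A (a \<oplus> ?z \<otimes> ?z) (a \<oplus> ?y \<otimes> ?y)"
      using a c by (simp only: sqrt_iter.simps(2)[of a "Suc m"] sqrt_iter.simps(2)[of a m]
          vdiff_scale add_closed mult_closed)
    also have "vdiff A (a \<oplus> ?z \<otimes> ?z) (a \<oplus> ?y \<otimes> ?y) = vdiff A ?z ?y \<otimes> (?z \<oplus> ?y)"
      using a c comm by (simp del: sqrt_iter.simps
          add: vdiff_mult mult_add_right mult_add_left mult_vdiff vdiff_add_add vdiff_trans)
    finally have "nrm A (vdiff A (sqrt_iter a (Suc (Suc m))) ?z)
        = nrm A (vdiff A ?z ?y \<otimes> (?z \<oplus> ?y)) / 2"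
      using c by (simp del: sqrt_iter.simps add: nrm_scale)
    also have "\<dots> \<le> nrm A (vdiff A ?z ?y) * nrm A (?z \<oplus> ?y) / 2"
      using c by (intro divide_right_mono nrm_mult) auto
    also have "\<dots> \<le> (real_iter (Suc m) - real_iter m) * (real_iter (Suc m) + real_iter m) / 2"
    proof (intro divide_right_mono mult_mono Suc)
      show "nrm A (?z \<oplus> ?y) \<le> real_iter (Suc m) + real_iter m"
        using nrm_triangle[OF c(2,1)] le[of m] le[of "Suc m"] by linarith
      show "0 \<le> nrm A (?z \<oplus> ?y)" using c by (intro nrm_nonneg) auto
    qed (use real_iter_mono[of m] in \<open>simp_all del: real_iter.simps\<close>)
    also have "\<dots> = real_iter (Suc (Suc m)) - real_iter (Suc m)"
      unfolding real_iter.simps(2)[of "Suc m"]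
      by (simp add: power2_eq_square field_simps)
    finally show ?case .
  qed
qed

text \<open>The increments telescope to a bound by the convergent real iteration. The last clause,
  that y commutes with whatever commutes with a, is what later supplies the commutation hypothesis
  of \<open>cartesian_parts\<close>.\<close>

lemma sqrt_exists:
  assumes a: "a \<in> carrier A" "star A a = a" "nrm A a \<le> 1"
  obtains y where "y \<in> carrier A" "star A y = y" "nrm A y \<le> 1"
    "2 \<odot> y = a \<oplus> y \<otimes> y" "\<And>b. \<lbrakk>b \<in> carrier A; a \<otimes> b = b \<otimes> a\<rbrakk> \<Longrightarrow> y \<otimes> b = b \<otimes> y"
proof -
  let ?s = "sqrt_iter a"
  have c: "\<And>m. ?s m \<in> carrier A" using a by simp
  have mono: "nrm A (vdiff A (?s (m + d)) (?s m)) \<le> real_iter (m + d) - real_iter m" for m d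
  proof (induction d)
    case (Suc d)
    have "nrm A (vdiff A (?s (m + Suc d)) (?s m))
        \<le> nrm A (vdiff A (?s (Suc (m + d))) (?s (m + d))) + nrm A (vdiff A (?s (m + d)) (?s m))"
      using nrm_vdiff_triangle[of "?s (Suc (m + d))" "?s (m + d)" "?s m"] c
      by (simp del: sqrt_iter.simps)
    then show ?case using Suc sqrt_iter_bounds(2)[OF a(1,3), of "m + d"] by simp
  qed (use c in simp)
  have bound: "nrm A (vdiff A (?s j) (?s k)) \<le> \<bar>real_iter j - real_iter k\<bar>" for j k
  proof (cases "k \<le> j")
    case True
    then show ?thesis using mono[of k "j - k"] by simp
  next
    case False
    then show ?thesis using mono[of j "k - j"] nrm_vdiff_commute[OF c c, of j k] by simp
  qed
  obtain y where y: "y \<in> carrier A" "conv ?s y"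
    by (rule Cauchy_convergent_bound[OF c bound real_iter_convergent])
  show ?thesis
  proof
    show "y \<in> carrier A" by fact
    have "conv (\<lambda>m. star A (?s m)) (star A y)" using y c by (intro conv_star)
    then have "conv ?s (star A y)" using a by (simp add: sqrt_iter_star)
    then show "star A y = y" using y c by (intro conv_unique[of ?s]) auto
    show "nrm A y \<le> 1"
    proof (rule LIMSEQ_le_const2[OF conv_nrm[OF c y]], intro exI allI impI)
      show "nrm A (?s m) \<le> 1" for m
        using sqrt_iter_bounds(1)[OF a(1,3), of m] real_iter_bounds[of m] by linarith
    qed
    have "conv (\<lambda>m. a \<oplus> ?s m \<otimes> ?s m) (a \<oplus> y \<otimes> y)"
      using y c a by (intro conv_add conv_mult conv_const) auto
    moreover have "conv (\<lambda>m. 2 \<odot> ?s (Suc m)) (2 \<odot> y)"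
      using LIMSEQ_Suc[OF conv_scale[OF c y, unfolded converges_to_def]]
      by (simp only: converges_to_def)
    moreover have "(\<lambda>m. 2 \<odot> ?s (Suc m)) = (\<lambda>m. a \<oplus> ?s m \<otimes> ?s m)"
      using a c by (simp add: scale_scale)
    ultimately show "2 \<odot> y = a \<oplus> y \<otimes> y"
      using y c a by (intro conv_unique[of "\<lambda>m. a \<oplus> ?s m \<otimes> ?s m"]) auto
  next
    fix b assume b: "b \<in> carrier A" "a \<otimes> b = b \<otimes> a"
    have "conv (\<lambda>m. ?s m \<otimes> b) (y \<otimes> b)"
      using y c b by (intro conv_mult conv_const) auto
    moreover have "conv (\<lambda>m. b \<otimes> ?s m) (b \<otimes> y)"
      using y c b by (intro conv_mult conv_const) auto
    moreover have "(\<lambda>m. ?s m \<otimes> b) = (\<lambda>m. b \<otimes> ?s m)"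
      using a b sqrt_iter_commute by blast
    ultimately show "y \<otimes> b = b \<otimes> y"
      using y c b by (intro conv_unique[of "\<lambda>m. b \<otimes> ?s m"]) auto
  qed
qed

end

section \<open>Unital \<open>C\<^sup>*\<close>-algebras\<close>

locale unital_cstar = cstar_algebra A for A :: "('a, 'm) cstar_scheme" (structure) +
  fixes unit :: 'a  ("\<one>")
  assumes unit_closed [simp, intro]: "\<one> \<in> carrier A"
    and unit_mult [simp]: "a \<in> carrier A \<Longrightarrow> \<one> \<otimes> a = a"
    and mult_unit [simp]: "a \<in> carrier A \<Longrightarrow> a \<otimes> \<one> = a"
begin

lemma star_unit [simp]: "star A \<one> = \<one>"
  by (metis mult_unit star_closed star_mult star_star unit_closed)

lemma nrm_unit_le: "nrm A \<one> \<le> 1"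
  by (rule projection_nrm_le) auto

text \<open>Together with \<open>b\<close>, the element \<open>c = \<surd>(1 - b\<^sup>2)\<close> makes \<open>b + \<i>c\<close> unitary, which gives all norm
  estimates below.\<close>

lemma sqrt_complement:
  assumes b: "b \<in> carrier A" "star A b = b" "nrm A b \<le> 1"
  obtains c where "c \<in> carrier A" "star A c = c" "b \<otimes> c = c \<otimes> b"
    "b \<otimes> b \<oplus> c \<otimes> c = \<one>" "nrm A c \<le> 1"
proof -
  have bb: "b \<otimes> b \<in> carrier A" "star A (b \<otimes> b) = b \<otimes> b" "nrm A (b \<otimes> b) \<le> 1"
    using cstar_identity[OF b(1)] b power_le_one[of "nrm A b" 2] by (simp_all add: star_mult)
  obtain y where y: "y \<in> carrier A" "star A y = y" "2 \<odot> y = b \<otimes> b \<oplus> y \<otimes> y"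
    "\<And>x. \<lbrakk>x \<in> carrier A; b \<otimes> b \<otimes> x = x \<otimes> (b \<otimes> b)\<rbrakk> \<Longrightarrow> y \<otimes> x = x \<otimes> y"
    by (rule sqrt_exists[OF bb]) (rule that)
  define c where "c = vdiff A \<one> y"
  have yb: "y \<otimes> b = b \<otimes> y" using y(4)[of b] b by (simp add: mult_assoc)
  have c: "c \<in> carrier A" "star A c = c" using y(1,2) by (auto simp: c_def star_vdiff)
  have bc: "b \<otimes> c = c \<otimes> b" using yb b(1) y(1) by (simp add: c_def mult_vdiff vdiff_mult)
  have "b \<otimes> b \<oplus> c \<otimes> c = (b \<otimes> b \<oplus> y \<otimes> y) \<oplus> (\<one> \<oplus> (- 2) \<odot> y)"
    using b(1) y(1) scale_add_left[of y "- 1" "- 1"]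
    by (simp add: c_def vdiff_def ring_rules add_ac)
  also have "b \<otimes> b \<oplus> y \<otimes> y = 2 \<odot> y" using y(3) by simp
  also have "2 \<odot> y \<oplus> (\<one> \<oplus> (- 2) \<odot> y) = \<one> \<oplus> (2 \<odot> y \<oplus> (- 2) \<odot> y)"
    using y(1) by (simp add: add_ac)
  also have "2 \<odot> y \<oplus> (- 2) \<odot> y = \<zero>" using y(1) scale_add_left[of y 2 "- 2"] by simp
  finally have sum: "b \<otimes> b \<oplus> c \<otimes> c = \<one>" by simp
  define u where "u = b \<oplus> \<i> \<odot> c"
  have u: "u \<in> carrier A" using b c by (simp add: u_def)
  note uu = cartesian_parts[OF b(1,2) c u_def]
  have "star A u \<otimes> u = b \<otimes> b \<oplus> c \<otimes> c" using uu(3)[OF bc] .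
  then have "(nrm A u)\<^sup>2 \<le> 1" using cstar_identity[OF u] sum nrm_unit_le by simp
  then have nu: "nrm A u \<le> 1" using nrm_nonneg[OF u] by (simp add: power_le_one_iff abs_square_le_1)
  have "nrm A c = nrm A (vdiff A u (star A u)) / 2"
    by (subst uu(2)) (use u in \<open>simp add: nrm_scale norm_mult norm_divide\<close>)
  then have "nrm A c \<le> 1" using nrm_vdiff_le[OF u star_closed[OF u]] nu u by simp
  then show ?thesis using that c bc sum by blast
qed

text \<open>Makes 1 - i^2 a contraction in the construction of approximate units.\<close>

lemma nrm_one_minus_square_le:
  assumes b: "b \<in> carrier A" "star A b = b" "nrm A b \<le> 1"
  shows "nrm A (vdiff A \<one> (b \<otimes> b)) \<le> 1"
proof -
  obtain c where c: "c \<in> carrier A" "star A c = c"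
    "b \<otimes> b \<oplus> c \<otimes> c = \<one>" "nrm A c \<le> 1" by (rule sqrt_complement[OF b])
  have "vdiff A \<one> (b \<otimes> b) = c \<otimes> c"
    using c(1,3) b(1) by (intro vdiff_eqI) auto
  then show ?thesis using cstar_identity[OF c(1)] c power_le_one[of "nrm A c" 2] by simp
qed

end

text \<open>For self-adjoint b in the unit ball complete b to u = b + i c with u* u = 1. Then f(u)*
  f(u) = f(1) is a projection, whether or not f preserves units, so f(u) and with it f(b) are
  contractions. Scaling, and the C*-identity for a* a, give the general case.\<close>

lemma star_hom_contractive:
  assumes "unital_cstar A e" "cstar_algebra D" "star_hom A D f" "a \<in> carrier A"
  shows "nrm D (f a) \<le> nrm A a"
proof -
  interpret A: unital_cstar A e by fact
  interpret D: cstar_algebra D by fact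
  note f [simp] = star_homD[OF assms(3)]
  have sa: "nrm D (f b) \<le> 1"
    if b: "b \<in> carrier A" "star A b = b" "nrm A b \<le> 1" for b
  proof -
    obtain c where c: "c \<in> carrier A" "star A c = c" "b \<otimes>\<^bsub>A\<^esub> c = c \<otimes>\<^bsub>A\<^esub> b"
      "b \<otimes>\<^bsub>A\<^esub> b \<oplus>\<^bsub>A\<^esub> c \<otimes>\<^bsub>A\<^esub> c = e" using A.sqrt_complement[OF b] by blast
    define p where "p = f e"
    have "star D p = p" using f(6)[of e] by (simp add: p_def)
    moreover have "p \<otimes>\<^bsub>D\<^esub> p = p" using f(5)[of e e] by (simp add: p_def)
    ultimately have p: "p \<in> carrier D" "star D p \<otimes>\<^bsub>D\<^esub> p = p" by (simp_all add: p_def)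
    define u where "u = b \<oplus>\<^bsub>A\<^esub> \<i> \<odot>\<^bsub>A\<^esub> c"
    have u: "u \<in> carrier A" using b c by (simp add: u_def)
    note uu = A.cartesian_parts[OF b(1,2) c(1,2) u_def]
    have "star A u \<otimes>\<^bsub>A\<^esub> u = b \<otimes>\<^bsub>A\<^esub> b \<oplus>\<^bsub>A\<^esub> c \<otimes>\<^bsub>A\<^esub> c" using uu(3)[OF c(3)] .
    then have "f (star A u \<otimes>\<^bsub>A\<^esub> u) = p" using c by (simp add: p_def)
    then have "star D (f u) \<otimes>\<^bsub>D\<^esub> f u = p" using u by simp
    then have "(nrm D (f u))\<^sup>2 \<le> 1"
      using D.cstar_identity[of "f u"] u D.projection_nrm_le[OF p] by simp
    then have nu: "nrm D (f u) \<le> 1" using u by (simp add: abs_square_le_1)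
    have "f b = (1/2) \<odot>\<^bsub>D\<^esub> (f u \<oplus>\<^bsub>D\<^esub> star D (f u))"
      by (subst uu(1)) (use u in simp)
    then show ?thesis using D.nrm_half_sum_le[of "f u" "star D (f u)"] nu u by simp
  qed
  have sa': "nrm D (f b) \<le> nrm A b" if b: "b \<in> carrier A" "star A b = b" for b
  proof (cases "b = \<zero>\<^bsub>A\<^esub>")
    case True
    then show ?thesis
      using star_hom_zero[OF assms(3) A.complex_space_axioms D.complex_space_axioms] by simp
  next
    case False
    then have pos: "nrm A b > 0" using b A.nrm_eq_zero A.nrm_nonneg by (metis less_eq_real_def)
    let ?r = "complex_of_real (1 / nrm A b)"
    have "nrm D (f (?r \<odot>\<^bsub>A\<^esub> b)) \<le> 1"
      using b pos by (intro sa) (auto simp: A.star_scale A.nrm_scale norm_divide)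
    then show ?thesis using b pos by (simp add: D.nrm_scale norm_divide field_simps)
  qed
  have "nrm D (f (star A a \<otimes>\<^bsub>A\<^esub> a)) \<le> nrm A (star A a \<otimes>\<^bsub>A\<^esub> a)"
    using assms(4) by (intro sa') (auto simp: A.star_mult)
  then have "(nrm D (f a))\<^sup>2 \<le> (nrm A a)\<^sup>2"
    using assms(4) D.cstar_identity[of "f a"] A.cstar_identity[of a] by simp
  then show ?thesis using A.nrm_nonneg[OF assms(4)] by (rule power2_le_imp_le)
qed

lemma star_hom_conv:
  assumes "unital_cstar A e" "cstar_algebra D" "star_hom A D f"
    and "\<And>k. s k \<in> carrier A" "l \<in> carrier A" "converges_to A (nrm A) s l"
  shows "converges_to D (nrm D) (\<lambda>k. f (s k)) (f l)"
  unfolding converges_to_def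
proof (rule Lim_null_comparison)
  interpret A: unital_cstar A e by fact
  interpret D: cstar_algebra D by fact
  show "\<forall>\<^sub>F k in sequentially. norm (nrm D (vdiff D (f (s k)) (f l))) \<le> nrm A (vdiff A (s k) l)"
    using star_hom_contractive[OF assms(1-3)] assms(4,5) star_homD[OF assms(3)]
    by (auto simp: star_hom_vdiff[OF assms(3) A.complex_space_axioms, symmetric])
qed (use assms in \<open>simp add: converges_to_def\<close>)

lemma star_hom_eqI:
  assumes "unital_cstar A e" "cstar_algebra D" "star_hom A D f" "star_hom A D g"
    and "cstar_generated A S = carrier A" "\<And>x. x \<in> S \<Longrightarrow> f x = g x" "S \<subseteq> carrier A"
    and "a \<in> carrier A"
  shows "f a = g a"
proof -
  interpret A: unital_cstar A e by fact
  interpret D: cstar_algebra D by fact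
  note f [simp] = star_homD[OF assms(3)] and g [simp] = star_homD[OF assms(4)]
  let ?T = "{a \<in> carrier A. f a = g a}"
  have "a \<in> ?T"
  proof (rule A.cstar_generated_induct)
    show "a \<in> cstar_generated A S" using assms by simp
    show "A.star_subalgebra ?T"
      using star_hom_zero[OF assms(3) A.complex_space_axioms D.complex_space_axioms]
        star_hom_zero[OF assms(4) A.complex_space_axioms D.complex_space_axioms]
      by (auto simp: A.star_subalgebra_def subspace_of_def)
    show "A.closed_set ?T"
    proof (rule A.closed_setI)
      fix s l assume *: "\<And>k. s k \<in> ?T" "l \<in> carrier A" "A.conv s l"
      have "D.conv (\<lambda>k. f (s k)) (f l)" "D.conv (\<lambda>k. g (s k)) (g l)"
        using star_hom_conv[OF assms(1,2)] assms(3,4) * by blast+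
      moreover have "(\<lambda>k. f (s k)) = (\<lambda>k. g (s k))" using * by auto
      ultimately have "f l = g l"
        using * by (intro D.conv_unique[of "\<lambda>k. f (s k)"]) auto
      then show "l \<in> ?T" using * by simp
    qed
    show "S \<subseteq> ?T" using assms by auto
  qed
  then show ?thesis by simp
qed

section \<open>Subalgebras, transport of structure and quotients\<close>

text \<open>Identities survive along any surjection that intertwines the operations. Injectivity is
  not asked for, so this covers both transport along an injection and the quotient map.\<close>

lemma star_algebra_image:
  assumes "star_algebra A" and carrier: "carrier Q = q ` carrier A"
    and q: "\<And>a b. \<lbrakk>a \<in> carrier A; b \<in> carrier A\<rbrakk> \<Longrightarrow> q a \<oplus>\<^bsub>Q\<^esub> q b = q (a \<oplus>\<^bsub>A\<^esub> b)"
    "\<zero>\<^bsub>Q\<^esub> = q \<zero>\<^bsub>A\<^esub>" "\<And>c a. a \<in> carrier A \<Longrightarrow> c \<odot>\<^bsub>Q\<^esub> q a = q (c \<odot>\<^bsub>A\<^esub> a)"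
    "\<And>a b. \<lbrakk>a \<in> carrier A; b \<in> carrier A\<rbrakk> \<Longrightarrow> q a \<otimes>\<^bsub>Q\<^esub> q b = q (a \<otimes>\<^bsub>A\<^esub> b)"
    "\<And>a. a \<in> carrier A \<Longrightarrow> star Q (q a) = q (star A a)"
  shows "star_algebra Q"
proof -
  interpret A: star_algebra A by fact
  show ?thesis
  proof
    fix t u v w c d
    assume "u \<in> carrier Q" "v \<in> carrier Q" "w \<in> carrier Q"
    then obtain a b c where "u = q a" "v = q b" "w = q c" "a \<in> carrier A" "b \<in> carrier A"
      "c \<in> carrier A" by (auto simp: carrier)
    then show "(u \<oplus>\<^bsub>Q\<^esub> v) \<oplus>\<^bsub>Q\<^esub> w = u \<oplus>\<^bsub>Q\<^esub> (v \<oplus>\<^bsub>Q\<^esub> w)"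
      and "(u \<otimes>\<^bsub>Q\<^esub> v) \<otimes>\<^bsub>Q\<^esub> w = u \<otimes>\<^bsub>Q\<^esub> (v \<otimes>\<^bsub>Q\<^esub> w)"
      and "u \<otimes>\<^bsub>Q\<^esub> (v \<oplus>\<^bsub>Q\<^esub> w) = u \<otimes>\<^bsub>Q\<^esub> v \<oplus>\<^bsub>Q\<^esub> u \<otimes>\<^bsub>Q\<^esub> w"
      and "(u \<oplus>\<^bsub>Q\<^esub> v) \<otimes>\<^bsub>Q\<^esub> w = u \<otimes>\<^bsub>Q\<^esub> w \<oplus>\<^bsub>Q\<^esub> v \<otimes>\<^bsub>Q\<^esub> w"
      by (simp_all add: q A.add_assoc A.mult_assoc A.mult_add_left A.mult_add_right)
  next
    fix t u v c d
    assume "u \<in> carrier Q" "v \<in> carrier Q"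
    then obtain a b where "u = q a" "v = q b" "a \<in> carrier A" "b \<in> carrier A"
      by (auto simp: carrier)
    then show "u \<oplus>\<^bsub>Q\<^esub> v \<in> carrier Q" and "u \<oplus>\<^bsub>Q\<^esub> v = v \<oplus>\<^bsub>Q\<^esub> u"
      and "c \<odot>\<^bsub>Q\<^esub> (u \<oplus>\<^bsub>Q\<^esub> v) = c \<odot>\<^bsub>Q\<^esub> u \<oplus>\<^bsub>Q\<^esub> c \<odot>\<^bsub>Q\<^esub> v"
      and "u \<otimes>\<^bsub>Q\<^esub> v \<in> carrier Q"
      and "u \<otimes>\<^bsub>Q\<^esub> (t \<odot>\<^bsub>Q\<^esub> v) = t \<odot>\<^bsub>Q\<^esub> (u \<otimes>\<^bsub>Q\<^esub> v)"
      and "(t \<odot>\<^bsub>Q\<^esub> u) \<otimes>\<^bsub>Q\<^esub> v = t \<odot>\<^bsub>Q\<^esub> (u \<otimes>\<^bsub>Q\<^esub> v)"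
      and "star Q (u \<oplus>\<^bsub>Q\<^esub> v) = star Q u \<oplus>\<^bsub>Q\<^esub> star Q v"
      and "star Q (u \<otimes>\<^bsub>Q\<^esub> v) = star Q v \<otimes>\<^bsub>Q\<^esub> star Q u"
      by (simp_all add: carrier q A.add_comm A.scale_add_right A.mult_scale_left
          A.mult_scale_right A.star_add A.star_mult)
  next
    fix t u c d
    assume "u \<in> carrier Q"
    then obtain a where "u = q a" "a \<in> carrier A" by (auto simp: carrier)
    then show "c \<odot>\<^bsub>Q\<^esub> u \<in> carrier Q" and "u \<oplus>\<^bsub>Q\<^esub> \<zero>\<^bsub>Q\<^esub> = u"
      and "(c + d) \<odot>\<^bsub>Q\<^esub> u = c \<odot>\<^bsub>Q\<^esub> u \<oplus>\<^bsub>Q\<^esub> d \<odot>\<^bsub>Q\<^esub> u"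
      and "c \<odot>\<^bsub>Q\<^esub> (d \<odot>\<^bsub>Q\<^esub> u) = (c * d) \<odot>\<^bsub>Q\<^esub> u"
      and "1 \<odot>\<^bsub>Q\<^esub> u = u" and "0 \<odot>\<^bsub>Q\<^esub> u = \<zero>\<^bsub>Q\<^esub>"
      and "star Q u \<in> carrier Q" and "star Q (star Q u) = u"
      and "star Q (t \<odot>\<^bsub>Q\<^esub> u) = cnj t \<odot>\<^bsub>Q\<^esub> star Q u"
      by (simp_all add: carrier q A.scale_add_left A.scale_scale A.star_scale)
  qed (simp add: carrier q)
qed

lemma cstar_algebra_intro:
  assumes "star_algebra A"
    and "\<And>a. a \<in> carrier A \<Longrightarrow> 0 \<le> nrm A a"
    and "\<And>a. a \<in> carrier A \<Longrightarrow> nrm A a = 0 \<longleftrightarrow> a = \<zero>\<^bsub>A\<^esub>"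
    and "\<And>a b. \<lbrakk>a \<in> carrier A; b \<in> carrier A\<rbrakk> \<Longrightarrow> nrm A (a \<oplus>\<^bsub>A\<^esub> b) \<le> nrm A a + nrm A b"
    and "\<And>a t. a \<in> carrier A \<Longrightarrow> nrm A (t \<odot>\<^bsub>A\<^esub> a) = cmod t * nrm A a"
    and "\<And>a b. \<lbrakk>a \<in> carrier A; b \<in> carrier A\<rbrakk> \<Longrightarrow> nrm A (a \<otimes>\<^bsub>A\<^esub> b) \<le> nrm A a * nrm A b"
    and "\<And>a. a \<in> carrier A \<Longrightarrow> nrm A (star A a \<otimes>\<^bsub>A\<^esub> a) = (nrm A a)\<^sup>2"
    and "complete_norm A (nrm A)"
  shows "cstar_algebra A"
proof -
  interpret star_algebra A by fact
  show ?thesis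
    by unfold_locales (simp_all add: assms mult_assoc mult_add_right mult_add_left
        mult_scale_right mult_scale_left star_add star_scale star_mult)
qed

lemma vdiff_carrier_update: "vdiff (D\<lparr>carrier := G\<rparr>) = vdiff D"
  by (intro ext) (simp add: vdiff_def)

lemma converges_to_carrier_update: "converges_to (D\<lparr>carrier := G\<rparr>) = converges_to D"
  by (intro ext) (simp add: converges_to_def vdiff_carrier_update)

lemma cstar_subalgebra:
  assumes "cstar_algebra D" "cstar_algebra.star_subalgebra D G" "cstar_algebra.closed_set D G"
  shows "cstar_algebra (D\<lparr>carrier := G\<rparr>)"
proof -
  interpret D: cstar_algebra D by fact
  have G: "\<And>x. x \<in> G \<Longrightarrow> x \<in> carrier D" and ops: "\<zero>\<^bsub>D\<^esub> \<in> G"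
    "\<And>u v. \<lbrakk>u \<in> G; v \<in> G\<rbrakk> \<Longrightarrow> u \<oplus>\<^bsub>D\<^esub> v \<in> G" "\<And>c v. v \<in> G \<Longrightarrow> c \<odot>\<^bsub>D\<^esub> v \<in> G"
    "\<And>u v. \<lbrakk>u \<in> G; v \<in> G\<rbrakk> \<Longrightarrow> u \<otimes>\<^bsub>D\<^esub> v \<in> G" "\<And>v. v \<in> G \<Longrightarrow> star D v \<in> G"
    using assms(2) by (auto simp: D.star_subalgebra_def subspace_of_def)
  show ?thesis
  proof (rule cstar_algebra_intro)
    show "star_algebra (D\<lparr>carrier := G\<rparr>)"
      by unfold_locales (simp_all add: G ops D.ring_rules D.add_ac D.scale_add_left)
    show "complete_norm (D\<lparr>carrier := G\<rparr>) (nrm (D\<lparr>carrier := G\<rparr>))"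
      unfolding complete_norm_def
    proof (intro allI impI)
      fix s :: "nat \<Rightarrow> _"
      assume s: "\<forall>k. s k \<in> carrier (D\<lparr>carrier := G\<rparr>)"
        and C: "\<forall>e>0. \<exists>M. \<forall>j\<ge>M. \<forall>k\<ge>M.
          nrm (D\<lparr>carrier := G\<rparr>) (vdiff (D\<lparr>carrier := G\<rparr>) (s j) (s k)) < e"
      have sD: "\<And>k. s k \<in> carrier D" and sG: "\<And>k. s k \<in> G" using s G by auto
      have C': "\<exists>M. \<forall>j\<ge>M. \<forall>k\<ge>M. nrm D (vdiff D (s j) (s k)) < e" if "e > 0" for e
        using C that by (simp add: vdiff_carrier_update)
      obtain l where l: "l \<in> carrier D" "D.conv s l"
        by (rule D.Cauchy_convergent[OF sD C'])
      then have "l \<in> G" using D.closed_setD[OF assms(3), of s l] sG by simp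
      then show "\<exists>l\<in>carrier (D\<lparr>carrier := G\<rparr>).
          converges_to (D\<lparr>carrier := G\<rparr>) (nrm (D\<lparr>carrier := G\<rparr>)) s l"
        using l by (auto simp: converges_to_carrier_update)
    qed
  qed (simp_all add: G ops D.nrm_eq_zero D.nrm_triangle D.nrm_scale D.nrm_mult D.cstar_identity)
qed

text \<open>Moves an algebra into another element type; the target will be the type over which
  \<open>cuntz_pimsner\<close> tests universality.\<close>

definition transport :: "('d \<Rightarrow> 'e) \<Rightarrow> 'd cstar \<Rightarrow> 'e cstar" where
  "transport f D = (let g = inv_into (carrier D) f in
     \<lparr>carrier = f ` carrier D,
      vadd = (\<lambda>u v. f (g u \<oplus>\<^bsub>D\<^esub> g v)),
      vzero = f \<zero>\<^bsub>D\<^esub>,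
      vscale = (\<lambda>c u. f (c \<odot>\<^bsub>D\<^esub> g u)),
      amult = (\<lambda>u v. f (g u \<otimes>\<^bsub>D\<^esub> g v)),
      star = (\<lambda>u. f (star D (g u))),
      nrm = (\<lambda>u. nrm D (g u))\<rparr>)"

lemma cstar_transport:
  assumes "cstar_algebra D" "inj_on f (carrier D)"
  shows "cstar_algebra (transport f D)" "star_hom D (transport f D) f"
    "star_hom (transport f D) D (inv_into (carrier D) f)"
proof -
  interpret D: cstar_algebra D by fact
  let ?E = "transport f D" and ?g = "inv_into (carrier D) f"
  have g [simp]: "?g (f x) = x" if "x \<in> carrier D" for x using that assms(2) by simp
  have carrier: "carrier ?E = f ` carrier D" by (simp add: transport_def Let_def)
  have gE [simp]: "u \<in> carrier ?E \<Longrightarrow> ?g u \<in> carrier D" "u \<in> carrier ?E \<Longrightarrow> f (?g u) = u" for u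
    by (auto simp: carrier)
  have ops: "u \<oplus>\<^bsub>?E\<^esub> v = f (?g u \<oplus>\<^bsub>D\<^esub> ?g v)" "\<zero>\<^bsub>?E\<^esub> = f \<zero>\<^bsub>D\<^esub>" "c \<odot>\<^bsub>?E\<^esub> u = f (c \<odot>\<^bsub>D\<^esub> ?g u)"
    "u \<otimes>\<^bsub>?E\<^esub> v = f (?g u \<otimes>\<^bsub>D\<^esub> ?g v)" "star ?E u = f (star D (?g u))" "nrm ?E u = nrm D (?g u)"
    for u v c by (simp_all add: transport_def Let_def)
  have SE: "star_algebra ?E"
    by (rule star_algebra_image[OF D.star_algebra_axioms carrier]) (simp_all add: ops)
  interpret E: star_algebra ?E by fact
  have gv: "?g (vdiff ?E u v) = vdiff D (?g u) (?g v)" if "u \<in> carrier ?E" "v \<in> carrier ?E" for u v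
    using that by (simp add: vdiff_def ops)
  show "cstar_algebra ?E"
  proof (rule cstar_algebra_intro[OF SE])
    show "complete_norm ?E (nrm ?E)" unfolding complete_norm_def
    proof (intro allI impI)
      fix s :: "nat \<Rightarrow> _" assume s: "\<forall>k. s k \<in> carrier ?E"
        and C: "\<forall>e>0. \<exists>M. \<forall>j\<ge>M. \<forall>k\<ge>M. nrm ?E (vdiff ?E (s j) (s k)) < e"
      obtain l where l: "l \<in> carrier D" "D.conv (\<lambda>k. ?g (s k)) l"
        by (rule D.Cauchy_convergent[of "\<lambda>k. ?g (s k)"]) (use s C in \<open>auto simp: gv ops(6)\<close>)
      then have "converges_to ?E (nrm ?E) s (f l)"
        using s by (simp add: converges_to_def ops(6) gv carrier)
      then show "\<exists>l\<in>carrier ?E. converges_to ?E (nrm ?E) s l" using l by (auto simp: carrier)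
    qed
    show "nrm ?E a = 0 \<longleftrightarrow> a = \<zero>\<^bsub>?E\<^esub>" if "a \<in> carrier ?E" for a
      using that by (metis D.nrm_eq_zero D.zero_closed g gE ops(2,6))
  qed (simp_all add: ops D.nrm_triangle D.nrm_scale D.nrm_mult D.cstar_identity)
  show "star_hom D ?E f" by (rule star_homI) (simp_all add: carrier ops)
  show "star_hom ?E D ?g" by (rule star_homI) (simp_all add: ops)
qed

section \<open>Closed ideals and their orthogonality\<close>

context cstar_algebra
begin

text \<open>Self-adjointness is built in, so that the adjoint passes to the quotient at
  once.\<close>

definition closed_ideal :: "'a set \<Rightarrow> bool" where
  "closed_ideal I \<longleftrightarrow> subspace_of I A \<and> (\<forall>a\<in>carrier A. \<forall>i\<in>I. a \<otimes> i \<in> I \<and> i \<otimes> a \<in> I) \<and>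
     (\<forall>i\<in>I. star A i \<in> I) \<and> closed_set I"

definition ideal_generated :: "'a set \<Rightarrow> 'a set" where
  "ideal_generated S = \<Inter>{I. closed_ideal I \<and> S \<subseteq> I}"

lemma ideal_generated_superset: "S \<subseteq> ideal_generated S"
  by (auto simp: ideal_generated_def)

lemma ideal_generated_least: "\<lbrakk>closed_ideal I; S \<subseteq> I\<rbrakk> \<Longrightarrow> ideal_generated S \<subseteq> I"
  by (auto simp: ideal_generated_def)

lemma closed_ideal_carrier: "closed_ideal (carrier A)"
  by (auto simp: closed_ideal_def subspace_of_def intro: closed_setI)

lemma closed_ideal_generated:
  assumes "S \<subseteq> carrier A"
  shows "closed_ideal (ideal_generated S)"
proof -
  have sub: "ideal_generated S \<subseteq> carrier A"
    using assms closed_ideal_carrier by (auto simp: ideal_generated_def)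
  have "subspace_of (ideal_generated S) A"
    unfolding subspace_of_def using sub
    by (auto simp: ideal_generated_def closed_ideal_def subspace_of_def)
  moreover have "closed_set (ideal_generated S)"
  proof (rule closed_setI)
    fix s l assume *: "\<And>k. s k \<in> ideal_generated S" "l \<in> carrier A" "conv s l"
    show "l \<in> ideal_generated S" unfolding ideal_generated_def
    proof
      fix I assume I: "I \<in> {I. closed_ideal I \<and> S \<subseteq> I}"
      then have "\<And>k. s k \<in> I" using *(1) by (auto simp: ideal_generated_def)
      then show "l \<in> I" using I * by (auto simp: closed_ideal_def intro: closed_setD)
    qed
  qed
  ultimately show ?thesis
    by (auto simp: closed_ideal_def ideal_generated_def)
qed

text \<open>For orthogonal ideals \<open>\<parallel>i\<parallel> \<le> \<parallel>i + j\<parallel>\<close>, since \<open>i\<^sup>* (i + j) = i\<^sup>* i\<close>; hence the sum is closed.\<close>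

lemma closed_ideal_sum:
  assumes I: "closed_ideal I" and J: "closed_ideal J"
    and orth: "\<And>i j. \<lbrakk>i \<in> I; j \<in> J\<rbrakk> \<Longrightarrow> i \<otimes> j = \<zero>"
  shows "closed_ideal {i \<oplus> j | i j. i \<in> I \<and> j \<in> J}"
proof -
  let ?S = "{i \<oplus> j | i j. i \<in> I \<and> j \<in> J}"
  have cI [simp]: "\<And>i. i \<in> I \<Longrightarrow> i \<in> carrier A" and cJ [simp]: "\<And>i. i \<in> J \<Longrightarrow> i \<in> carrier A"
    and zero: "\<zero> \<in> I" "\<zero> \<in> J"
    and opI: "\<And>u v. \<lbrakk>u \<in> I; v \<in> I\<rbrakk> \<Longrightarrow> u \<oplus> v \<in> I" "\<And>c v. v \<in> I \<Longrightarrow> c \<odot> v \<in> I"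
      "\<And>a i. \<lbrakk>a \<in> carrier A; i \<in> I\<rbrakk> \<Longrightarrow> a \<otimes> i \<in> I \<and> i \<otimes> a \<in> I" "\<And>i. i \<in> I \<Longrightarrow> star A i \<in> I"
    and opJ: "\<And>u v. \<lbrakk>u \<in> J; v \<in> J\<rbrakk> \<Longrightarrow> u \<oplus> v \<in> J" "\<And>c v. v \<in> J \<Longrightarrow> c \<odot> v \<in> J"
      "\<And>a i. \<lbrakk>a \<in> carrier A; i \<in> J\<rbrakk> \<Longrightarrow> a \<otimes> i \<in> J \<and> i \<otimes> a \<in> J" "\<And>i. i \<in> J \<Longrightarrow> star A i \<in> J"
    using I J by (auto simp: closed_ideal_def subspace_of_def)
  have nrm: "nrm A i \<le> nrm A (i \<oplus> j)" if ij: "i \<in> I" "j \<in> J" for i j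
  proof (cases "nrm A i = 0")
    case False
    have "star A i \<otimes> (i \<oplus> j) = star A i \<otimes> i"
      using ij orth[of "star A i" j] by (simp add: mult_add_right opI)
    then have "nrm A i * nrm A i \<le> nrm A i * nrm A (i \<oplus> j)"
      using cstar_identity[of i] nrm_mult[of "star A i" "i \<oplus> j"] ij by (simp add: power2_eq_square)
    then show ?thesis using False nrm_nonneg[of i] ij
      by (metis cI mult_le_cancel_left_pos order_less_le)
  qed (use ij in simp)
  have closed: "closed_set ?S"
  proof (rule closed_setI)
    fix s l assume s: "\<And>k. s k \<in> ?S" and l: "l \<in> carrier A" "conv s l"
    from s have "\<forall>k. \<exists>i j. i \<in> I \<and> j \<in> J \<and> s k = i \<oplus> j" by blast
    then obtain a b where ab: "\<And>k. a k \<in> I" "\<And>k. b k \<in> J" "\<And>k. s k = a k \<oplus> b k" by metis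
    have C: "nrm A (vdiff A (a j) (a k)) \<le> nrm A (vdiff A (s j) (s k))" for j k
      using nrm[of "vdiff A (a j) (a k)" "vdiff A (b j) (b k)"] ab
      by (simp add: vdiff_add_add) (simp add: vdiff_def opI opJ)
    obtain i where i: "i \<in> carrier A" "conv a i"
    proof (rule Cauchy_convergent[of a])
      fix e :: real assume "e > 0"
      then obtain M where M: "\<And>j. j \<ge> M \<Longrightarrow> nrm A (vdiff A (s j) l) < e/2"
        using conv_less[OF l(2), of "e/2"] by auto
      have "nrm A (vdiff A (a j) (a k)) < e" if "j \<ge> M" "k \<ge> M" for j k
      proof -
        have c: "s j \<in> carrier A" "s k \<in> carrier A" using ab by simp_all
        have "nrm A (vdiff A (s j) (s k)) \<le> nrm A (vdiff A (s j) l) + nrm A (vdiff A l (s k))"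
          by (rule nrm_vdiff_triangle) (use c l in auto)
        then show ?thesis using C[of j k] M[OF that(1)] M[OF that(2)]
            nrm_vdiff_commute[OF l(1) c(2)] by linarith
      qed
      then show "\<exists>M. \<forall>j\<ge>M. \<forall>k\<ge>M. nrm A (vdiff A (a j) (a k)) < e" by blast
    qed (use ab in auto)
    have iI: "i \<in> I" using i ab I by (auto simp: closed_ideal_def intro: closed_setD)
    have "conv (\<lambda>k. vdiff A (s k) (a k)) (vdiff A l i)"
      unfolding vdiff_def by (intro conv_add conv_scale l i) (use ab l i in auto)
    moreover have "(\<lambda>k. vdiff A (s k) (a k)) = b"
      using ab by (intro ext vdiff_eqI) auto
    ultimately have "conv b (vdiff A l i)" by simp
    then have "vdiff A l i \<in> J"
      using closed_setD[of J b "vdiff A l i"] ab l i J by (simp add: closed_ideal_def)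
    then show "l \<in> ?S" using iI l i
      by (intro CollectI exI[of _ i] exI[of _ "vdiff A l i"]) simp
  qed
  have SI: "i \<oplus> j \<in> ?S" if "i \<in> I" "j \<in> J" for i j using that by blast
  have "subspace_of ?S A" unfolding subspace_of_def
  proof (intro conjI ballI allI)
    show "\<zero> \<in> ?S" using zero by (intro CollectI exI[of _ \<zero>]) simp
    fix u v assume "u \<in> ?S" "v \<in> ?S"
    then obtain i j i' j' where *: "u = i \<oplus> j" "v = i' \<oplus> j'" "i \<in> I" "j \<in> J" "i' \<in> I" "j' \<in> J"
      by auto
    then have "u \<oplus> v = (i \<oplus> i') \<oplus> (j \<oplus> j')" by (simp add: add_ac)
    then show "u \<oplus> v \<in> ?S" using SI[OF opI(1) opJ(1)] * by simp
  next
    fix c u assume "u \<in> ?S"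
    then obtain i j where *: "u = i \<oplus> j" "i \<in> I" "j \<in> J" by auto
    then have "c \<odot> u = c \<odot> i \<oplus> c \<odot> j" by (simp add: scale_add_right)
    then show "c \<odot> u \<in> ?S" using SI[OF opI(2) opJ(2)] * by simp
  qed auto
  moreover have "a \<otimes> u \<in> ?S \<and> u \<otimes> a \<in> ?S" if "a \<in> carrier A" "u \<in> ?S" for a u
  proof -
    obtain i j where *: "u = i \<oplus> j" "i \<in> I" "j \<in> J" using \<open>u \<in> ?S\<close> by auto
    then have "a \<otimes> u = a \<otimes> i \<oplus> a \<otimes> j" "u \<otimes> a = i \<otimes> a \<oplus> j \<otimes> a"
      using that by (simp_all add: mult_add_left mult_add_right)
    then show ?thesis using SI[of "a \<otimes> i" "a \<otimes> j"] SI[of "i \<otimes> a" "j \<otimes> a"] * opI(3) opJ(3) that by simp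
  qed
  moreover have "star A u \<in> ?S" if "u \<in> ?S" for u
  proof -
    obtain i j where *: "u = i \<oplus> j" "i \<in> I" "j \<in> J" using \<open>u \<in> ?S\<close> by auto
    then have "star A u = star A i \<oplus> star A j" by (simp add: star_add)
    then show ?thesis using SI[OF opI(4) opJ(4)] * by simp
  qed
  ultimately show ?thesis using closed unfolding closed_ideal_def by simp
qed

text \<open>Two annihilators in turn. The elements killed from the left by g A form a closed ideal
  containing f, hence the ideal of f; the left annihilator of the latter is again a closed ideal,
  and it contains g.\<close>

lemma ideal_generated_orthogonal:
  assumes f: "f \<in> carrier A" "star A f = f" and g: "g \<in> carrier A" "star A g = g"
    and orth: "\<And>x. x \<in> carrier A \<Longrightarrow> g \<otimes> x \<otimes> f = \<zero>"
    and y: "y \<in> ideal_generated {g}" and z: "z \<in> ideal_generated {f}"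
  shows "y \<otimes> z = \<zero>"
proof -
  \<comment> \<open>The clause for \<open>star A y\<close> makes the annihilator self-adjoint, as
    \<open>closed_ideal\<close> demands.\<close>
  let ?N = "{y \<in> carrier A. \<forall>x\<in>carrier A. g \<otimes> x \<otimes> y = \<zero> \<and> g \<otimes> x \<otimes> star A y = \<zero>}"
  have "closed_ideal ?N"
    unfolding closed_ideal_def
  proof (intro conjI ballI)
    show "subspace_of ?N A"
      using g by (auto simp: subspace_of_def mult_add_right star_add mult_scale_right star_scale)
    show "closed_set ?N"
    proof (rule closed_setI)
      fix s l assume *: "\<And>k. s k \<in> ?N" "l \<in> carrier A" "conv s l"
      have "g \<otimes> x \<otimes> l = \<zero> \<and> g \<otimes> x \<otimes> star A l = \<zero>" if x: "x \<in> carrier A" for x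
      proof
        have "conv (\<lambda>k. g \<otimes> x \<otimes> s k) (g \<otimes> x \<otimes> l)"
          using * x g by (intro conv_mult conv_const) auto
        then have "conv (\<lambda>_. \<zero>) (g \<otimes> x \<otimes> l)" using * x by simp
        then show "g \<otimes> x \<otimes> l = \<zero>"
          using * x g by (intro conv_unique[OF _ _ _ _ conv_const]) auto
        have "conv (\<lambda>k. g \<otimes> x \<otimes> star A (s k)) (g \<otimes> x \<otimes> star A l)"
          using * x g by (intro conv_mult conv_const conv_star) auto
        then have "conv (\<lambda>_. \<zero>) (g \<otimes> x \<otimes> star A l)" using * x by simp
        then show "g \<otimes> x \<otimes> star A l = \<zero>"
          using * x g by (intro conv_unique[OF _ _ _ _ conv_const]) auto
      qed
      then show "l \<in> ?N" using * by auto
    qed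
  next
    fix a i assume a: "a \<in> carrier A" and "i \<in> ?N"
    then have i: "i \<in> carrier A" "\<And>x. x \<in> carrier A \<Longrightarrow> g \<otimes> x \<otimes> i = \<zero>"
      "\<And>x. x \<in> carrier A \<Longrightarrow> g \<otimes> x \<otimes> star A i = \<zero>" by auto
    have "g \<otimes> x \<otimes> (a \<otimes> i) = g \<otimes> (x \<otimes> a) \<otimes> i" "g \<otimes> x \<otimes> (i \<otimes> a) = (g \<otimes> x \<otimes> i) \<otimes> a"
      "g \<otimes> x \<otimes> star A (a \<otimes> i) = (g \<otimes> x \<otimes> star A i) \<otimes> star A a"
      "g \<otimes> x \<otimes> star A (i \<otimes> a) = g \<otimes> (x \<otimes> star A a) \<otimes> star A i" if "x \<in> carrier A" for x
      using that a i(1) g by (simp_all add: mult_assoc star_mult)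
    then show "a \<otimes> i \<in> ?N" "i \<otimes> a \<in> ?N" using i a by auto
  next
    fix i assume "i \<in> ?N"
    then show "star A i \<in> ?N" by auto
  qed
  moreover have "{f} \<subseteq> ?N" using f orth by auto
  ultimately have N: "ideal_generated {f} \<subseteq> ?N" by (rule ideal_generated_least)
  have If: "closed_ideal (ideal_generated {f})" using f by (intro closed_ideal_generated) auto
  let ?M = "{z \<in> carrier A. \<forall>y\<in>ideal_generated {f}. z \<otimes> y = \<zero> \<and> star A z \<otimes> y = \<zero>}"
  have fc: "\<And>y. y \<in> ideal_generated {f} \<Longrightarrow> y \<in> carrier A" using N by auto
  have fa: "\<And>y a. \<lbrakk>y \<in> ideal_generated {f}; a \<in> carrier A\<rbrakk> \<Longrightarrow> a \<otimes> y \<in> ideal_generated {f}"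
    using If by (auto simp: closed_ideal_def)
  have "closed_ideal ?M"
    unfolding closed_ideal_def
  proof (intro conjI ballI)
    show "subspace_of ?M A"
      using fc by (auto simp: subspace_of_def mult_add_left star_add mult_scale_left star_scale)
    show "closed_set ?M"
    proof (rule closed_setI)
      fix s l assume *: "\<And>k. s k \<in> ?M" "l \<in> carrier A" "conv s l"
      have "l \<otimes> x = \<zero> \<and> star A l \<otimes> x = \<zero>" if x: "x \<in> ideal_generated {f}" for x
      proof
        have "conv (\<lambda>k. s k \<otimes> x) (l \<otimes> x)"
          using * x fc by (intro conv_mult conv_const) auto
        then have "conv (\<lambda>_. \<zero>) (l \<otimes> x)" using * x by simp
        then show "l \<otimes> x = \<zero>"
          using * x fc by (intro conv_unique[OF _ _ _ _ conv_const]) auto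
        have "conv (\<lambda>k. star A (s k) \<otimes> x) (star A l \<otimes> x)"
          using * x fc by (intro conv_mult conv_const conv_star) auto
        then have "conv (\<lambda>_. \<zero>) (star A l \<otimes> x)" using * x by simp
        then show "star A l \<otimes> x = \<zero>"
          using * x fc by (intro conv_unique[OF _ _ _ _ conv_const]) auto
      qed
      then show "l \<in> ?M" using * by auto
    qed
  next
    fix a i assume a: "a \<in> carrier A" and "i \<in> ?M"
    then have i: "i \<in> carrier A" "\<And>x. x \<in> ideal_generated {f} \<Longrightarrow> i \<otimes> x = \<zero>"
      "\<And>x. x \<in> ideal_generated {f} \<Longrightarrow> star A i \<otimes> x = \<zero>" by auto
    then show "a \<otimes> i \<in> ?M" "i \<otimes> a \<in> ?M" using a fc fa by (auto simp: mult_assoc star_mult)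
  next
    fix i assume "i \<in> ?M"
    then show "star A i \<in> ?M" by auto
  qed
  moreover have "{g} \<subseteq> ?M"
  proof -
    have "g \<otimes> y = \<zero>" if "y \<in> ideal_generated {f}" for y
    proof (rule star_mult_self_zero)
      \<comment> \<open>No unit is assumed, so x = g is substituted in \<open>?N\<close>; then y* g
        g y = 0, which forces g y = 0.\<close>
      have "g \<otimes> g \<otimes> y = \<zero>" "y \<in> carrier A" using that N g by auto
      then show "star A (g \<otimes> y) \<otimes> (g \<otimes> y) = \<zero>" "g \<otimes> y \<in> carrier A"
        using g by (simp_all add: star_mult mult_assoc)
    qed
    then show ?thesis using g by simp
  qed
  ultimately have "ideal_generated {g} \<subseteq> ?M" by (rule ideal_generated_least)
  then show ?thesis using y z by auto
qed

end

lemma closed_ideal_kernel: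
  assumes "unital_cstar A e" "cstar_algebra D" "star_hom A D f"
  shows "cstar_algebra.closed_ideal A {a \<in> carrier A. f a = \<zero>\<^bsub>D\<^esub>}"
proof -
  interpret A: unital_cstar A e by fact
  interpret D: cstar_algebra D by fact
  note f [simp] = star_homD[OF assms(3)]
  let ?T = "{a \<in> carrier A. f a = \<zero>\<^bsub>D\<^esub>}"
  have "A.closed_set ?T"
  proof (rule A.closed_setI)
    fix s l assume *: "\<And>k. s k \<in> ?T" "l \<in> carrier A" "A.conv s l"
    have "D.conv (\<lambda>k. f (s k)) (f l)"
      using star_hom_conv[OF assms] * by blast
    moreover have "(\<lambda>k. f (s k)) = (\<lambda>k. \<zero>\<^bsub>D\<^esub>)" using * by auto
    ultimately have "f l = \<zero>\<^bsub>D\<^esub>"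
      using * by (intro D.conv_unique[OF _ _ _ _ D.conv_const]) auto
    then show "l \<in> ?T" using * by simp
  qed
  then show ?thesis
    using star_hom_zero[OF assms(3) A.complex_space_axioms D.complex_space_axioms]
    by (auto simp: A.closed_ideal_def subspace_of_def)
qed

lemma star_hom_ideal_generated:
  assumes "unital_cstar A e" "cstar_algebra D" "star_hom A D f"
    and "S \<subseteq> carrier A" "\<And>x. x \<in> S \<Longrightarrow> f x = \<zero>\<^bsub>D\<^esub>"
    and "a \<in> cstar_algebra.ideal_generated A S"
  shows "f a = \<zero>\<^bsub>D\<^esub>"
proof -
  interpret A: unital_cstar A e by fact
  have "A.ideal_generated S \<subseteq> {a \<in> carrier A. f a = \<zero>\<^bsub>D\<^esub>}"
    using closed_ideal_kernel[OF assms(1-3)] assms(4,5) by (intro A.ideal_generated_least) auto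
  then show ?thesis using assms(6) by auto
qed

text \<open>Turns bounds by representatives into a bound by the product of two infima, for the
  submultiplicativity of \<open>qnorm\<close>.\<close>

lemma le_mult_of_upper_bounds:
  fixes x a b :: real
  assumes "\<And>C D. \<lbrakk>C > a; D > b\<rbrakk> \<Longrightarrow> x \<le> C * D"
  shows "x \<le> a * b"
proof (rule LIMSEQ_le_const)
  have "(\<lambda>k. (a + inverse (real (Suc k))) * (b + inverse (real (Suc k)))) \<longlonglongrightarrow> (a + 0) * (b + 0)"
    by (intro tendsto_intros LIMSEQ_inverse_real_of_nat)
  then show "(\<lambda>k. (a + inverse (real (Suc k))) * (b + inverse (real (Suc k)))) \<longlonglongrightarrow> a * b"
    by simp
  show "\<exists>N. \<forall>k\<ge>N. x \<le> (a + inverse (real (Suc k))) * (b + inverse (real (Suc k)))"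
    using assms by simp
qed

locale cstar_ideal = unital_cstar A unit for A :: "('a, 'm) cstar_scheme" (structure) and unit ("\<one>") +
  fixes I :: "'a set"
  assumes closed_ideal: "closed_ideal I"
begin

lemma ideal_carrier [simp]: "i \<in> I \<Longrightarrow> i \<in> carrier A"
  and ideal_zero [simp]: "\<zero> \<in> I"
  and ideal_add [simp]: "\<lbrakk>i \<in> I; j \<in> I\<rbrakk> \<Longrightarrow> i \<oplus> j \<in> I"
  and ideal_scale [simp]: "i \<in> I \<Longrightarrow> c \<odot> i \<in> I"
  and ideal_mult_left [simp]: "\<lbrakk>a \<in> carrier A; i \<in> I\<rbrakk> \<Longrightarrow> a \<otimes> i \<in> I"
  and ideal_mult_right [simp]: "\<lbrakk>a \<in> carrier A; i \<in> I\<rbrakk> \<Longrightarrow> i \<otimes> a \<in> I"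
  and ideal_star [simp]: "i \<in> I \<Longrightarrow> star A i \<in> I"
  and ideal_closed: "closed_set I"
  using closed_ideal by (auto simp: closed_ideal_def subspace_of_def)

subsection \<open>Approximate units\<close>

fun geo :: "'a \<Rightarrow> nat \<Rightarrow> 'a" where
  "geo c 0 = \<zero>"
| "geo c (Suc m) = \<one> \<oplus> c \<otimes> geo c m"

text \<open>With \<open>c = 1 - i\<^sup>2\<close> and \<open>E = (1 + c + \<dots> + c\<^sup>m\<^sup>-\<^sup>1) / m\<close> one has \<open>i\<^sup>2 E = (1 - c\<^sup>m) / m\<close>, which is small.\<close>

lemma approximate_unit:
  assumes i: "i \<in> I" "star A i = i" "nrm A i \<le> 1" and m: "m > 0"
  obtains E where "E \<in> carrier A" "star A E = E" "nrm A E \<le> 1" "vdiff A \<one> E \<in> I"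
    "(nrm A (i \<otimes> E))\<^sup>2 \<le> 2 / real m"
proof -
  define s where "s = i \<otimes> i"
  define c where "c = vdiff A \<one> s"
  have s: "s \<in> I" "s \<in> carrier A" "star A s = s" using i by (simp_all add: s_def star_mult)
  have c: "c \<in> carrier A" "star A c = c" using s by (simp_all add: c_def star_vdiff)
  have nc: "nrm A c \<le> 1" unfolding c_def s_def by (rule nrm_one_minus_square_le) (use i in auto)
  have sc: "s \<otimes> c = c \<otimes> s" using s by (simp add: c_def mult_vdiff vdiff_mult)
  let ?G = "geo c"
  have G: "?G k \<in> carrier A" for k by (induction k) (use c in auto)
  have cG: "c \<otimes> ?G k = ?G k \<otimes> c" for k
  proof (induction k)
    case (Suc k)
    then show ?case using c G by (simp add: mult_add_left mult_add_right mult_assoc Suc[symmetric])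
  qed (use c in simp)
  have sG: "s \<otimes> ?G k = ?G k \<otimes> s" for k
  proof (induction k)
    case (Suc k)
    have "s \<otimes> (c \<otimes> ?G k) = c \<otimes> ?G k \<otimes> s" using s c G Suc sc by (metis mult_assoc)
    then show ?case using s c G by (simp add: mult_add_left mult_add_right)
  qed (use s in auto)
  have starG: "star A (?G k) = ?G k" for k
    by (induction k) (use c G in \<open>auto simp: star_add star_mult cG\<close>)
  have nG: "nrm A (?G k) \<le> real k" for k
  proof (induction k)
    case (Suc k)
    have "nrm A (?G (Suc k)) \<le> nrm A \<one> + nrm A c * nrm A (?G k)"
      using nrm_triangle[of \<one> "c \<otimes> ?G k"] nrm_mult[of c "?G k"] c G by auto
    also have "\<dots> \<le> 1 + 1 * real k"
      using nc Suc nrm_unit_le G c by (intro add_mono mult_mono) auto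
    finally show ?case by simp
  qed simp
  \<comment> \<open>Telescoping shows that 1 - s G_k is the k-th power of c.\<close>
  have n1: "nrm A (vdiff A \<one> (s \<otimes> ?G k)) \<le> 1" for k
  proof (induction k)
    case 0
    then show ?case using s nrm_unit_le by simp
  next
    case (Suc k)
    have "s \<otimes> ?G (Suc k) = s \<oplus> c \<otimes> (s \<otimes> ?G k)"
      using s c G sc by (simp add: mult_add_right flip: mult_assoc)
    then have "vdiff A \<one> (s \<otimes> ?G (Suc k)) = vdiff A (s \<oplus> c) (s \<oplus> c \<otimes> (s \<otimes> ?G k))"
      using s by (simp add: c_def)
    also have "\<dots> = c \<otimes> vdiff A \<one> (s \<otimes> ?G k)"
      using s c G by (simp add: vdiff_add_add mult_vdiff)
    finally have "nrm A (vdiff A \<one> (s \<otimes> ?G (Suc k))) \<le> nrm A c * nrm A (vdiff A \<one> (s \<otimes> ?G k))"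
      using nrm_mult[of c "vdiff A \<one> (s \<otimes> ?G k)"] s c G by simp
    also have "\<dots> \<le> 1 * 1" using nc Suc s c G by (intro mult_mono) auto
    finally show ?case by simp
  qed
  \<comment> \<open>Modulo \<open>I\<close> the element c is the unit, so G_k is k times the unit,
    and \<open>E\<close> will be congruent to the unit.\<close>
  have GI: "vdiff A (complex_of_nat k \<odot> \<one>) (?G k) \<in> I" for k
  proof (induction k)
    case (Suc k)
    have "complex_of_nat (Suc k) \<odot> \<one> = \<one> \<oplus> complex_of_nat k \<odot> \<one>"
      using scale_add_left[of \<one> 1 "complex_of_nat k"] by simp
    then have "vdiff A (complex_of_nat (Suc k) \<odot> \<one>) (?G (Suc k))
        = vdiff A (complex_of_nat k \<odot> \<one>) (c \<otimes> ?G k)"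
      using c G by (simp add: vdiff_add_add del: of_nat_Suc)
    also have "\<dots> = vdiff A (complex_of_nat k \<odot> \<one>) (?G k) \<oplus> vdiff A (?G k) (c \<otimes> ?G k)"
      using c G by (intro vdiff_trans[symmetric]) auto
    also have "vdiff A (?G k) (c \<otimes> ?G k) = s \<otimes> ?G k"
      using s G by (intro vdiff_eqI) (auto simp: c_def vdiff_mult)
    finally show ?case using Suc s G by simp
  qed simp
  define E where "E = (1 / complex_of_nat m) \<odot> ?G m"
  show ?thesis
  proof
    show E: "E \<in> carrier A" "star A E = E" using G starG by (simp_all add: E_def star_scale)
    show nE: "nrm A E \<le> 1" using nG[of m] m G by (simp add: E_def nrm_scale norm_divide)
    have "vdiff A \<one> E = (1 / complex_of_nat m) \<odot> vdiff A (complex_of_nat m \<odot> \<one>) (?G m)"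
      unfolding E_def using m G by (subst vdiff_scale[symmetric]) (auto simp: scale_scale)
    then show "vdiff A \<one> E \<in> I" using GI by simp
    have sE: "nrm A (s \<otimes> E) \<le> 2 / real m"
    proof -
      have "nrm A (s \<otimes> ?G m) \<le> 2"
      proof -
        have "s \<otimes> ?G m = vdiff A \<one> (vdiff A \<one> (s \<otimes> ?G m))"
          using s G by (intro vdiff_eqI[symmetric]) auto
        then show ?thesis using nrm_vdiff_le[of \<one> "vdiff A \<one> (s \<otimes> ?G m)"] n1[of m] nrm_unit_le s G
          by simp
      qed
      then show ?thesis using s G m
        by (simp add: E_def mult_scale_right nrm_scale norm_divide divide_right_mono)
    qed
    have "(nrm A (i \<otimes> E))\<^sup>2 = nrm A (star A (i \<otimes> E) \<otimes> (i \<otimes> E))"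
      using i E by (intro cstar_identity[symmetric]) auto
    also have "star A (i \<otimes> E) \<otimes> (i \<otimes> E) = E \<otimes> (s \<otimes> E)"
      using i E by (simp add: star_mult mult_assoc s_def)
    also have "nrm A (E \<otimes> (s \<otimes> E)) \<le> nrm A E * nrm A (s \<otimes> E)"
      using E s by (intro nrm_mult) auto
    also have "\<dots> \<le> 1 * (2 / real m)" using nE sE E s by (intro mult_mono) auto
    finally show "(nrm A (i \<otimes> E))\<^sup>2 \<le> 2 / real m" by simp
  qed
qed

subsection \<open>The quotient\<close>

definition qnorm :: "'a \<Rightarrow> real" where
  "qnorm a = Inf {nrm A (a \<oplus> i) | i. i \<in> I}"

lemma qnorm_le: "\<lbrakk>a \<in> carrier A; i \<in> I\<rbrakk> \<Longrightarrow> qnorm a \<le> nrm A (a \<oplus> i)"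
  unfolding qnorm_def by (intro cInf_lower bdd_belowI[of _ 0]) auto

lemma qnorm_less:
  assumes "a \<in> carrier A" "qnorm a < C"
  obtains i where "i \<in> I" "nrm A (a \<oplus> i) < C"
proof -
  have "{nrm A (a \<oplus> i) | i. i \<in> I} \<noteq> {}" using ideal_zero by blast
  from cInf_lessD[OF this assms(2)[unfolded qnorm_def]]
  obtain r where "r \<in> {nrm A (a \<oplus> i) | i. i \<in> I}" "r < C" by blast
  then show ?thesis using that by blast
qed

lemma qnorm_nonneg: "a \<in> carrier A \<Longrightarrow> 0 \<le> qnorm a"
  unfolding qnorm_def by (rule cInf_greatest) (use ideal_zero in \<open>blast, auto\<close>)

lemma qnorm_le_nrm: "a \<in> carrier A \<Longrightarrow> qnorm a \<le> nrm A a"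
  using qnorm_le[of a \<zero>] by simp

lemma qnorm_le_of_diff:
  assumes "a \<in> carrier A" "b \<in> carrier A" "vdiff A b a \<in> I"
  shows "qnorm a \<le> nrm A b"
  using qnorm_le[OF assms(1,3)] assms by simp

lemma qnorm_cong_le:
  assumes ab: "a \<in> carrier A" "b \<in> carrier A" "vdiff A a b \<in> I"
  shows "qnorm a \<le> qnorm b"
proof (rule dense_ge)
  fix C assume "qnorm b < C"
  then obtain i where i: "i \<in> I" "nrm A (b \<oplus> i) < C" using qnorm_less ab by blast
  have "vdiff A b a \<in> I" using ab by (subst vdiff_swap) auto
  then have "vdiff A b a \<oplus> i \<in> I" using i by simp
  moreover have "a \<oplus> (vdiff A b a \<oplus> i) = b \<oplus> i" using ab i by (simp flip: add_assoc)
  ultimately show "qnorm a \<le> C" using qnorm_le[OF ab(1)] i by fastforce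
qed

lemma qnorm_cong:
  assumes "a \<in> carrier A" "b \<in> carrier A" "vdiff A a b \<in> I"
  shows "qnorm a = qnorm b"
proof -
  have "vdiff A b a \<in> I" using assms by (subst vdiff_swap) auto
  then show ?thesis using qnorm_cong_le assms by (meson order_antisym)
qed

lemma qnorm_triangle:
  assumes ab: "a \<in> carrier A" "b \<in> carrier A"
  shows "qnorm (a \<oplus> b) \<le> qnorm a + qnorm b"
proof (rule field_le_epsilon)
  fix e :: real assume "e > 0"
  then obtain i j where ij: "i \<in> I" "nrm A (a \<oplus> i) < qnorm a + e/2"
    "j \<in> I" "nrm A (b \<oplus> j) < qnorm b + e/2"
    using qnorm_less[OF ab(1), of "qnorm a + e/2"] qnorm_less[OF ab(2), of "qnorm b + e/2"]
    by (metis half_gt_zero less_add_same_cancel1)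
  have "qnorm (a \<oplus> b) \<le> nrm A ((a \<oplus> b) \<oplus> (i \<oplus> j))" using ab ij by (intro qnorm_le) auto
  also have "(a \<oplus> b) \<oplus> (i \<oplus> j) = (a \<oplus> i) \<oplus> (b \<oplus> j)" using ab ij by (simp add: add_ac)
  also have "nrm A \<dots> \<le> nrm A (a \<oplus> i) + nrm A (b \<oplus> j)" using ab ij by (intro nrm_triangle) auto
  finally show "qnorm (a \<oplus> b) \<le> qnorm a + qnorm b + e" using ij by simp
qed

lemma qnorm_scale_le:
  assumes a: "a \<in> carrier A" and "t \<noteq> 0"
  shows "qnorm (t \<odot> a) \<le> cmod t * qnorm a"
proof (rule dense_ge)
  fix C assume "cmod t * qnorm a < C"
  then have "qnorm a < C / cmod t" using assms by (simp add: field_simps)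
  then obtain i where i: "i \<in> I" "nrm A (a \<oplus> i) < C / cmod t" using qnorm_less a by blast
  have "qnorm (t \<odot> a) \<le> nrm A (t \<odot> a \<oplus> t \<odot> i)" using a i by (intro qnorm_le) auto
  also have "\<dots> = cmod t * nrm A (a \<oplus> i)" using a i by (simp add: nrm_scale flip: scale_add_right)
  also have "\<dots> \<le> C" using i assms by (simp add: field_simps)
  finally show "qnorm (t \<odot> a) \<le> C" .
qed

lemma qnorm_scale:
  assumes a: "a \<in> carrier A"
  shows "qnorm (t \<odot> a) = cmod t * qnorm a"
proof (cases "t = 0")
  case True
  have "qnorm \<zero> = 0" using qnorm_le_nrm[of \<zero>] qnorm_nonneg[of \<zero>] by simp
  then show ?thesis using a True by simp
next
  case False
  have "qnorm ((1/t) \<odot> (t \<odot> a)) \<le> cmod (1/t) * qnorm (t \<odot> a)"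
    using a False by (intro qnorm_scale_le) auto
  then have "cmod t * qnorm a \<le> qnorm (t \<odot> a)"
    using a False by (simp add: scale_scale norm_divide field_simps)
  then show ?thesis using qnorm_scale_le[OF a False] by simp
qed

lemma qnorm_mult:
  assumes ab: "a \<in> carrier A" "b \<in> carrier A"
  shows "qnorm (a \<otimes> b) \<le> qnorm a * qnorm b"
proof (rule le_mult_of_upper_bounds)
  fix C D assume "qnorm a < C" "qnorm b < D"
  then obtain i j where ij: "i \<in> I" "nrm A (a \<oplus> i) < C" "j \<in> I" "nrm A (b \<oplus> j) < D"
    using qnorm_less ab by metis
  have "(a \<oplus> i) \<otimes> (b \<oplus> j) = a \<otimes> b \<oplus> (a \<otimes> j \<oplus> (i \<otimes> b \<oplus> i \<otimes> j))"
    using ab ij by (simp add: mult_add_left mult_add_right add_ac)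
  then have "qnorm (a \<otimes> b) \<le> nrm A ((a \<oplus> i) \<otimes> (b \<oplus> j))"
    using qnorm_le[of "a \<otimes> b" "a \<otimes> j \<oplus> (i \<otimes> b \<oplus> i \<otimes> j)"] ab ij by simp
  also have "\<dots> \<le> nrm A (a \<oplus> i) * nrm A (b \<oplus> j)" using ab ij by (intro nrm_mult) auto
  also have "\<dots> \<le> C * D"
    using ij nrm_nonneg[of "a \<oplus> i"] nrm_nonneg[of "b \<oplus> j"] ab
    by (intro mult_mono less_imp_le[OF ij(2)] less_imp_le[OF ij(4)]) (auto simp del: nrm_nonneg)
  finally show "qnorm (a \<otimes> b) \<le> C * D" .
qed

lemma qnorm_eq_zero:
  assumes a: "a \<in> carrier A"
  shows "qnorm a = 0 \<longleftrightarrow> a \<in> I"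
proof
  assume "a \<in> I"
  then show "qnorm a = 0"
    using qnorm_le_of_diff[of a \<zero>] qnorm_nonneg[OF a] by (simp add: vdiff_def)
next
  assume q: "qnorm a = 0"
  have "a \<in> norm_closure A (nrm A) I"
  proof (subst norm_closure_iff)
    show "a \<in> carrier A \<and> (\<forall>e>0. \<exists>u\<in>I. nrm A (vdiff A u a) < e)"
    proof (intro conjI allI impI a)
      fix e :: real assume "e > 0"
      then obtain i where i: "i \<in> I" "nrm A (a \<oplus> i) < e" using q a qnorm_less by metis
      have "vdiff A ((- 1) \<odot> i) a = (- 1) \<odot> (a \<oplus> i)"
        using a i by (simp add: vdiff_def scale_add_right add_comm)
      then show "\<exists>u\<in>I. nrm A (vdiff A u a) < e"
        using i a by (intro bexI[of _ "(- 1) \<odot> i"]) auto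
    qed
  qed auto
  then show "a \<in> I" using ideal_closed by (auto simp: closed_set_iff)
qed

lemma qnorm_star:
  assumes a: "a \<in> carrier A"
  shows "qnorm (star A a) = qnorm a"
proof -
  have *: "qnorm (star A b) \<le> qnorm b" if b: "b \<in> carrier A" for b
  proof (rule dense_ge)
    fix C assume "qnorm b < C"
    then obtain i where i: "i \<in> I" "nrm A (b \<oplus> i) < C" using qnorm_less b by blast
    have "qnorm (star A b) \<le> nrm A (star A b \<oplus> star A i)" using b i by (intro qnorm_le) auto
    also have "\<dots> = nrm A (star A (b \<oplus> i))" using b i by (simp add: star_add)
    finally show "qnorm (star A b) \<le> C" using i b by simp
  qed
  from *[OF a] *[of "star A a"] a show ?thesis by simp
qed

text \<open>Take a self-adjoint h in \<open>I\<close> such that a* a + h has norm below C, and E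
  congruent to 1 modulo \<open>I\<close> with h E small. Then a E represents a, and its squared norm
  is that of E (a* a) E = E (a* a + h) E - E h E, at most C plus a small error.\<close>

lemma qnorm_square_le:
  assumes a: "a \<in> carrier A"
  shows "(qnorm a)\<^sup>2 \<le> qnorm (star A a \<otimes> a)"
proof (rule dense_ge)
  fix C assume "qnorm (star A a \<otimes> a) < C"
  then obtain i0 where i0: "i0 \<in> I" "nrm A (star A a \<otimes> a \<oplus> i0) < C"
    using qnorm_less a by (metis mult_closed star_closed)
  define x where "x = star A a \<otimes> a \<oplus> i0"
  \<comment> \<open>The approximate unit is built from a self-adjoint element. Averaging with the
    adjoint keeps the norm below C, because a* a is self-adjoint.\<close>
  define h where "h = (1/2) \<odot> (i0 \<oplus> star A i0)"
  define y where "y = star A a \<otimes> a \<oplus> h"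
  have h: "h \<in> I" "h \<in> carrier A" "star A h = h"
    using i0 by (simp_all add: h_def star_scale star_add add_comm)
  have x: "x \<in> carrier A" using a i0 by (simp add: x_def)
  have y: "y \<in> carrier A" using a h by (simp add: y_def)
  have "(1/2) \<odot> (x \<oplus> star A x) = (1/2) \<odot> ((star A a \<otimes> a \<oplus> star A a \<otimes> a) \<oplus> (i0 \<oplus> star A i0))"
    using a i0 by (simp add: x_def star_add star_mult add_ac)
  also have "\<dots> = y" using a i0
    by (simp add: scale_add_right add_half scale_scale h_def y_def)
  finally have "y = (1/2) \<odot> (x \<oplus> star A x)" by simp
  then have "nrm A y = nrm A (x \<oplus> star A x) / 2" using x by (simp add: nrm_scale)
  then have ny: "nrm A y < C"
    using nrm_triangle[OF x star_closed[OF x]] x i0 by (simp add: x_def)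
  \<comment> \<open>Rescales h into the unit ball required by \<open>approximate_unit\<close>;
    adding 1 keeps the divisor positive.\<close>
  define \<kappa> where "\<kappa> = 1 + nrm A h"
  have \<kappa>: "\<kappa> > 0" using nrm_nonneg[OF h(2)] unfolding \<kappa>_def by linarith
  define i where "i = complex_of_real (1/\<kappa>) \<odot> h"
  have i: "i \<in> I" "i \<in> carrier A" "star A i = i"
    using h by (auto simp: i_def star_scale)
  have "nrm A i = nrm A h / \<kappa>" using h \<kappa> by (simp add: i_def nrm_scale norm_divide)
  also have "\<dots> \<le> 1" using \<kappa> by (simp add: \<kappa>_def)
  finally have ni: "nrm A i \<le> 1" .
  have hi: "h = complex_of_real \<kappa> \<odot> i" using h \<kappa> by (simp add: i_def scale_scale)
  have bound: "(qnorm a)\<^sup>2 \<le> C + \<kappa> * sqrt (2 / real (Suc m))" for m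
  proof -
    obtain E where E: "E \<in> carrier A" "star A E = E" "nrm A E \<le> 1" "vdiff A \<one> E \<in> I"
      "(nrm A (i \<otimes> E))\<^sup>2 \<le> 2 / real (Suc m)"
      using approximate_unit[OF i(1,3) ni, of "Suc m"] by blast
    have "vdiff A (a \<otimes> E) a = (- 1) \<odot> (a \<otimes> vdiff A \<one> E)"
      using a E by (simp add: mult_vdiff vdiff_swap[of a])
    then have "vdiff A (a \<otimes> E) a \<in> I" using a E by simp
    then have "qnorm a \<le> nrm A (a \<otimes> E)" using a E by (intro qnorm_le_of_diff) auto
    then have "(qnorm a)\<^sup>2 \<le> (nrm A (a \<otimes> E))\<^sup>2"
      using qnorm_nonneg[OF a] by (intro power_mono) auto
    also have "\<dots> = nrm A (star A (a \<otimes> E) \<otimes> (a \<otimes> E))"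
      using a E by (intro cstar_identity[symmetric]) auto
    also have "star A (a \<otimes> E) \<otimes> (a \<otimes> E) = E \<otimes> (star A a \<otimes> a) \<otimes> E"
      using a E by (simp add: star_mult mult_assoc)
    also have "star A a \<otimes> a = vdiff A y h"
      using a h by (intro vdiff_eqI[symmetric]) (auto simp: y_def add_comm)
    also have "E \<otimes> vdiff A y h \<otimes> E = vdiff A (E \<otimes> (y \<otimes> E)) (E \<otimes> (h \<otimes> E))"
      using y h E by (simp add: mult_vdiff vdiff_mult mult_assoc)
    also have "nrm A \<dots> \<le> nrm A (E \<otimes> (y \<otimes> E)) + nrm A (E \<otimes> (h \<otimes> E))"
      using y h E by (intro nrm_vdiff_le) auto
    also have "nrm A (E \<otimes> (y \<otimes> E)) \<le> C"
    proof -
      have "0 \<le> C" using ny nrm_nonneg[OF y] by linarith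
      have "nrm A (E \<otimes> (y \<otimes> E)) \<le> nrm A E * (nrm A y * nrm A E)"
        using y E by (intro order_trans[OF nrm_mult] mult_left_mono nrm_mult) auto
      also have "\<dots> \<le> 1 * (C * 1)"
        using ny E y \<open>0 \<le> C\<close> by (intro mult_mono) auto
      finally show ?thesis by simp
    qed
    also have "nrm A (E \<otimes> (h \<otimes> E)) \<le> \<kappa> * sqrt (2 / real (Suc m))"
    proof -
      have "nrm A (E \<otimes> (h \<otimes> E)) \<le> nrm A E * nrm A (h \<otimes> E)"
        using h E by (intro nrm_mult) auto
      also have "nrm A (h \<otimes> E) = \<kappa> * nrm A (i \<otimes> E)"
        using i E \<kappa> by (subst hi) (simp add: mult_scale_left nrm_scale)
      also have "nrm A E * (\<kappa> * nrm A (i \<otimes> E)) \<le> 1 * (\<kappa> * sqrt (2 / real (Suc m)))"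
        using E i \<kappa> by (intro mult_mono real_le_rsqrt) auto
      finally show ?thesis by simp
    qed
    finally show ?thesis by simp
  qed
  have "(\<lambda>m. C + \<kappa> * sqrt (2 * inverse (real (Suc m)))) \<longlonglongrightarrow> C + \<kappa> * sqrt (2 * 0)"
    by (intro tendsto_intros LIMSEQ_inverse_real_of_nat)
  then have "(\<lambda>m. C + \<kappa> * sqrt (2 / real (Suc m))) \<longlonglongrightarrow> C"
    by (simp add: divide_inverse)
  then show "(qnorm a)\<^sup>2 \<le> C"
    by (rule LIMSEQ_le_const) (use bound in auto)
qed

lemma qnorm_cstar:
  assumes a: "a \<in> carrier A"
  shows "qnorm (star A a \<otimes> a) = (qnorm a)\<^sup>2"
  using qnorm_square_le[OF a] qnorm_mult[of "star A a" a] qnorm_star[OF a] a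
  by (simp add: power2_eq_square)

text \<open>Along a subsequence whose increments in the quotient are below 2^-m, each increment has
  a representative of norm below 2^-m. Adding these up gives a Cauchy sequence in \<open>A\<close>
  itself, and its limit represents the limit in the quotient.\<close>

lemma qnorm_complete:
  assumes x: "\<And>k. x k \<in> carrier A"
    and C: "\<And>e. e > 0 \<Longrightarrow> \<exists>M. \<forall>j\<ge>M. \<forall>k\<ge>M. qnorm (vdiff A (x j) (x k)) < e"
  obtains l where "l \<in> carrier A" "(\<lambda>k. qnorm (vdiff A (x k) l)) \<longlonglongrightarrow> 0"
proof -
  have "\<forall>m. \<exists>M. \<forall>j\<ge>M. \<forall>k\<ge>M. qnorm (vdiff A (x j) (x k)) < (1/2)^m" using C by simp
  then obtain N0 where N0: "\<And>m j k. \<lbrakk>j \<ge> N0 m; k \<ge> N0 m\<rbrakk> \<Longrightarrow> qnorm (vdiff A (x j) (x k)) < (1/2)^m"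
    by metis
  \<comment> \<open>Partial sums make the chosen indices monotone while they stay above
    \<open>N0 m\<close>.\<close>
  define N where "N m = (\<Sum>k\<le>m. N0 k)" for m
  have N: "N m \<ge> N0 m" for m by (auto simp: N_def intro: member_le_sum)
  have Nm: "N (Suc m) \<ge> N m" for m by (simp add: N_def)
  have "\<exists>f. \<forall>m. (f m \<in> carrier A \<and> vdiff A (f m) (x (N m)) \<in> I) \<and>
      nrm A (vdiff A (f (Suc m)) (f m)) < (1/2)^m"
  proof (rule dependent_nat_choice)
    show "\<exists>z. z \<in> carrier A \<and> vdiff A z (x (N 0)) \<in> I" using x by (intro exI[of _ "x (N 0)"]) auto
    fix z m assume z: "z \<in> carrier A \<and> vdiff A z (x (N m)) \<in> I"
    have "qnorm (vdiff A (x (N (Suc m))) (x (N m))) < (1/2)^m"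
      using N[of m] Nm[of m] by (intro N0) auto
    then obtain i where i: "i \<in> I" "nrm A (vdiff A (x (N (Suc m))) (x (N m)) \<oplus> i) < (1/2)^m"
      using qnorm_less x by (metis vdiff_closed)
    let ?d = "vdiff A (x (N (Suc m))) (x (N m)) \<oplus> i"
    have d: "?d \<in> carrier A" using x i by simp
    have "vdiff A (z \<oplus> ?d) z = ?d" using z d by (intro vdiff_eqI) auto
    moreover have "vdiff A (z \<oplus> ?d) (x (N (Suc m))) = vdiff A z (x (N m)) \<oplus> i"
    proof (rule vdiff_eqI)
      have "x (N (Suc m)) \<oplus> (vdiff A z (x (N m)) \<oplus> i)
          = z \<oplus> (x (N (Suc m)) \<oplus> ((- 1) \<odot> x (N m) \<oplus> i))"
        using z i x by (simp add: vdiff_def add_ac)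
      then show "x (N (Suc m)) \<oplus> (vdiff A z (x (N m)) \<oplus> i) = z \<oplus> ?d"
        using x i by (simp add: vdiff_def add_assoc)
    qed (use z i x in auto)
    ultimately show "\<exists>z'. (z' \<in> carrier A \<and> vdiff A z' (x (N (Suc m))) \<in> I) \<and>
        nrm A (vdiff A z' z) < (1/2)^m"
      using z d i by (intro exI[of _ "z \<oplus> ?d"]) auto
  qed
  then obtain z where z: "\<And>m. z m \<in> carrier A" "\<And>m. vdiff A (z m) (x (N m)) \<in> I"
    "\<And>m. nrm A (vdiff A (z (Suc m)) (z m)) < (1/2)^m" by blast
  \<comment> \<open>The bound is the geometric sum of 2^-j for j from m up to m + d - 1.\<close>
  have mono: "nrm A (vdiff A (z (m + d)) (z m)) \<le> 2 * (1/2)^m - 2 * (1/2)^(m + d)" for m d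
  proof (induction d)
    case (Suc d)
    have "nrm A (vdiff A (z (m + Suc d)) (z m))
        \<le> nrm A (vdiff A (z (Suc (m + d))) (z (m + d))) + nrm A (vdiff A (z (m + d)) (z m))"
      using nrm_vdiff_triangle[of "z (Suc (m + d))" "z (m + d)" "z m"] z(1) by simp
    then show ?case using Suc z(3)[of "m + d"] by simp
  qed (use z in simp)
  have bound: "nrm A (vdiff A (z j) (z k)) \<le> \<bar>2 * (1/2)^j - 2 * (1/2)^k\<bar>" for j k
  proof (cases "k \<le> j")
    case True
    then have "nrm A (vdiff A (z j) (z k)) \<le> 2 * (1/2)^k - 2 * (1/2)^j"
      using mono[of k "j - k"] by simp
    then show ?thesis by linarith
  next
    case False
    then have "nrm A (vdiff A (z k) (z j)) \<le> 2 * (1/2)^j - 2 * (1/2)^k"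
      using mono[of j "k - j"] by simp
    then show ?thesis using nrm_vdiff_commute[OF z(1) z(1), of j k] by linarith
  qed
  have "convergent (\<lambda>k. 2 * (1/2::real)^k)"
    by (rule convergentI[of _ 0]) (intro tendsto_mult_right_zero LIMSEQ_power_zero, simp)
  then obtain l where l: "l \<in> carrier A" "conv z l"
    by (rule Cauchy_convergent_bound[OF z(1) bound])
  have "(\<lambda>k. qnorm (vdiff A (x k) l)) \<longlonglongrightarrow> 0"
  proof (rule LIMSEQ_I)
    fix e :: real assume "e > 0"
    obtain M2 where M2: "\<And>m. m \<ge> M2 \<Longrightarrow> nrm A (vdiff A (z m) l) < e/2"
      using conv_less[OF l(2), of "e/2"] \<open>e > 0\<close> by auto
    show "\<exists>K. \<forall>k\<ge>K. norm (qnorm (vdiff A (x k) l) - 0) < e"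
    proof -
      obtain m1 where m1: "(1/2::real)^m1 < e/2"
        using real_arch_pow_inv[of "e/2" "1/2"] \<open>e > 0\<close> by auto
      define m where "m = max m1 M2"
      have pm: "(1/2::real)^m < e/2"
      proof -
        have "(1/2::real)^m \<le> (1/2)^m1" unfolding m_def by (rule power_decreasing) auto
        then show ?thesis using m1 by linarith
      qed
      have "norm (qnorm (vdiff A (x k) l) - 0) < e" if k: "k \<ge> N m" for k
      proof -
        have "qnorm (vdiff A (x k) l) = qnorm (vdiff A (x k) (x (N m)) \<oplus> vdiff A (x (N m)) l)"
          using x l by (simp add: vdiff_trans)
        also have "\<dots> \<le> qnorm (vdiff A (x k) (x (N m))) + qnorm (vdiff A (x (N m)) l)"
          using x l by (intro qnorm_triangle) auto
        also have "qnorm (vdiff A (x k) (x (N m))) < (1/2)^m"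
          using k N[of m] by (intro N0) auto
        also have "qnorm (vdiff A (x (N m)) l) \<le> nrm A (vdiff A (z m) l)"
        proof (rule qnorm_le_of_diff)
          have "vdiff A (vdiff A (z m) l) (vdiff A (x (N m)) l) = vdiff A (z m) (x (N m))"
            by (rule vdiff_eqI) (use z(1) x l in \<open>auto simp: add_comm[of "vdiff A (x (N m)) l"] vdiff_trans\<close>)
          then show "vdiff A (vdiff A (z m) l) (vdiff A (x (N m)) l) \<in> I" using z(2) by simp
        qed (use x z l in auto)
        also have "nrm A (vdiff A (z m) l) < e/2" using M2[of m] by (simp add: m_def)
        finally show ?thesis using pm qnorm_nonneg[of "vdiff A (x k) l"] x l by simp
      qed
      then show ?thesis by blast
    qed
  qed
  then show ?thesis using that l by blast
qed

text \<open>The quotient lives on a set of representatives, so that its elements have the type of those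
  of \<open>A\<close>.\<close>

definition rep :: "'a \<Rightarrow> 'a" where
  "rep a = (SOME b. b \<in> carrier A \<and> vdiff A b a \<in> I)"

definition quotient :: "'a cstar" where
  "quotient = \<lparr>carrier = rep ` carrier A, vadd = (\<lambda>u v. rep (u \<oplus> v)), vzero = rep \<zero>,
     vscale = (\<lambda>c u. rep (c \<odot> u)), amult = (\<lambda>u v. rep (u \<otimes> v)), star = (\<lambda>u. rep (star A u)),
     nrm = qnorm\<rparr>"

lemma ideal_vdiff_sym: "\<lbrakk>a \<in> carrier A; b \<in> carrier A; vdiff A a b \<in> I\<rbrakk> \<Longrightarrow> vdiff A b a \<in> I"
  by (subst vdiff_swap) auto

lemma ideal_vdiff_trans:
  "\<lbrakk>a \<in> carrier A; b \<in> carrier A; c \<in> carrier A; vdiff A a b \<in> I; vdiff A b c \<in> I\<rbrakk>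
     \<Longrightarrow> vdiff A a c \<in> I"
  using vdiff_trans[of a b c] ideal_add by metis

lemma rep:
  assumes "a \<in> carrier A"
  shows rep_closed [simp]: "rep a \<in> carrier A" and rep_vdiff: "vdiff A (rep a) a \<in> I"
proof -
  have "rep a \<in> carrier A \<and> vdiff A (rep a) a \<in> I"
    unfolding rep_def by (rule someI[of _ a]) (use assms in auto)
  then show "rep a \<in> carrier A" "vdiff A (rep a) a \<in> I" by auto
qed

text \<open>Congruence to a and congruence to b are the same condition, so \<open>SOME\<close> is
  asked the same question and returns the same representative.\<close>

lemma rep_eqI:
  assumes ab: "a \<in> carrier A" "b \<in> carrier A" "vdiff A a b \<in> I"
  shows "rep a = rep b"
proof -
  have "vdiff A c a \<in> I \<longleftrightarrow> vdiff A c b \<in> I" if "c \<in> carrier A" for c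
    using ab that ideal_vdiff_trans ideal_vdiff_sym by meson
  then show ?thesis unfolding rep_def by (metis (no_types, lifting))
qed

lemma rep_eq_iff:
  assumes ab: "a \<in> carrier A" "b \<in> carrier A"
  shows "rep a = rep b \<longleftrightarrow> vdiff A a b \<in> I"
proof
  assume "rep a = rep b"
  then have "vdiff A (rep a) a \<in> I" "vdiff A (rep a) b \<in> I" using rep_vdiff ab by metis+
  then show "vdiff A a b \<in> I"
    using ab ideal_vdiff_trans[of a "rep a" b] ideal_vdiff_sym[of "rep a" a] by simp
qed (rule rep_eqI[OF ab])

lemma rep_ops [simp]:
  assumes ab: "a \<in> carrier A" "b \<in> carrier A"
  shows "rep (rep a \<oplus> rep b) = rep (a \<oplus> b)" "rep (c \<odot> rep a) = rep (c \<odot> a)"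
    "rep (rep a \<otimes> rep b) = rep (a \<otimes> b)" "rep (star A (rep a)) = rep (star A a)"
proof -
  show "rep (rep a \<oplus> rep b) = rep (a \<oplus> b)"
    using ab rep_vdiff by (intro rep_eqI) (auto simp: vdiff_add_add)
  show "rep (c \<odot> rep a) = rep (c \<odot> a)"
    using ab rep_vdiff by (intro rep_eqI) (auto simp: vdiff_scale)
  show "rep (star A (rep a)) = rep (star A a)"
    using ab rep_vdiff by (intro rep_eqI) (auto simp flip: star_vdiff)
  show "rep (rep a \<otimes> rep b) = rep (a \<otimes> b)"
  proof (rule rep_eqI)
    have "vdiff A (rep a \<otimes> rep b) (a \<otimes> b)
        = vdiff A (rep a) a \<otimes> rep b \<oplus> a \<otimes> vdiff A (rep b) b"
      using ab by (simp add: vdiff_mult mult_vdiff vdiff_trans)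
    then show "vdiff A (rep a \<otimes> rep b) (a \<otimes> b) \<in> I" using ab rep_vdiff by simp
  qed (use ab in auto)
qed

lemma qnorm_rep: "a \<in> carrier A \<Longrightarrow> qnorm (rep a) = qnorm a"
  by (intro qnorm_cong) (auto simp: rep_vdiff)

lemma quotient_simps:
  "carrier quotient = rep ` carrier A" "\<zero>\<^bsub>quotient\<^esub> = rep \<zero>"
  "u \<oplus>\<^bsub>quotient\<^esub> v = rep (u \<oplus> v)" "c \<odot>\<^bsub>quotient\<^esub> u = rep (c \<odot> u)"
  "u \<otimes>\<^bsub>quotient\<^esub> v = rep (u \<otimes> v)" "star quotient u = rep (star A u)" "nrm quotient = qnorm"
  by (simp_all add: quotient_def)

lemma quotient_vdiff:
  "\<lbrakk>a \<in> carrier A; b \<in> carrier A\<rbrakk> \<Longrightarrow> vdiff quotient (rep a) (rep b) = rep (vdiff A a b)"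
  by (simp add: vdiff_def quotient_simps)

lemma quotient_star_hom: "star_hom A quotient rep"
  by (rule star_homI) (simp_all add: quotient_simps)

lemma quotient_cstar: "cstar_algebra quotient"
proof (rule cstar_algebra_intro)
  show "star_algebra quotient"
    by (rule star_algebra_image[OF star_algebra_axioms, where q = rep]) (simp_all add: quotient_simps)
  show "complete_norm quotient (nrm quotient)"
    unfolding complete_norm_def
  proof (intro allI impI)
    fix s :: "nat \<Rightarrow> 'a"
    assume s: "\<forall>k. s k \<in> carrier quotient"
      and C: "\<forall>e>0. \<exists>M. \<forall>j\<ge>M. \<forall>k\<ge>M. nrm quotient (vdiff quotient (s j) (s k)) < e"
    then have "\<forall>k. \<exists>a. a \<in> carrier A \<and> s k = rep a" by (auto simp: quotient_simps)
    then obtain x where x: "\<And>k. x k \<in> carrier A" "\<And>k. s k = rep (x k)" by metis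
    have C': "\<exists>M. \<forall>j\<ge>M. \<forall>k\<ge>M. qnorm (vdiff A (x j) (x k)) < e" if "e > 0" for e
      using C that x by (simp add: quotient_vdiff quotient_simps(7) qnorm_rep)
    obtain l where l: "l \<in> carrier A" "(\<lambda>k. qnorm (vdiff A (x k) l)) \<longlonglongrightarrow> 0"
      by (rule qnorm_complete[OF x(1) C'])
    then have "converges_to quotient (nrm quotient) s (rep l)"
      by (simp add: converges_to_def x quotient_vdiff quotient_simps(7) qnorm_rep)
    then show "\<exists>l\<in>carrier quotient. converges_to quotient (nrm quotient) s l"
      using l by (auto simp: quotient_simps(1))
  qed
  fix u assume "u \<in> carrier quotient"
  then obtain a where a: "u = rep a" "a \<in> carrier A" by (auto simp: quotient_simps)
  show "nrm quotient u = 0 \<longleftrightarrow> u = \<zero>\<^bsub>quotient\<^esub>"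
    using a by (simp add: quotient_simps qnorm_rep qnorm_eq_zero rep_eq_iff)
  show "nrm quotient (c \<odot>\<^bsub>quotient\<^esub> u) = cmod c * nrm quotient u" for c
    using a by (simp add: quotient_simps qnorm_rep qnorm_scale)
  show "nrm quotient (star quotient u \<otimes>\<^bsub>quotient\<^esub> u) = (nrm quotient u)\<^sup>2"
    using a by (simp add: quotient_simps qnorm_rep qnorm_cstar)
  show "0 \<le> nrm quotient u" using a by (simp add: quotient_simps qnorm_nonneg)
  fix v assume "v \<in> carrier quotient"
  then obtain b where b: "v = rep b" "b \<in> carrier A" by (auto simp: quotient_simps)
  show "nrm quotient (u \<oplus>\<^bsub>quotient\<^esub> v) \<le> nrm quotient u + nrm quotient v"
    using a b by (simp add: quotient_simps qnorm_rep qnorm_triangle)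
  show "nrm quotient (u \<otimes>\<^bsub>quotient\<^esub> v) \<le> nrm quotient u * nrm quotient v"
    using a b by (simp add: quotient_simps qnorm_rep qnorm_mult)
qed

lemma quotient_unital: "unital_cstar quotient (rep \<one>)"
proof -
  interpret Q: cstar_algebra quotient by (rule quotient_cstar)
  show ?thesis by unfold_locales (auto simp: quotient_simps)
qed

lemma rep_eq_zero_iff: "a \<in> carrier A \<Longrightarrow> rep a = \<zero>\<^bsub>quotient\<^esub> \<longleftrightarrow> a \<in> I"
  by (simp add: quotient_simps rep_eq_iff)

text \<open>The quotient consists of elements of \<open>A\<close>, so the induced homomorphism is
  \<open>h\<close> itself.\<close>

lemma star_hom_quotient:
  assumes h: "star_hom A D h" and D: "cstar_algebra D"
    and ker: "\<And>i. i \<in> I \<Longrightarrow> h i = \<zero>\<^bsub>D\<^esub>"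
  shows "\<And>a. a \<in> carrier A \<Longrightarrow> h (rep a) = h a" "star_hom quotient D h"
proof -
  interpret D: cstar_algebra D by fact
  note h' [simp] = star_homD[OF h]
  show *: "h (rep a) = h a" if a: "a \<in> carrier A" for a
  proof -
    have "h (vdiff A (rep a) a) = \<zero>\<^bsub>D\<^esub>" using ker rep_vdiff[OF a] by blast
    then show ?thesis
      using a star_hom_vdiff[OF h complex_space_axioms, of "rep a" a] by (simp add: D.vdiff_eq_zero_iff)
  qed
  have c: "u \<in> carrier quotient \<Longrightarrow> u \<in> carrier A" for u by (auto simp: quotient_simps)
  show "star_hom quotient D h"
    by (rule star_homI) (simp_all add: c quotient_simps(2-6) *)
qed

end

section \<open>Correspondences with a finite frame\<close>

text \<open>The algebraic part of the axioms of a correspondence. The restricted direct sum below is only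
  shown to satisfy these.\<close>

locale star_corr =
  complex_space X + coef: star_algebra "coef X" for X :: "('x, 'a) corr" (structure) +
  assumes nrm_coef_zero: "nrm (coef X) \<zero>\<^bsub>coef X\<^esub> = 0"
    and ract_closed [simp, intro]: "\<lbrakk>\<xi> \<in> carrier X; a \<in> carrier (coef X)\<rbrakk> \<Longrightarrow> ract X \<xi> a \<in> carrier X"
    and ip_closed [simp, intro]: "\<lbrakk>\<xi> \<in> carrier X; \<eta> \<in> carrier X\<rbrakk> \<Longrightarrow> ip X \<xi> \<eta> \<in> carrier (coef X)"
    and ip_add_right: "\<lbrakk>\<xi> \<in> carrier X; \<eta> \<in> carrier X; \<zeta> \<in> carrier X\<rbrakk>
                      \<Longrightarrow> ip X \<xi> (\<eta> \<oplus> \<zeta>) = ip X \<xi> \<eta> \<oplus>\<^bsub>coef X\<^esub> ip X \<xi> \<zeta>"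
    and ip_scale_right: "\<lbrakk>\<xi> \<in> carrier X; \<eta> \<in> carrier X\<rbrakk>
                      \<Longrightarrow> ip X \<xi> (c \<odot> \<eta>) = c \<odot>\<^bsub>coef X\<^esub> ip X \<xi> \<eta>"
    and ip_ract_right: "\<lbrakk>\<xi> \<in> carrier X; \<eta> \<in> carrier X; a \<in> carrier (coef X)\<rbrakk>
                      \<Longrightarrow> ip X \<xi> (ract X \<eta> a) = ip X \<xi> \<eta> \<otimes>\<^bsub>coef X\<^esub> a"
    and ip_star: "\<lbrakk>\<xi> \<in> carrier X; \<eta> \<in> carrier X\<rbrakk> \<Longrightarrow> star (coef X) (ip X \<xi> \<eta>) = ip X \<eta> \<xi>"
    and lact_funcset: "a \<in> carrier (coef X) \<Longrightarrow> lact X a \<in> carrier X \<rightarrow>\<^sub>E carrier X"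
    and lact_adjoint: "\<lbrakk>a \<in> carrier (coef X); \<xi> \<in> carrier X; \<eta> \<in> carrier X\<rbrakk>
                      \<Longrightarrow> ip X (lact X a \<xi>) \<eta> = ip X \<xi> (lact X (star (coef X) a) \<eta>)"
begin

lemma lact_closed [simp, intro]:
  "\<lbrakk>a \<in> carrier (coef X); \<xi> \<in> carrier X\<rbrakk> \<Longrightarrow> lact X a \<xi> \<in> carrier X"
  using lact_funcset by fastforce

lemma ip_ract_left:
  assumes "\<xi> \<in> carrier X" "\<eta> \<in> carrier X" "a \<in> carrier (coef X)"
  shows "ip X (ract X \<xi> a) \<eta> = star (coef X) a \<otimes>\<^bsub>coef X\<^esub> ip X \<xi> \<eta>"
proof -
  have "ip X (ract X \<xi> a) \<eta> = star (coef X) (ip X \<eta> (ract X \<xi> a))"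
    using assms by (simp add: ip_star)
  then show ?thesis using assms by (simp add: ip_ract_right coef.star_mult ip_star)
qed

lemma ip_linear: "\<xi> \<in> carrier X \<Longrightarrow> linear_map X (coef X) (ip X \<xi>)"
  by (auto simp: linear_map_def ip_add_right ip_scale_right)

lemma ip_zero_right [simp]: "\<xi> \<in> carrier X \<Longrightarrow> ip X \<xi> \<zero> = \<zero>\<^bsub>coef X\<^esub>"
  by (rule linear_map_zero[OF ip_linear complex_space_axioms coef.complex_space_axioms])

lemma ip_zero_left [simp]: "\<xi> \<in> carrier X \<Longrightarrow> ip X \<zero> \<xi> = \<zero>\<^bsub>coef X\<^esub>"
  by (metis coef.star_zero ip_star ip_zero_right zero_closed)

lemma ip_vsum:
  "\<lbrakk>\<xi> \<in> carrier X; \<And>k. k \<in> set ks \<Longrightarrow> f k \<in> carrier X\<rbrakk>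
     \<Longrightarrow> ip X \<xi> (vsum X f ks) = vsum (coef X) (\<lambda>k. ip X \<xi> (f k)) ks"
  by (rule linear_map_vsum[OF ip_linear complex_space_axioms coef.complex_space_axioms])

end

lemma (in cstar_correspondence) star_corr: "star_corr X"
proof
  show "lact X a \<in> carrier X \<rightarrow>\<^sub>E carrier X" if "a \<in> carrier (coef X)" for a
    using star_hom_closed[OF lact_star_hom that] by (auto simp: adjointables_def)
  show "ip X (lact X a \<xi>) \<eta> = ip X \<xi> (lact X (star (coef X) a) \<eta>)"
    if "a \<in> carrier (coef X)" "\<xi> \<in> carrier X" "\<eta> \<in> carrier X" for a \<xi> \<eta>
  proof -
    have "\<exists>S. is_adjoint X (lact X a) S"
      using star_hom_closed[OF lact_star_hom that(1)] by (auto simp: adjointables_def)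
    then have "is_adjoint X (lact X a) (star (\<L> X) (lact X a))"
      unfolding adjointables_def by (simp add: someI_ex)
    then show ?thesis
      using that star_hom_star[OF lact_star_hom that(1)] by (simp add: is_adjoint_def)
  qed
qed (simp_all add: ract_closed ip_closed ip_add_right ip_scale_right ip_ract_right ip_star)

lemma lact_zero_map:
  "(lact X b = \<zero>\<^bsub>\<L> X\<^esub>) \<longleftrightarrow> lact X b = (\<lambda>\<xi>\<in>carrier X. \<zero>\<^bsub>X\<^esub>)"
  by (simp add: adjointables_def)

text \<open>A finite frame expands the identity into finitely many rank-one operators. It gives
  compactness of all left actions and reduces statements about operators to the vectors
  \<open>w k\<close>.\<close>

locale framed_corr = star_corr X for X :: "('x, 'a) corr" (structure) +
  fixes ks :: "'i list" and w :: "'i \<Rightarrow> 'x"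
  assumes frame_closed [simp]: "k \<in> set ks \<Longrightarrow> w k \<in> carrier X"
    and frame: "\<xi> \<in> carrier X \<Longrightarrow> vsum X (\<lambda>k. ract X (w k) (ip X (w k) \<xi>)) ks = \<xi>"
begin

text \<open>The frame formula does the work of definiteness of the inner product, which is not among
  the axioms of \<open>star_corr\<close>.\<close>

lemma frame_eqI:
  assumes "\<xi> \<in> carrier X" "\<eta> \<in> carrier X" "\<And>k. k \<in> set ks \<Longrightarrow> ip X (w k) \<xi> = ip X (w k) \<eta>"
  shows "\<xi> = \<eta>"
proof -
  have "vsum X (\<lambda>k. ract X (w k) (ip X (w k) \<xi>)) ks = vsum X (\<lambda>k. ract X (w k) (ip X (w k) \<eta>)) ks"
    using assms(3) by (intro vsum_cong) simp
  then show ?thesis using assms frame by simp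
qed

lemma adjoint_star:
  assumes "T \<in> carrier (\<L> X)"
  shows "is_adjoint X T (star (\<L> X) T)"
  using assms by (simp add: adjointables_def someI_ex)

lemma adjoint_swap:
  assumes "is_adjoint X T S" "T \<in> carrier X \<rightarrow>\<^sub>E carrier X" "\<xi> \<in> carrier X" "\<eta> \<in> carrier X"
  shows "ip X \<xi> (T \<eta>) = ip X (S \<xi>) \<eta>"
proof -
  have c: "T \<eta> \<in> carrier X" "S \<xi> \<in> carrier X" using assms by (auto simp: is_adjoint_def)
  have "ip X (T \<eta>) \<xi> = ip X \<eta> (S \<xi>)" using assms by (auto simp: is_adjoint_def)
  then show ?thesis using c assms ip_star by metis
qed

lemma adjoint_adjointable:
  assumes "is_adjoint X T S" "T \<in> carrier (\<L> X)"
  shows "S \<in> carrier (\<L> X)"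
proof -
  have T: "T \<in> carrier X \<rightarrow>\<^sub>E carrier X" using assms(2) by (simp add: adjointables_def)
  then have "is_adjoint X S T"
    using assms(1) adjoint_swap[OF assms(1) T] by (auto simp: is_adjoint_def)
  then show ?thesis using assms(1) by (auto simp: adjointables_def is_adjoint_def)
qed

text \<open>An adjoint alone yields linearity over the coefficients: move T to the other side of the
  inner product and test on the frame.\<close>

lemma adjointable_ract:
  assumes T: "T \<in> carrier (\<L> X)" and \<xi>: "\<xi> \<in> carrier X" and a: "a \<in> carrier (coef X)"
  shows "T (ract X \<xi> a) = ract X (T \<xi>) a"
proof -
  have T': "T \<in> carrier X \<rightarrow>\<^sub>E carrier X" using T by (simp add: adjointables_def)
  then have c: "T \<xi> \<in> carrier X" "T (ract X \<xi> a) \<in> carrier X" using \<xi> a by auto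
  have S: "star (\<L> X) T \<zeta> \<in> carrier X" if "\<zeta> \<in> carrier X" for \<zeta>
    using adjoint_star[OF T] that by (auto simp: is_adjoint_def)
  show ?thesis
    by (rule frame_eqI)
      (use \<xi> a c S in \<open>simp_all add: adjoint_swap[OF adjoint_star[OF T] T'] ip_ract_right\<close>)
qed

lemma adjointable_linear:
  assumes T: "T \<in> carrier (\<L> X)"
  shows "linear_map X X T"
proof -
  have T': "T \<in> carrier X \<rightarrow>\<^sub>E carrier X" using T by (simp add: adjointables_def)
  then have c: "T \<xi> \<in> carrier X" if "\<xi> \<in> carrier X" for \<xi> using that by auto
  have S: "star (\<L> X) T \<zeta> \<in> carrier X" if "\<zeta> \<in> carrier X" for \<zeta>
    using adjoint_star[OF T] that by (auto simp: is_adjoint_def)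
  have "T (\<xi> \<oplus> \<eta>) = T \<xi> \<oplus> T \<eta>" if "\<xi> \<in> carrier X" "\<eta> \<in> carrier X" for \<xi> \<eta>
    by (rule frame_eqI)
      (use that c S in \<open>simp_all add: adjoint_swap[OF adjoint_star[OF T] T'] ip_add_right\<close>)
  moreover have "T (t \<odot> \<xi>) = t \<odot> T \<xi>" if "\<xi> \<in> carrier X" for \<xi> t
    by (rule frame_eqI)
      (use that c S in \<open>simp_all add: adjoint_swap[OF adjoint_star[OF T] T'] ip_scale_right\<close>)
  ultimately show ?thesis using c by (auto simp: linear_map_def)
qed

lemma id_adjointable: "(\<lambda>\<xi>\<in>carrier X. \<xi>) \<in> carrier (\<L> X)"
  by (auto simp: adjointables_def is_adjoint_def intro!: exI[of _ "\<lambda>\<xi>\<in>carrier X. \<xi>"])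

lemma lact_adjointable: "a \<in> carrier (coef X) \<Longrightarrow> lact X a \<in> carrier (\<L> X)"
  using lact_funcset[of a] lact_funcset[of "star (coef X) a"] lact_adjoint[of a]
  by (auto simp: adjointables_def is_adjoint_def intro!: exI[of _ "lact X (star (coef X) a)"])

lemma vsum_adjointables:
  assumes "\<And>k. k \<in> set ls \<Longrightarrow> f k \<in> extensional (carrier X)"
  shows "vsum (\<L> X) f ls = (\<lambda>\<xi>\<in>carrier X. vsum X (\<lambda>k. f k \<xi>) ls)"
  using assms by (induction ls) (auto simp: adjointables_def fun_eq_iff)

text \<open>Apply the left action to the frame formula. The result is a finite sum of rank-one
  operators, on which any extension of a representation to the compacts can be evaluated.\<close>

lemma lact_expand:
  assumes a: "a \<in> carrier (coef X)"
  shows "lact X a = vsum (\<L> X) (\<lambda>k. theta X (lact X a (w k)) (w k)) ks"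
proof (rule extensionalityI[of _ "carrier X"])
  fix \<xi> assume \<xi>: "\<xi> \<in> carrier X"
  have "lact X a \<xi> = lact X a (vsum X (\<lambda>k. ract X (w k) (ip X (w k) \<xi>)) ks)"
    using \<xi> by (simp add: frame)
  also have "\<dots> = vsum X (\<lambda>k. lact X a (ract X (w k) (ip X (w k) \<xi>))) ks"
    by (rule linear_map_vsum[OF adjointable_linear[OF lact_adjointable[OF a]]
          complex_space_axioms complex_space_axioms]) (use \<xi> in auto)
  also have "\<dots> = vsum X (\<lambda>k. theta X (lact X a (w k)) (w k) \<xi>) ks"
    using \<xi> a by (intro vsum_cong) (simp add: adjointable_ract[OF lact_adjointable] theta_def)
  finally show "lact X a \<xi> = vsum (\<L> X) (\<lambda>k. theta X (lact X a (w k)) (w k)) ks \<xi>"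
    using \<xi> by (subst vsum_adjointables) (auto simp: theta_def)
next
  show "vsum (\<L> X) (\<lambda>k. theta X (lact X a (w k)) (w k)) ks \<in> extensional (carrier X)"
    by (subst vsum_adjointables) (auto simp: theta_def)
qed (use lact_funcset[OF a] in \<open>auto simp: PiE_def\<close>)

lemma vsum_lin_span:
  assumes "\<And>k. k \<in> set ls \<Longrightarrow> f k \<in> S"
  shows "vsum V f ls \<in> lin_span V S"
proof -
  have "vsum V f ls \<in> W" if "subspace_of W V" "S \<subseteq> W" for W
  proof -
    have "vsum V f ls' \<in> W" if "set ls' \<subseteq> set ls" for ls'
      using that
    proof (induction ls')
      case (Cons k ls')
      then have "f k \<in> W" "vsum V f ls' \<in> W" using assms \<open>S \<subseteq> W\<close> by auto
      then show ?case using \<open>subspace_of W V\<close> by (simp add: subspace_of_def)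
    qed (use \<open>subspace_of W V\<close> in \<open>simp add: subspace_of_def\<close>)
    then show ?thesis by blast
  qed
  then show ?thesis by (auto simp: lin_span_def)
qed

text \<open>A finite sum lies in the closure as the limit of a constant sequence. This takes an
  explicit adjoint and the fact that the zero operator has norm 0, which is what
  \<open>nrm_coef_zero\<close> is for.\<close>

lemma theta_sum_compact:
  assumes ab: "\<And>k. k \<in> set ls \<Longrightarrow> a k \<in> carrier X" "\<And>k. k \<in> set ls \<Longrightarrow> b k \<in> carrier X"
  shows "vsum (\<L> X) (\<lambda>k. theta X (a k) (b k)) ls \<in> carrier (\<K> X)"
proof -
  let ?T = "vsum (\<L> X) (\<lambda>k. theta X (a k) (b k)) ls"
  let ?S = "\<lambda>\<xi>\<in>carrier X. vsum X (\<lambda>k. ract X (b k) (ip X (a k) \<xi>)) ls"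
  have T: "?T = (\<lambda>\<xi>\<in>carrier X. vsum X (\<lambda>k. ract X (a k) (ip X (b k) \<xi>)) ls)"
    by (subst vsum_adjointables) (auto simp: theta_def cong: vsum_cong)
  have Tc: "?T \<in> carrier X \<rightarrow>\<^sub>E carrier X" unfolding T using ab by auto
  have "is_adjoint X ?T ?S"
    unfolding is_adjoint_def
  proof (intro conjI ballI)
    fix \<xi> \<eta> assume \<xi>: "\<xi> \<in> carrier X" and \<eta>: "\<eta> \<in> carrier X"
    have "ip X (?T \<xi>) \<eta> = star (coef X) (ip X \<eta> (vsum X (\<lambda>k. ract X (a k) (ip X (b k) \<xi>)) ls))"
      using \<xi> \<eta> ab by (simp add: T ip_star)
    also have "\<dots> = vsum (coef X) (\<lambda>k. star (coef X) (ip X \<eta> (ract X (a k) (ip X (b k) \<xi>)))) ls"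
      using \<xi> \<eta> ab by (simp add: ip_vsum coef.star_vsum)
    also have "\<dots> = vsum (coef X) (\<lambda>k. ip X \<xi> (ract X (b k) (ip X (a k) \<eta>))) ls"
      using \<xi> \<eta> ab by (intro vsum_cong) (simp add: ip_ract_right coef.star_mult ip_star)
    also have "\<dots> = ip X \<xi> (?S \<eta>)" using \<xi> \<eta> ab by (simp add: ip_vsum)
    finally show "ip X (?T \<xi>) \<eta> = ip X \<xi> (?S \<eta>)" .
  qed (use ab in auto)
  then have L: "?T \<in> carrier (\<L> X)" using Tc by (auto simp: adjointables_def)
  have span: "?T \<in> lin_span (\<L> X) {theta X \<xi> \<eta> | \<xi> \<eta>. \<xi> \<in> carrier X \<and> \<eta> \<in> carrier X}"
    by (rule vsum_lin_span) (use ab in blast)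
  have "?T \<xi> \<oplus> (- 1) \<odot> ?T \<xi> = \<zero>" if "\<xi> \<in> carrier X" for \<xi>
    using Tc that by (intro add_neg) auto
  then have zero: "vdiff (\<L> X) ?T ?T = (\<lambda>\<xi>\<in>carrier X. \<zero>)"
    by (auto simp: vdiff_def adjointables_def[of X] fun_eq_iff)
  have "{mod_norm X ((\<lambda>\<xi>\<in>carrier X. \<zero>) \<xi>) | \<xi>. \<xi> \<in> carrier X \<and> mod_norm X \<xi> \<le> 1} = {0}"
    by (auto simp: mod_norm_def nrm_coef_zero intro!: exI[of _ \<zero>])
  then have "nrm (\<L> X) (vdiff (\<L> X) ?T ?T) = 0"
    by (subst zero) (simp add: adjointables_def)
  then show ?thesis
    using span L
    by (auto simp: compacts_def norm_closure_def converges_to_def intro!: exI[of _ "\<lambda>_. ?T"])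
qed

lemma lact_compact: "a \<in> carrier (coef X) \<Longrightarrow> lact X a \<in> carrier (\<K> X)"
  by (subst lact_expand) (auto intro!: theta_sum_compact)

lemma compacts_hom_theta_sum:
  assumes h: "star_hom (\<K> X) D h" and D: "cstar_algebra D"
    and ab: "\<And>k. k \<in> set ls \<Longrightarrow> a k \<in> carrier X" "\<And>k. k \<in> set ls \<Longrightarrow> b k \<in> carrier X"
  shows "h (vsum (\<L> X) (\<lambda>k. theta X (a k) (b k)) ls) = vsum D (\<lambda>k. h (theta X (a k) (b k))) ls"
  using ab
proof (induction ls)
  case Nil
  interpret D: cstar_algebra D by fact
  have 0: "\<zero>\<^bsub>\<L> X\<^esub> \<in> carrier (\<K> X)" using theta_sum_compact[of "[]"] by simp
  \<comment> \<open>The vector space axioms of \<open>\<K> X\<close> are not at hand, so the zero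
    operator is sent to 0 by writing it as 0 times itself.\<close>
  have "h (0 \<odot>\<^bsub>\<K> X\<^esub> \<zero>\<^bsub>\<L> X\<^esub>) = \<zero>\<^bsub>D\<^esub>"
    using star_homD(2,4)[OF h] 0 by simp
  moreover have "0 \<odot>\<^bsub>\<K> X\<^esub> \<zero>\<^bsub>\<L> X\<^esub> = \<zero>\<^bsub>\<L> X\<^esub>" by (simp add: compacts_def adjointables_def fun_eq_iff)
  ultimately show ?case by simp
next
  case (Cons k ls)
  have "vsum (\<L> X) (\<lambda>k. theta X (a k) (b k)) [k] = theta X (a k) (b k)"
    using Cons.prems(1)[of k] Cons.prems(2)[of k]
    by (simp add: adjointables_def theta_def fun_eq_iff)
  then have "theta X (a k) (b k) \<in> carrier (\<K> X)"
    using theta_sum_compact[of "[k]" a b] Cons.prems by simp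
  moreover have "vsum (\<L> X) (\<lambda>k. theta X (a k) (b k)) ls \<in> carrier (\<K> X)"
    using Cons.prems by (intro theta_sum_compact) auto
  moreover have "vadd (\<K> X) = vadd (\<L> X)" by (simp add: compacts_def)
  ultimately show ?case using Cons star_homD(3)[OF h] by simp
qed

text \<open>The frame makes every left action compact, which settles the first condition and leaves
  the annihilator condition.\<close>

lemma katsura_ideal_iff:
  "a \<in> katsura_ideal X \<longleftrightarrow> a \<in> carrier (coef X) \<and>
     (\<forall>b\<in>carrier (coef X). (\<forall>\<xi>\<in>carrier X. lact X b \<xi> = \<zero>) \<longrightarrow> a \<otimes>\<^bsub>coef X\<^esub> b = \<zero>\<^bsub>coef X\<^esub>)"
proof -
  have "lact X b = (\<lambda>\<xi>\<in>carrier X. \<zero>) \<longleftrightarrow> (\<forall>\<xi>\<in>carrier X. lact X b \<xi> = \<zero>)"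
    if "b \<in> carrier (coef X)" for b
    using lact_funcset[OF that] by (auto simp: fun_eq_iff PiE_def extensional_def)
  then show ?thesis
    unfolding katsura_ideal_def lact_zero_map using lact_compact by auto
qed

end

section \<open>Representations of framed correspondences and their extension to the compact
  operators\<close>

locale corr_rep = X: framed_corr X ks w + cstar_algebra D
  for X :: "('x, 'a) corr" and ks and w :: "'i \<Rightarrow> 'x" and D :: "'d cstar" (structure) +
  fixes \<rho>X :: "'x \<Rightarrow> 'd" and \<rho>A :: "'a \<Rightarrow> 'd"
  assumes \<rho>X_linear: "linear_map X D \<rho>X" and \<rho>A_hom: "star_hom (coef X) D \<rho>A"
    and \<rho>X_ip: "\<lbrakk>\<xi> \<in> carrier X; \<eta> \<in> carrier X\<rbrakk> \<Longrightarrow> star D (\<rho>X \<xi>) \<otimes> \<rho>X \<eta> = \<rho>A (ip X \<xi> \<eta>)"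
begin

lemmas \<rho>A = star_homD[OF \<rho>A_hom]

lemma \<rho>X_closed [simp]: "\<xi> \<in> carrier X \<Longrightarrow> \<rho>X \<xi> \<in> carrier D"
  using \<rho>X_linear by auto

lemma \<rho>A_closed [simp]: "a \<in> carrier (coef X) \<Longrightarrow> \<rho>A a \<in> carrier D"
  by (rule \<rho>A)

lemma \<rho>A_zero [simp]: "\<rho>A \<zero>\<^bsub>coef X\<^esub> = \<zero>" and \<rho>X_zero [simp]: "\<rho>X \<zero>\<^bsub>X\<^esub> = \<zero>"
  using star_hom_zero[OF \<rho>A_hom X.coef.complex_space_axioms complex_space_axioms]
    linear_map_zero[OF \<rho>X_linear X.complex_space_axioms complex_space_axioms] .

text \<open>Right linearity follows from compatibility with inner products: for d the difference of
  both sides, all four terms of d* d equal \<open>\<rho>A\<close> of the same inner product, so d* d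
  = 0.\<close>

lemma \<rho>X_ract:
  assumes \<xi>: "\<xi> \<in> carrier X" and a: "a \<in> carrier (coef X)"
  shows "\<rho>X (ract X \<xi> a) = \<rho>X \<xi> \<otimes> \<rho>A a"
proof -
  let ?u = "\<rho>X (ract X \<xi> a)" and ?v = "\<rho>X \<xi> \<otimes> \<rho>A a"
  let ?i = "\<rho>A (ip X (ract X \<xi> a) (ract X \<xi> a))"
  have uv: "?u \<in> carrier D" "?v \<in> carrier D" using \<xi> a by auto
  have "star D ?u \<otimes> ?u = ?i" using \<xi> a by (simp add: \<rho>X_ip)
  moreover have "star D ?u \<otimes> ?v = ?i"
    using \<xi> a by (simp add: mult_assoc[symmetric] \<rho>X_ip X.ip_ract_right \<rho>A)
  moreover have "star D ?v \<otimes> ?u = ?i"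
    using \<xi> a by (simp add: star_mult mult_assoc \<rho>X_ip X.ip_ract_left \<rho>A)
  moreover have "star D ?v \<otimes> ?v = ?i"
  proof -
    have "star D ?v \<otimes> ?v = star D (\<rho>A a) \<otimes> ((star D (\<rho>X \<xi>) \<otimes> \<rho>X \<xi>) \<otimes> \<rho>A a)"
      using \<xi> a by (simp add: star_mult mult_assoc)
    also have "\<dots> = ?i"
      using \<xi> a by (simp add: \<rho>X_ip X.ip_ract_left X.ip_ract_right X.coef.mult_assoc \<rho>A)
    finally show ?thesis .
  qed
  ultimately have "star D (vdiff D ?u ?v) \<otimes> vdiff D ?u ?v = \<zero>"
    using uv \<xi> a by (simp add: star_vdiff vdiff_mult mult_vdiff)
  then show ?thesis using star_mult_self_zero uv vdiff_eq_zero_iff by blast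
qed

lemma \<rho>X_vsum: "(\<And>k. k \<in> set ls \<Longrightarrow> f k \<in> carrier X) \<Longrightarrow> \<rho>X (vsum X f ls) = vsum D (\<lambda>k. \<rho>X (f k)) ls"
  by (rule linear_map_vsum[OF \<rho>X_linear X.complex_space_axioms complex_space_axioms])

lemma \<rho>X_expand:
  assumes T: "T \<in> carrier (\<L> X)" and \<xi>: "\<xi> \<in> carrier X"
  shows "\<rho>X (T \<xi>) = vsum D (\<lambda>k. \<rho>X (T (w k)) \<otimes> \<rho>A (ip X (w k) \<xi>)) ks"
proof -
  have Tc: "T \<zeta> \<in> carrier X" if "\<zeta> \<in> carrier X" for \<zeta> using T that by (auto simp: adjointables_def)
  have "T \<xi> = T (vsum X (\<lambda>k. ract X (w k) (ip X (w k) \<xi>)) ks)" using \<xi> by (simp add: X.frame)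
  also have "\<dots> = vsum X (\<lambda>k. T (ract X (w k) (ip X (w k) \<xi>))) ks"
    using \<xi> by (intro linear_map_vsum[OF X.adjointable_linear[OF T]] X.complex_space_axioms) auto
  also have "\<rho>X \<dots> = vsum D (\<lambda>k. \<rho>X (T (ract X (w k) (ip X (w k) \<xi>)))) ks"
    using \<xi> by (intro \<rho>X_vsum Tc) auto
  also have "\<dots> = vsum D (\<lambda>k. \<rho>X (T (w k)) \<otimes> \<rho>A (ip X (w k) \<xi>)) ks"
    using \<xi> Tc by (intro vsum_cong) (simp add: X.adjointable_ract[OF T] \<rho>X_ract)
  finally show ?thesis .
qed

text \<open>The extension to the compacts, written out with the frame. The formula makes sense on
  all adjointable operators, and its value at the identity is \<open>F\<close>.\<close>

definition plus :: "('x \<Rightarrow> 'x) \<Rightarrow> 'd" where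
  "plus T = vsum D (\<lambda>k. \<rho>X (T (w k)) \<otimes> star D (\<rho>X (w k))) ks"

lemma adjointable_closed [simp]: "\<lbrakk>T \<in> carrier (\<L> X); \<xi> \<in> carrier X\<rbrakk> \<Longrightarrow> T \<xi> \<in> carrier X"
  by (auto simp: adjointables_def)

lemma plus_closed [simp]: "T \<in> carrier (\<L> X) \<Longrightarrow> plus T \<in> carrier D"
  by (simp add: plus_def)

lemma plus_\<rho>X:
  assumes T: "T \<in> carrier (\<L> X)" and \<xi>: "\<xi> \<in> carrier X"
  shows "plus T \<otimes> \<rho>X \<xi> = \<rho>X (T \<xi>)"
  unfolding plus_def \<rho>X_expand[OF assms] using assms
  by (subst vsum_mult) (auto intro!: vsum_cong simp: mult_assoc \<rho>X_ip)

definition F :: 'd where "F = vsum D (\<lambda>k. \<rho>X (w k) \<otimes> star D (\<rho>X (w k))) ks"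

lemma F_closed [simp]: "F \<in> carrier D"
  by (simp add: F_def)

lemma F_star [simp]: "star D F = F"
  unfolding F_def by (subst star_vsum) (auto intro!: vsum_cong simp: star_mult)

lemma F_\<rho>X [simp]: "\<xi> \<in> carrier X \<Longrightarrow> F \<otimes> \<rho>X \<xi> = \<rho>X \<xi>"
  using plus_\<rho>X[OF X.id_adjointable, of \<xi>] by (simp add: plus_def F_def cong: vsum_cong)

lemma \<rho>X_star_F [simp]: "\<xi> \<in> carrier X \<Longrightarrow> star D (\<rho>X \<xi>) \<otimes> F = star D (\<rho>X \<xi>)"
  using star_mult[of F "\<rho>X \<xi>"] by simp

lemma plus_theta: "\<lbrakk>\<xi> \<in> carrier X; \<eta> \<in> carrier X\<rbrakk> \<Longrightarrow> plus (theta X \<xi> \<eta>) = \<rho>X \<xi> \<otimes> star D (\<rho>X \<eta>)"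
proof -
  assume c: "\<xi> \<in> carrier X" "\<eta> \<in> carrier X"
  have "plus (theta X \<xi> \<eta>) = vsum D (\<lambda>k. (\<rho>X \<xi> \<otimes> star D (\<rho>X \<eta>)) \<otimes> (\<rho>X (w k) \<otimes> star D (\<rho>X (w k)))) ks"
    unfolding plus_def using c
    by (intro vsum_cong) (simp add: theta_def \<rho>X_ract \<rho>X_ip[symmetric] mult_assoc)
  also have "\<dots> = \<rho>X \<xi> \<otimes> star D (\<rho>X \<eta>) \<otimes> F"
    unfolding F_def using c by (intro mult_vsum[symmetric]) auto
  finally show ?thesis using c by (simp add: mult_assoc)
qed

lemma plus_mult:
  assumes T: "T \<in> carrier (\<L> X)" and S: "S \<in> carrier (\<L> X)"
  shows "plus (\<lambda>\<xi>\<in>carrier X. T (S \<xi>)) = plus T \<otimes> plus S"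
  unfolding plus_def[of S] plus_def[of "\<lambda>\<xi>\<in>carrier X. T (S \<xi>)"] using assms
  by (subst mult_vsum) (auto intro!: vsum_cong simp: mult_assoc[symmetric] plus_\<rho>X)

text \<open>Both sides equal \<open>\<Sum> \<rho>(w l) \<rho>(w l)\<^sup>* \<rho>(S (w k)) \<rho>(w k)\<^sup>*\<close>, because \<open>F\<close> is a unit for \<open>\<rho>X\<close>.\<close>

lemma plus_adjoint:
  assumes T: "T \<in> carrier (\<L> X)" and S: "S \<in> carrier (\<L> X)" and adj: "is_adjoint X T S"
  shows "plus S = star D (plus T)"
proof -
  have "star D (\<rho>X (w l)) \<otimes> plus S = star D (\<rho>X (T (w l)))" if l: "l \<in> set ks" for l
  proof -
    have "star D (\<rho>X (w l)) \<otimes> plus S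
        = vsum D (\<lambda>k. star D (\<rho>X (w l)) \<otimes> \<rho>X (S (w k)) \<otimes> star D (\<rho>X (w k))) ks"
      unfolding plus_def using l S by (subst mult_vsum) (auto intro!: vsum_cong simp: mult_assoc)
    also have "\<dots> = vsum D (\<lambda>k. star D (\<rho>X (T (w l))) \<otimes> (\<rho>X (w k) \<otimes> star D (\<rho>X (w k)))) ks"
      using l T S adj by (intro vsum_cong) (simp add: \<rho>X_ip is_adjoint_def flip: mult_assoc)
    also have "\<dots> = star D (\<rho>X (T (w l))) \<otimes> F"
      unfolding F_def using l T by (intro mult_vsum[symmetric]) auto
    finally show ?thesis using l T by simp
  qed
  then have "F \<otimes> plus S = vsum D (\<lambda>l. \<rho>X (w l) \<otimes> star D (\<rho>X (T (w l)))) ks"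
    unfolding F_def using S by (subst vsum_mult) (auto intro!: vsum_cong simp: mult_assoc)
  moreover have "F \<otimes> plus S = plus S"
    unfolding plus_def using S by (subst mult_vsum) (auto intro!: vsum_cong simp flip: mult_assoc)
  ultimately show ?thesis
    unfolding plus_def[of T] using T by (simp add: star_vsum star_mult cong: vsum_cong)
qed

lemma plus_hom: "star_hom (\<K> X) D plus"
proof -
  have L: "T \<in> carrier (\<L> X)" if "T \<in> carrier (\<K> X)" for T
    using that by (simp add: compacts_def norm_closure_def)
  note ops = compacts_def adjointables_def[of X]
  show ?thesis
  proof (rule star_homI)
    fix T assume "T \<in> carrier (\<K> X)"
    note T = L[OF this]
    show "plus T \<in> carrier D" using T by simp
    have "(c \<odot>\<^bsub>\<K> X\<^esub> T) \<xi> = c \<odot>\<^bsub>X\<^esub> T \<xi>" if "\<xi> \<in> carrier X" for c \<xi>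
      using that by (simp add: ops)
    then show "plus (c \<odot>\<^bsub>\<K> X\<^esub> T) = c \<odot> plus T" for c
      unfolding plus_def using T
      by (subst vsum_scale[symmetric])
        (auto intro!: vsum_cong simp: linear_map_scale[OF \<rho>X_linear] mult_scale_left)
    have adj: "is_adjoint X T (star (\<L> X) T)" by (rule X.adjoint_star[OF T])
    then have "star (\<L> X) T \<in> carrier (\<L> X)"
      by (simp add: X.adjoint_adjointable[OF adj] T)
    then show "plus (star (\<K> X) T) = star D (plus T)"
      using plus_adjoint[OF T _ adj] by (simp add: compacts_def)
    fix S assume "S \<in> carrier (\<K> X)"
    note S = L[OF this]
    have "(T \<oplus>\<^bsub>\<K> X\<^esub> S) \<xi> = T \<xi> \<oplus>\<^bsub>X\<^esub> S \<xi>" if "\<xi> \<in> carrier X" for \<xi>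
      using that by (simp add: ops)
    then show "plus (T \<oplus>\<^bsub>\<K> X\<^esub> S) = plus T \<oplus> plus S"
      unfolding plus_def using T S
      by (subst vsum_add[symmetric])
        (auto intro!: vsum_cong simp: linear_map_add[OF \<rho>X_linear] mult_add_left)
    show "plus (T \<otimes>\<^bsub>\<K> X\<^esub> S) = plus T \<otimes> plus S"
      using plus_mult[OF T S] by (simp add: ops)
  qed
qed

end

locale framed_rep = corr_rep +
  assumes \<rho>X_lact: "\<lbrakk>a \<in> carrier (coef X); \<xi> \<in> carrier X\<rbrakk> \<Longrightarrow> \<rho>X (lact X a \<xi>) = \<rho>A a \<otimes> \<rho>X \<xi>"
    and covariant: "a \<in> katsura_ideal X \<Longrightarrow> \<rho>A a \<otimes> F = \<rho>A a"

context framed_corr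
begin

abbreviation rep :: "'d cstar \<Rightarrow> ('x \<Rightarrow> 'd) \<Rightarrow> ('a \<Rightarrow> 'd) \<Rightarrow> bool" where "rep \<equiv> framed_rep X ks w"

text \<open>By \<open>lact_expand\<close> any extension to the compacts has the value
  \<open>\<rho>A a \<otimes> F\<close> at the left action of a; conversely \<open>plus\<close> is
  such an extension. So the existential in the definition of covariance becomes an equation.\<close>

lemma covariant_rep_iff: "covariant_rep X D \<rho>X \<rho>A \<longleftrightarrow> rep D \<rho>X \<rho>A"
proof
  assume cov: "covariant_rep X D \<rho>X \<rho>A"
  then interpret D: cstar_algebra D by (simp add: covariant_rep_def)
  interpret D: corr_rep X ks w D \<rho>X \<rho>A
    by unfold_locales (use cov in \<open>auto simp: covariant_rep_def\<close>)
  obtain \<rho>plus where plus: "star_hom (\<K> X) D \<rho>plus"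
    "\<And>\<xi> \<eta>. \<lbrakk>\<xi> \<in> carrier X; \<eta> \<in> carrier X\<rbrakk> \<Longrightarrow> \<rho>plus (theta X \<xi> \<eta>) = \<rho>X \<xi> \<otimes>\<^bsub>D\<^esub> star D (\<rho>X \<eta>)"
    "\<And>a. a \<in> katsura_ideal X \<Longrightarrow> \<rho>A a = \<rho>plus (lact X a)"
    using cov by (auto simp: covariant_rep_def)
  have left: "\<rho>X (lact X a \<xi>) = \<rho>A a \<otimes>\<^bsub>D\<^esub> \<rho>X \<xi>" if "a \<in> carrier (coef X)" "\<xi> \<in> carrier X" for a \<xi>
    using cov that by (auto simp: covariant_rep_def)
  have "\<rho>A a \<otimes>\<^bsub>D\<^esub> D.F = \<rho>A a" if a: "a \<in> katsura_ideal X" for a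
  proof -
    have aX: "a \<in> carrier (coef X)" using a by (simp add: katsura_ideal_def)
    have "\<rho>A a = \<rho>plus (vsum (\<L> X) (\<lambda>k. theta X (lact X a (w k)) (w k)) ks)"
      using plus(3)[OF a] lact_expand[OF aX] by simp
    also have "\<dots> = vsum D (\<lambda>k. \<rho>A a \<otimes>\<^bsub>D\<^esub> (\<rho>X (w k) \<otimes>\<^bsub>D\<^esub> star D (\<rho>X (w k)))) ks"
      using aX by (subst compacts_hom_theta_sum[OF plus(1) D.cstar_algebra_axioms])
        (auto intro!: vsum_cong simp: plus(2) left D.mult_assoc)
    also have "\<dots> = \<rho>A a \<otimes>\<^bsub>D\<^esub> D.F" unfolding D.F_def using aX by (intro D.mult_vsum[symmetric]) auto
    finally show ?thesis by simp
  qed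
  then show "rep D \<rho>X \<rho>A" by unfold_locales (simp_all add: left)
next
  assume "rep D \<rho>X \<rho>A"
  then interpret D: framed_rep X ks w D \<rho>X \<rho>A .
  have "\<rho>A a = D.plus (lact X a)" if a: "a \<in> katsura_ideal X" for a
  proof -
    have aX: "a \<in> carrier (coef X)" using a by (simp add: katsura_ideal_def)
    have "D.plus (lact X a) = \<rho>A a \<otimes>\<^bsub>D\<^esub> D.F"
      unfolding D.plus_def D.F_def using aX
      by (subst D.mult_vsum) (auto intro!: vsum_cong simp: D.\<rho>X_lact D.mult_assoc)
    then show ?thesis using D.covariant[OF a] by simp
  qed
  then show "covariant_rep X D \<rho>X \<rho>A"
    unfolding covariant_rep_def
    using D.cstar_algebra_axioms D.\<rho>X_linear D.\<rho>A_hom D.\<rho>X_ip D.\<rho>X_lact D.plus_hom D.plus_theta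
    by (intro conjI ballI exI[of _ D.plus]) auto
qed

end

section \<open>Representations constructed from their values on a frame\<close>

locale frame_data = X: framed_corr X ks w + cstar_algebra D
  for X :: "('x, 'a) corr" and ks and w :: "'i \<Rightarrow> 'x" and D :: "'d cstar" (structure) +
  fixes \<rho>A :: "'a \<Rightarrow> 'd" and t :: "'i \<Rightarrow> 'd"
  assumes hom: "star_hom (coef X) D \<rho>A"
    and t_closed [simp]: "k \<in> set ks \<Longrightarrow> t k \<in> carrier D"
    and t_ip: "\<lbrakk>k \<in> set ks; l \<in> set ks\<rbrakk> \<Longrightarrow> star D (t k) \<otimes> t l = \<rho>A (ip X (w k) (w l))"
begin

text \<open>Right linearity and the frame formula leave no other choice once \<open>w k\<close> is
  to go to \<open>t k\<close>.\<close>

definition \<rho>X :: "'x \<Rightarrow> 'd" where "\<rho>X \<xi> = vsum D (\<lambda>k. t k \<otimes> \<rho>A (ip X (w k) \<xi>)) ks"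

lemma hom_simps [simp]: "a \<in> carrier (coef X) \<Longrightarrow> \<rho>A a \<in> carrier D"
  by (rule star_hom_closed[OF hom])

lemma ext_closed [simp]: "\<xi> \<in> carrier X \<Longrightarrow> \<rho>X \<xi> \<in> carrier D"
  by (simp add: \<rho>X_def)

lemma ext_linear: "linear_map X D \<rho>X"
  unfolding linear_map_def
proof (intro conjI ballI allI)
  fix \<xi> \<eta> assume "\<xi> \<in> carrier X" "\<eta> \<in> carrier X"
  then show "\<rho>X (\<xi> \<oplus>\<^bsub>X\<^esub> \<eta>) = \<rho>X \<xi> \<oplus> \<rho>X \<eta>"
    unfolding \<rho>X_def
    by (subst vsum_add[symmetric])
      (auto intro!: vsum_cong simp: X.ip_add_right mult_add_right star_hom_add[OF hom])
next
  fix d \<xi> assume "\<xi> \<in> carrier X"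
  then show "\<rho>X (d \<odot>\<^bsub>X\<^esub> \<xi>) = d \<odot> \<rho>X \<xi>"
    unfolding \<rho>X_def
    by (subst vsum_scale[symmetric])
      (auto intro!: vsum_cong simp: X.ip_scale_right mult_scale_right star_hom_scale[OF hom])
qed auto

text \<open>Parseval's identity, transported to \<open>D\<close>.\<close>

lemma ip_frame:
  assumes "\<xi> \<in> carrier X" "\<eta> \<in> carrier X"
  shows "vsum D (\<lambda>k. \<rho>A (ip X \<xi> (w k) \<otimes>\<^bsub>coef X\<^esub> ip X (w k) \<eta>)) ks = \<rho>A (ip X \<xi> \<eta>)"
proof -
  have "ip X \<xi> \<eta> = ip X \<xi> (vsum X (\<lambda>k. ract X (w k) (ip X (w k) \<eta>)) ks)"
    using assms by (simp add: X.frame)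
  also have "\<dots> = vsum (coef X) (\<lambda>k. ip X \<xi> (w k) \<otimes>\<^bsub>coef X\<^esub> ip X (w k) \<eta>) ks"
    using assms by (subst X.ip_vsum) (auto simp: X.ip_ract_right cong: vsum_cong)
  finally show ?thesis
    using assms by (simp add: star_hom_vsum[OF hom X.coef.complex_space_axioms complex_space_axioms])
qed

lemma t_ext:
  assumes "k \<in> set ks" "\<eta> \<in> carrier X"
  shows "star D (t k) \<otimes> \<rho>X \<eta> = \<rho>A (ip X (w k) \<eta>)"
proof -
  have "star D (t k) \<otimes> \<rho>X \<eta> = vsum D (\<lambda>l. \<rho>A (ip X (w k) (w l) \<otimes>\<^bsub>coef X\<^esub> ip X (w l) \<eta>)) ks"
    unfolding \<rho>X_def using assms
    by (subst mult_vsum)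
      (auto intro!: vsum_cong simp: mult_assoc[symmetric] t_ip star_hom_mult[OF hom])
  then show ?thesis using assms by (simp add: ip_frame)
qed

lemma ext_ip:
  assumes "\<xi> \<in> carrier X" "\<eta> \<in> carrier X"
  shows "star D (\<rho>X \<xi>) \<otimes> \<rho>X \<eta> = \<rho>A (ip X \<xi> \<eta>)"
proof -
  have "star D (\<rho>X \<xi>) \<otimes> \<rho>X \<eta> = vsum D (\<lambda>k. star D (t k \<otimes> \<rho>A (ip X (w k) \<xi>)) \<otimes> \<rho>X \<eta>) ks"
    using assms by (subst \<rho>X_def) (simp add: star_vsum vsum_mult)
  also have "\<dots> = vsum D (\<lambda>k. \<rho>A (ip X \<xi> (w k) \<otimes>\<^bsub>coef X\<^esub> ip X (w k) \<eta>)) ks"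
    using assms by (intro vsum_cong)
      (simp add: star_mult mult_assoc t_ext X.ip_star star_hom_mult[OF hom] flip: star_hom_star[OF hom])
  finally show ?thesis using assms by (simp add: ip_frame)
qed

sublocale corr_rep X ks w D \<rho>X \<rho>A
  by unfold_locales (simp_all add: ext_linear hom ext_ip)

lemma ext_frame [simp]:
  assumes l: "l \<in> set ks"
  shows "\<rho>X (w l) = t l"
proof -
  have "star D (\<rho>X (w l)) \<otimes> t l = star D (star D (t l) \<otimes> \<rho>X (w l))"
    using l by (simp add: star_mult)
  also have "\<dots> = \<rho>A (ip X (w l) (w l))" using l by (simp add: t_ext X.ip_star flip: \<rho>A(6))
  finally have "star D (vdiff D (\<rho>X (w l)) (t l)) \<otimes> vdiff D (\<rho>X (w l)) (t l) = \<zero>"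
    using l by (simp add: star_vdiff vdiff_mult mult_vdiff ext_ip t_ext t_ip)
  then show ?thesis
    using star_mult_self_zero[of "vdiff D (\<rho>X (w l)) (t l)"] l by (simp add: vdiff_eq_zero_iff)
qed

lemma F_frame: "F = vsum D (\<lambda>k. t k \<otimes> star D (t k)) ks"
  unfolding F_def by (intro vsum_cong) simp

lemma framed_repI:
  assumes left: "\<And>a l. \<lbrakk>a \<in> carrier (coef X); l \<in> set ks\<rbrakk> \<Longrightarrow> \<rho>X (lact X a (w l)) = \<rho>A a \<otimes> t l"
    and cov: "\<And>a. a \<in> katsura_ideal X \<Longrightarrow> \<rho>A a \<otimes> F = \<rho>A a"
  shows "framed_rep X ks w D \<rho>X \<rho>A"
proof unfold_locales
  fix a \<xi> assume a: "a \<in> carrier (coef X)" and \<xi>: "\<xi> \<in> carrier X"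
  show "\<rho>X (lact X a \<xi>) = \<rho>A a \<otimes> \<rho>X \<xi>"
    unfolding \<rho>X_expand[OF X.lact_adjointable[OF a] \<xi>] \<rho>X_def[of \<xi>] using a \<xi>
    by (subst mult_vsum) (auto intro!: vsum_cong simp: left mult_assoc)
qed (rule cov)

end

subsection \<open>Testing the universal property on arbitrary unital algebras\<close>

text \<open>By definition \<open>\<O>\<^sub>X\<close> is universal for algebras over a single type only. The limits of sequences
  of star polynomials in a representation form a subalgebra that embeds in that type.\<close>

definition word :: "'d cstar \<Rightarrow> 'd \<Rightarrow> ('g \<Rightarrow> 'd) \<Rightarrow> ('g \<times> bool) list \<Rightarrow> 'd" where
  "word D e \<gamma> = (\<lambda>ls. foldr (\<lambda>(g, s) u. (if s then star D (\<gamma> g) else \<gamma> g) \<otimes>\<^bsub>D\<^esub> u) ls e)"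

definition star_poly :: "'d cstar \<Rightarrow> 'd \<Rightarrow> ('g \<Rightarrow> 'd) \<Rightarrow> (complex \<times> ('g \<times> bool) list) list \<Rightarrow> 'd" where
  "star_poly D e \<gamma> = vsum D (\<lambda>(c, ls). c \<odot>\<^bsub>D\<^esub> word D e \<gamma> ls)"

locale poly_setting = unital_cstar D e for D :: "'d cstar" (structure) and e :: 'd +
  fixes \<gamma> :: "'g \<Rightarrow> 'd"
  assumes gen_closed [simp]: "\<gamma> g \<in> carrier D"
begin

lemma word_closed [simp]: "word D e \<gamma> ls \<in> carrier D"
  by (induction ls) (auto simp: word_def)

lemma word_append: "word D e \<gamma> (ls @ ms) = word D e \<gamma> ls \<otimes> word D e \<gamma> ms"
  by (induction ls) (use word_closed in \<open>auto simp: word_def mult_assoc\<close>)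

lemma star_word: "star D (word D e \<gamma> ls) = word D e \<gamma> (rev (map (\<lambda>(g, s). (g, \<not> s)) ls))"
proof (induction ls)
  case Nil
  then show ?case by (simp add: word_def)
next
  case (Cons a ls)
  obtain g s where a: "a = (g, s)" by (cases a)
  let ?u = "if s then star D (\<gamma> g) else \<gamma> g"
  have "word D e \<gamma> (a # ls) = ?u \<otimes> word D e \<gamma> ls" by (simp add: word_def a)
  then have "star D (word D e \<gamma> (a # ls)) = star D (word D e \<gamma> ls) \<otimes> star D ?u"
    by (simp add: star_mult)
  also have "star D ?u = word D e \<gamma> [(g, \<not> s)]" by (simp add: word_def)
  finally show ?case by (simp add: Cons word_append a)
qed

lemma star_poly_closed [simp]: "star_poly D e \<gamma> p \<in> carrier D"
  by (auto simp: star_poly_def)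

lemma word_mult_poly:
  "(c \<odot> word D e \<gamma> ls) \<otimes> star_poly D e \<gamma> p
    = star_poly D e \<gamma> (map (\<lambda>(d, ms). (c * d, ls @ ms)) p)"
  unfolding star_poly_def vsum_map
  by (subst mult_vsum)
    (auto intro!: vsum_cong simp: word_append mult_scale_left mult_scale_right scale_scale mult.commute)

lemma star_subalgebra_polys: "star_subalgebra (range (star_poly D e \<gamma>))"
  unfolding star_subalgebra_def subspace_of_def
proof (intro conjI ballI allI)
  show "\<zero> \<in> range (star_poly D e \<gamma>)" by (rule range_eqI[of _ _ "[]"]) (simp add: star_poly_def)
  fix a assume "a \<in> range (star_poly D e \<gamma>)"
  then obtain p where p: "a = star_poly D e \<gamma> p" by blast
  show "c \<odot> a \<in> range (star_poly D e \<gamma>)" for c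
    by (rule range_eqI[of _ _ "map (\<lambda>(d, ls). (c * d, ls)) p"])
      (auto simp: p star_poly_def vsum_map scale_scale split_def simp flip: vsum_scale intro!: vsum_cong)
  show "star D a \<in> range (star_poly D e \<gamma>)"
    by (rule range_eqI[of _ _ "map (\<lambda>(d, ls). (cnj d, rev (map (\<lambda>(g, s). (g, \<not> s)) ls))) p"])
      (simp add: p star_poly_def vsum_map split_def star_vsum star_scale star_word[unfolded split_def])
  fix b assume "b \<in> range (star_poly D e \<gamma>)"
  then obtain q where q: "b = star_poly D e \<gamma> q" by blast
  show "a \<oplus> b \<in> range (star_poly D e \<gamma>)"
    by (rule range_eqI[of _ _ "p @ q"], unfold p q star_poly_def, subst vsum_append) auto
  have "\<exists>r. star_poly D e \<gamma> p \<otimes> star_poly D e \<gamma> q = star_poly D e \<gamma> r"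
  proof (induction p)
    case Nil
    have "star_poly D e \<gamma> [] = \<zero>" by (simp add: star_poly_def)
    then show ?case by (intro exI[of _ "[]"]) simp
  next
    case (Cons t p)
    obtain c ls where t: "t = (c, ls)" by (cases t)
    obtain r where r: "star_poly D e \<gamma> p \<otimes> star_poly D e \<gamma> q = star_poly D e \<gamma> r"
      using Cons by blast
    let ?m = "map (\<lambda>(d, ms). (c * d, ls @ ms)) q"
    have "star_poly D e \<gamma> (t # p) = c \<odot> word D e \<gamma> ls \<oplus> star_poly D e \<gamma> p"
      by (simp add: star_poly_def t)
    then have "star_poly D e \<gamma> (t # p) \<otimes> star_poly D e \<gamma> q
        = star_poly D e \<gamma> ?m \<oplus> star_poly D e \<gamma> r"
      by (simp add: mult_add_left word_mult_poly r)
    also have "\<dots> = star_poly D e \<gamma> (?m @ r)"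
      unfolding star_poly_def by (subst vsum_append) auto
    finally show ?case by blast
  qed
  then show "a \<otimes> b \<in> range (star_poly D e \<gamma>)" by (auto simp: p q)
qed auto

text \<open>Choose for each limit one sequence of polynomials converging to it. Limits are unique,
  so the choice is injective.\<close>

lemma embed_in_poly_seqs:
  obtains G and f :: "'d \<Rightarrow> nat \<Rightarrow> (complex \<times> ('g \<times> bool) list) list"
  where "star_subalgebra G" "closed_set G" "range \<gamma> \<subseteq> G" "inj_on f G"
proof -
  let ?S = "range (star_poly D e \<gamma>)"
  let ?G = "norm_closure D (nrm D) ?S"
  have S: "?S \<subseteq> carrier D" by auto
  have "\<forall>a\<in>?G. \<exists>p. conv (\<lambda>k. star_poly D e \<gamma> (p k)) a"
  proof
    fix a assume "a \<in> ?G"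
    then obtain s where s: "\<forall>k. s k \<in> ?S" "conv s a" unfolding norm_closure_def by blast
    have "\<forall>k. \<exists>p. s k = star_poly D e \<gamma> p" using s(1) by blast
    then obtain p where "\<forall>k. s k = star_poly D e \<gamma> (p k)" by (rule choice[THEN exE])
    then have "s = (\<lambda>k. star_poly D e \<gamma> (p k))" by (simp add: fun_eq_iff)
    then show "\<exists>p. conv (\<lambda>k. star_poly D e \<gamma> (p k)) a" using s(2) by (intro exI[of _ p]) simp
  qed
  then obtain f where "\<forall>a\<in>?G. conv (\<lambda>k. star_poly D e \<gamma> (f a k)) a"
    by (rule bchoice[THEN exE])
  then have f: "\<And>a. a \<in> ?G \<Longrightarrow> conv (\<lambda>k. star_poly D e \<gamma> (f a k)) a" by blast
  have "\<gamma> g \<in> ?S" for g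
    by (rule range_eqI[of _ _ "[(1, [(g, False)])]"]) (simp add: star_poly_def word_def)
  then have range: "range \<gamma> \<subseteq> ?G" using norm_closure_superset[OF S] by auto
  have inj: "inj_on f ?G"
  proof (rule inj_onI)
    fix a b assume ab: "a \<in> ?G" "b \<in> ?G" "f a = f b"
    show "a = b"
      by (rule conv_unique[of "\<lambda>k. star_poly D e \<gamma> (f a k)"])
        (use ab f[of a] f[of b] norm_closure_subset in auto)
  qed
  show ?thesis
    by (rule that[OF star_subalgebra_norm_closure[OF star_subalgebra_polys]
          closed_norm_closure[OF S] range inj])
qed

end

lemma vsum_carrier_update: "vsum (D\<lparr>carrier := G\<rparr>) f ks = vsum D f ks"
  by (induction ks) auto

lemma (in framed_rep) framed_rep_comp:
  assumes h: "star_hom D A h" and "cstar_algebra A"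
  shows "framed_rep X ks w A (\<lambda>\<xi>. h (\<rho>X \<xi>)) (\<lambda>a. h (\<rho>A a))"
proof -
  interpret A: cstar_algebra A by fact
  note h' [simp] = star_homD[OF h]
  interpret A: corr_rep X ks w A "\<lambda>\<xi>. h (\<rho>X \<xi>)" "\<lambda>a. h (\<rho>A a)"
    by unfold_locales (auto simp: linear_map_comp[OF \<rho>X_linear h'(1)] star_hom_comp[OF \<rho>A_hom h]
        simp flip: h'(5,6) \<rho>X_ip)
  have F: "h F = A.F"
    unfolding A.F_def F_def
    by (subst star_hom_vsum[OF h complex_space_axioms A.complex_space_axioms]) (auto intro!: vsum_cong)
  show ?thesis
  proof unfold_locales
    fix a assume a: "a \<in> katsura_ideal X"
    then have "h (\<rho>A a \<otimes> F) = h (\<rho>A a) \<otimes>\<^bsub>A\<^esub> A.F" by (simp add: katsura_ideal_def F)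
    then show "h (\<rho>A a) \<otimes>\<^bsub>A\<^esub> A.F = h (\<rho>A a)" by (simp add: covariant a)
  qed (simp add: \<rho>X_lact)
qed

section \<open>Cuntz-Pimsner algebras of framed correspondences\<close>

locale cp_algebra = X: framed_corr X ks w
  for X :: "('x, 'a) corr" and ks and w :: "'i \<Rightarrow> 'x" +
  fixes Oo :: "'o cstar" (structure) and \<pi>X :: "'x \<Rightarrow> 'o" and \<pi>A :: "'a \<Rightarrow> 'o"
  assumes cp: "cuntz_pimsner X Oo \<pi>X \<pi>A"
begin

sublocale framed_rep X ks w Oo \<pi>X \<pi>A
  using cp by (simp add: cuntz_pimsner_def X.covariant_rep_iff)

lemma generated: "cstar_generated Oo (\<pi>X ` carrier X \<union> \<pi>A ` carrier (coef X)) = carrier Oo"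
  using cp by (simp add: cuntz_pimsner_def)

lemma universal:
  fixes D :: "'d cstar"
  assumes "unital_cstar D e" and rep: "X.rep D rX rA"
  obtains h where "star_hom Oo D h" "\<And>\<xi>. \<xi> \<in> carrier X \<Longrightarrow> h (\<pi>X \<xi>) = rX \<xi>"
    "\<And>a. a \<in> carrier (coef X) \<Longrightarrow> h (\<pi>A a) = rA a"
proof -
  interpret D: unital_cstar D e by fact
  interpret R: framed_rep X ks w D rX rA by (rule rep)
  \<comment> \<open>Polynomials range over all elements of the two types, so the representation is
    extended by 0 off the carriers.\<close>
  define \<gamma> where "\<gamma> = (\<lambda>g. case g of Inl \<xi> \<Rightarrow> if \<xi> \<in> carrier X then rX \<xi> else \<zero>\<^bsub>D\<^esub>
    | Inr a \<Rightarrow> if a \<in> carrier (coef X) then rA a else \<zero>\<^bsub>D\<^esub>)"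
  interpret P: poly_setting D e \<gamma> by unfold_locales (auto simp: \<gamma>_def split: sum.split)
  obtain G and f :: "'d \<Rightarrow> ('x, 'a) star_poly_seq"
    where G: "D.star_subalgebra G" "D.closed_set G" "range \<gamma> \<subseteq> G" and f: "inj_on f G"
    by (rule P.embed_in_poly_seqs) (rule that)
  let ?D = "D\<lparr>carrier := G\<rparr>"
  have D': "cstar_algebra ?D" by (rule cstar_subalgebra[OF D.cstar_algebra_axioms G(1,2)])
  then interpret D': cstar_algebra ?D .
  have "\<gamma> g \<in> G" for g using G(3) by auto
  from this[of "Inl \<xi>" for \<xi>] this[of "Inr a" for a]
  have inG: "\<xi> \<in> carrier X \<Longrightarrow> rX \<xi> \<in> G" "a \<in> carrier (coef X) \<Longrightarrow> rA a \<in> G" for \<xi> a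
    unfolding \<gamma>_def sum.case by metis+
  have GD: "g \<in> G \<Longrightarrow> g \<in> carrier D" for g
    using G(1) by (auto simp: D.star_subalgebra_def subspace_of_def)
  interpret D': corr_rep X ks w ?D rX rA
    using R.\<rho>X_linear R.\<rho>A_hom
    by unfold_locales (auto simp: inG linear_map_def star_hom_def R.\<rho>X_ip)
  interpret D': framed_rep X ks w ?D rX rA
    by unfold_locales (simp_all add: R.\<rho>X_lact D'.F_def vsum_carrier_update R.covariant flip: R.F_def)
  have f': "inj_on f (carrier ?D)" using f by simp
  note tr = cstar_transport[OF D' f']
  have "covariant_rep X (transport f ?D) (\<lambda>\<xi>. f (rX \<xi>)) (\<lambda>a. f (rA a))"
    unfolding X.covariant_rep_iff by (rule D'.framed_rep_comp[OF tr(2,1)])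
  then obtain h where h: "star_hom Oo (transport f ?D) h" "\<And>\<xi>. \<xi> \<in> carrier X \<Longrightarrow> h (\<pi>X \<xi>) = f (rX \<xi>)"
    "\<And>a. a \<in> carrier (coef X) \<Longrightarrow> h (\<pi>A a) = f (rA a)"
    using cp[unfolded cuntz_pimsner_def, THEN conjunct2, THEN conjunct2, rule_format] by blast
  \<comment> \<open>The way back from the type of sequences: undo the embedding, then include the
    subalgebra in \<open>D\<close>.\<close>
  let ?g = "inv_into (carrier ?D) f"
  have "star_hom ?D D id" by (rule star_homI) (auto simp: GD)
  then have "star_hom Oo D (\<lambda>x. id (?g (h x)))"
    by (intro star_hom_comp[OF star_hom_comp[OF h(1) tr(3)]])
  then show ?thesis
    by (rule that) (use f in \<open>simp_all add: h inG\<close>)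
qed

text \<open>The elements for which \<open>\<pi>A u\<close> is a two-sided unit form a closed
  *-subalgebra. It contains the generators because u acts as the identity on X from both
  sides.\<close>

lemma unital:
  assumes u: "u \<in> carrier (coef X)"
    and unit: "\<And>a. a \<in> carrier (coef X) \<Longrightarrow> u \<otimes>\<^bsub>coef X\<^esub> a = a \<and> a \<otimes>\<^bsub>coef X\<^esub> u = a"
    and act: "\<And>k. k \<in> set ks \<Longrightarrow> lact X u (w k) = w k"
  shows "unital_cstar Oo (\<pi>A u)"
proof -
  have star_u: "star (coef X) u = u"
    by (metis u unit X.coef.star_closed X.coef.star_mult X.coef.star_star)
  let ?e = "\<pi>A u"
  have e: "?e \<in> carrier Oo" "star Oo ?e = ?e"
    using u star_u \<rho>A(6)[OF u] by auto
  let ?T = "{a \<in> carrier Oo. ?e \<otimes> a = a \<and> a \<otimes> ?e = a}"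
  have T: "a \<in> ?T" if "a \<in> carrier Oo" for a
  proof (rule cstar_generated_induct)
    show "a \<in> cstar_generated Oo (\<pi>X ` carrier X \<union> \<pi>A ` carrier (coef X))"
      using that generated by simp
    show "star_subalgebra ?T"
      unfolding star_subalgebra_def subspace_of_def using e
      by (auto simp: mult_add_left mult_add_right mult_scale_left mult_scale_right mult_assoc[symmetric])
        (auto simp: mult_assoc, (metis star_mult)+)
    show "closed_set ?T"
    proof (rule closed_setI)
      fix s l assume *: "\<And>k. s k \<in> ?T" "l \<in> carrier Oo" "conv s l"
      have "conv (\<lambda>k. ?e \<otimes> s k) (?e \<otimes> l)" "conv (\<lambda>k. s k \<otimes> ?e) (l \<otimes> ?e)"
        by (intro conv_mult conv_const *(2,3) e; use *(1) e in simp)+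
      moreover have "(\<lambda>k. ?e \<otimes> s k) = s" "(\<lambda>k. s k \<otimes> ?e) = s"
        using *(1) by (simp_all add: fun_eq_iff)
      ultimately have "conv s (?e \<otimes> l)" "conv s (l \<otimes> ?e)" by simp_all
      then have "?e \<otimes> l = l" "l \<otimes> ?e = l"
        using *(1) by (auto intro!: conv_unique[OF _ _ _ _ *(3)] simp: *(2) e)
      then show "l \<in> ?T" using *(2) by simp
    qed
    have "?e \<otimes> \<pi>X \<xi> = \<pi>X \<xi> \<and> \<pi>X \<xi> \<otimes> ?e = \<pi>X \<xi>" if \<xi>: "\<xi> \<in> carrier X" for \<xi>
    proof
      have "lact X u \<xi> = \<xi>"
        by (rule X.frame_eqI) (use \<xi> u act X.lact_adjoint[of u _ \<xi>, symmetric] in \<open>auto simp: star_u\<close>)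
      then show "?e \<otimes> \<pi>X \<xi> = \<pi>X \<xi>" using \<rho>X_lact[OF u \<xi>] by simp
      have "ract X \<xi> u = \<xi>"
        by (rule X.frame_eqI) (use \<xi> u unit in \<open>auto simp: X.ip_ract_right\<close>)
      then show "\<pi>X \<xi> \<otimes> ?e = \<pi>X \<xi>" using \<rho>X_ract[OF \<xi> u] by simp
    qed
    then show "\<pi>X ` carrier X \<union> \<pi>A ` carrier (coef X) \<subseteq> ?T"
      using u unit by (auto simp flip: \<rho>A(5))
  qed
  show ?thesis by unfold_locales (use T e in auto)
qed

lemma hom_eqI:
  assumes unital: "unital_cstar Oo u" and D: "cstar_algebra D"
    and f: "star_hom Oo D f" and g: "star_hom Oo D g"
    and eqX: "\<And>k. k \<in> set ks \<Longrightarrow> f (\<pi>X (w k)) = g (\<pi>X (w k))"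
    and eqA: "\<And>a. a \<in> carrier (coef X) \<Longrightarrow> f (\<pi>A a) = g (\<pi>A a)"
    and a: "a \<in> carrier Oo"
  shows "f a = g a"
proof (rule star_hom_eqI[OF unital D f g generated _ _ a])
  interpret D: cstar_algebra D by fact
  show "\<pi>X ` carrier X \<union> \<pi>A ` carrier (coef X) \<subseteq> carrier Oo" by auto
  fix x assume "x \<in> \<pi>X ` carrier X \<union> \<pi>A ` carrier (coef X)"
  then show "f x = g x"
  proof
    assume "x \<in> \<pi>X ` carrier X"
    then obtain \<xi> where x: "x = \<pi>X \<xi>" and \<xi>: "\<xi> \<in> carrier X" by blast
    have "x = vsum Oo (\<lambda>k. \<pi>X (w k) \<otimes> \<pi>A (ip X (w k) \<xi>)) ks"
      using \<rho>X_expand[OF X.id_adjointable \<xi>] \<xi> by (simp add: x cong: vsum_cong)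
    then have "h x = vsum D (\<lambda>k. h (\<pi>X (w k)) \<otimes>\<^bsub>D\<^esub> h (\<pi>A (ip X (w k) \<xi>))) ks" if "star_hom Oo D h" for h
      using \<xi> star_homD(5)[OF that]
      by (simp, subst star_hom_vsum[OF that complex_space_axioms D.complex_space_axioms])
        (auto intro!: vsum_cong)
    from this[OF f] this[OF g] show ?thesis using \<xi> eqX eqA by (auto intro!: vsum_cong)
  qed (auto simp: eqA)
qed

end

section \<open>Algebras generated by orthogonal projections\<close>

text \<open>For z of modulus r = cos f and argument s, the two points are those with arguments s + f
  and s - f. This lets norm estimates replace coefficients in a disc by unimodular ones.\<close>

lemma complex_mean_of_unit:
  assumes "cmod z \<le> 1"
  obtains a b where "cmod a = 1" "cmod b = 1" "z = (a + b) / 2"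
proof -
  define r where "r = cmod z"
  define f where "f = arccos r"
  have r: "0 \<le> r" "r \<le> 1" using assms by (auto simp: r_def)
  then have c: "cos f = r" unfolding f_def by (intro cos_arccos) auto
  define s where "s = Arg z"
  have s: "z = of_real r * cis s" using rcis_cmod_Arg[of z] by (simp add: rcis_def r_def s_def)
  have "cis (s + f) + cis (s - f) = 2 * of_real r * cis s"
    by (simp add: complex_eq_iff cos_add sin_add cos_diff sin_diff c)
  then show ?thesis using that[of "cis (s + f)" "cis (s - f)"] by (simp add: s)
qed

text \<open>Zero is allowed here, unlike in \<open>orthogonal_projections\<close>, since
  homomorphisms and quotients may kill projections.\<close>

definition orth_family :: "('a, 'm) cstar_scheme \<Rightarrow> 'i set \<Rightarrow> ('i \<Rightarrow> 'a) \<Rightarrow> bool" where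
  "orth_family D S p \<longleftrightarrow> (\<forall>i\<in>S. p i \<in> carrier D \<and> star D (p i) = p i) \<and>
     (\<forall>i\<in>S. \<forall>j\<in>S. p i \<otimes>\<^bsub>D\<^esub> p j = (if i = j then p i else \<zero>\<^bsub>D\<^esub>))"

lemma orth_familyD:
  assumes "orth_family D S p" "i \<in> S"
  shows "p i \<in> carrier D" "star D (p i) = p i" "p i \<otimes>\<^bsub>D\<^esub> p i = p i"
    "\<And>j. \<lbrakk>j \<in> S; i \<noteq> j\<rbrakk> \<Longrightarrow> p i \<otimes>\<^bsub>D\<^esub> p j = \<zero>\<^bsub>D\<^esub>"
  using assms by (auto simp: orth_family_def)

lemma orth_family_hom:
  assumes "star_hom A D h" "complex_space A" "complex_space D" "orth_family A S p"
  shows "orth_family D S (\<lambda>i. h (p i))"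
  using assms(4) star_homD[OF assms(1)] star_hom_zero[OF assms(1-3)]
  by (auto simp: orth_family_def simp flip: star_hom_mult[OF assms(1)] star_hom_star[OF assms(1)])

lemma orth_family_subset: "\<lbrakk>orth_family D S p; T \<subseteq> S\<rbrakk> \<Longrightarrow> orth_family D T p"
  unfolding orth_family_def by (metis subsetD)

lemma orth_family_projections:
  "orthogonal_projections D S p \<Longrightarrow> orth_family D S p"
  by (auto simp: orth_family_def orthogonal_projections_def projection_def)

definition osum :: "('a, 'm) cstar_scheme \<Rightarrow> ('i \<Rightarrow> 'a) \<Rightarrow> ('i \<Rightarrow> complex) \<Rightarrow> 'i list \<Rightarrow> 'a" where
  "osum D p c ls = vsum D (\<lambda>i. c i \<odot>\<^bsub>D\<^esub> p i) ls"

context star_algebra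
begin

lemma osum_closed [simp]: "orth_family A (set ls) p \<Longrightarrow> osum A p c ls \<in> carrier A"
  unfolding osum_def by (intro vsum_closed) (auto dest: orth_familyD)

lemma osum_add:
  "orth_family A (set ls) p \<Longrightarrow> osum A p c ls \<oplus> osum A p d ls = osum A p (\<lambda>i. c i + d i) ls"
  unfolding osum_def
  by (subst vsum_add[symmetric]) (auto dest: orth_familyD simp: scale_add_left intro!: vsum_cong)

lemma osum_scale:
  "orth_family A (set ls) p \<Longrightarrow> t \<odot> osum A p c ls = osum A p (\<lambda>i. t * c i) ls"
  unfolding osum_def
  by (subst vsum_scale[symmetric]) (auto dest: orth_familyD simp: scale_scale intro!: vsum_cong)

lemma osum_star:
  "orth_family A (set ls) p \<Longrightarrow> star A (osum A p c ls) = osum A p (\<lambda>i. cnj (c i)) ls"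
  unfolding osum_def
  using orth_familyD(1,2)[of A "set ls" p]
  by (subst star_vsum) (auto simp: star_scale intro!: vsum_cong)

lemma proj_osum:
  assumes o: "orth_family A (set ls) p" and "distinct ls" "i \<in> set ls"
  shows "p i \<otimes> osum A p c ls = c i \<odot> p i" "osum A p c ls \<otimes> p i = c i \<odot> p i"
proof -
  note oD = orth_familyD[OF o]
  have "p i \<otimes> osum A p c ls = vsum A (\<lambda>k. p i \<otimes> (c k \<odot> p k)) ls"
    unfolding osum_def using assms oD by (intro mult_vsum) auto
  also have "\<dots> = p i \<otimes> (c i \<odot> p i)"
    using assms oD by (intro vsum_single) (auto simp: mult_scale_right)
  finally show "p i \<otimes> osum A p c ls = c i \<odot> p i" using assms oD by (simp add: mult_scale_right)
  have "osum A p c ls \<otimes> p i = vsum A (\<lambda>k. (c k \<odot> p k) \<otimes> p i) ls"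
    unfolding osum_def using assms oD by (intro vsum_mult) auto
  also have "\<dots> = (c i \<odot> p i) \<otimes> p i"
    using assms oD by (intro vsum_single[where f = "\<lambda>k. (c k \<odot> p k) \<otimes> p i"]) (auto simp: mult_scale_left)
  finally show "osum A p c ls \<otimes> p i = c i \<odot> p i" using assms oD by (simp add: mult_scale_left)
qed

lemma osum_mult:
  assumes o: "orth_family A (set ls) p" and "distinct ls"
  shows "osum A p c ls \<otimes> osum A p d ls = osum A p (\<lambda>i. c i * d i) ls"
proof -
  note oD = orth_familyD[OF o]
  have "osum A p c ls \<otimes> osum A p d ls = vsum A (\<lambda>i. (c i \<odot> p i) \<otimes> osum A p d ls) ls"
    unfolding osum_def[of A p c] using assms oD by (intro vsum_mult) auto
  also have "\<dots> = osum A p (\<lambda>i. c i * d i) ls"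
    unfolding osum_def[of A p "\<lambda>i. c i * d i"] using assms oD
    by (intro vsum_cong) (simp add: mult_scale_left proj_osum scale_scale)
  finally show ?thesis .
qed

lemma osum_indicator:
  assumes o: "orth_family A (set ls) p" and "distinct ls" "i \<in> set ls"
  shows "osum A p (\<lambda>j. if j = i then 1 else 0) ls = p i"
  unfolding osum_def
  by (subst vsum_single[where l = i]) (use assms in \<open>auto dest: orth_familyD\<close>)

end

text \<open>If all coefficients of u are unimodular, then u* u is the sum of the projections, so u
  has norm at most 1. Any other combination is C times an average of two of these.\<close>

lemma (in cstar_algebra) osum_nrm_le:
  assumes o: "orth_family A (set ls) p" and ls: "distinct ls" and C: "0 \<le> C"
    and c: "\<And>i. i \<in> set ls \<Longrightarrow> cmod (c i) \<le> C"
  shows "nrm A (osum A p c ls) \<le> C"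
proof (cases "C = 0")
  case True
  then have "osum A p c ls = \<zero>"
    unfolding osum_def using c o by (intro vsum_zero) (auto dest: orth_familyD)
  then show ?thesis using C by simp
next
  case False
  have unit: "nrm A (osum A p a ls) \<le> 1" if "\<And>i. i \<in> set ls \<Longrightarrow> cmod (a i) = 1" for a
  proof -
    let ?E = "osum A p (\<lambda>_. 1) ls"
    have "star A ?E \<otimes> ?E = ?E" using o ls by (simp add: osum_star osum_mult)
    then have E: "nrm A ?E \<le> 1" using o by (intro projection_nrm_le) auto
    have "osum A p (\<lambda>i. cnj (a i) * a i) ls = ?E"
      unfolding osum_def using that
      by (intro vsum_cong) (simp add: mult.commute[of "cnj _"] complex_norm_square[symmetric])
    then have "(nrm A (osum A p a ls))\<^sup>2 = nrm A ?E"
      using cstar_identity[of "osum A p a ls"] o ls by (simp add: osum_star osum_mult)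
    then have "(nrm A (osum A p a ls))\<^sup>2 \<le> 1" using E by simp
    then show ?thesis using o by (simp add: abs_square_le_1)
  qed
  have "\<forall>i. \<exists>a b. i \<in> set ls \<longrightarrow> cmod a = 1 \<and> cmod b = 1 \<and> c i / of_real C = (a + b) / 2"
  proof
    fix i
    show "\<exists>a b. i \<in> set ls \<longrightarrow> cmod a = 1 \<and> cmod b = 1 \<and> c i / of_real C = (a + b) / 2"
    proof (cases "i \<in> set ls")
      case True
      then have "cmod (c i / of_real C) \<le> 1" using c C False by (simp add: norm_divide)
      then show ?thesis by (metis complex_mean_of_unit)
    qed auto
  qed
  then obtain a b where ab: "\<And>i. i \<in> set ls \<Longrightarrow> cmod (a i) = 1"
    "\<And>i. i \<in> set ls \<Longrightarrow> cmod (b i) = 1" "\<And>i. i \<in> set ls \<Longrightarrow> c i / of_real C = (a i + b i) / 2"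
    by metis
  have "osum A p c ls = osum A p (\<lambda>i. of_real C * ((1/2) * (a i + b i))) ls"
    unfolding osum_def
  proof (intro vsum_cong)
    fix i assume "i \<in> set ls"
    then have "c i = of_real C * ((1/2) * (a i + b i))" using ab(3)[of i] False by (simp add: field_simps)
    then show "c i \<odot> p i = (of_real C * ((1/2) * (a i + b i))) \<odot> p i" by (rule arg_cong)
  qed
  also have "\<dots> = of_real C \<odot> ((1/2) \<odot> (osum A p a ls \<oplus> osum A p b ls))"
    using o by (simp add: osum_scale osum_add)
  finally have "nrm A (osum A p c ls) = C * nrm A ((1/2) \<odot> (osum A p a ls \<oplus> osum A p b ls))"
    using o C by (simp add: nrm_scale)
  also have "\<dots> \<le> C * 1"
    using C o by (intro mult_left_mono nrm_half_sum_le unit ab) auto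
  finally show ?thesis by simp
qed

text \<open>Coordinates are recovered from products with the projections; \<open>coord\<close> is junk off the span.\<close>

definition coord :: "('a, 'm) cstar_scheme \<Rightarrow> ('i \<Rightarrow> 'a) \<Rightarrow> 'a \<Rightarrow> 'i \<Rightarrow> complex" where
  "coord A P a i = (SOME c. P i \<otimes>\<^bsub>A\<^esub> a = c \<odot>\<^bsub>A\<^esub> P i)"

locale proj_span = star_algebra A for A :: "('a, 'm) cstar_scheme" (structure) +
  fixes P :: "'i \<Rightarrow> 'a" and ls :: "'i list"
  assumes orth: "orth_family A (set ls) P" and distinct: "distinct ls"
    and nonzero: "i \<in> set ls \<Longrightarrow> P i \<noteq> \<zero>"
    and span: "carrier A = lin_span A (P ` set ls)"
begin

lemma scale_P_eq:
  assumes "i \<in> set ls" "c \<odot> P i = d \<odot> P i" shows "c = d"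
proof (rule ccontr)
  assume "c \<noteq> d"
  have P: "P i \<in> carrier A" using orth assms(1) by (rule orth_familyD)
  have "(c - d) \<odot> P i = \<zero>" using P assms(2) by (simp add: vdiff_scale_left[symmetric])
  then have "(1 / (c - d)) \<odot> ((c - d) \<odot> P i) = \<zero>" by simp
  then show False using P \<open>c \<noteq> d\<close> nonzero[OF assms(1)] by (simp add: scale_scale)
qed

lemma expand:
  assumes "a \<in> carrier A"
  shows "a = osum A P (coord A P a) ls"
proof -
  let ?T = "range (\<lambda>c. osum A P c ls)"
  have "a \<in> ?T"
  proof (rule lin_span_induct)
    show "a \<in> lin_span A (P ` set ls)" using assms span by simp
    show "P ` set ls \<subseteq> ?T" using osum_indicator[OF orth distinct] by (metis image_subsetI rangeI)
    show "subspace_of ?T A" unfolding subspace_of_def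
    proof (intro conjI ballI allI)
      show "\<zero> \<in> ?T"
        by (rule range_eqI[of _ _ "\<lambda>_. 0"]) (use orth in \<open>auto simp: osum_def dest: orth_familyD intro!: vsum_zero[symmetric]\<close>)
      fix u assume "u \<in> ?T"
      then obtain c where u: "u = osum A P c ls" by blast
      then show "t \<odot> u \<in> ?T" for t using orth by (simp add: osum_scale)
      fix v assume "v \<in> ?T"
      then obtain d where "v = osum A P d ls" by blast
      then show "u \<oplus> v \<in> ?T" using orth u by (simp add: osum_add)
    qed (use orth in auto)
  qed
  then obtain c where c: "a = osum A P c ls" by blast
  have "coord A P a i = c i" if "i \<in> set ls" for i
    unfolding coord_def c proj_osum(1)[OF orth distinct that]
    using scale_P_eq[OF that] by blast
  then show ?thesis by (subst c) (auto simp: osum_def intro!: vsum_cong)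
qed

lemma mult_P:
  assumes "a \<in> carrier A" "i \<in> set ls"
  shows "P i \<otimes> a = coord A P a i \<odot> P i" "a \<otimes> P i = coord A P a i \<odot> P i"
  by (subst expand[OF assms(1)], simp add: proj_osum[OF orth distinct assms(2)])+

lemma coord_eqI: "\<lbrakk>i \<in> set ls; a \<in> carrier A; P i \<otimes> a = c \<odot> P i\<rbrakk> \<Longrightarrow> coord A P a i = c"
  using mult_P(1) scale_P_eq by metis

lemma P_closed [simp]: "i \<in> set ls \<Longrightarrow> P i \<in> carrier A"
  using orth by (rule orth_familyD)

lemma coord_ops:
  assumes "i \<in> set ls" "a \<in> carrier A" "b \<in> carrier A"
  shows "coord A P (a \<oplus> b) i = coord A P a i + coord A P b i"
    "coord A P (t \<odot> a) i = t * coord A P a i"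
    "coord A P (a \<otimes> b) i = coord A P a i * coord A P b i"
    "coord A P (star A a) i = cnj (coord A P a i)"
proof -
  note m = mult_P[OF _ assms(1)]
  show "coord A P (a \<oplus> b) i = coord A P a i + coord A P b i"
    by (rule coord_eqI) (use assms in \<open>auto simp: mult_add_right m scale_add_left\<close>)
  show "coord A P (t \<odot> a) i = t * coord A P a i"
    by (rule coord_eqI) (use assms in \<open>auto simp: mult_scale_right m scale_scale\<close>)
  show "coord A P (a \<otimes> b) i = coord A P a i * coord A P b i"
    by (rule coord_eqI) (use assms in \<open>auto simp: mult_assoc[symmetric] m(1) mult_scale_left scale_scale\<close>)
  have "P i \<otimes> star A a = star A (a \<otimes> P i)" using assms orth by (simp add: star_mult orth_familyD(2))
  also have "\<dots> = cnj (coord A P a i) \<odot> P i"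
    using assms orth by (simp add: m(2) star_scale orth_familyD(2))
  finally show "coord A P (star A a) i = cnj (coord A P a i)" using assms by (intro coord_eqI) auto
qed

lemma eq_coords:
  assumes "a \<in> carrier A" "b \<in> carrier A" "\<And>i. i \<in> set ls \<Longrightarrow> coord A P a i = coord A P b i"
  shows "a = b"
proof -
  have "osum A P (coord A P a) ls = osum A P (coord A P b) ls"
    unfolding osum_def using assms(3) by (intro vsum_cong) simp
  then show ?thesis using expand[OF assms(1)] expand[OF assms(2)] by simp
qed

lemma coord_P: "\<lbrakk>i \<in> set ls; j \<in> set ls\<rbrakk> \<Longrightarrow> coord A P (P j) i = (if i = j then 1 else 0)"
  using orth by (intro coord_eqI) (auto simp: orth_family_def)

lemma hom_exists:
  assumes "star_algebra D" "orth_family D (set ls) p"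
  shows "star_hom A D (\<lambda>a. osum D p (coord A P a) ls)"
    "\<And>i. i \<in> set ls \<Longrightarrow> osum D p (coord A P (P i)) ls = p i"
proof -
  interpret D: star_algebra D by fact
  note o = assms(2)
  have cong: "osum D p c ls = osum D p d ls" if "\<And>i. i \<in> set ls \<Longrightarrow> c i = d i" for c d
    unfolding osum_def using that by (intro vsum_cong) simp
  show "star_hom A D (\<lambda>a. osum D p (coord A P a) ls)"
    by (rule star_homI)
      (use o distinct in \<open>auto simp: D.osum_add D.osum_scale D.osum_mult D.osum_star coord_ops intro!: cong\<close>)
  show "osum D p (coord A P (P i)) ls = p i" if "i \<in> set ls" for i
    using D.osum_indicator[OF o distinct that] that
    by (subst (asm) cong[where d = "coord A P (P i)"]) (auto simp: coord_P)
qed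

definition one :: 'a where "one = osum A P (\<lambda>_. 1) ls"

lemma one_unit:
  "one \<in> carrier A" "\<And>a. a \<in> carrier A \<Longrightarrow> one \<otimes> a = a \<and> a \<otimes> one = a"
proof -
  show "one \<in> carrier A" using orth by (simp add: one_def)
  fix a assume "a \<in> carrier A"
  from expand[OF this] obtain c where "a = osum A P c ls" by blast
  then show "one \<otimes> a = a \<and> a \<otimes> one = a" using orth distinct by (simp add: one_def osum_mult)
qed

end

section \<open>The triangular correspondences\<close>

definition nats :: "nat \<Rightarrow> nat list" where
  "nats m = [1..<m + 1]"

lemma set_nats [simp]: "set (nats m) = {1..m}"
  and distinct_nats [simp]: "distinct (nats m)"
  by (auto simp: nats_def)

definition trow :: "nat \<Rightarrow> nat \<Rightarrow> nat list" where
  "trow i m = filter (\<lambda>j. i \<le> j) (nats m)"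

lemma set_trow [simp]: "set (trow i m) = {j. 1 \<le> j \<and> i \<le> j \<and> j \<le> m}"
  and distinct_trow [simp]: "distinct (trow i m)"
  by (auto simp: trow_def)

lemma trow_Suc: "i \<le> m + 1 \<Longrightarrow> trow i (m + 1) = trow i m @ [m + 1]"
  by (simp add: trow_def nats_def)

lemma trow_self: "1 \<le> n \<Longrightarrow> trow n n = [n]"
  by (cases n) (auto simp: trow_def nats_def filter_empty_conv)

text \<open>Listed row by row, so that frame sums split by the first index, the one seen by the left
  action.\<close>

definition tri :: "nat \<Rightarrow> nat \<Rightarrow> (nat \<times> nat) list" where
  "tri n m = concat (map (\<lambda>i. map (Pair i) (trow i m)) (nats n))"

lemma set_tri: "set (tri n m) = {(i, j). i \<in> {1..n} \<and> j \<in> {i..m}}"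
  by (auto simp: tri_def image_iff)

lemma in_tri [simp]: "(i, j) \<in> set (tri n m) \<longleftrightarrow> 1 \<le> i \<and> i \<le> n \<and> i \<le> j \<and> j \<le> m"
  by (auto simp: set_tri)

lemma distinct_tri [simp]: "distinct (tri n m)"
proof -
  have "distinct (concat (map (\<lambda>i. map (Pair i) (trow i m)) xs))" if "distinct xs" for xs
    using that by (induction xs) (auto simp: distinct_map inj_on_def)
  then show ?thesis by (simp add: tri_def)
qed

lemma (in complex_space) vsum_concat:
  "(\<And>k l. \<lbrakk>k \<in> set ks; l \<in> set (g k)\<rbrakk> \<Longrightarrow> f l \<in> carrier V)
     \<Longrightarrow> vsum V f (concat (map g ks)) = vsum V (\<lambda>k. vsum V f (g k)) ks"
proof (induction ks)
  case (Cons k ks)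
  have "vsum V f (g k @ concat (map g ks)) = vsum V f (g k) \<oplus> vsum V f (concat (map g ks))"
    using Cons.prems by (intro vsum_append) auto
  moreover have "vsum V f (concat (map g ks)) = vsum V (\<lambda>k. vsum V f (g k)) ks"
    by (rule Cons.IH) (use Cons.prems in auto)
  ultimately show ?case by simp
qed simp

lemma (in complex_space) vsum_tri:
  assumes "\<And>i j. \<lbrakk>1 \<le> i; i \<le> n; i \<le> j; j \<le> m\<rbrakk> \<Longrightarrow> f (i, j) \<in> carrier V"
  shows "vsum V f (tri n m) = vsum V (\<lambda>i. vsum V (\<lambda>j. f (i, j)) (trow i m)) (nats n)"
  unfolding tri_def by (subst vsum_concat) (use assms in \<open>auto simp: vsum_map\<close>)

lemma (in complex_space) vsum_tri_row:
  assumes "\<And>i j. \<lbrakk>1 \<le> i; i \<le> n; i \<le> j; j \<le> m\<rbrakk> \<Longrightarrow> f (i, j) \<in> carrier V"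
    and "\<And>i j. \<lbrakk>1 \<le> i; i \<le> n; i \<le> j; j \<le> m; i \<noteq> k\<rbrakk> \<Longrightarrow> f (i, j) = \<zero>"
    and "1 \<le> k" "k \<le> n"
  shows "vsum V f (tri n m) = vsum V (\<lambda>j. f (k, j)) (trow k m)"
proof -
  have "vsum V (\<lambda>i. vsum V (\<lambda>j. f (i, j)) (trow i m)) (nats n) = vsum V (\<lambda>j. f (k, j)) (trow k m)"
    by (rule vsum_single) (use assms in \<open>auto intro!: vsum_zero\<close>)
  then show ?thesis using vsum_tri[of n m f] assms(1) by simp
qed

lemma (in hilbert_module) ract_zero [simp]: "\<xi> \<in> carrier X \<Longrightarrow> ract X \<xi> \<zero>\<^bsub>coef X\<^esub> = \<zero>"
  using ract_scale_right[of \<xi> "\<zero>\<^bsub>coef X\<^esub>" 0] ract_closed[of \<xi> "\<zero>\<^bsub>coef X\<^esub>"] by simp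

lemma (in cstar_correspondence) lact_ops:
  assumes "a \<in> carrier (coef X)" "\<xi> \<in> carrier X"
  shows "b \<in> carrier (coef X) \<Longrightarrow> lact X (a \<oplus>\<^bsub>coef X\<^esub> b) \<xi> = lact X a \<xi> \<oplus> lact X b \<xi>"
    "b \<in> carrier (coef X) \<Longrightarrow> lact X (a \<otimes>\<^bsub>coef X\<^esub> b) \<xi> = lact X a (lact X b \<xi>)"
    "lact X (c \<odot>\<^bsub>coef X\<^esub> a) \<xi> = c \<odot> lact X a \<xi>"
  using assms star_homD[OF lact_star_hom] by (simp_all add: adjointables_def[of X])

locale triangular =
  fixes n m :: nat and X :: "('x, 'a) corr" (structure) and P w
  assumes triangular: "triangular_corr n m X P w" and n_pos: "1 \<le> n" and n_le: "n \<le> m"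
begin

sublocale cstar_correspondence X
  using triangular by (simp add: triangular_corr_def)

sublocale A: proj_span "coef X" P "nats m"
proof
  have "orthogonal_projections (coef X) {1..m} P"
    and "carrier (coef X) = lin_span (coef X) (P ` {1..m})"
    using triangular unfolding triangular_corr_def by blast+
  then show "orth_family (coef X) (set (nats m)) P"
    "carrier (coef X) = lin_span (coef X) (P ` set (nats m))"
    "i \<in> set (nats m) \<Longrightarrow> P i \<noteq> \<zero>\<^bsub>coef X\<^esub>" for i
    by (auto simp: orth_family_projections orthogonal_projections_def)
qed simp

lemma w_closed [simp]: "\<lbrakk>1 \<le> i; i \<le> n; i \<le> j; j \<le> m\<rbrakk> \<Longrightarrow> w i j \<in> carrier X"
proof -
  have "\<forall>i\<in>{1..n}. \<forall>j\<in>{i..m}. w i j \<in> carrier X"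
    using triangular unfolding triangular_corr_def by blast
  then show "\<lbrakk>1 \<le> i; i \<le> n; i \<le> j; j \<le> m\<rbrakk> \<Longrightarrow> w i j \<in> carrier X" by simp
qed

lemma w_ip: "\<lbrakk>1 \<le> i; i \<le> n; i \<le> j; j \<le> m; 1 \<le> k; k \<le> n; k \<le> l; l \<le> m\<rbrakk>
    \<Longrightarrow> ip X (w i j) (w k l) = (if i = k \<and> j = l then P j else \<zero>\<^bsub>coef X\<^esub>)"
  using triangular by (simp add: triangular_corr_def)

lemma w_ract: "\<lbrakk>1 \<le> i; i \<le> n; i \<le> j; j \<le> m; 1 \<le> k; k \<le> m\<rbrakk>
    \<Longrightarrow> ract X (w i j) (P k) = (if j = k then w i j else \<zero>\<^bsub>X\<^esub>)"
  and w_lact: "\<lbrakk>1 \<le> i; i \<le> n; i \<le> j; j \<le> m; 1 \<le> k; k \<le> m\<rbrakk>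
    \<Longrightarrow> lact X (P k) (w i j) = (if i = k then w i j else \<zero>\<^bsub>X\<^esub>)"
  using triangular by (simp_all add: triangular_corr_def)

lemma w_nonzero: "\<lbrakk>1 \<le> i; i \<le> n; i \<le> j; j \<le> m\<rbrakk> \<Longrightarrow> w i j \<noteq> \<zero>\<^bsub>X\<^esub>"
proof
  interpret star_corr X by (rule star_corr)
  assume ij: "1 \<le> i" "i \<le> n" "i \<le> j" "j \<le> m" and "w i j = \<zero>\<^bsub>X\<^esub>"
  then have "P j = \<zero>\<^bsub>coef X\<^esub>" using w_ip[of i j i j] by simp
  then show False using A.nonzero[of j] ij by simp
qed

lemma lact_w:
  assumes "a \<in> carrier (coef X)" "1 \<le> i" "i \<le> n" "i \<le> j" "j \<le> m"
  shows "lact X a (w i j) = coord (coef X) P a i \<odot>\<^bsub>X\<^esub> w i j"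
proof -
  have Pi: "P i \<in> carrier (coef X)" using assms n_le by (intro A.P_closed) auto
  have "lact X a (w i j) = lact X a (lact X (P i) (w i j))" using assms n_le by (simp add: w_lact)
  also have "\<dots> = lact X (a \<otimes>\<^bsub>coef X\<^esub> P i) (w i j)"
    using assms Pi by (simp add: lact_ops)
  also have "a \<otimes>\<^bsub>coef X\<^esub> P i = coord (coef X) P a i \<odot>\<^bsub>coef X\<^esub> P i"
    using assms n_le by (intro A.mult_P) auto
  finally show ?thesis using assms Pi n_le by (simp add: lact_ops w_lact)
qed

text \<open>The frame formula holds at each \<open>w i j\<close> by orthogonality, and the vectors
  it fixes form a subspace, hence contain the span.\<close>

sublocale framed_corr X "tri n m" "\<lambda>(i, j). w i j"
proof -
  interpret star_corr X by (rule star_corr)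
  let ?F = "\<lambda>\<xi>. vsum X (\<lambda>k. ract X (case k of (i, j) \<Rightarrow> w i j) (ip X (case k of (i, j) \<Rightarrow> w i j) \<xi>)) (tri n m)"
  have wc: "(case k of (i, j) \<Rightarrow> w i j) \<in> carrier X" if "k \<in> set (tri n m)" for k
    by (cases k; use that in simp)
  have F: "?F \<xi> \<in> carrier X" if "\<xi> \<in> carrier X" for \<xi> using wc that by (intro vsum_closed) auto
  have "\<xi> \<in> {\<xi> \<in> carrier X. ?F \<xi> = \<xi>}" if \<xi>: "\<xi> \<in> carrier X" for \<xi>
  proof (rule lin_span_induct)
    show "\<xi> \<in> lin_span X {w i j | i j. i \<in> {1..n} \<and> j \<in> {i..m}}"
      using \<xi> triangular by (simp add: triangular_corr_def)
    show "{w i j | i j. i \<in> {1..n} \<and> j \<in> {i..m}} \<subseteq> {\<xi> \<in> carrier X. ?F \<xi> = \<xi>}"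
    proof (rule subsetI)
      fix \<eta> assume "\<eta> \<in> {w i j | i j. i \<in> {1..n} \<and> j \<in> {i..m}}"
      then obtain k l where kl: "1 \<le> k" "k \<le> n" "k \<le> l" "l \<le> m" "\<eta> = w k l" by auto
      have "?F \<eta> = ract X (w k l) (ip X (w k l) \<eta>)"
      proof (subst vsum_single[where l = "(k, l)"])
        fix x assume "x \<in> set (tri n m)" "x \<noteq> (k, l)"
        moreover obtain i j where "x = (i, j)" by (cases x)
        ultimately show "ract X (case x of (i, j) \<Rightarrow> w i j) (ip X (case x of (i, j) \<Rightarrow> w i j) \<eta>) = \<zero>"
          using kl by (auto simp: w_ip)
      qed (use kl in \<open>auto simp: distinct_tri\<close>)
      also have "\<dots> = \<eta>" using kl by (simp add: w_ip w_ract)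
      finally show "\<eta> \<in> {\<xi> \<in> carrier X. ?F \<xi> = \<xi>}" using kl by simp
    qed
    have "?F (\<xi> \<oplus> \<eta>) = ?F \<xi> \<oplus> ?F \<eta>" if "\<xi> \<in> carrier X" "\<eta> \<in> carrier X" for \<xi> \<eta>
      using that wc by (subst vsum_add[symmetric]) (auto intro!: vsum_cong simp: ip_add_right ract_add_right)
    moreover have "?F (c \<odot> \<xi>) = c \<odot> ?F \<xi>" if "\<xi> \<in> carrier X" for c \<xi>
      using that wc by (subst vsum_scale[symmetric]) (auto intro!: vsum_cong simp: ip_scale_right ract_scale_right)
    moreover have "?F \<zero> = \<zero>"
      using wc by (intro vsum_zero) (auto intro: ract_zero)
    ultimately show "subspace_of {\<xi> \<in> carrier X. ?F \<xi> = \<xi>} X"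
      by (auto simp: subspace_of_def)
  qed
  then show "framed_corr X (tri n m) (\<lambda>(i, j). w i j)"
    by unfold_locales (use wc in auto)
qed

text \<open>No frame vector has a first index above n, so these projections act as 0; they are the
  sinks of the graph.\<close>

lemma lact_sink:
  assumes i: "n < i" "i \<le> m" and \<xi>: "\<xi> \<in> carrier X"
  shows "lact X (P i) \<xi> = \<zero>"
proof (rule frame_eqI)
  fix k assume "k \<in> set (tri n m)"
  moreover obtain i' j where "k = (i', j)" by (cases k)
  ultimately show "ip X (case k of (i, j) \<Rightarrow> w i j) (lact X (P i) \<xi>) = ip X (case k of (i, j) \<Rightarrow> w i j) \<zero>"
    using i \<xi> lact_adjoint[of "P i" "w i' j" \<xi>] orth_familyD(2)[OF A.orth, of i]
    by (simp add: w_lact)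
qed (use \<xi> i in auto)

lemma coord_one: "i \<in> set (nats m) \<Longrightarrow> coord (coef X) P A.one i = 1"
  using coef.proj_osum(1)[OF A.orth distinct_nats, of i "\<lambda>_. 1"]
  by (intro A.coord_eqI A.one_unit(1)) (auto simp: A.one_def)

lemma lact_one: "\<lbrakk>1 \<le> i; i \<le> n; i \<le> j; j \<le> m\<rbrakk> \<Longrightarrow> lact X A.one (w i j) = w i j"
  using coord_one[of i] n_le by (simp add: lact_w A.one_unit(1))

text \<open>An element acting as 0 has vanishing coordinates up to n, as the diagonal vectors
  \<open>w i i\<close> show, while a vanishes at the sinks. Hence their product is 0.\<close>

lemma katsuraI:
  assumes a: "a \<in> carrier (coef X)" and 0: "\<And>i. \<lbrakk>n < i; i \<le> m\<rbrakk> \<Longrightarrow> a \<otimes>\<^bsub>coef X\<^esub> P i = \<zero>\<^bsub>coef X\<^esub>"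
  shows "a \<in> katsura_ideal X"
  unfolding katsura_ideal_iff
proof (intro conjI ballI impI a)
  fix b assume b: "b \<in> carrier (coef X)" and ker: "\<forall>\<xi>\<in>carrier X. lact X b \<xi> = \<zero>"
  have "coord (coef X) P (a \<otimes>\<^bsub>coef X\<^esub> b) i = 0" if i: "i \<in> set (nats m)" for i
  proof (cases "i \<le> n")
    case True
    have "coord (coef X) P b i \<odot> w i i = \<zero>" using ker lact_w[of b i i] i True b by simp
    then have "coord (coef X) P b i = 0"
      using w_nonzero[of i i] i True scale_cancel[of "coord (coef X) P b i" "w i i" \<zero>] by auto
    then show ?thesis using a b i by (simp add: A.coord_ops)
  next
    case False
    then have "a \<otimes>\<^bsub>coef X\<^esub> P i = \<zero>\<^bsub>coef X\<^esub>" using i 0 by simp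
    then have "P i \<otimes>\<^bsub>coef X\<^esub> a = 0 \<odot>\<^bsub>coef X\<^esub> P i" using A.mult_P[OF a i] i by simp
    then have "coord (coef X) P a i = 0" using a i by (intro A.coord_eqI) auto
    then show ?thesis using a b i by (simp add: A.coord_ops)
  qed
  then have "osum (coef X) P (coord (coef X) P (a \<otimes>\<^bsub>coef X\<^esub> b)) (nats m) = \<zero>\<^bsub>coef X\<^esub>"
    unfolding osum_def by (intro coef.vsum_zero) auto
  then show "a \<otimes>\<^bsub>coef X\<^esub> b = \<zero>\<^bsub>coef X\<^esub>"
    using A.expand[of "a \<otimes>\<^bsub>coef X\<^esub> b"] a b by simp
qed

end

text \<open>The relations presenting \<open>\<O>\<^sub>X\<close>; the last one is covariance for \<open>P i\<close>.\<close>

locale triangular_family = X: triangular n m X P w + cstar_algebra D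
  for n m and X :: "('x, 'a) corr" and P w and D :: "'d cstar" (structure) +
  fixes p :: "nat \<Rightarrow> 'd" and t :: "nat \<Rightarrow> nat \<Rightarrow> 'd"
  assumes p: "orth_family D {1..m} p"
    and t: "\<And>i j. \<lbrakk>1 \<le> i; i \<le> n; i \<le> j; j \<le> m\<rbrakk> \<Longrightarrow> t i j \<in> carrier D"
    and tt: "\<And>i j k l. \<lbrakk>1 \<le> i; i \<le> n; i \<le> j; j \<le> m; 1 \<le> k; k \<le> n; k \<le> l; l \<le> m\<rbrakk>
      \<Longrightarrow> star D (t i j) \<otimes> t k l = (if i = k \<and> j = l then p j else \<zero>)"
    and pt: "\<And>i j. \<lbrakk>1 \<le> i; i \<le> n; i \<le> j; j \<le> m\<rbrakk> \<Longrightarrow> p i \<otimes> t i j = t i j"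
    and rows: "\<And>i. \<lbrakk>1 \<le> i; i \<le> n\<rbrakk> \<Longrightarrow> p i \<otimes> vsum D (\<lambda>j. t i j \<otimes> star D (t i j)) (trow i m) = p i"
begin

definition \<rho>A :: "'a \<Rightarrow> 'd" where "\<rho>A a = osum D p (coord (coef X) P a) (nats m)"

lemma p': "orth_family D (set (nats m)) p"
  using p by simp

lemma hom: "star_hom (coef X) D \<rho>A" and \<rho>A_P: "\<lbrakk>1 \<le> i; i \<le> m\<rbrakk> \<Longrightarrow> \<rho>A (P i) = p i"
  using X.A.hom_exists[OF star_algebra_axioms p'] by (simp_all add: \<rho>A_def[abs_def])

sublocale frame_data X "tri n m" "\<lambda>(i, j). w i j" D \<rho>A "\<lambda>(i, j). t i j"
  using \<rho>A_P star_hom_zero[OF hom X.coef.complex_space_axioms complex_space_axioms]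
  by unfold_locales (auto simp: hom t tt X.w_ip set_tri)

lemma \<rho>X_w: "\<lbrakk>1 \<le> i; i \<le> n; i \<le> j; j \<le> m\<rbrakk> \<Longrightarrow> \<rho>X (w i j) = t i j"
  using ext_frame[of "(i, j)"] by simp

lemma p_F:
  assumes i: "1 \<le> i" "i \<le> n"
  shows "p i \<otimes> F = p i"
proof -
  note pD = orth_familyD[OF p]
  let ?t = "\<lambda>(i, j). t i j"
  have pi: "p i \<in> carrier D" using pD(1)[of i] i X.n_le by simp
  have pz: "p i \<otimes> t i' j = \<zero>" if "1 \<le> i'" "i' \<le> n" "i' \<le> j" "j \<le> m" "i' \<noteq> i" for i' j
  proof -
    have "p i \<otimes> t i' j = (p i \<otimes> p i') \<otimes> t i' j"
      using that i pD(1)[of i'] pi t X.n_le by (simp add: mult_assoc pt)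
    then show ?thesis using that i pD(4)[of i i'] t X.n_le by simp
  qed
  have "p i \<otimes> F = vsum D (\<lambda>k. p i \<otimes> (?t k \<otimes> star D (?t k))) (tri n m)"
    unfolding F_frame using pi t by (intro mult_vsum) (auto simp: set_tri)
  also have "\<dots> = vsum D (\<lambda>j. p i \<otimes> (?t (i, j) \<otimes> star D (?t (i, j)))) (trow i m)"
    by (rule vsum_tri_row) (use i pi t pz in \<open>auto simp: mult_assoc[symmetric]\<close>)
  also have "\<dots> = p i \<otimes> vsum D (\<lambda>j. t i j \<otimes> star D (t i j)) (trow i m)"
    using i pi t by (subst mult_vsum) auto
  finally show ?thesis using rows[OF i] by simp
qed

text \<open>Everything is checked coordinatewise. In the covariance relation a coordinate up to n is
  handled by \<open>p_F\<close>, and a coordinate at a sink vanishes because the sink projection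
  lies in the kernel of the left action.\<close>

lemma rep: "framed_rep X (tri n m) (\<lambda>(i, j). w i j) D \<rho>X \<rho>A"
proof (rule framed_repI)
  note pD = orth_familyD[OF p]
  fix a assume a: "a \<in> carrier (coef X)"
  fix l assume "l \<in> set (tri n m)"
  moreover obtain i j where l: "l = (i, j)" by (cases l)
  ultimately have ij: "1 \<le> i" "i \<le> n" "i \<le> j" "j \<le> m" "i \<le> m" using X.n_le by auto
  have "\<rho>A a \<otimes> t i j = (\<rho>A a \<otimes> p i) \<otimes> t i j"
    using ij t[OF ij(1-4)] pD(1)[of i] a by (simp add: mult_assoc pt)
  also have "\<rho>A a \<otimes> p i = coord (coef X) P a i \<odot> p i"
    unfolding \<rho>A_def using ij by (intro proj_osum(2)[OF p']) auto
  also have "\<dots> \<otimes> t i j = coord (coef X) P a i \<odot> t i j"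
    using ij t[OF ij(1-4)] pD(1)[of i] by (simp add: mult_scale_left pt)
  finally show "\<rho>X (lact X a (case l of (i, j) \<Rightarrow> w i j)) = \<rho>A a \<otimes> (case l of (i, j) \<Rightarrow> t i j)"
    using ij a by (simp add: l X.lact_w linear_map_scale[OF \<rho>X_linear] \<rho>X_w)
next
  note pD = orth_familyD[OF p]
  fix a assume "a \<in> katsura_ideal X"
  then have a: "a \<in> carrier (coef X)"
    and ker: "\<And>b. \<lbrakk>b \<in> carrier (coef X); \<forall>\<xi>\<in>carrier X. lact X b \<xi> = \<zero>\<^bsub>X\<^esub>\<rbrakk>
      \<Longrightarrow> a \<otimes>\<^bsub>coef X\<^esub> b = \<zero>\<^bsub>coef X\<^esub>"
    unfolding X.katsura_ideal_iff by auto
  let ?c = "coord (coef X) P a"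
  have "?c i \<odot> p i \<otimes> F = ?c i \<odot> p i" if "i \<in> set (nats m)" for i
  proof (cases "i \<le> n")
    case True
    then show ?thesis using that pD(1)[of i] p_F[of i] by (simp add: mult_scale_left)
  next
    case False
    have "a \<otimes>\<^bsub>coef X\<^esub> P i = \<zero>\<^bsub>coef X\<^esub>" using that False X.lact_sink by (intro ker) auto
    then have "P i \<otimes>\<^bsub>coef X\<^esub> a = 0 \<odot>\<^bsub>coef X\<^esub> P i" using X.A.mult_P[OF a that] that by simp
    then have "?c i = 0" using a that by (intro X.A.coord_eqI) auto
    then show ?thesis using that pD(1)[of i] by simp
  qed
  then show "\<rho>A a \<otimes> F = \<rho>A a"
    unfolding \<rho>A_def[of a] osum_def using pD(1) by (subst vsum_mult) (auto intro!: vsum_cong)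
qed

end

section \<open>The quantum disc and sphere algebras by generators and relations\<close>

locale triangular_cp = X: triangular n m X P w + cp_algebra X "tri n m" "\<lambda>(i, j). w i j" Oo \<pi>X \<pi>A
  for n m and X :: "('x, 'a) corr" and P w and Oo :: "'o cstar" (structure) and \<pi>X \<pi>A
begin

lemma unital: "unital_cstar Oo (\<pi>A X.A.one)"
  by (rule unital[OF X.A.one_unit]) (auto simp: X.lact_one set_tri)

sublocale unital_cstar Oo "\<pi>A X.A.one" by (rule unital)

lemma hom_of_family:
  fixes D :: "'d cstar"
  assumes "triangular_family n m X P w D p t" and D: "unital_cstar D u"
  obtains h where "star_hom Oo D h"
    "\<And>i j. \<lbrakk>1 \<le> i; i \<le> n; i \<le> j; j \<le> m\<rbrakk> \<Longrightarrow> h (\<pi>X (w i j)) = t i j"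
    "\<And>i. \<lbrakk>1 \<le> i; i \<le> m\<rbrakk> \<Longrightarrow> h (\<pi>A (P i)) = p i"
proof -
  interpret D: triangular_family n m X P w D p t by fact
  obtain h where h: "star_hom Oo D h" "\<And>\<xi>. \<xi> \<in> carrier X \<Longrightarrow> h (\<pi>X \<xi>) = D.\<rho>X \<xi>"
    "\<And>a. a \<in> carrier (coef X) \<Longrightarrow> h (\<pi>A a) = D.\<rho>A a"
    by (rule universal[OF D D.rep]) (rule that)
  show ?thesis by (rule that[OF h(1)]) (simp_all add: h(2,3) D.\<rho>X_w D.\<rho>A_P)
qed

abbreviation T :: "nat \<Rightarrow> nat \<Rightarrow> 'o" where "T i j \<equiv> \<pi>X (w i j)"
abbreviation p :: "nat \<Rightarrow> 'o" where "p i \<equiv> \<pi>A (P i)"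

lemma P_coef: "\<lbrakk>1 \<le> i; i \<le> m\<rbrakk> \<Longrightarrow> P i \<in> carrier (coef X)"
  using X.A.P_closed[of i] by simp

lemma p_orth: "orth_family Oo {1..m} p"
  using orth_family_hom[OF \<rho>A_hom X.coef.complex_space_axioms complex_space_axioms X.A.orth] by simp

lemma p_closed [simp]: "\<lbrakk>1 \<le> i; i \<le> m\<rbrakk> \<Longrightarrow> p i \<in> carrier Oo"
  and p_star [simp]: "\<lbrakk>1 \<le> i; i \<le> m\<rbrakk> \<Longrightarrow> star Oo (p i) = p i"
  and p_mult: "\<lbrakk>1 \<le> i; i \<le> m; 1 \<le> j; j \<le> m\<rbrakk> \<Longrightarrow> p i \<otimes> p j = (if i = j then p i else \<zero>)"
  using p_orth by (auto simp: orth_family_def)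

lemma T_star_T: "\<lbrakk>1 \<le> i; i \<le> n; i \<le> j; j \<le> m; 1 \<le> k; k \<le> n; k \<le> l; l \<le> m\<rbrakk>
    \<Longrightarrow> star Oo (T i j) \<otimes> T k l = (if i = k \<and> j = l then p j else \<zero>)"
  by (simp add: \<rho>X_ip X.w_ip)

lemma p_T: "\<lbrakk>1 \<le> i; i \<le> n; i \<le> j; j \<le> m; 1 \<le> k; k \<le> m\<rbrakk> \<Longrightarrow> p k \<otimes> T i j = (if i = k then T i j else \<zero>)"
  and T_p: "\<lbrakk>1 \<le> i; i \<le> n; i \<le> j; j \<le> m; 1 \<le> k; k \<le> m\<rbrakk> \<Longrightarrow> T i j \<otimes> p k = (if j = k then T i j else \<zero>)"
  by (simp_all add: \<rho>X_lact[symmetric] \<rho>X_ract[symmetric] P_coef X.w_lact X.w_ract)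

text \<open>P i is orthogonal to the sinks, so it lies in the Katsura ideal; covariance at P i
  involves only row i of the frame.\<close>

lemma row_sum:
  assumes i: "1 \<le> i" "i \<le> n"
  shows "vsum Oo (\<lambda>j. T i j \<otimes> star Oo (T i j)) (trow i m) = p i"
proof -
  have im: "i \<le> m" using i X.n_le by simp
  let ?h = "\<lambda>k. \<pi>X (case k of (i, j) \<Rightarrow> w i j) \<otimes> star Oo (\<pi>X (case k of (i, j) \<Rightarrow> w i j))"
  have "P i \<in> katsura_ideal X"
  proof (rule X.katsuraI)
    show "P i \<otimes>\<^bsub>coef X\<^esub> P k = \<zero>\<^bsub>coef X\<^esub>" if "n < k" "k \<le> m" for k
      using that i im orth_familyD(4)[OF X.A.orth, of i k] by simp
  qed (use i im P_coef in simp)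
  then have "p i = p i \<otimes> F" by (simp add: covariant)
  also have "\<dots> = vsum Oo (\<lambda>k. p i \<otimes> ?h k) (tri n m)"
    unfolding F_def using i im by (intro mult_vsum) (auto simp: set_tri)
  also have "\<dots> = vsum Oo (\<lambda>j. p i \<otimes> ?h (i, j)) (trow i m)"
    by (rule vsum_tri_row) (use i im in \<open>auto simp: p_T simp flip: mult_assoc\<close>)
  also have "\<dots> = vsum Oo (\<lambda>j. T i j \<otimes> star Oo (T i j)) (trow i m)"
    using i im by (intro vsum_cong) (auto simp: p_T simp flip: mult_assoc)
  finally show ?thesis by simp
qed

lemma \<pi>A_one: "vsum Oo p (nats m) = \<pi>A X.A.one"
proof -
  have "\<pi>A X.A.one = vsum Oo (\<lambda>i. \<pi>A (1 \<odot>\<^bsub>coef X\<^esub> P i)) (nats m)"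
    unfolding X.A.one_def osum_def
    by (rule star_hom_vsum[OF \<rho>A_hom X.coef.complex_space_axioms complex_space_axioms]) simp
  also have "\<dots> = vsum Oo p (nats m)" by (intro vsum_cong) (simp add: P_coef)
  finally show ?thesis ..
qed

lemma eq_unitI:
  assumes H: "H \<in> carrier Oo" and "\<And>i. \<lbrakk>1 \<le> i; i \<le> m\<rbrakk> \<Longrightarrow> p i \<otimes> H = p i"
  shows "H = \<pi>A X.A.one"
proof -
  have "H = vsum Oo p (nats m) \<otimes> H" using H by (simp add: \<pi>A_one)
  also have "\<dots> = vsum Oo (\<lambda>i. p i \<otimes> H) (nats m)" using H by (intro vsum_mult) auto
  also have "\<dots> = vsum Oo p (nats m)" using assms(2) by (intro vsum_cong) simp
  finally show ?thesis by (simp add: \<pi>A_one)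
qed

lemma hom_eqI_generators:
  assumes D: "cstar_algebra D" and H: "star_hom Oo D H" and G: "star_hom Oo D G"
    and T: "\<And>i j. \<lbrakk>1 \<le> i; i \<le> n; i \<le> j; j \<le> m\<rbrakk> \<Longrightarrow> H (T i j) = G (T i j)"
    and p: "\<And>i. \<lbrakk>1 \<le> i; i \<le> m\<rbrakk> \<Longrightarrow> H (p i) = G (p i)" and a: "a \<in> carrier Oo"
  shows "H a = G a"
proof (rule hom_eqI[OF unital D H G _ _ a])
  interpret D: cstar_algebra D by fact
  show "H (\<pi>X (case k of (i, j) \<Rightarrow> w i j)) = G (\<pi>X (case k of (i, j) \<Rightarrow> w i j))" if "k \<in> set (tri n m)" for k
    by (cases k; use that T in simp)
  fix c assume c: "c \<in> carrier (coef X)"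
  have "K (\<pi>A c) = vsum D (\<lambda>i. coord (coef X) P c i \<odot>\<^bsub>D\<^esub> K (p i)) (nats m)" if K: "star_hom Oo D K" for K
  proof -
    have "K (\<pi>A c) = K (\<pi>A (osum (coef X) P (coord (coef X) P c) (nats m)))" using X.A.expand[OF c] by simp
    also have "\<dots> = vsum D (\<lambda>i. K (\<pi>A (coord (coef X) P c i \<odot>\<^bsub>coef X\<^esub> P i))) (nats m)"
      unfolding osum_def using P_coef
      by (intro star_hom_vsum[OF star_hom_comp[OF \<rho>A_hom K] X.coef.complex_space_axioms D.complex_space_axioms]) simp
    also have "\<dots> = vsum D (\<lambda>i. coord (coef X) P c i \<odot>\<^bsub>D\<^esub> K (p i)) (nats m)"
      by (intro vsum_cong) (simp add: P_coef \<rho>A star_homD[OF K])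
    finally show ?thesis .
  qed
  from this[OF H] this[OF G] show "H (\<pi>A c) = G (\<pi>A c)" using p by (auto intro: vsum_cong)
qed

end

section \<open>The coefficient algebra of the mirror correspondence\<close>

text \<open>The relations between the \<open>R\<^sub>i\<close> and \<open>Q\<^sub>k\<close>, without the requirement that they be nonzero.\<close>

locale mirror_projections = star_algebra D for D :: "('d, 'k) cstar_scheme" (structure) +
  fixes n :: nat and r q :: "nat \<Rightarrow> 'd"
  assumes r_orth: "orth_family D {1..n+1} r" and q_orth: "orth_family D {1..} q"
    and qr: "k \<ge> 1 \<Longrightarrow> q k \<otimes> r n = q k" and n_ge: "n \<ge> 1"
begin

lemma r_closed [simp]: "\<lbrakk>1 \<le> i; i \<le> n + 1\<rbrakk> \<Longrightarrow> r i \<in> carrier D"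
  and r_star [simp]: "\<lbrakk>1 \<le> i; i \<le> n + 1\<rbrakk> \<Longrightarrow> star D (r i) = r i"
  and r_mult [simp]: "\<lbrakk>1 \<le> i; i \<le> n + 1; 1 \<le> j; j \<le> n + 1\<rbrakk> \<Longrightarrow> r i \<otimes> r j = (if i = j then r i else \<zero>)"
  using r_orth by (auto simp: orth_family_def)

lemma q_closed [simp]: "1 \<le> k \<Longrightarrow> q k \<in> carrier D"
  and q_star [simp]: "1 \<le> k \<Longrightarrow> star D (q k) = q k"
  and q_mult [simp]: "\<lbrakk>1 \<le> k; 1 \<le> l\<rbrakk> \<Longrightarrow> q k \<otimes> q l = (if k = l then q k else \<zero>)"
  using q_orth by (auto simp: orth_family_def)

lemma qr_mult [simp]:
  assumes "1 \<le> k" "1 \<le> i" "i \<le> n + 1"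
  shows "q k \<otimes> r i = (if i = n then q k else \<zero>)" "r i \<otimes> q k = (if i = n then q k else \<zero>)"
proof -
  have "q k \<otimes> r i = (q k \<otimes> r n) \<otimes> r i" using assms by (simp add: qr)
  also have "\<dots> = q k \<otimes> (r n \<otimes> r i)" using assms n_ge by (intro mult_assoc) auto
  finally show *: "q k \<otimes> r i = (if i = n then q k else \<zero>)" using assms n_ge qr by (auto split: if_splits)
  have "r i \<otimes> q k = star D (q k \<otimes> r i)" using assms by (simp only: star_mult q_star r_star q_closed r_closed)
  then show "r i \<otimes> q k = (if i = n then q k else \<zero>)" using assms by (simp add: *)
qed

text \<open>R_n is not minimal: at level K it splits into Q_1, ..., Q_K and a remainder, which is
  placed at \<open>Inl n\<close>. Each level spans a finite-dimensional commutative
  subalgebra.\<close>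

definition fam :: "nat \<Rightarrow> nat + nat \<Rightarrow> 'd" where
  "fam K l = (case l of Inl i \<Rightarrow> if i = n then vdiff D (r n) (vsum D q (nats K)) else r i | Inr k \<Rightarrow> q k)"

definition labels :: "nat \<Rightarrow> (nat + nat) list" where
  "labels K = map Inl (nats (n + 1)) @ map Inr (nats K)"

definition comb :: "nat \<Rightarrow> (nat + nat \<Rightarrow> complex) \<Rightarrow> 'd" where
  "comb K c = osum D (fam K) c (labels K)"

lemma set_labels: "set (labels K) = Inl ` {1..n+1} \<union> Inr ` {1..K}"
  and distinct_labels: "distinct (labels K)"
  by (auto simp: labels_def distinct_map inj_on_def)

lemma
  shows q_sum_closed [simp]: "vsum D q (nats K) \<in> carrier D"
    and q_sum_star: "star D (vsum D q (nats K)) = vsum D q (nats K)"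
    and q_sum_mult: "1 \<le> k \<Longrightarrow> q k \<otimes> vsum D q (nats K) = (if k \<le> K then q k else \<zero>)"
      "1 \<le> k \<Longrightarrow> vsum D q (nats K) \<otimes> q k = (if k \<le> K then q k else \<zero>)"
proof -
  show c: "vsum D q (nats K) \<in> carrier D" by auto
  show s: "star D (vsum D q (nats K)) = vsum D q (nats K)"
    by (subst star_vsum) (auto intro!: vsum_cong)
  show m: "q k \<otimes> vsum D q (nats K) = (if k \<le> K then q k else \<zero>)" if k: "1 \<le> k" for k
  proof (cases "k \<le> K")
    case True
    have "q k \<otimes> vsum D q (nats K) = vsum D (\<lambda>j. q k \<otimes> q j) (nats K)"
      using k by (intro mult_vsum) auto
    also have "\<dots> = q k \<otimes> q k" using k True by (intro vsum_single) auto
    finally show ?thesis using k True by simp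
  next
    case False
    have "q k \<otimes> vsum D q (nats K) = vsum D (\<lambda>j. q k \<otimes> q j) (nats K)"
      using k by (intro mult_vsum) auto
    also have "\<dots> = \<zero>" using k False by (intro vsum_zero) auto
    finally show ?thesis using False by simp
  qed
  show "vsum D q (nats K) \<otimes> q k = (if k \<le> K then q k else \<zero>)" if "1 \<le> k"
    using star_mult[of "q k" "vsum D q (nats K)"] that c m[of k] s by (auto split: if_splits)
qed

lemma r_q_sum: "\<lbrakk>1 \<le> i; i \<le> n + 1\<rbrakk> \<Longrightarrow> r i \<otimes> vsum D q (nats K) = (if i = n then vsum D q (nats K) else \<zero>)"
  "\<lbrakk>1 \<le> i; i \<le> n + 1\<rbrakk> \<Longrightarrow> vsum D q (nats K) \<otimes> r i = (if i = n then vsum D q (nats K) else \<zero>)"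
  by (subst mult_vsum vsum_mult; auto intro!: vsum_zero vsum_cong)+

lemma q_sum_idem: "vsum D q (nats K) \<otimes> vsum D q (nats K) = vsum D q (nats K)"
proof -
  have "vsum D q (nats K) \<otimes> vsum D q (nats K) = vsum D (\<lambda>k. q k \<otimes> vsum D q (nats K)) (nats K)"
    by (rule vsum_mult) auto
  also have "\<dots> = vsum D q (nats K)" by (intro vsum_cong) (auto simp: q_sum_mult)
  finally show ?thesis .
qed

lemma fam_orth: "orth_family D (set (labels K)) (fam K)"
  unfolding orth_family_def
proof (intro conjI ballI)
  fix l assume l: "l \<in> set (labels K)"
  then show "fam K l \<in> carrier D" "star D (fam K l) = fam K l"
    using n_ge by (auto simp: set_labels fam_def star_vdiff q_sum_star)
  fix l' assume l': "l' \<in> set (labels K)"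
  show "fam K l \<otimes> fam K l' = (if l = l' then fam K l else \<zero>)"
    using l l' n_ge
    by (auto simp: set_labels fam_def vdiff_mult mult_vdiff q_sum_mult r_q_sum q_sum_idem
        split: if_splits)
qed

lemma comb_closed [simp]: "comb K c \<in> carrier D"
  by (simp add: comb_def fam_orth)

lemma comb_ops:
  "comb K c \<oplus> comb K d = comb K (\<lambda>l. c l + d l)" "t \<odot> comb K c = comb K (\<lambda>l. t * c l)"
  "comb K c \<otimes> comb K d = comb K (\<lambda>l. c l * d l)" "star D (comb K c) = comb K (\<lambda>l. cnj (c l))"
  by (simp_all add: comb_def osum_add osum_scale osum_mult osum_star fam_orth distinct_labels)

lemma fam_comb:
  assumes "l \<in> set (labels K)"
  shows "fam K l \<otimes> comb K c = c l \<odot> fam K l" "comb K c \<otimes> fam K l = c l \<odot> fam K l"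
  using proj_osum[OF fam_orth distinct_labels assms] by (simp_all add: comb_def)

lemma comb_cong: "(\<And>l. l \<in> set (labels K) \<Longrightarrow> c l = d l) \<Longrightarrow> comb K c = comb K d"
  unfolding comb_def osum_def by (intro vsum_cong) simp

text \<open>In this form a combination does not depend on \<open>K\<close>.\<close>

lemma comb_expand:
  "comb K c = vsum D (\<lambda>i. c (Inl i) \<odot> r i) (nats (n + 1))
     \<oplus> vsum D (\<lambda>k. (c (Inr k) - c (Inl n)) \<odot> q k) (nats K)"
proof -
  let ?S = "vsum D q (nats K)"
  have "comb K c = vsum D (\<lambda>i. c (Inl i) \<odot> fam K (Inl i)) (nats (n + 1))
      \<oplus> vsum D (\<lambda>k. c (Inr k) \<odot> q k) (nats K)"
    unfolding comb_def osum_def labels_def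
    by (subst vsum_append) (use n_ge in \<open>auto simp: vsum_map fam_def\<close>)
  also have "vsum D (\<lambda>i. c (Inl i) \<odot> fam K (Inl i)) (nats (n + 1))
      = vsum D (\<lambda>i. c (Inl i) \<odot> r i \<oplus> (if i = n then (- c (Inl n)) \<odot> ?S else \<zero>)) (nats (n + 1))"
    using n_ge by (intro vsum_cong) (auto simp: fam_def vdiff_def scale_add_right scale_scale)
  also have "\<dots> = vsum D (\<lambda>i. c (Inl i) \<odot> r i) (nats (n + 1))
      \<oplus> vsum D (\<lambda>i. if i = n then (- c (Inl n)) \<odot> ?S else \<zero>) (nats (n + 1))"
    by (intro vsum_add) auto
  also have "vsum D (\<lambda>i. if i = n then (- c (Inl n)) \<odot> ?S else \<zero>) (nats (n + 1)) = (- c (Inl n)) \<odot> ?S"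
    using n_ge by (subst vsum_single[where l = n]) auto
  finally have "comb K c = vsum D (\<lambda>i. c (Inl i) \<odot> r i) (nats (n + 1))
      \<oplus> ((- c (Inl n)) \<odot> ?S \<oplus> vsum D (\<lambda>k. c (Inr k) \<odot> q k) (nats K))"
    by (subst (asm) add_assoc) auto
  also have "(- c (Inl n)) \<odot> ?S \<oplus> vsum D (\<lambda>k. c (Inr k) \<odot> q k) (nats K)
      = vsum D (\<lambda>k. (- c (Inl n)) \<odot> q k \<oplus> c (Inr k) \<odot> q k) (nats K)"
  proof -
    have "vsum D (\<lambda>k. (- c (Inl n)) \<odot> q k) (nats K) = (- c (Inl n)) \<odot> ?S"
      by (rule vsum_scale) auto
    then show ?thesis by (subst vsum_add) auto
  qed
  also have "\<dots> = vsum D (\<lambda>k. (c (Inr k) - c (Inl n)) \<odot> q k) (nats K)"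
    by (intro vsum_cong) (simp add: scale_add_left[symmetric])
  finally show ?thesis .
qed

lemma nats_Suc: "nats (Suc K) = nats K @ [Suc K]"
  by (simp add: nats_def)

lemma comb_mono:
  assumes "K \<le> K'" "\<And>k. \<lbrakk>K < k; k \<le> K'\<rbrakk> \<Longrightarrow> c (Inr k) = c (Inl n)"
  shows "comb K' c = comb K c"
  using assms
proof (induction K' rule: dec_induct)
  case (step K'')
  have "vsum D (\<lambda>k. (c (Inr k) - c (Inl n)) \<odot> q k) (nats (Suc K''))
      = vsum D (\<lambda>k. (c (Inr k) - c (Inl n)) \<odot> q k) (nats K'')"
    unfolding nats_Suc by (subst vsum_append) (use step in \<open>auto intro!: add_zero\<close>)
  then have "comb (Suc K'') c = comb K'' c" by (simp add: comb_expand)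
  then show ?case using step by simp
qed simp

text \<open>Raising the level splits the remainder further, and the new Q_k inherit its
  coefficient.\<close>

definition ext :: "nat \<Rightarrow> (nat + nat \<Rightarrow> complex) \<Rightarrow> nat + nat \<Rightarrow> complex" where
  "ext K c l = (case l of Inl i \<Rightarrow> c (Inl i) | Inr k \<Rightarrow> if k \<le> K then c (Inr k) else c (Inl n))"

lemma comb_ext: "K \<le> K' \<Longrightarrow> comb K' (ext K c) = comb K c"
proof -
  assume "K \<le> K'"
  then have "comb K' (ext K c) = comb K (ext K c)" by (rule comb_mono) (simp add: ext_def)
  also have "\<dots> = comb K c" by (rule comb_cong) (auto simp: ext_def set_labels)
  finally show ?thesis .
qed

lemma comb_gen:
  "\<lbrakk>1 \<le> i; i \<le> n + 1\<rbrakk> \<Longrightarrow> comb 0 (\<lambda>l. if l = Inl i then 1 else 0) = r i"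
  "1 \<le> k \<Longrightarrow> comb k (\<lambda>l. if l = Inr k then 1 else 0) = q k"
proof -
  assume i: "1 \<le> i" "i \<le> n + 1"
  have "comb 0 (\<lambda>l. if l = Inl i then 1 else 0) = fam 0 (Inl i)"
    unfolding comb_def using i by (intro osum_indicator[OF fam_orth distinct_labels]) (auto simp: set_labels)
  then show "comb 0 (\<lambda>l. if l = Inl i then 1 else 0) = r i" using i n_ge by (simp add: fam_def nats_def)
next
  assume k: "1 \<le> k"
  have "comb k (\<lambda>l. if l = Inr k then 1 else 0) = fam k (Inr k)"
    unfolding comb_def using k by (intro osum_indicator[OF fam_orth distinct_labels]) (auto simp: set_labels)
  then show "comb k (\<lambda>l. if l = Inr k then 1 else 0) = q k" by (simp add: fam_def)
qed

end

text \<open>The algebra \<open>B\<close>; its minimal projections \<open>Mp\<close> are the \<open>R\<^sub>i\<close> with \<open>i \<noteq> n\<close> and the \<open>Q\<^sub>k\<close>.\<close>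

locale mirror_algebra = cstar_algebra B for B :: "('b, 'k) cstar_scheme" (structure) +
  fixes n :: nat and R Q :: "nat \<Rightarrow> 'b"
  assumes R: "orthogonal_projections B {1..n+1} R" and Q: "orthogonal_projections B {1..} Q"
    and QR: "k \<ge> 1 \<Longrightarrow> Q k \<otimes> R n = Q k" and n_ge: "n \<ge> 1"
    and generated: "cstar_generated B (R ` {1..n+1} \<union> Q ` {1..}) = carrier B"
begin

sublocale mirror_projections B n R Q
  using R Q QR n_ge by unfold_locales (auto intro: orth_family_projections)

definition Ml :: "(nat + nat) set" where
  "Ml = Inl ` ({1..n+1} - {n}) \<union> Inr ` {1..}"

definition Mp :: "nat + nat \<Rightarrow> 'b" where
  "Mp l = (case l of Inl i \<Rightarrow> R i | Inr k \<Rightarrow> Q k)"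

lemma Mp_closed [simp]: "l \<in> Ml \<Longrightarrow> Mp l \<in> carrier B"
  by (auto simp: Ml_def Mp_def)

lemma Mp_nrm: "l \<in> Ml \<Longrightarrow> nrm B (Mp l) = 1"
  using R Q n_ge by (intro projection_nrm_eq)
    (auto simp: Ml_def Mp_def orthogonal_projections_def)

text \<open>Pass to a level high enough for l to occur among the labels; there the combination is
  diagonal.\<close>

lemma Mp_comb:
  assumes "l \<in> Ml"
  shows "Mp l \<otimes> comb K c = ext K c l \<odot> Mp l" "comb K c \<otimes> Mp l = ext K c l \<odot> Mp l"
proof -
  define K' where "K' = max K (case l of Inl i \<Rightarrow> 0 | Inr k \<Rightarrow> k)"
  have l: "l \<in> set (labels K')" "fam K' l = Mp l"
    using assms by (auto simp: set_labels K'_def Ml_def Mp_def fam_def split: if_splits)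
  have "comb K' (ext K c) = comb K c" by (rule comb_ext) (simp add: K'_def)
  then show "Mp l \<otimes> comb K c = ext K c l \<odot> Mp l" "comb K c \<otimes> Mp l = ext K c l \<odot> Mp l"
    using fam_comb[OF l(1), of "ext K c"] l(2) by simp_all
qed

lemma comb_nrm_le:
  assumes C: "\<And>l. l \<in> Ml \<Longrightarrow> cmod (ext K c l) \<le> C"
  shows "nrm B (comb K c) \<le> C"
  unfolding comb_def
proof (rule osum_nrm_le[OF fam_orth distinct_labels])
  \<comment> \<open>\<open>Inl n\<close> does not label a minimal projection; the coefficient of the
    remainder is read off at the first Q beyond level K.\<close>
  have Inr: "Inr (Suc K) \<in> Ml" by (simp add: Ml_def)
  from C[OF this] show "0 \<le> C" by (meson norm_ge_zero order_trans)
  fix l assume l: "l \<in> set (labels K)"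
  show "cmod (c l) \<le> C"
  proof (cases "l = Inl n")
    case True
    then show ?thesis using C[OF Inr] by (simp add: ext_def)
  next
    case False
    then have "l \<in> Ml" "ext K c l = c l" using l by (auto simp: set_labels Ml_def ext_def)
    then show ?thesis using C by metis
  qed
qed

text \<open>Two combinations can be moved to a common level by \<open>ext\<close>, so the
  combinations of all levels form a *-subalgebra containing the generators.\<close>

lemma dense: "carrier B \<subseteq> norm_closure B (nrm B) {comb K c | K c. True}"
proof -
  let ?U = "{comb K c | K c. True}"
  have common: "\<exists>M e f. u = comb M e \<and> v = comb M f" if "u \<in> ?U" "v \<in> ?U" for u v
  proof -
    obtain K c L d where "u = comb K c" "v = comb L d" using \<open>u \<in> ?U\<close> \<open>v \<in> ?U\<close> by blast
    then have "u = comb (max K L) (ext K c)" "v = comb (max K L) (ext L d)"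
      by (simp_all add: comb_ext)
    then show ?thesis by blast
  qed
  have inU: "comb K c \<in> ?U" for K c by blast
  have "star_subalgebra ?U"
    unfolding star_subalgebra_def subspace_of_def
  proof (intro conjI ballI allI)
    show "?U \<subseteq> carrier B" by auto
    have "\<zero> = 0 \<odot> comb 0 (\<lambda>_. 0)" by simp
    then show "\<zero> \<in> ?U" using inU comb_ops(2) by metis
    fix u assume u: "u \<in> ?U"
    then obtain K c where uc: "u = comb K c" by blast
    show "t \<odot> u \<in> ?U" for t unfolding uc comb_ops by (rule inU)
    show "star B u \<in> ?U" unfolding uc comb_ops by (rule inU)
    fix v assume "v \<in> ?U"
    from common[OF u this] obtain M e f where uv: "u = comb M e" "v = comb M f" by blast
    show "u \<oplus> v \<in> ?U" "u \<otimes> v \<in> ?U" unfolding uv comb_ops by (rule inU)+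
  qed
  moreover have "R ` {1..n+1} \<union> Q ` {1..} \<subseteq> ?U"
  proof
    fix x assume "x \<in> R ` {1..n+1} \<union> Q ` {1..}"
    then show "x \<in> ?U" using comb_gen inU by (metis (no_types, lifting) Un_iff atLeastAtMost_iff
          atLeast_iff imageE)
  qed
  ultimately have "cstar_generated B (R ` {1..n+1} \<union> Q ` {1..}) \<subseteq> norm_closure B (nrm B) ?U"
    by (rule cstar_generated_subset_closure)
  then show ?thesis unfolding generated .
qed

lemma approximation:
  assumes b: "b \<in> carrier B" and "e > 0"
  obtains K c where "nrm B (vdiff B (comb K c) b) < e"
proof -
  have "{comb K c | K c. True} \<subseteq> carrier B" by auto
  then have "\<exists>u\<in>{comb K c | K c. True}. nrm B (vdiff B u b) < e"
    using norm_closure_iff[of "{comb K c | K c. True}" b] dense assms by blast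
  then show ?thesis using that by blast
qed

lemma scale_Mp_eq: "\<lbrakk>l \<in> Ml; c \<odot> Mp l = d \<odot> Mp l\<rbrakk> \<Longrightarrow> c = d"
proof -
  assume l: "l \<in> Ml" and eq: "c \<odot> Mp l = d \<odot> Mp l"
  have "nrm B (vdiff B (c \<odot> Mp l) (d \<odot> Mp l)) = cmod (c - d)"
    using l by (simp only: vdiff_scale_left Mp_closed nrm_scale Mp_nrm)
  then show "c = d" using eq l by simp
qed

text \<open>For combinations tending to b the coefficients at l form a Cauchy sequence, because
  \<open>Mp l\<close> has norm 1; their limit is the value at b.\<close>

lemma character_exists:
  assumes l: "l \<in> Ml" and b: "b \<in> carrier B"
  shows "\<exists>c. Mp l \<otimes> b = c \<odot> Mp l \<and> b \<otimes> Mp l = c \<odot> Mp l"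
proof -
  have "b \<in> norm_closure B (nrm B) {comb K c | K c. True}" using dense b by blast
  then obtain s where s: "\<forall>k. s k \<in> {comb K c | K c. True}" "conv s b"
    unfolding norm_closure_def by blast
  have "\<forall>k. \<exists>x. s k \<in> carrier B \<and> Mp l \<otimes> s k = x \<odot> Mp l \<and> s k \<otimes> Mp l = x \<odot> Mp l"
  proof
    fix k
    obtain K c where "s k = comb K c" using s(1) by blast
    then show "\<exists>x. s k \<in> carrier B \<and> Mp l \<otimes> s k = x \<odot> Mp l \<and> s k \<otimes> Mp l = x \<odot> Mp l"
      using Mp_comb[OF l] by (intro exI[of _ "ext K c l"]) simp
  qed
  then obtain x where x: "\<And>k. s k \<in> carrier B" "\<And>k. Mp l \<otimes> s k = x k \<odot> Mp l"
    "\<And>k. s k \<otimes> Mp l = x k \<odot> Mp l" by metis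
  have c1: "conv (\<lambda>k. x k \<odot> Mp l) (Mp l \<otimes> b)"
    using conv_mult[OF _ x(1) _ b conv_const s(2), of "Mp l"] l by (simp add: x)
  have c2: "conv (\<lambda>k. x k \<odot> Mp l) (b \<otimes> Mp l)"
    using conv_mult[OF x(1) _ b _ s(2) conv_const, of "Mp l"] l by (simp add: x)
  have "Cauchy x"
  proof (rule metric_CauchyI)
    fix e :: real assume "e > 0"
    then obtain M where M: "\<And>k. k \<ge> M \<Longrightarrow> nrm B (vdiff B (x k \<odot> Mp l) (Mp l \<otimes> b)) < e/2"
      using conv_less[OF c1, of "e/2"] by auto
    have "dist (x j) (x k) < e" if jk: "j \<ge> M" "k \<ge> M" for j k
    proof -
      have "dist (x j) (x k) = nrm B (vdiff B (x j \<odot> Mp l) (x k \<odot> Mp l))"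
        using l by (simp only: vdiff_scale_left Mp_closed nrm_scale Mp_nrm) (simp add: dist_norm)
      also have "\<dots> \<le> nrm B (vdiff B (x j \<odot> Mp l) (Mp l \<otimes> b)) + nrm B (vdiff B (Mp l \<otimes> b) (x k \<odot> Mp l))"
        using l b by (intro nrm_vdiff_triangle) auto
      also have "nrm B (vdiff B (Mp l \<otimes> b) (x k \<odot> Mp l)) = nrm B (vdiff B (x k \<odot> Mp l) (Mp l \<otimes> b))"
        using l b by (intro nrm_vdiff_commute) auto
      finally show ?thesis using M[OF jk(1)] M[OF jk(2)] by linarith
    qed
    then show "\<exists>M. \<forall>m\<ge>M. \<forall>n\<ge>M. dist (x m) (x n) < e" by blast
  qed
  then obtain y where y: "x \<longlonglongrightarrow> y" by (auto simp: Cauchy_convergent_iff convergent_def)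
  have "conv (\<lambda>k. x k \<odot> Mp l) (y \<odot> Mp l)"
    unfolding converges_to_def using l tendsto_norm_zero[OF LIM_zero[OF y]]
    by (simp add: vdiff_scale_left nrm_scale Mp_nrm)
  then have "Mp l \<otimes> b = y \<odot> Mp l" "b \<otimes> Mp l = y \<odot> Mp l"
    using conv_unique[OF _ _ _ c1] conv_unique[OF _ _ _ c2] l b by auto
  then show ?thesis by blast
qed

definition chr :: "nat + nat \<Rightarrow> 'b \<Rightarrow> complex" where
  "chr l b = (SOME c. Mp l \<otimes> b = c \<odot> Mp l)"

lemma Mp_mult:
  assumes "l \<in> Ml" "b \<in> carrier B"
  shows "Mp l \<otimes> b = chr l b \<odot> Mp l" "b \<otimes> Mp l = chr l b \<odot> Mp l"
proof -
  obtain c where c: "Mp l \<otimes> b = c \<odot> Mp l" "b \<otimes> Mp l = c \<odot> Mp l"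
    using character_exists[OF assms] by blast
  have "chr l b = c" unfolding chr_def c(1) using scale_Mp_eq[OF assms(1)] by blast
  then show "Mp l \<otimes> b = chr l b \<odot> Mp l" "b \<otimes> Mp l = chr l b \<odot> Mp l" using c by simp_all
qed

lemma chr_eqI: "\<lbrakk>l \<in> Ml; b \<in> carrier B; Mp l \<otimes> b = c \<odot> Mp l\<rbrakk> \<Longrightarrow> chr l b = c"
  using Mp_mult(1) scale_Mp_eq by metis

lemma chr_ops:
  assumes "l \<in> Ml" "a \<in> carrier B" "b \<in> carrier B"
  shows "chr l (a \<oplus> b) = chr l a + chr l b" "chr l (t \<odot> a) = t * chr l a"
    "chr l (a \<otimes> b) = chr l a * chr l b" "chr l (star B a) = cnj (chr l a)"
proof -
  note m = Mp_mult[OF assms(1)]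
  show "chr l (a \<oplus> b) = chr l a + chr l b"
    by (rule chr_eqI) (use assms in \<open>auto simp: mult_add_right m scale_add_left\<close>)
  show "chr l (t \<odot> a) = t * chr l a"
    by (rule chr_eqI) (use assms in \<open>auto simp: mult_scale_right m scale_scale\<close>)
  show "chr l (a \<otimes> b) = chr l a * chr l b"
    by (rule chr_eqI) (use assms in \<open>auto simp: mult_assoc[symmetric] m(1) mult_scale_left scale_scale\<close>)
  have sM: "star B (Mp l) = Mp l" using assms(1) by (auto simp: Ml_def Mp_def)
  have "Mp l \<otimes> star B a = star B (a \<otimes> Mp l)" using assms by (simp add: star_mult sM)
  also have "\<dots> = cnj (chr l a) \<odot> Mp l" using assms by (simp add: m(2) star_scale sM)
  finally show "chr l (star B a) = cnj (chr l a)" using assms by (intro chr_eqI) auto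
qed

lemma chr_le: "\<lbrakk>l \<in> Ml; b \<in> carrier B\<rbrakk> \<Longrightarrow> cmod (chr l b) \<le> nrm B b"
  using nrm_mult[of "Mp l" b] Mp_mult(1)[of l b] by (simp add: nrm_scale Mp_nrm)

text \<open>This holds for combinations by \<open>comb_nrm_le\<close> and passes to limits. The
  point of the spectrum missing from \<open>Ml\<close> is the limit of the points Q_k, so no norm is
  lost. Commutativity, the unit and positivity in B are tested on these characters.\<close>

lemma nrm_le_characters:
  assumes b: "b \<in> carrier B" and C: "\<And>l. l \<in> Ml \<Longrightarrow> cmod (chr l b) \<le> C"
  shows "nrm B b \<le> C"
proof (rule field_le_epsilon)
  fix e :: real assume "e > 0"
  then obtain K c where "nrm B (vdiff B (comb K c) b) < e/2"
    by (rule approximation[OF b half_gt_zero])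
  moreover define u where u: "u = comb K c"
  ultimately have ub: "nrm B (vdiff B u b) < e/2" by simp
  have "cmod (ext K c l) \<le> C + e/2" if l: "l \<in> Ml" for l
  proof -
    have uc: "u \<in> carrier B" by (simp add: u)
    have "chr l u = ext K c l" unfolding u using Mp_comb[OF l] l by (intro chr_eqI) auto
    moreover have "chr l u = chr l b + chr l (vdiff B u b)"
      using chr_ops(1)[OF l b, of "vdiff B u b"] uc b by simp
    ultimately have "cmod (ext K c l) \<le> cmod (chr l b) + cmod (chr l (vdiff B u b))"
      by (metis norm_triangle_ineq)
    moreover have "cmod (chr l (vdiff B u b)) < e/2"
      using chr_le[OF l, of "vdiff B u b"] ub uc b by simp
    ultimately show ?thesis using C[OF l] by linarith
  qed
  then have "nrm B u \<le> C + e/2"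
    unfolding u by (rule comb_nrm_le)
  moreover have "nrm B b \<le> nrm B u + nrm B (vdiff B b u)" using b by (intro nrm_le_vdiff) (auto simp: u)
  moreover have "nrm B (vdiff B b u) = nrm B (vdiff B u b)" using b by (intro nrm_vdiff_commute) (auto simp: u)
  ultimately show "nrm B b \<le> C + e" using ub by linarith
qed

lemma eq_zero_characters:
  assumes "b \<in> carrier B" "\<And>l. l \<in> Ml \<Longrightarrow> chr l b = 0"
  shows "b = \<zero>"
proof -
  have "nrm B b = 0" using nrm_le_characters[of b 0] assms by (intro order_antisym nrm_nonneg) auto
  then show ?thesis using assms(1) by (simp add: nrm_eq_zero)
qed

definition one :: 'b where "one = comb 0 (\<lambda>_. 1)"

lemma one_closed [simp]: "one \<in> carrier B" by (simp add: one_def)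

lemma chr_one: "l \<in> Ml \<Longrightarrow> chr l one = 1"
  using Mp_comb(1)[of l 0 "\<lambda>_. 1"] by (intro chr_eqI) (auto simp: one_def ext_def split: sum.split)

lemma eq_characters:
  assumes "a \<in> carrier B" "b \<in> carrier B" "\<And>l. l \<in> Ml \<Longrightarrow> chr l a = chr l b"
  shows "a = b"
proof -
  have "chr l (vdiff B a b) = 0" if "l \<in> Ml" for l
    using chr_ops(1)[OF that assms(1), of "(- 1) \<odot> b"] chr_ops(2)[OF that assms(2,2)] assms that
    by (simp add: vdiff_def)
  then have "vdiff B a b = \<zero>" using assms by (intro eq_zero_characters) auto
  then show ?thesis using assms by (simp add: vdiff_eq_zero_iff)
qed

lemma commutative: "\<lbrakk>a \<in> carrier B; b \<in> carrier B\<rbrakk> \<Longrightarrow> a \<otimes> b = b \<otimes> a"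
  by (rule eq_characters) (auto simp: chr_ops)

lemma unital: "unital_cstar B one"
proof
  fix a assume a: "a \<in> carrier B"
  show "one \<otimes> a = a" "a \<otimes> one = a"
    by (rule eq_characters; use a in \<open>simp add: chr_ops chr_one\<close>)+
qed simp

lemma chr_comb: "l \<in> Ml \<Longrightarrow> chr l (comb K c) = ext K c l"
  using Mp_comb(1) by (intro chr_eqI) auto

text \<open>The homomorphism is the pointwise limit of those which only use the first \<open>K\<close> of the \<open>Q k\<close> and read
  off the coefficient of \<open>R n\<close> at \<open>Q (K + 1)\<close>.\<close>

lemma hom_exists:
  assumes D: "cstar_algebra D" and mp: "mirror_projections D n r q"
  obtains \<rho> where "star_hom B D \<rho>" "\<And>i. \<lbrakk>1 \<le> i; i \<le> n + 1\<rbrakk> \<Longrightarrow> \<rho> (R i) = r i"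
    "\<And>k. 1 \<le> k \<Longrightarrow> \<rho> (Q k) = q k"
proof -
  interpret D: cstar_algebra D by fact
  interpret D: mirror_projections D n r q by fact
  define lab where "lab K l = (if l = Inl n then Inr (Suc K) else l)" for K :: nat and l :: "nat + nat"
  define f where "f K b = D.comb K (\<lambda>l. chr (lab K l) b)" for K b
  have lab: "lab K l \<in> Ml" if "l \<in> set (D.labels K)" for K l
    using that by (auto simp: lab_def D.set_labels Ml_def)
  have hom: "star_hom B D (f K)" for K
    by (rule star_homI; simp only: f_def D.comb_ops D.comb_closed)
      (auto intro!: D.comb_cong simp: lab chr_ops)
  have le: "nrm D (f K b) \<le> nrm B b" if "b \<in> carrier B" for K b
    unfolding f_def D.comb_def using that
    by (intro D.osum_nrm_le[OF D.fam_orth D.distinct_labels]) (auto simp: lab intro: chr_le nrm_nonneg)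
  have const: "f K (comb M c) = D.comb M c" if "M \<le> K" for K M c
  proof -
    have "f K (comb M c) = D.comb K (ext M c)"
      unfolding f_def using that by (intro D.comb_cong) (simp add: chr_comb[OF lab], simp add: lab_def ext_def)
    then show ?thesis using that by (simp add: D.comb_ext)
  qed
  have "\<forall>b\<in>carrier B. \<exists>d\<in>carrier D. D.conv (\<lambda>K. f K b) d"
  proof
    fix b assume b: "b \<in> carrier B"
    have fb: "f K a \<in> carrier D" if "a \<in> carrier B" for K a using star_hom_closed[OF hom that] .
    obtain d where "d \<in> carrier D" "D.conv (\<lambda>K. f K b) d"
    proof (rule D.Cauchy_convergent[of "\<lambda>K. f K b"])
      fix e :: real assume "e > 0"
      then obtain M c where "nrm B (vdiff B (comb M c) b) < e/2"
        by (rule approximation[OF b half_gt_zero])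
      moreover define u where u: "u = comb M c"
      ultimately have ub: "nrm B (vdiff B u b) < e/2" by simp
      have "nrm D (vdiff D (f K b) (D.comb M c)) < e/2" if "K \<ge> M" for K
      proof -
        have "vdiff D (f K u) (f K b) = f K (vdiff B u b)"
          using star_hom_vdiff[OF hom complex_space_axioms _ b, of u K] by (simp add: u)
        then have "nrm D (vdiff D (D.comb M c) (f K b)) \<le> nrm B (vdiff B u b)"
          using le[of "vdiff B u b" K] b const[OF that] by (simp add: u)
        then show ?thesis using ub D.nrm_vdiff_commute[OF fb[OF b, of K] D.comb_closed[of M c]] by simp
      qed
      note close = this
      have "nrm D (vdiff D (f j b) (f k b)) < e" if "j \<ge> M" "k \<ge> M" for j k
        using close[OF that(1)] close[OF that(2)] D.nrm_vdiff_triangle[OF fb[OF b, of j] D.comb_closed[of M c] fb[OF b, of k]]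
          D.nrm_vdiff_commute[OF fb[OF b, of k] D.comb_closed[of M c]] by linarith
      then show "\<exists>M. \<forall>j\<ge>M. \<forall>k\<ge>M. nrm D (vdiff D (f j b) (f k b)) < e" by blast
    qed (use fb b in auto)
    then show "\<exists>d\<in>carrier D. D.conv (\<lambda>K. f K b) d" by blast
  qed
  then obtain \<rho> where "\<forall>b\<in>carrier B. \<rho> b \<in> carrier D \<and> D.conv (\<lambda>K. f K b) (\<rho> b)"
    unfolding Bex_def by (rule bchoice[THEN exE])
  then have \<rho>: "\<And>b. b \<in> carrier B \<Longrightarrow> \<rho> b \<in> carrier D" "\<And>b. b \<in> carrier B \<Longrightarrow> D.conv (\<lambda>K. f K b) (\<rho> b)"
    by blast+
  have f: "\<And>K b. b \<in> carrier B \<Longrightarrow> f K b \<in> carrier D" using star_hom_closed[OF hom] .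
  have \<rho>I: "\<rho> b = d" if "b \<in> carrier B" "d \<in> carrier D" "D.conv (\<lambda>K. f K b) d" for b d
    by (rule D.conv_unique[OF f \<rho>(1) _ \<rho>(2)]) (rule that)+
  have \<rho>c: "\<rho> (comb M c) = D.comb M c" for M c
  proof (rule \<rho>I)
    show "D.conv (\<lambda>K. f K (comb M c)) (D.comb M c)"
      unfolding converges_to_def
      by (rule tendsto_eventually, rule eventually_sequentiallyI[of M]) (simp add: const)
  qed auto
  have "star_hom B D \<rho>"
  proof (rule star_homI)
    fix a assume a: "a \<in> carrier B"
    show "\<rho> a \<in> carrier D" by (rule \<rho>(1)[OF a])
    show "\<rho> (t \<odot> a) = t \<odot>\<^bsub>D\<^esub> \<rho> a" for t
      using D.conv_scale[OF f \<rho>, OF a a a, of t] a \<rho>(1) by (intro \<rho>I) (simp_all add: star_homD[OF hom])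
    show "\<rho> (star B a) = star D (\<rho> a)"
      using D.conv_star[OF f \<rho>, OF a a a] a \<rho>(1) by (intro \<rho>I) (simp_all add: star_homD[OF hom])
    fix b assume b: "b \<in> carrier B"
    show "\<rho> (a \<oplus> b) = \<rho> a \<oplus>\<^bsub>D\<^esub> \<rho> b"
      using D.conv_add[OF f f \<rho>(1,1,2,2), OF a b a b a b] a b \<rho>(1)
      by (intro \<rho>I) (simp_all add: star_homD[OF hom])
    show "\<rho> (a \<otimes> b) = \<rho> a \<otimes>\<^bsub>D\<^esub> \<rho> b"
      using D.conv_mult[OF f f \<rho>(1,1,2,2), OF a b a b a b] a b \<rho>(1)
      by (intro \<rho>I) (simp_all add: star_homD[OF hom])
  qed
  then show ?thesis
  proof (rule that)
    show "\<rho> (R i) = r i" if "1 \<le> i" "i \<le> n + 1" for i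
      using \<rho>c[of 0 "\<lambda>l. if l = Inl i then 1 else 0"] that by (simp only: comb_gen D.comb_gen)
    show "\<rho> (Q k) = q k" if "1 \<le> k" for k
      using \<rho>c[of k "\<lambda>l. if l = Inr k then 1 else 0"] that by (simp only: comb_gen D.comb_gen)
  qed
qed

end

section \<open>Restricted direct sums\<close>

lemma pullback_simps:
  "(a, b) \<in> carrier (cstar_pullback A B f g) \<longleftrightarrow> a \<in> carrier A \<and> b \<in> carrier B \<and> f a = g b"
  "(a, b) \<oplus>\<^bsub>cstar_pullback A B f g\<^esub> (a', b') = (a \<oplus>\<^bsub>A\<^esub> a', b \<oplus>\<^bsub>B\<^esub> b')"
  "\<zero>\<^bsub>cstar_pullback A B f g\<^esub> = (\<zero>\<^bsub>A\<^esub>, \<zero>\<^bsub>B\<^esub>)"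
  "c \<odot>\<^bsub>cstar_pullback A B f g\<^esub> (a, b) = (c \<odot>\<^bsub>A\<^esub> a, c \<odot>\<^bsub>B\<^esub> b)"
  "(a, b) \<otimes>\<^bsub>cstar_pullback A B f g\<^esub> (a', b') = (a \<otimes>\<^bsub>A\<^esub> a', b \<otimes>\<^bsub>B\<^esub> b')"
  "star (cstar_pullback A B f g) (a, b) = (star A a, star B b)"
  "nrm (cstar_pullback A B f g) (a, b) = max (nrm A a) (nrm B b)"
  by (simp_all add: cstar_pullback_def)

lemma pullback_star_algebra:
  assumes "star_algebra A" "star_algebra B" "star_algebra C" "star_hom A C f" "star_hom B C g"
  shows "star_algebra (cstar_pullback A B f g)"
proof -
  interpret A: star_algebra A by fact
  interpret B: star_algebra B by fact
  interpret C: star_algebra C by fact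
  note f = star_homD[OF assms(4)] and g = star_homD[OF assms(5)]
  have 0: "f \<zero>\<^bsub>A\<^esub> = \<zero>\<^bsub>C\<^esub>" "g \<zero>\<^bsub>B\<^esub> = \<zero>\<^bsub>C\<^esub>"
    using star_hom_zero assms A.complex_space_axioms B.complex_space_axioms C.complex_space_axioms
    by blast+
  show ?thesis
    by unfold_locales
      (auto simp: pullback_simps 0 f g A.ring_rules B.ring_rules A.add_ac B.add_ac
        A.scale_add_left B.scale_add_left)
qed

lemma corr_morphismD:
  assumes "corr_morphism X Z \<psi>X \<psi>A"
  shows "linear_map X Z \<psi>X" "star_hom (coef X) (coef Z) \<psi>A"
    "\<And>\<xi> \<eta>. \<lbrakk>\<xi> \<in> carrier X; \<eta> \<in> carrier X\<rbrakk> \<Longrightarrow> ip Z (\<psi>X \<xi>) (\<psi>X \<eta>) = \<psi>A (ip X \<xi> \<eta>)"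
    "\<And>a \<xi>. \<lbrakk>a \<in> carrier (coef X); \<xi> \<in> carrier X\<rbrakk> \<Longrightarrow> \<psi>X (lact X a \<xi>) = lact Z (\<psi>A a) (\<psi>X \<xi>)"
  using assms by (auto simp: corr_morphism_def)

text \<open>Right linearity is not an axiom of a morphism; as for representations, the difference of
  the two sides has inner product 0 with itself.\<close>

lemma corr_morphism_ract:
  assumes "cstar_correspondence X" "cstar_correspondence Z" "corr_morphism X Z \<psi>X \<psi>A"
    and \<xi>: "\<xi> \<in> carrier X" and a: "a \<in> carrier (coef X)"
  shows "\<psi>X (ract X \<xi> a) = ract Z (\<psi>X \<xi>) (\<psi>A a)"
proof -
  interpret X: cstar_correspondence X by fact
  interpret Z: cstar_correspondence Z by fact
  interpret X': star_corr X by (rule X.star_corr)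
  interpret Z': star_corr Z by (rule Z.star_corr)
  note \<psi> = corr_morphismD[OF assms(3)]
  note A = star_homD[OF \<psi>(2)]
  have c: "\<psi>X \<zeta> \<in> carrier Z" if "\<zeta> \<in> carrier X" for \<zeta> using \<psi>(1) that by auto
  let ?u = "\<psi>X (ract X \<xi> a)" and ?v = "ract Z (\<psi>X \<xi>) (\<psi>A a)"
  let ?d = "vdiff Z ?u ?v"
  have uv: "?u \<in> carrier Z" "?v \<in> carrier Z" using \<xi> a c A by auto
  have ip: "ip Z ?u ?u = \<psi>A (ip X (ract X \<xi> a) (ract X \<xi> a))"
    "ip Z ?u ?v = \<psi>A (ip X (ract X \<xi> a) (ract X \<xi> a))"
    "ip Z ?v ?u = \<psi>A (ip X (ract X \<xi> a) (ract X \<xi> a))"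
    "ip Z ?v ?v = \<psi>A (ip X (ract X \<xi> a) (ract X \<xi> a))"
    using \<xi> a c A
    by (simp_all add: \<psi>(3) X'.ip_ract_left X'.ip_ract_right Z'.ip_ract_left Z'.ip_ract_right X.coef.mult_assoc
        Z.coef.mult_assoc)
  have "ip Z \<zeta> ?d = \<zero>\<^bsub>coef Z\<^esub>" if "\<zeta> \<in> carrier Z" "ip Z \<zeta> ?u = ip Z \<zeta> ?v" for \<zeta>
    using that uv by (simp add: vdiff_def Z'.ip_add_right Z'.ip_scale_right)
  then have "ip Z ?u ?d = \<zero>\<^bsub>coef Z\<^esub>" "ip Z ?v ?d = \<zero>\<^bsub>coef Z\<^esub>" using ip uv by auto
  then have "ip Z ?d ?u = \<zero>\<^bsub>coef Z\<^esub>" "ip Z ?d ?v = \<zero>\<^bsub>coef Z\<^esub>"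
    by (subst Z'.ip_star[symmetric]; use uv in simp)+
  then have "ip Z ?d ?d = \<zero>\<^bsub>coef Z\<^esub>"
    using linear_map_vdiff[OF Z'.ip_linear[of ?d] Z.complex_space_axioms uv] uv by simp
  then have "?d = \<zero>\<^bsub>Z\<^esub>" using uv by (intro Z.ip_definite) auto
  then show ?thesis using uv Z.vdiff_eq_zero_iff by blast
qed

lemma restricted_sum_simps:
  "(\<xi>, \<eta>) \<in> carrier (restricted_sum X Y \<psi>X \<psi>A \<omega>Y \<omega>B) \<longleftrightarrow> \<xi> \<in> carrier X \<and> \<eta> \<in> carrier Y \<and> \<psi>X \<xi> = \<omega>Y \<eta>"
  "(\<xi>, \<eta>) \<oplus>\<^bsub>restricted_sum X Y \<psi>X \<psi>A \<omega>Y \<omega>B\<^esub> (\<xi>', \<eta>') = (\<xi> \<oplus>\<^bsub>X\<^esub> \<xi>', \<eta> \<oplus>\<^bsub>Y\<^esub> \<eta>')"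
  "\<zero>\<^bsub>restricted_sum X Y \<psi>X \<psi>A \<omega>Y \<omega>B\<^esub> = (\<zero>\<^bsub>X\<^esub>, \<zero>\<^bsub>Y\<^esub>)"
  "c \<odot>\<^bsub>restricted_sum X Y \<psi>X \<psi>A \<omega>Y \<omega>B\<^esub> (\<xi>, \<eta>) = (c \<odot>\<^bsub>X\<^esub> \<xi>, c \<odot>\<^bsub>Y\<^esub> \<eta>)"
  "coef (restricted_sum X Y \<psi>X \<psi>A \<omega>Y \<omega>B) = cstar_pullback (coef X) (coef Y) \<psi>A \<omega>B"
  "ract (restricted_sum X Y \<psi>X \<psi>A \<omega>Y \<omega>B) (\<xi>, \<eta>) (a, b) = (ract X \<xi> a, ract Y \<eta> b)"
  "ip (restricted_sum X Y \<psi>X \<psi>A \<omega>Y \<omega>B) (\<xi>, \<eta>) (\<xi>', \<eta>') = (ip X \<xi> \<xi>', ip Y \<eta> \<eta>')"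
  by (simp_all add: restricted_sum_def Let_def)

lemma restricted_sum_lact:
  "(\<xi>, \<eta>) \<in> carrier (restricted_sum X Y \<psi>X \<psi>A \<omega>Y \<omega>B) \<Longrightarrow>
    lact (restricted_sum X Y \<psi>X \<psi>A \<omega>Y \<omega>B) (a, b) (\<xi>, \<eta>) = (lact X a \<xi>, lact Y b \<eta>)"
  by (simp add: restricted_sum_def Let_def)

lemma vsum_restricted_sum:
  "vsum (restricted_sum X Y \<psi>X \<psi>A \<omega>Y \<omega>B) h ks = (vsum X (\<lambda>k. fst (h k)) ks, vsum Y (\<lambda>k. snd (h k)) ks)"
  by (induction ks) (simp_all add: restricted_sum_def Let_def split_def)

lemma restricted_sum_star_corr:
  assumes X: "cstar_correspondence X" and Y: "cstar_correspondence Y" and Z: "cstar_correspondence Z"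
    and \<psi>: "corr_morphism X Z \<psi>X \<psi>A" and \<omega>: "corr_morphism Y Z \<omega>Y \<omega>B"
  shows "star_corr (restricted_sum X Y \<psi>X \<psi>A \<omega>Y \<omega>B)" (is "star_corr ?W")
proof -
  interpret Xc: cstar_correspondence X by fact
  interpret Yc: cstar_correspondence Y by fact
  interpret Zc: cstar_correspondence Z by fact
  interpret X: star_corr X by (rule Xc.star_corr)
  interpret Y: star_corr Y by (rule Yc.star_corr)
  interpret Z: star_corr Z by (rule Zc.star_corr)
  note \<psi>D = corr_morphismD[OF \<psi>] and \<omega>D = corr_morphismD[OF \<omega>]
  note \<psi>r = corr_morphism_ract[OF X Z \<psi>] and \<omega>r = corr_morphism_ract[OF Y Z \<omega>]
  interpret C: star_algebra "coef ?W"
    unfolding restricted_sum_simps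
    by (rule pullback_star_algebra[OF Xc.coef.star_algebra_axioms Yc.coef.star_algebra_axioms
          Zc.coef.star_algebra_axioms \<psi>D(2) \<omega>D(2)])
  have 0: "\<psi>X \<zero>\<^bsub>X\<^esub> = \<zero>\<^bsub>Z\<^esub>" "\<omega>Y \<zero>\<^bsub>Y\<^esub> = \<zero>\<^bsub>Z\<^esub>"
    using linear_map_zero[OF \<psi>D(1)] linear_map_zero[OF \<omega>D(1)] Xc.complex_space_axioms
      Yc.complex_space_axioms Zc.complex_space_axioms by auto
  interpret V: complex_space ?W
    by unfold_locales
      (auto simp: restricted_sum_simps 0 linear_map_add[OF \<psi>D(1)] linear_map_add[OF \<omega>D(1)]
        linear_map_scale[OF \<psi>D(1)] linear_map_scale[OF \<omega>D(1)] Xc.add_assoc Yc.add_assoc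
        Xc.add_left_comm Yc.add_left_comm Xc.add_comm Yc.add_comm Xc.scale_add_right Yc.scale_add_right Xc.scale_add_left Yc.scale_add_left
        Xc.scale_scale Yc.scale_scale)
  have lact: "lact ?W (a, b) \<in> carrier ?W \<rightarrow>\<^sub>E carrier ?W" if "(a, b) \<in> carrier (coef ?W)" for a b
  proof
    fix \<zeta> assume "\<zeta> \<in> carrier ?W"
    then show "lact ?W (a, b) \<zeta> \<in> carrier ?W"
      using that by (cases \<zeta>)
        (auto simp: restricted_sum_lact restricted_sum_simps pullback_simps \<psi>D(4) \<omega>D(4))
  qed (simp add: restricted_sum_def Let_def)
  show ?thesis
  proof
    show "nrm (coef ?W) \<zero>\<^bsub>coef ?W\<^esub> = 0"
      by (simp add: restricted_sum_simps pullback_simps)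
    show "lact ?W c \<in> carrier ?W \<rightarrow>\<^sub>E carrier ?W" if "c \<in> carrier (coef ?W)" for c
      using lact[of "fst c" "snd c"] that by simp
  qed (auto simp: restricted_sum_simps pullback_simps restricted_sum_lact \<psi>r \<omega>r
      \<psi>D(3)[symmetric] \<omega>D(3)[symmetric] X.ip_add_right Y.ip_add_right X.ip_scale_right Y.ip_scale_right
      X.ip_ract_right Y.ip_ract_right X.ip_star Y.ip_star X.lact_adjoint Y.lact_adjoint
      \<psi>D(4) \<omega>D(4) star_homD[OF \<psi>D(2)] star_homD[OF \<omega>D(2)])
qed

text \<open>Both frames have the same index list and matching images in Z, so the pairs lie in the
  restricted sum and the frame formula holds in each coordinate.\<close>

lemma restricted_sum_framed:
  assumes "star_corr (restricted_sum X Y \<psi>X \<psi>A \<omega>Y \<omega>B)" (is "star_corr ?W")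
    and "framed_corr X ks w" and "framed_corr Y ks v"
    and "\<And>k. k \<in> set ks \<Longrightarrow> \<psi>X (w k) = \<omega>Y (v k)"
  shows "framed_corr (restricted_sum X Y \<psi>X \<psi>A \<omega>Y \<omega>B) ks (\<lambda>k. (w k, v k))"
proof -
  interpret W: star_corr ?W by fact
  interpret X: framed_corr X ks w by fact
  interpret Y: framed_corr Y ks v by fact
  show ?thesis
  proof
    show "(w k, v k) \<in> carrier ?W" if "k \<in> set ks" for k
      using that assms(4) by (simp add: restricted_sum_simps)
    fix \<zeta> assume \<zeta>: "\<zeta> \<in> carrier ?W"
    obtain \<xi> \<eta> where "\<zeta> = (\<xi>, \<eta>)" by (cases \<zeta>)
    then show "vsum ?W (\<lambda>k. ract ?W (w k, v k) (ip ?W (w k, v k) \<zeta>)) ks = \<zeta>"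
      using \<zeta> by (simp add: vsum_restricted_sum restricted_sum_simps X.frame Y.frame)
  qed
qed

section \<open>The mirror correspondence\<close>

text \<open>A common index set for frames of \<open>X\<close>, of \<open>Y\<close> and of their restricted sum; the frames are padded
  with zeros.\<close>

definition widx :: "nat \<Rightarrow> ((nat \<times> nat) + nat) list" where
  "widx n = map Inl (tri n (n + 1)) @ map Inr (filter (\<lambda>i. i < n) (nats n))"

lemma set_widx: "set (widx n) = Inl ` {(i, j). 1 \<le> i \<and> i \<le> n \<and> i \<le> j \<and> j \<le> n + 1} \<union> Inr ` {1..<n}"
  by (auto simp: widx_def)

lemma distinct_widx: "distinct (widx n)"
  by (auto simp: widx_def distinct_map inj_on_def)

locale mirror_module =
  fixes n :: nat and Y :: "('y, 'b) corr" (structure) and R Q x xn y y' ys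
  assumes mirror: "mirror_corr n Y R Q x xn y y' ys" and n_pos: "1 \<le> n"
begin

sublocale cstar_correspondence Y
  using mirror by (simp add: mirror_corr_def)

sublocale star_corr Y by (rule star_corr)

lemma mirror_coef: "orthogonal_projections (coef Y) {1..n+1} R"
  "orthogonal_projections (coef Y) {1..} Q" "\<forall>j\<ge>1. Q j \<otimes>\<^bsub>coef Y\<^esub> R n = Q j"
  "cstar_generated (coef Y) (R ` {1..n+1} \<union> Q ` {1..}) = carrier (coef Y)"
  using mirror unfolding mirror_corr_def by - (elim conjE, assumption)+

sublocale B: mirror_algebra "coef Y" n R Q
  by unfold_locales (use mirror_coef n_pos in simp_all)

lemma mirror_module:
  "\<forall>i\<in>{1..<n}. \<forall>j\<in>{i..n+1}. x i j \<in> carrier Y" "y \<in> carrier Y" "y' \<in> carrier Y"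
  "\<forall>i\<in>{1..<n}. \<forall>j\<in>{i..n+1}. \<forall>k\<in>{1..<n}. \<forall>l\<in>{k..n+1}.
        ip Y (x i j) (x k l) = (if i = k \<and> j = l then R j else \<zero>\<^bsub>coef Y\<^esub>)"
  "ip Y y y = R n" "ip Y y y' = Q 1" "ip Y y' y' = Q 1" "\<forall>i\<ge>1. ip Y y (ys i) = Q (i + 1)"
  "\<forall>i\<ge>1. \<forall>j\<ge>1. ip Y (ys i) (ys j) = (if i = j then Q (i + 1) else \<zero>\<^bsub>coef Y\<^esub>)"
  "\<forall>i\<in>{1..<n}. \<forall>j\<in>{i..n+1}.
        ip Y (x i j) y = \<zero>\<^bsub>coef Y\<^esub> \<and> ip Y (x i j) y' = \<zero>\<^bsub>coef Y\<^esub> \<and>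
        (\<forall>k\<ge>1. ip Y (x i j) (ys k) = \<zero>\<^bsub>coef Y\<^esub>)"
  "\<forall>i\<in>{1..<n}. \<forall>j\<in>{i..n+1}.
        (\<forall>k\<in>{1..n+1}. ract Y (x i j) (R k) = (if j = k then x i j else \<zero>)) \<and>
        (\<forall>k\<ge>1. ract Y (x i j) (Q k) = (if j = n then xn i k else \<zero>))"
  "\<forall>k\<in>{1..n+1}. ract Y y (R k) = (if n = k then y else \<zero>)"
  "ract Y y (Q 1) = y'" "\<forall>k\<ge>2. ract Y y (Q k) = ys (k - 1)"
  "\<forall>i\<in>{1..<n}. \<forall>j\<in>{i..n+1}.
        (\<forall>k\<in>{1..n+1}. lact Y (R k) (x i j) = (if i = k then x i j else \<zero>)) \<and>
        (\<forall>k\<ge>1. lact Y (Q k) (x i j) = \<zero>)"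
  "\<forall>k\<in>{1..n+1}.
        lact Y (R k) y = (if n = k then vdiff Y y y' else \<zero>) \<oplus> (if n + 1 = k then y' else \<zero>) \<and>
        lact Y (R k) y' = (if n + 1 = k then y' else \<zero>) \<and>
        (\<forall>i\<ge>1. lact Y (R k) (ys i) = (if n = k then ys i else \<zero>))"
  "\<forall>k\<ge>1. lact Y (Q k) y = ys k \<and> lact Y (Q k) y' = \<zero> \<and>
        (\<forall>i\<ge>1. lact Y (Q k) (ys i) = (if i = k then ys i else \<zero>))"
  using mirror unfolding mirror_corr_def by - (elim conjE, assumption)+

lemma x_closed [simp]: "\<lbrakk>1 \<le> i; i < n; i \<le> j; j \<le> n + 1\<rbrakk> \<Longrightarrow> x i j \<in> carrier Y"
  and y_closed [simp]: "y \<in> carrier Y"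
  and y'_closed [simp]: "y' \<in> carrier Y"
  using mirror_module(1-3) by simp_all

lemma ip_x: "\<lbrakk>1 \<le> i; i < n; i \<le> j; j \<le> n + 1; 1 \<le> k; k < n; k \<le> l; l \<le> n + 1\<rbrakk>
    \<Longrightarrow> ip Y (x i j) (x k l) = (if i = k \<and> j = l then R j else \<zero>\<^bsub>coef Y\<^esub>)"
  and ip_y: "ip Y y y = R n" "ip Y y y' = Q 1" "ip Y y' y' = Q 1"
  and ip_y_ys: "1 \<le> k \<Longrightarrow> ip Y y (ys k) = Q (k + 1)"
  and ip_ys: "1 \<le> k \<Longrightarrow> ip Y (ys k) (ys k) = Q (k + 1)"
  and ip_xy: "\<lbrakk>1 \<le> i; i < n; i \<le> j; j \<le> n + 1\<rbrakk> \<Longrightarrow> ip Y (x i j) y = \<zero>\<^bsub>coef Y\<^esub>"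
  using mirror_module(4-10) by simp_all

lemma ip_yx: "\<lbrakk>1 \<le> i; i < n; i \<le> j; j \<le> n + 1\<rbrakk> \<Longrightarrow> ip Y y (x i j) = \<zero>\<^bsub>coef Y\<^esub>"
  by (subst ip_star[symmetric]) (auto simp: ip_xy)

lemma ract_x: "\<lbrakk>1 \<le> i; i < n; i \<le> j; j \<le> n + 1\<rbrakk> \<Longrightarrow> ract Y (x i j) (R j) = x i j"
  and ract_xn: "\<lbrakk>1 \<le> i; i < n; 1 \<le> k\<rbrakk> \<Longrightarrow> ract Y (x i n) (Q k) = xn i k"
  and ract_y: "ract Y y (R n) = y" "ract Y y (Q 1) = y'"
  and ract_ys: "1 \<le> k \<Longrightarrow> ract Y y (Q (k + 1)) = ys k"
proof -
  note r = mirror_module(11-14)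
  show "\<lbrakk>1 \<le> i; i < n; i \<le> j; j \<le> n + 1\<rbrakk> \<Longrightarrow> ract Y (x i j) (R j) = x i j"
    "\<lbrakk>1 \<le> i; i < n; 1 \<le> k\<rbrakk> \<Longrightarrow> ract Y (x i n) (Q k) = xn i k"
    using r(1) by auto
  show "ract Y y (R n) = y" using r(2) n_pos by auto
  show "ract Y y (Q 1) = y'" by fact
  show "1 \<le> k \<Longrightarrow> ract Y y (Q (k + 1)) = ys k" using r(4)[rule_format, of "k + 1"] by simp
qed

lemma lact_x: "\<lbrakk>1 \<le> i; i < n; i \<le> j; j \<le> n + 1; 1 \<le> k; k \<le> n + 1\<rbrakk>
    \<Longrightarrow> lact Y (R k) (x i j) = (if i = k then x i j else \<zero>)"
  and lact_Q_x: "\<lbrakk>1 \<le> i; i < n; i \<le> j; j \<le> n + 1; 1 \<le> k\<rbrakk> \<Longrightarrow> lact Y (Q k) (x i j) = \<zero>"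
  and lact_Q_y: "1 \<le> k \<Longrightarrow> lact Y (Q k) y = ys k"
  and lact_Q_y': "1 \<le> k \<Longrightarrow> lact Y (Q k) y' = \<zero>"
  and lact_R_y: "\<lbrakk>1 \<le> k; k \<le> n + 1\<rbrakk> \<Longrightarrow> lact Y (R k) y
    = (if n = k then vdiff Y y y' else \<zero>) \<oplus> (if n + 1 = k then y' else \<zero>)"
  and lact_R_y': "\<lbrakk>1 \<le> k; k \<le> n + 1\<rbrakk> \<Longrightarrow> lact Y (R k) y' = (if n + 1 = k then y' else \<zero>)"
  using mirror_module(15-17) by simp_all

lemma ys_closed [simp]: "1 \<le> k \<Longrightarrow> ys k \<in> carrier Y"
  using ract_ys[of k] ract_closed[of y "Q (k + 1)"] by simp

text \<open>Partners for the frame of X: the edges of X into vertex n + 1 are paired with 0, the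
  loop (n, n) with y, and the \<open>Inr\<close> entries are the edges of Y into its own vertex n +
  1. The vectors xn, y' and ys are right multiples of \<open>x i n\<close> and y by the Q_k.\<close>

definition yf :: "(nat \<times> nat) + nat \<Rightarrow> 'y" where
  "yf k = (case k of Inl (i, j) \<Rightarrow> if j = n + 1 then \<zero> else if i < n then x i j else y
     | Inr i \<Rightarrow> x i (n + 1))"

lemma yf_closed [simp]: "k \<in> set (widx n) \<Longrightarrow> yf k \<in> carrier Y"
  by (auto simp: set_widx yf_def)

lemma yf_orth: "\<lbrakk>k \<in> set (widx n); l \<in> set (widx n); k \<noteq> l\<rbrakk> \<Longrightarrow> ip Y (yf k) (yf l) = \<zero>\<^bsub>coef Y\<^esub>"
proof -
  assume kl: "k \<in> set (widx n)" "l \<in> set (widx n)" "k \<noteq> l"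
  show ?thesis using kl n_pos by (auto simp: set_widx yf_def ip_x ip_xy ip_yx split: if_splits)
qed

lemma yf_ract: "k \<in> set (widx n) \<Longrightarrow> ract Y (yf k) (ip Y (yf k) (yf k)) = yf k"
proof -
  assume k: "k \<in> set (widx n)"
  have 0: "ract Y \<zero> \<zero>\<^bsub>coef Y\<^esub> = \<zero>" by simp
  show ?thesis using k n_pos
    by (auto simp: set_widx yf_def ip_x ip_y ract_x ract_y 0 split: if_splits)
qed

definition proj :: "'y \<Rightarrow> 'y" where
  "proj \<eta> = vsum Y (\<lambda>k. ract Y (yf k) (ip Y (yf k) \<eta>)) (widx n)"

lemma proj_closed [simp]: "\<eta> \<in> carrier Y \<Longrightarrow> proj \<eta> \<in> carrier Y"
  unfolding proj_def by (intro vsum_closed) auto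

lemma proj_add: "\<lbrakk>\<xi> \<in> carrier Y; \<eta> \<in> carrier Y\<rbrakk> \<Longrightarrow> proj (\<xi> \<oplus> \<eta>) = proj \<xi> \<oplus> proj \<eta>"
  unfolding proj_def by (subst vsum_add[symmetric]) (auto intro!: vsum_cong simp: ip_add_right ract_add_right)

lemma proj_scale: "\<xi> \<in> carrier Y \<Longrightarrow> proj (c \<odot> \<xi>) = c \<odot> proj \<xi>"
  unfolding proj_def by (subst vsum_scale[symmetric]) (auto intro!: vsum_cong simp: ip_scale_right ract_scale_right)

lemma proj_vdiff: "\<lbrakk>\<xi> \<in> carrier Y; \<eta> \<in> carrier Y\<rbrakk> \<Longrightarrow> proj (vdiff Y \<xi> \<eta>) = vdiff Y (proj \<xi>) (proj \<eta>)"
  by (simp add: vdiff_def proj_add proj_scale)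

lemma vsum_ract: "\<lbrakk>\<And>k. k \<in> set ks \<Longrightarrow> f k \<in> carrier Y; a \<in> carrier (coef Y)\<rbrakk>
    \<Longrightarrow> ract Y (vsum Y f ks) a = vsum Y (\<lambda>k. ract Y (f k) a) ks"
proof (induction ks)
  case Nil
  then show ?case using ract_scale_left[of \<zero> a 0] ract_closed[of \<zero> a] by simp
qed (simp add: ract_add_left)

lemma proj_ract: "\<lbrakk>\<xi> \<in> carrier Y; a \<in> carrier (coef Y)\<rbrakk> \<Longrightarrow> proj (ract Y \<xi> a) = ract Y (proj \<xi>) a"
  unfolding proj_def by (subst vsum_ract) (auto intro!: vsum_cong simp: ip_ract_right ract_mult)

lemma proj_yf: "l \<in> set (widx n) \<Longrightarrow> proj (yf l) = yf l"
  unfolding proj_def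
  by (subst vsum_single[where l = l]) (auto simp: distinct_widx yf_orth yf_ract)

lemma ip_yf_residue:
  assumes "\<eta> \<in> carrier Y" and l: "l \<in> set (widx n)"
  shows "ip Y (yf l) (vdiff Y \<eta> (proj \<eta>)) = \<zero>\<^bsub>coef Y\<^esub>"
proof -
  have "ip Y (yf l) (proj \<eta>) = vsum (coef Y) (\<lambda>k. ip Y (yf l) (ract Y (yf k) (ip Y (yf k) \<eta>))) (widx n)"
    unfolding proj_def using assms by (intro ip_vsum) auto
  also have "\<dots> = ip Y (yf l) (ract Y (yf l) (ip Y (yf l) \<eta>))"
    using assms by (intro coef.vsum_single) (auto simp: distinct_widx ip_ract_right yf_orth)
  also have "\<dots> = ip Y (ract Y (yf l) (ip Y (yf l) (yf l))) \<eta>"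
    using assms by (simp add: ip_ract_right ip_ract_left ip_star)
  also have "\<dots> = ip Y (yf l) \<eta>" using l by (simp add: yf_ract)
  finally show ?thesis
    using assms linear_map_vdiff[OF ip_linear complex_space_axioms, of "yf l" \<eta> "proj \<eta>"] by simp
qed

text \<open>Bessel's inequality, checked on the characters of \<open>B\<close>.\<close>

lemma residue_mod_norm_le:
  assumes \<eta>: "\<eta> \<in> carrier Y"
  shows "mod_norm Y (vdiff Y \<eta> (proj \<eta>)) \<le> mod_norm Y \<eta>"
proof -
  define \<zeta> where "\<zeta> = vdiff Y \<eta> (proj \<eta>)"
  have \<zeta>: "\<zeta> \<in> carrier Y" using \<eta> by (simp add: \<zeta>_def)
  let ?c = "\<lambda>k. ip Y (yf k) \<eta>"
  let ?S = "vsum (coef Y) (\<lambda>k. star (coef Y) (?c k) \<otimes>\<^bsub>coef Y\<^esub> ?c k) (widx n)"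
  have S: "?S \<in> carrier (coef Y)" using \<eta> by (intro coef.vsum_closed) auto
  have split: "\<eta> = \<zeta> \<oplus> proj \<eta>" using \<eta> by (simp add: \<zeta>_def)
  have "ip Y \<zeta> (proj \<eta>) = vsum (coef Y) (\<lambda>k. ip Y \<zeta> (ract Y (yf k) (?c k))) (widx n)"
    unfolding proj_def using \<eta> \<zeta> by (intro ip_vsum) auto
  also have "\<dots> = \<zero>\<^bsub>coef Y\<^esub>"
  proof (rule coef.vsum_zero)
    fix k assume k: "k \<in> set (widx n)"
    have "ip Y \<zeta> (yf k) = star (coef Y) (ip Y (yf k) \<zeta>)" using k \<zeta> by (simp add: ip_star)
    also have "\<dots> = \<zero>\<^bsub>coef Y\<^esub>" using k \<eta> by (simp add: \<zeta>_def ip_yf_residue)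
    finally show "ip Y \<zeta> (ract Y (yf k) (?c k)) = \<zero>\<^bsub>coef Y\<^esub>" using k \<eta> \<zeta> by (simp add: ip_ract_right)
  qed
  finally have \<zeta>p: "ip Y \<zeta> (proj \<eta>) = \<zero>\<^bsub>coef Y\<^esub>" .
  have "ip Y \<zeta> \<eta> = ip Y \<zeta> (\<zeta> \<oplus> proj \<eta>)" by (simp only: split[symmetric])
  also have "\<dots> = ip Y \<zeta> \<zeta>" using \<zeta> \<eta> \<zeta>p by (simp add: ip_add_right)
  finally have "ip Y \<eta> \<zeta> = star (coef Y) (ip Y \<zeta> \<zeta>)" using \<zeta> \<eta> ip_star[of \<zeta> \<eta>] by simp
  then have 1: "ip Y \<eta> \<zeta> = ip Y \<zeta> \<zeta>" using \<zeta> by (simp add: ip_star)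
  have 2: "ip Y \<eta> (proj \<eta>) = ?S"
    unfolding proj_def using \<eta>
    by (subst ip_vsum) (auto intro!: vsum_cong simp: ip_ract_right ip_star)
  have "ip Y \<eta> \<eta> = ip Y \<eta> (\<zeta> \<oplus> proj \<eta>)" by (simp only: split[symmetric])
  also have "\<dots> = ip Y \<zeta> \<zeta> \<oplus>\<^bsub>coef Y\<^esub> ?S" using \<eta> \<zeta> by (simp add: ip_add_right 1 2)
  finally have sum: "ip Y \<eta> \<eta> = ip Y \<zeta> \<zeta> \<oplus>\<^bsub>coef Y\<^esub> ?S" .
  have "nrm (coef Y) (ip Y \<zeta> \<zeta>) \<le> nrm (coef Y) (ip Y \<eta> \<eta>)"
  proof (rule B.nrm_le_characters)
    fix l assume l: "l \<in> B.Ml"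
    \<comment> \<open>Positivity enters through characters: on b* b they take the value of a squared
      modulus.\<close>
    have sq: "B.chr l (star (coef Y) b \<otimes>\<^bsub>coef Y\<^esub> b) = of_real ((cmod (B.chr l b))\<^sup>2)"
      if "b \<in> carrier (coef Y)" for b
      using that l by (simp only: B.chr_ops coef.star_closed complex_norm_square mult.commute)
    have pos: "\<exists>r\<ge>0. B.chr l (vsum (coef Y) (\<lambda>k. star (coef Y) (?c k) \<otimes>\<^bsub>coef Y\<^esub> ?c k) ks) = of_real r"
      if "set ks \<subseteq> set (widx n)" for ks using that
    proof (induction ks)
      case Nil
      then show ?case using B.chr_ops(2)[OF l coef.zero_closed coef.zero_closed, of 0] by auto
    next
      case (Cons k ks)
      then obtain r where r: "r \<ge> 0" "B.chr l (vsum (coef Y) (\<lambda>k. star (coef Y) (?c k) \<otimes>\<^bsub>coef Y\<^esub> ?c k) ks) = of_real r"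
        by auto
      have "vsum (coef Y) (\<lambda>k. star (coef Y) (?c k) \<otimes>\<^bsub>coef Y\<^esub> ?c k) ks \<in> carrier (coef Y)"
        using Cons.prems \<eta> by (intro coef.vsum_closed) auto
      then have "B.chr l (vsum (coef Y) (\<lambda>k. star (coef Y) (?c k) \<otimes>\<^bsub>coef Y\<^esub> ?c k) (k # ks))
          = of_real ((cmod (B.chr l (?c k)))\<^sup>2 + r)"
        using Cons.prems \<eta> l r by (simp add: B.chr_ops(1) sq)
      then show ?case using r(1) by (intro exI[of _ "(cmod (B.chr l (?c k)))\<^sup>2 + r"]) simp
    qed
    obtain r where r: "r \<ge> 0" "B.chr l ?S = of_real r" using pos[of "widx n"] by auto
    obtain b where b: "b \<in> carrier (coef Y)" "ip Y \<zeta> \<zeta> = star (coef Y) b \<otimes>\<^bsub>coef Y\<^esub> b"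
      using ip_positive[OF \<zeta>] by blast
    have \<zeta>\<zeta>: "B.chr l (ip Y \<zeta> \<zeta>) = of_real ((cmod (B.chr l b))\<^sup>2)" using b sq by simp
    have "B.chr l (ip Y \<eta> \<eta>) = of_real ((cmod (B.chr l b))\<^sup>2 + r)"
      using l \<zeta> S by (simp add: sum B.chr_ops(1) \<zeta>\<zeta> r)
    then have "cmod (B.chr l (ip Y \<eta> \<eta>)) = (cmod (B.chr l b))\<^sup>2 + r"
      using r(1) by (simp only: norm_of_real) simp
    moreover have "cmod (B.chr l (ip Y \<zeta> \<zeta>)) = (cmod (B.chr l b))\<^sup>2"
      unfolding \<zeta>\<zeta> by (simp only: norm_of_real) simp
    ultimately show "cmod (B.chr l (ip Y \<zeta> \<zeta>)) \<le> nrm (coef Y) (ip Y \<eta> \<eta>)"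
      using B.chr_le[OF l, of "ip Y \<eta> \<eta>"] r(1) \<eta> by simp
  qed (use \<zeta> in simp)
  then show ?thesis by (simp add: mod_norm_def \<zeta>_def)
qed

text \<open>\<open>proj\<close> fixes the vectors of the dense span, so the residue of \<eta> is, up
  to sign, that of s k - \<eta>. By the Bessel estimate it is bounded by the norm of this
  difference, which tends to 0.\<close>

lemma yf_expand:
  assumes \<eta>: "\<eta> \<in> carrier Y"
  shows "proj \<eta> = \<eta>"
proof -
  let ?gens = "{x i j | i j. i \<in> {1..<n} \<and> j \<in> {i..n+1}} \<union>
        {xn i j | i j. i \<in> {1..<n} \<and> j \<ge> 1} \<union> {y, y'} \<union> {ys i | i. i \<ge> 1}"
  have "carrier Y = norm_closure Y (mod_norm Y) (lin_span Y ?gens)"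
    using mirror unfolding mirror_corr_def by (elim conjE)
  then obtain s where s: "\<forall>k. s k \<in> lin_span Y ?gens" "converges_to Y (mod_norm Y) s \<eta>"
    using \<eta> unfolding norm_closure_def by blast
  let ?T = "{\<xi> \<in> carrier Y. proj \<xi> = \<xi>}"
  have T: "subspace_of ?T Y"
    using proj_scale[of \<zero> 0] by (auto simp: subspace_of_def proj_add proj_scale)
  have Tr: "ract Y \<xi> a \<in> ?T" if "\<xi> \<in> ?T" "a \<in> carrier (coef Y)" for \<xi> a
    using that by (auto simp: proj_ract)
  have Tyf: "yf k \<in> ?T" if "k \<in> set (widx n)" for k using that by (simp add: proj_yf)
  have Tx: "x i j \<in> ?T" if "1 \<le> i" "i < n" "i \<le> j" "j \<le> n + 1" for i j
  proof (cases "j = n + 1")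
    case True
    then show ?thesis using Tyf[of "Inr i"] that by (simp add: set_widx yf_def)
  next
    case False
    then show ?thesis using Tyf[of "Inl (i, j)"] that by (simp add: set_widx yf_def image_iff)
  qed
  have Ty: "y \<in> ?T" using Tyf[of "Inl (n, n)"] n_pos by (simp add: set_widx yf_def image_iff)
  have gens: "?gens \<subseteq> ?T"
  proof -
    have "xn i k \<in> ?T" if "1 \<le> i" "i < n" "1 \<le> k" for i k
      using Tr[OF Tx[of i n], of "Q k"] that by (simp add: ract_xn)
    moreover have "y' \<in> ?T" using Tr[OF Ty, of "Q 1"] unfolding ract_y by simp
    moreover have "ys k \<in> ?T" if "1 \<le> k" for k
      using Tr[OF Ty, of "Q (k + 1)"] that unfolding ract_ys[OF that] by simp
    ultimately show ?thesis using Tx Ty by auto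
  qed
  have sT: "s k \<in> ?T" for k using lin_span_induct[OF s(1)[rule_format] T gens] .
  define \<zeta> where "\<zeta> = vdiff Y \<eta> (proj \<eta>)"
  have \<zeta>: "\<zeta> \<in> carrier Y" using \<eta> by (simp add: \<zeta>_def)
  have le: "mod_norm Y \<zeta> \<le> mod_norm Y (vdiff Y (s k) \<eta>)" for k
  proof -
    have sk: "s k \<in> carrier Y" "proj (s k) = s k" using sT by auto
    have "vdiff Y (vdiff Y (s k) \<eta>) (proj (vdiff Y (s k) \<eta>)) = (- 1) \<odot> \<zeta>"
      unfolding proj_vdiff[OF sk(1) \<eta>] sk(2) \<zeta>_def
      by (rule vdiff_eqI) (use sk \<eta> in \<open>auto simp: vdiff_def scale_add_right scale_scale add_ac\<close>)
    moreover have "mod_norm Y ((- 1) \<odot> \<zeta>) = mod_norm Y \<zeta>"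
    proof -
      have "ip Y ((- 1) \<odot> \<zeta>) \<zeta> = star (coef Y) (ip Y \<zeta> ((- 1) \<odot> \<zeta>))" using \<zeta> by (simp add: ip_star)
      also have "\<dots> = (- 1) \<odot>\<^bsub>coef Y\<^esub> ip Y \<zeta> \<zeta>" using \<zeta> by (simp add: ip_scale_right coef.star_scale ip_star)
      finally have "ip Y ((- 1) \<odot> \<zeta>) ((- 1) \<odot> \<zeta>) = ip Y \<zeta> \<zeta>"
        using \<zeta> by (simp add: ip_scale_right coef.scale_scale)
      then show ?thesis by (simp add: mod_norm_def)
    qed
    ultimately show ?thesis using residue_mod_norm_le[of "vdiff Y (s k) \<eta>"] sk \<eta> by simp
  qed
  have "mod_norm Y \<zeta> \<le> 0"
    by (rule LIMSEQ_le_const[OF s(2)[unfolded converges_to_def]]) (use le in auto)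
  then have "nrm (coef Y) (ip Y \<zeta> \<zeta>) = 0"
    using \<zeta> by (intro order_antisym coef.nrm_nonneg) (auto simp: mod_norm_def)
  then have "\<zeta> = \<zero>" using \<zeta> by (intro ip_definite) (auto simp: coef.nrm_eq_zero)
  then show ?thesis using \<eta> by (simp add: \<zeta>_def vdiff_eq_zero_iff)
qed

sublocale framed_corr Y "widx n" yf
  by unfold_locales (use yf_expand in \<open>auto simp: proj_def\<close>)

lemma character_lact_x:
  assumes b: "b \<in> carrier (coef Y)" and ij: "1 \<le> i" "i < n" "i \<le> j" "j \<le> n + 1"
  shows "lact Y b (x i j) = B.chr (Inl i) b \<odot> x i j"
proof -
  have Ri: "R i \<in> carrier (coef Y)" and l: "Inl i \<in> B.Ml" using ij by (auto simp: B.Ml_def)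
  have "lact Y b (x i j) = lact Y b (lact Y (R i) (x i j))" using ij by (simp add: lact_x)
  also have "\<dots> = lact Y (b \<otimes>\<^bsub>coef Y\<^esub> R i) (x i j)" using b Ri ij by (simp add: lact_ops)
  also have "b \<otimes>\<^bsub>coef Y\<^esub> R i = B.chr (Inl i) b \<odot>\<^bsub>coef Y\<^esub> R i"
    using B.Mp_mult(2)[OF l b] by (simp add: B.Mp_def)
  finally show ?thesis using Ri ij by (simp add: lact_ops lact_x)
qed

text \<open>Each minimal projection acts nontrivially on some frame vector: R_i with i < n on
  \<open>x i i\<close>, and R_{n+1} and Q_k on y, with images y' and \<open>ys k\<close>. So every
  character of b vanishes.\<close>

lemma lact_faithful:
  assumes b: "b \<in> carrier (coef Y)" and 0: "\<And>k. k \<in> set (widx n) \<Longrightarrow> lact Y b (yf k) = \<zero>"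
  shows "b = \<zero>\<^bsub>coef Y\<^esub>"
proof (rule B.eq_zero_characters[OF b])
  fix l assume l: "l \<in> B.Ml"
  have y0: "lact Y b y = \<zero>" using 0[of "Inl (n, n)"] n_pos by (simp add: set_widx yf_def image_iff)
  have key: "B.chr l b = 0"
    if c: "a \<in> carrier (coef Y)" "B.Mp l = a" and \<zeta>: "\<zeta> \<in> carrier Y" "lact Y b \<zeta> = \<zero>" "ip Y (lact Y a \<zeta>) (lact Y a \<zeta>) \<noteq> \<zero>\<^bsub>coef Y\<^esub>" for a \<zeta>
  proof (rule ccontr)
    assume ne: "B.chr l b \<noteq> 0"
    have lin: "linear_map Y Y (lact Y a)" by (rule adjointable_linear[OF lact_adjointable[OF c(1)]])
    have "lact Y a (lact Y b \<zeta>) = lact Y (a \<otimes>\<^bsub>coef Y\<^esub> b) \<zeta>" using b c \<zeta> by (simp add: lact_ops)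
    also have "\<dots> = B.chr l b \<odot> lact Y a \<zeta>"
      using B.Mp_mult(1)[OF l b] c \<zeta> by (simp add: lact_ops)
    finally have "B.chr l b \<odot> lact Y a \<zeta> = \<zero>"
      using \<zeta> linear_map_zero[OF lin complex_space_axioms complex_space_axioms] by simp
    then have "lact Y a \<zeta> = \<zero>" using scale_cancel[OF ne, of "lact Y a \<zeta>" \<zero>] c \<zeta> by simp
    then show False using \<zeta>(3) by simp
  qed
  have nz: "R i \<noteq> \<zero>\<^bsub>coef Y\<^esub>" "Q k \<noteq> \<zero>\<^bsub>coef Y\<^esub>" if "1 \<le> i" "i \<le> n + 1" "1 \<le> k" for i k
    using B.R B.Q that by (auto simp: orthogonal_projections_def)
  consider i where "l = Inl i" "1 \<le> i" "i < n" | "l = Inl (n + 1)" | k where "l = Inr k" "1 \<le> k"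
    using l by (force simp: B.Ml_def)
  then show "B.chr l b = 0"
  proof cases
    case 1
    have "lact Y b (x i i) = \<zero>" using 0[of "Inl (i, i)"] 1 by (simp add: set_widx yf_def image_iff)
    then show ?thesis using 1 nz(1)[of i 1]
      by (intro key[of "R i" "x i i"]) (auto simp: B.Mp_def lact_x ip_x)
  next
    case 2
    then show ?thesis using y0 nz(2)[of 1 1] n_pos
      by (intro key[of "R (n + 1)" y]) (auto simp: B.Mp_def lact_R_y ip_y)
  next
    case 3
    then show ?thesis using y0 nz(2)[of 1 "k + 1"] n_pos
      by (intro key[of "Q k" y]) (auto simp: B.Mp_def lact_Q_y ip_ys)
  qed
qed

text \<open>Expresses the left action on y through the right action, b y = y \<sigma>(b). It extends
  the shift R_{n+1} -> Q_1 -> Q_2 -> ... and becomes b -> t b t* in the disc algebra.\<close>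

definition \<sigma> :: "'b \<Rightarrow> 'b" where "\<sigma> b = ip Y y (lact Y b y)"

text \<open>Since b maps each \<open>x i j\<close> to a multiple of itself, b y stays orthogonal to
  the frame vectors other than y.\<close>

lemma lact_y:
  assumes b: "b \<in> carrier (coef Y)"
  shows "lact Y b y = ract Y y (\<sigma> b)"
proof (rule frame_eqI)
  fix k assume k: "k \<in> set (widx n)"
  show "ip Y (yf k) (lact Y b y) = ip Y (yf k) (ract Y y (\<sigma> b))"
  proof (cases "yf k = y")
    case True
    have Rn: "R n \<in> carrier (coef Y)" using n_pos by simp
    have "ip Y y (ract Y y (\<sigma> b)) = R n \<otimes>\<^bsub>coef Y\<^esub> \<sigma> b"
      using b by (simp add: \<sigma>_def ip_ract_right ip_y)
    also have "\<dots> = ip Y (ract Y y (R n)) (lact Y b y)"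
      using b Rn n_pos by (simp add: \<sigma>_def ip_ract_left)
    finally show ?thesis by (simp add: True ract_y)
  next
    case False
    then consider "yf k = \<zero>" | i j where "yf k = x i j" "1 \<le> i" "i < n" "i \<le> j" "j \<le> n + 1"
      using k by (auto simp: set_widx yf_def split: if_splits)
    then show ?thesis
    proof cases
      case 1
      then show ?thesis using b by (simp add: \<sigma>_def)
    next
      case 2
      have "ip Y (x i j) (lact Y b y) = ip Y (lact Y (star (coef Y) b) (x i j)) y"
        using 2 b by (simp add: lact_adjoint)
      also have "\<dots> = star (coef Y) (ip Y y (B.chr (Inl i) (star (coef Y) b) \<odot> x i j))"
        using 2 b by (simp add: character_lact_x ip_star)
      also have "\<dots> = \<zero>\<^bsub>coef Y\<^esub>"
        using 2 by (simp add: ip_scale_right ip_yx)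
      finally show ?thesis using 2 b by (simp add: ip_ract_right ip_xy \<sigma>_def)
    qed
  qed
qed (use b in \<open>auto simp: \<sigma>_def\<close>)

lemma \<sigma>_star_hom: "star_hom (coef Y) (coef Y) \<sigma>"
proof (rule star_homI)
  fix a assume a: "a \<in> carrier (coef Y)"
  show c: "\<sigma> a \<in> carrier (coef Y)" using a by (simp add: \<sigma>_def)
  show "\<sigma> (t \<odot>\<^bsub>coef Y\<^esub> a) = t \<odot>\<^bsub>coef Y\<^esub> \<sigma> a" for t
    using a by (simp add: \<sigma>_def lact_ops ip_scale_right)
  show "\<sigma> (star (coef Y) a) = star (coef Y) (\<sigma> a)"
    using a by (simp add: \<sigma>_def ip_star lact_adjoint)
  fix b assume b: "b \<in> carrier (coef Y)"
  show "\<sigma> (a \<oplus>\<^bsub>coef Y\<^esub> b) = \<sigma> a \<oplus>\<^bsub>coef Y\<^esub> \<sigma> b"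
    using a b by (simp add: \<sigma>_def lact_ops ip_add_right)
  have cb: "\<sigma> b \<in> carrier (coef Y)" using b by (simp add: \<sigma>_def)
  have "\<sigma> (a \<otimes>\<^bsub>coef Y\<^esub> b) = ip Y y (lact Y a (ract Y y (\<sigma> b)))"
    using a b by (simp add: \<sigma>_def[of "a \<otimes>\<^bsub>coef Y\<^esub> b"] lact_ops lact_y[of b])
  also have "lact Y a (ract Y y (\<sigma> b)) = ract Y (lact Y a y) (\<sigma> b)"
    using a cb by (intro adjointable_ract lact_adjointable) auto
  also have "ip Y y \<dots> = \<sigma> a \<otimes>\<^bsub>coef Y\<^esub> \<sigma> b"
    using a cb by (simp add: ip_ract_right \<sigma>_def[of a])
  finally show "\<sigma> (a \<otimes>\<^bsub>coef Y\<^esub> b) = \<sigma> a \<otimes>\<^bsub>coef Y\<^esub> \<sigma> b" .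
qed

lemma \<sigma>_values:
  "1 \<le> k \<Longrightarrow> \<sigma> (Q k) = Q (k + 1)" "\<sigma> (R (n + 1)) = Q 1"
  "\<lbrakk>1 \<le> i; i < n\<rbrakk> \<Longrightarrow> \<sigma> (R i) = \<zero>\<^bsub>coef Y\<^esub>" "\<sigma> (R n) = vdiff (coef Y) (R n) (Q 1)"
  using n_pos linear_map_vdiff[OF ip_linear complex_space_axioms, of y y y']
  by (simp_all add: \<sigma>_def lact_Q_y lact_R_y ip_y ip_y_ys)

end

lemma widx_exhaust:
  assumes "k \<in> set (widx n)"
  obtains i where "k = Inl (i, n + 1)" "1 \<le> i" "i \<le> n"
  | i j where "k = Inl (i, j)" "1 \<le> i" "i < n" "i \<le> j" "j \<le> n"
  | "k = Inl (n, n)" | i where "k = Inr i" "1 \<le> i" "i < n"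
  using assms unfolding set_widx by fastforce

context complex_space
begin

lemma vsum_widx_row:
  assumes c: "\<And>k. k \<in> set (widx n) \<Longrightarrow> h k \<in> carrier V" and i: "1 \<le> i" "i \<le> n"
    and "\<And>i' j. \<lbrakk>1 \<le> i'; i' \<le> n; i' \<le> j; j \<le> n + 1; i' \<noteq> i\<rbrakk> \<Longrightarrow> h (Inl (i', j)) = \<zero>"
    and "\<And>i'. \<lbrakk>1 \<le> i'; i' < n; i' \<noteq> i\<rbrakk> \<Longrightarrow> h (Inr i') = \<zero>"
  shows "vsum V h (widx n) = vsum V (\<lambda>j. h (Inl (i, j))) (trow i n)
    \<oplus> (h (Inl (i, n + 1)) \<oplus> (if i < n then h (Inr i) else \<zero>))"
proof -
  have cl: "h (Inl (i', j)) \<in> carrier V" if "1 \<le> i'" "i' \<le> n" "i' \<le> j" "j \<le> n + 1" for i' j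
    using c[of "Inl (i', j)"] that by (simp add: set_widx image_iff)
  have cr: "h (Inr i') \<in> carrier V" if "1 \<le> i'" "i' < n" for i'
    using c[of "Inr i'"] that by (simp add: set_widx)
  let ?ls = "filter (\<lambda>i. i < n) (nats n)"
  have "vsum V h (widx n) = vsum V (\<lambda>x. h (Inl x)) (tri n (n + 1)) \<oplus> vsum V (\<lambda>i. h (Inr i)) ?ls"
    unfolding widx_def using cl cr by (subst vsum_append) (auto simp: vsum_map)
  also have "vsum V (\<lambda>x. h (Inl x)) (tri n (n + 1)) = vsum V (\<lambda>j. h (Inl (i, j))) (trow i (n + 1))"
    by (rule vsum_tri_row) (use assms cl in auto)
  also have "\<dots> = vsum V (\<lambda>j. h (Inl (i, j))) (trow i n) \<oplus> h (Inl (i, n + 1))"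
    using i cl by (subst trow_Suc, simp, subst vsum_append) auto
  also have "vsum V (\<lambda>i. h (Inr i)) ?ls = (if i < n then h (Inr i) else \<zero>)"
  proof (cases "i < n")
    case True
    have "vsum V (\<lambda>i. h (Inr i)) ?ls = h (Inr i)"
      by (rule vsum_single[where f = "\<lambda>i. h (Inr i)"]) (use True i assms cr in auto)
    then show ?thesis using True by simp
  next
    case False
    then show ?thesis using assms by (auto intro!: vsum_zero)
  qed
  finally show ?thesis
    using i cl cr by (subst (asm) add_assoc) auto
qed

end

lemma (in cstar_correspondence) lact_zero [simp]:
  "\<xi> \<in> carrier X \<Longrightarrow> lact X \<zero>\<^bsub>coef X\<^esub> \<xi> = \<zero>"
proof -
  assume \<xi>: "\<xi> \<in> carrier X"
  interpret star_corr X by (rule star_corr)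
  show ?thesis using lact_ops(3)[of "\<zero>\<^bsub>coef X\<^esub>" \<xi> 0] \<xi> by simp
qed

lemma (in framed_corr) lact_at_zero [simp]: "a \<in> carrier (coef X) \<Longrightarrow> lact X a \<zero> = \<zero>"
  by (rule linear_map_zero[OF adjointable_linear[OF lact_adjointable] complex_space_axioms
        complex_space_axioms])

section \<open>The two morphisms and the restricted direct sum\<close>

locale mirror_setup =
  X: triangular n "n + 1" X P w + Y: mirror_module n Y R Q x xn y y' ys + Z: triangular n n Z S z
  for n :: nat and X :: "('x, 'a) corr" and P w and Y :: "('y, 'b) corr" and R Q x xn y y' ys
    and Z :: "('z, 'c) corr" and S z +
  fixes \<psi>X :: "'x \<Rightarrow> 'z" and \<psi>A :: "'a \<Rightarrow> 'c" and \<omega>Y :: "'y \<Rightarrow> 'z" and \<omega>B :: "'b \<Rightarrow> 'c"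
  assumes \<psi>: "corr_morphism X Z \<psi>X \<psi>A" and \<omega>: "corr_morphism Y Z \<omega>Y \<omega>B"
    and \<psi>_w: "\<And>i j. \<lbrakk>1 \<le> i; i \<le> n; i \<le> j; j \<le> n\<rbrakk> \<Longrightarrow> \<psi>X (w i j) = z i j"
    and \<psi>_w_sink: "\<And>i. \<lbrakk>1 \<le> i; i \<le> n\<rbrakk> \<Longrightarrow> \<psi>X (w i (n + 1)) = \<zero>\<^bsub>Z\<^esub>"
    and \<psi>_P: "\<And>i. \<lbrakk>1 \<le> i; i \<le> n\<rbrakk> \<Longrightarrow> \<psi>A (P i) = S i" and \<psi>_P_sink: "\<psi>A (P (n + 1)) = \<zero>\<^bsub>coef Z\<^esub>"
    and \<omega>_x: "\<And>i j. \<lbrakk>1 \<le> i; i < n; i \<le> j; j \<le> n\<rbrakk> \<Longrightarrow> \<omega>Y (x i j) = z i j"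
    and \<omega>_x_sink: "\<And>i. \<lbrakk>1 \<le> i; i < n\<rbrakk> \<Longrightarrow> \<omega>Y (x i (n + 1)) = \<zero>\<^bsub>Z\<^esub>"
    and \<omega>_y: "\<omega>Y y = z n n"
    and \<omega>_R: "\<And>i. \<lbrakk>1 \<le> i; i \<le> n\<rbrakk> \<Longrightarrow> \<omega>B (R i) = S i" and \<omega>_R_sink: "\<omega>B (R (n + 1)) = \<zero>\<^bsub>coef Z\<^esub>"
    and \<omega>_Q: "\<And>k. 1 \<le> k \<Longrightarrow> \<omega>B (Q k) = \<zero>\<^bsub>coef Z\<^esub>"
begin

abbreviation W :: "('x \<times> 'y, 'a \<times> 'b) corr" where
  "W \<equiv> restricted_sum X Y \<psi>X \<psi>A \<omega>Y \<omega>B"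

lemmas \<psi>D = corr_morphismD[OF \<psi>] and \<omega>D = corr_morphismD[OF \<omega>]

lemmas \<psi>A_hom = star_homD[OF \<psi>D(2)] and \<omega>B_hom = star_homD[OF \<omega>D(2)]

lemma \<psi>\<omega>_zero [simp]: "\<psi>X \<zero>\<^bsub>X\<^esub> = \<zero>\<^bsub>Z\<^esub>" "\<omega>Y \<zero>\<^bsub>Y\<^esub> = \<zero>\<^bsub>Z\<^esub>" "\<psi>A \<zero>\<^bsub>coef X\<^esub> = \<zero>\<^bsub>coef Z\<^esub>" "\<omega>B \<zero>\<^bsub>coef Y\<^esub> = \<zero>\<^bsub>coef Z\<^esub>"
  using linear_map_zero[OF \<psi>D(1) X.complex_space_axioms Z.complex_space_axioms]
    linear_map_zero[OF \<omega>D(1) Y.complex_space_axioms Z.complex_space_axioms]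
    star_hom_zero[OF \<psi>D(2) X.coef.complex_space_axioms Z.coef.complex_space_axioms]
    star_hom_zero[OF \<omega>D(2) Y.coef.complex_space_axioms Z.coef.complex_space_axioms]
  by simp_all

definition wf :: "(nat \<times> nat) + nat \<Rightarrow> 'x" where
  "wf k = (case k of Inl (i, j) \<Rightarrow> w i j | Inr i \<Rightarrow> \<zero>\<^bsub>X\<^esub>)"

lemma wf_closed [simp]: "k \<in> set (widx n) \<Longrightarrow> wf k \<in> carrier X"
  by (auto simp: set_widx wf_def)

lemma vsum_wf:
  assumes "complex_space V" "\<And>i j. \<lbrakk>1 \<le> i; i \<le> n; i \<le> j; j \<le> n + 1\<rbrakk> \<Longrightarrow> f (Inl (i, j)) \<in> carrier V"
    "\<And>i. f (Inr i) = \<zero>\<^bsub>V\<^esub>"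
  shows "vsum V f (widx n) = vsum V (\<lambda>(i, j). f (Inl (i, j))) (tri n (n + 1))"
proof -
  interpret V: complex_space V by fact
  have "vsum V f (widx n) = vsum V (\<lambda>k. f (Inl k)) (tri n (n + 1))
      \<oplus>\<^bsub>V\<^esub> vsum V (\<lambda>k. f (Inr k)) (filter (\<lambda>i. i < n) (nats n))"
    unfolding widx_def using assms(2,3) by (subst V.vsum_append) (auto simp: vsum_map)
  also have "vsum V (\<lambda>k. f (Inr k)) (filter (\<lambda>i. i < n) (nats n)) = \<zero>\<^bsub>V\<^esub>"
    by (rule V.vsum_zero) (simp add: assms(3))
  also have "vsum V (\<lambda>k. f (Inl k)) (tri n (n + 1)) = vsum V (\<lambda>(i, j). f (Inl (i, j))) (tri n (n + 1))"
    by (intro vsum_cong) auto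
  finally show ?thesis
    using assms(2) by (subst (asm) V.add_zero) (auto intro!: V.vsum_closed)
qed

lemma X_framed: "framed_corr X (widx n) wf"
proof
  fix \<xi> assume \<xi>: "\<xi> \<in> carrier X"
  have "vsum X (\<lambda>k. ract X (wf k) (ip X (wf k) \<xi>)) (widx n)
      = vsum X (\<lambda>(i, j). ract X (wf (Inl (i, j))) (ip X (wf (Inl (i, j))) \<xi>)) (tri n (n + 1))"
    by (rule vsum_wf[OF X.complex_space_axioms]) (use \<xi> in \<open>auto simp: wf_def\<close>)
  also have "\<dots> = vsum X (\<lambda>k. ract X (case k of (i, j) \<Rightarrow> w i j) (ip X (case k of (i, j) \<Rightarrow> w i j) \<xi>)) (tri n (n + 1))"
    by (intro vsum_cong) (auto simp: wf_def)
  also have "\<dots> = \<xi>" using \<xi> by (rule X.frame)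
  finally show "vsum X (\<lambda>k. ract X (wf k) (ip X (wf k) \<xi>)) (widx n) = \<xi>" .
qed simp

lemma \<psi>\<omega>_frame: "k \<in> set (widx n) \<Longrightarrow> \<psi>X (wf k) = \<omega>Y (Y.yf k)"
proof -
  assume k: "k \<in> set (widx n)"
  then show ?thesis
    by (cases rule: widx_exhaust) (use X.n_pos in \<open>simp_all add: wf_def Y.yf_def \<psi>_w \<psi>_w_sink[simplified] \<omega>_x
      \<omega>_x_sink[simplified] \<omega>_y\<close>)
qed

sublocale W: framed_corr W "widx n" "\<lambda>k. (wf k, Y.yf k)"
  by (rule restricted_sum_framed[OF restricted_sum_star_corr[OF X.cstar_correspondence_axioms
          Y.cstar_correspondence_axioms Z.cstar_correspondence_axioms \<psi> \<omega>] X_framed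
        Y.framed_corr_axioms \<psi>\<omega>_frame])

lemmas W_simps = restricted_sum_simps pullback_simps

lemma W_lact:
  "k \<in> set (widx n) \<Longrightarrow> lact W (a, b) (wf k, Y.yf k) = (lact X a (wf k), lact Y b (Y.yf k))"
  using W.frame_closed by (rule restricted_sum_lact)

subsection \<open>The coefficient algebra \<open>A \<oplus>\<^sub>C B\<close>\<close>

text \<open>The \<open>e i\<close> are the vertices shared by the two discs, \<open>f\<close> and
  \<open>g\<close> come from their separate vertices n + 1, and the \<open>q k\<close> are the
  projections of B below R_n.\<close>

definition e :: "nat \<Rightarrow> 'a \<times> 'b" where "e i = (P i, R i)"
definition f :: "'a \<times> 'b" where "f = (P (n + 1), \<zero>\<^bsub>coef Y\<^esub>)"
definition g :: "'a \<times> 'b" where "g = (\<zero>\<^bsub>coef X\<^esub>, R (n + 1))"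
definition q :: "nat \<Rightarrow> 'a \<times> 'b" where "q k = (\<zero>\<^bsub>coef X\<^esub>, Q k)"

lemma P_closed [simp]: "\<lbrakk>1 \<le> i; i \<le> n + 1\<rbrakk> \<Longrightarrow> P i \<in> carrier (coef X)"
  and P_star [simp]: "\<lbrakk>1 \<le> i; i \<le> n + 1\<rbrakk> \<Longrightarrow> star (coef X) (P i) = P i"
  and P_mult [simp]: "\<lbrakk>1 \<le> i; i \<le> n + 1; 1 \<le> j; j \<le> n + 1\<rbrakk>
    \<Longrightarrow> P i \<otimes>\<^bsub>coef X\<^esub> P j = (if i = j then P i else \<zero>\<^bsub>coef X\<^esub>)"
  using X.A.orth by (auto simp: orth_family_def)

lemma coef_closed [simp]:
  "\<lbrakk>1 \<le> i; i \<le> n\<rbrakk> \<Longrightarrow> e i \<in> carrier (coef W)" "f \<in> carrier (coef W)" "g \<in> carrier (coef W)"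
  "1 \<le> k \<Longrightarrow> q k \<in> carrier (coef W)"
  by (simp_all add: e_def f_def g_def q_def W_simps \<psi>_P \<omega>_R \<psi>_P_sink[simplified] \<omega>_R_sink[simplified] \<omega>_Q)

lemma coef_mult:
  "\<lbrakk>1 \<le> i; i \<le> n; 1 \<le> j; j \<le> n\<rbrakk> \<Longrightarrow> e i \<otimes>\<^bsub>coef W\<^esub> e j = (if i = j then e i else \<zero>\<^bsub>coef W\<^esub>)"
  "\<lbrakk>1 \<le> i; i \<le> n\<rbrakk> \<Longrightarrow> e i \<otimes>\<^bsub>coef W\<^esub> f = \<zero>\<^bsub>coef W\<^esub>" "\<lbrakk>1 \<le> i; i \<le> n\<rbrakk> \<Longrightarrow> f \<otimes>\<^bsub>coef W\<^esub> e i = \<zero>\<^bsub>coef W\<^esub>"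
  "\<lbrakk>1 \<le> i; i \<le> n\<rbrakk> \<Longrightarrow> e i \<otimes>\<^bsub>coef W\<^esub> g = \<zero>\<^bsub>coef W\<^esub>" "\<lbrakk>1 \<le> i; i \<le> n\<rbrakk> \<Longrightarrow> g \<otimes>\<^bsub>coef W\<^esub> e i = \<zero>\<^bsub>coef W\<^esub>"
  "f \<otimes>\<^bsub>coef W\<^esub> f = f" "g \<otimes>\<^bsub>coef W\<^esub> g = g" "f \<otimes>\<^bsub>coef W\<^esub> g = \<zero>\<^bsub>coef W\<^esub>" "g \<otimes>\<^bsub>coef W\<^esub> f = \<zero>\<^bsub>coef W\<^esub>"
  "1 \<le> k \<Longrightarrow> q k \<otimes>\<^bsub>coef W\<^esub> f = \<zero>\<^bsub>coef W\<^esub>" "1 \<le> k \<Longrightarrow> e n \<otimes>\<^bsub>coef W\<^esub> q k = q k"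
  using X.n_pos
  by (auto simp: e_def f_def g_def q_def W_simps)

lemma coef_star:
  "\<lbrakk>1 \<le> i; i \<le> n\<rbrakk> \<Longrightarrow> star (coef W) (e i) = e i" "star (coef W) f = f" "star (coef W) g = g"
  "1 \<le> k \<Longrightarrow> star (coef W) (q k) = q k"
  by (simp_all add: e_def f_def g_def q_def W_simps)

lemma q_g_commute:
  assumes "c \<in> carrier (coef W)"
  shows "g \<otimes>\<^bsub>coef W\<^esub> c = c \<otimes>\<^bsub>coef W\<^esub> g" "1 \<le> k \<Longrightarrow> q k \<otimes>\<^bsub>coef W\<^esub> c = c \<otimes>\<^bsub>coef W\<^esub> q k"
  using assms by (cases c; auto simp: g_def q_def W_simps Y.B.commutative)+

lemma \<psi>A_coord:
  assumes "a \<in> carrier (coef X)" "1 \<le> i" "i \<le> n"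
  shows "coord (coef Z) S (\<psi>A a) i = coord (coef X) P a i"
proof (rule Z.A.coord_eqI)
  have "S i \<otimes>\<^bsub>coef Z\<^esub> \<psi>A a = \<psi>A (P i \<otimes>\<^bsub>coef X\<^esub> a)"
    using assms by (simp add: \<psi>A_hom \<psi>_P)
  also have "\<dots> = coord (coef X) P a i \<odot>\<^bsub>coef Z\<^esub> S i"
    using assms by (simp add: X.A.mult_P \<psi>A_hom \<psi>_P)
  finally show "S i \<otimes>\<^bsub>coef Z\<^esub> \<psi>A a = coord (coef X) P a i \<odot>\<^bsub>coef Z\<^esub> S i" .
qed (use assms in \<open>auto simp: \<psi>A_hom\<close>)

text \<open>A multiplicative section of \<open>\<psi>A\<close> that avoids P_{n+1}; it completes
  elements of B to pairs.\<close>

definition \<kappa> :: "'c \<Rightarrow> 'a" where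
  "\<kappa> c = osum (coef X) P (coord (coef Z) S c) (nats n)"

lemma orth_nats_n: "orth_family (coef X) (set (nats n)) P"
  using X.A.orth by (rule orth_family_subset) auto

lemma \<kappa>_hom: "star_hom (coef Z) (coef X) \<kappa>" and \<kappa>_S: "\<lbrakk>1 \<le> i; i \<le> n\<rbrakk> \<Longrightarrow> \<kappa> (S i) = P i"
  using Z.A.hom_exists[OF X.coef.star_algebra_axioms orth_nats_n] by (simp_all add: \<kappa>_def[abs_def])

lemma \<kappa>_coord:
  assumes "c \<in> carrier (coef Z)" "1 \<le> i" "i \<le> n + 1"
  shows "coord (coef X) P (\<kappa> c) i = (if i \<le> n then coord (coef Z) S c i else 0)"
proof (rule X.A.coord_eqI)
  show "\<kappa> c \<in> carrier (coef X)" using star_hom_closed[OF \<kappa>_hom assms(1)] .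
  show "P i \<otimes>\<^bsub>coef X\<^esub> \<kappa> c = (if i \<le> n then coord (coef Z) S c i else 0) \<odot>\<^bsub>coef X\<^esub> P i"
  proof (cases "i \<le> n")
    case True
    then show ?thesis
      using X.coef.proj_osum(1)[OF orth_nats_n, of i] assms by (simp add: \<kappa>_def)
  next
    case False
    have "P i \<otimes>\<^bsub>coef X\<^esub> \<kappa> c = vsum (coef X) (\<lambda>j. P i \<otimes>\<^bsub>coef X\<^esub> (coord (coef Z) S c j \<odot>\<^bsub>coef X\<^esub> P j)) (nats n)"
      unfolding \<kappa>_def osum_def using assms by (intro X.coef.mult_vsum) auto
    also have "\<dots> = \<zero>\<^bsub>coef X\<^esub>"
      using assms False by (intro X.coef.vsum_zero) (auto simp: X.coef.mult_scale_right)
    finally show ?thesis using False assms by simp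
  qed
qed (use assms in simp)

lemma \<psi>_\<kappa>: "c \<in> carrier (coef Z) \<Longrightarrow> \<psi>A (\<kappa> c) = c"
  using star_hom_closed[OF \<kappa>_hom]
  by (intro Z.A.eq_coords) (auto simp: \<psi>A_hom \<psi>A_coord \<kappa>_coord)

definition lift :: "'b \<Rightarrow> 'a \<times> 'b" where "lift b = (\<kappa> (\<omega>B b), b)"

lemma lift_hom: "star_hom (coef Y) (coef W) lift"
  by (rule star_homI) (simp_all add: lift_def W_simps star_homD[OF \<kappa>_hom] \<omega>B_hom \<psi>_\<kappa>)

lemma lift_values:
  "\<lbrakk>1 \<le> i; i \<le> n\<rbrakk> \<Longrightarrow> lift (R i) = e i" "lift (R (n + 1)) = g" "1 \<le> k \<Longrightarrow> lift (Q k) = q k"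
proof -
  have 0: "\<kappa> \<zero>\<^bsub>coef Z\<^esub> = \<zero>\<^bsub>coef X\<^esub>"
    using star_hom_zero[OF \<kappa>_hom Z.coef.complex_space_axioms X.coef.complex_space_axioms] .
  show "\<lbrakk>1 \<le> i; i \<le> n\<rbrakk> \<Longrightarrow> lift (R i) = e i" "lift (R (n + 1)) = g" "1 \<le> k \<Longrightarrow> lift (Q k) = q k"
    using 0 by (simp_all add: lift_def e_def g_def q_def \<omega>_R \<omega>_R_sink[simplified] \<omega>_Q \<kappa>_S)
qed

text \<open>The kernel of \<open>\<psi>A\<close> is spanned by P_{n+1}, so a pair differs from the
  lift of its second entry by a multiple of \<open>f\<close>.\<close>

lemma coef_decompose:
  assumes "c \<in> carrier (coef W)"
  obtains b t where "b \<in> carrier (coef Y)" "c = lift b \<oplus>\<^bsub>coef W\<^esub> t \<odot>\<^bsub>coef W\<^esub> f"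
proof -
  obtain a b where c: "c = (a, b)" by (cases c)
  have ab: "a \<in> carrier (coef X)" "b \<in> carrier (coef Y)" "\<psi>A a = \<omega>B b" using assms by (simp_all add: c W_simps)
  let ?t = "coord (coef X) P a (n + 1)"
  have k: "\<kappa> (\<omega>B b) \<in> carrier (coef X)" using ab by (simp add: star_hom_closed[OF \<kappa>_hom] \<omega>B_hom)
  have "a = \<kappa> (\<omega>B b) \<oplus>\<^bsub>coef X\<^esub> ?t \<odot>\<^bsub>coef X\<^esub> P (n + 1)"
  proof (rule X.A.eq_coords)
    fix i assume i: "i \<in> set (nats (n + 1))"
    have "coord (coef X) P (\<kappa> (\<omega>B b) \<oplus>\<^bsub>coef X\<^esub> ?t \<odot>\<^bsub>coef X\<^esub> P (n + 1)) i
        = coord (coef X) P (\<kappa> (\<omega>B b)) i + ?t * coord (coef X) P (P (n + 1)) i"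
      using i k X.A.coord_ops(1)[OF i k, of "?t \<odot>\<^bsub>coef X\<^esub> P (n + 1)"]
        X.A.coord_ops(2)[OF i, of "P (n + 1)"] by simp
    also have "\<dots> = coord (coef X) P a i"
    proof (cases "i \<le> n")
      case True
      then show ?thesis
        using i ab \<psi>A_coord[OF ab(1), of i] X.A.coord_P[OF i, of "n + 1"] by (simp add: \<kappa>_coord \<omega>B_hom)
    next
      case False
      then have "i = n + 1" using i by simp
      then show ?thesis using i ab X.A.coord_P[OF i, of "n + 1"] by (simp add: \<kappa>_coord \<omega>B_hom)
    qed
    finally show "coord (coef X) P a i = coord (coef X) P (\<kappa> (\<omega>B b) \<oplus>\<^bsub>coef X\<^esub> ?t \<odot>\<^bsub>coef X\<^esub> P (n + 1)) i"
      by simp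
  qed (use ab k in auto)
  then have "c = lift b \<oplus>\<^bsub>coef W\<^esub> ?t \<odot>\<^bsub>coef W\<^esub> f"
    using ab by (simp add: c lift_def f_def W_simps)
  then show ?thesis using that ab by blast
qed

lemma coef_hom_eqI:
  assumes D: "cstar_algebra D" and F: "star_hom (coef W) D F" and G: "star_hom (coef W) D G"
    and "\<And>i. \<lbrakk>1 \<le> i; i \<le> n\<rbrakk> \<Longrightarrow> F (e i) = G (e i)" "F f = G f" "F g = G g"
    "\<And>k. 1 \<le> k \<Longrightarrow> F (q k) = G (q k)" and c: "c \<in> carrier (coef W)"
  shows "F c = G c"
proof -
  interpret D: cstar_algebra D by fact
  have eq: "F (lift b) = G (lift b)" if b: "b \<in> carrier (coef Y)" for b
  proof (rule star_hom_eqI[OF Y.B.unital D star_hom_comp[OF lift_hom F] star_hom_comp[OF lift_hom G]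
        Y.B.generated _ _ b])
    show "R ` {1..n + 1} \<union> Q ` {1..} \<subseteq> carrier (coef Y)" by auto
    fix u assume "u \<in> R ` {1..n + 1} \<union> Q ` {1..}"
    then consider i where "1 \<le> i" "i \<le> n" "u = R i" | "u = R (n + 1)" | k where "1 \<le> k" "u = Q k"
      by (auto simp: le_Suc_eq)
    then show "F (lift u) = G (lift u)" by cases (simp_all add: lift_values[simplified] assms)
  qed
  obtain b t where bt: "b \<in> carrier (coef Y)" "c = lift b \<oplus>\<^bsub>coef W\<^esub> t \<odot>\<^bsub>coef W\<^esub> f"
    by (rule coef_decompose[OF c])
  have "H c = H (lift b) \<oplus>\<^bsub>D\<^esub> t \<odot>\<^bsub>D\<^esub> H f" if "star_hom (coef W) D H" for H
    using bt star_hom_closed[OF lift_hom] star_homD[OF that] by simp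
  from this[OF F] this[OF G] show ?thesis using eq[OF bt(1)] assms(5) by simp
qed

lemma lact_f: "\<zeta> \<in> carrier W \<Longrightarrow> lact W f \<zeta> = \<zero>\<^bsub>W\<^esub>"
  by (cases \<zeta>) (auto simp: f_def restricted_sum_lact W_simps X.lact_sink)

lemma katsura_W_f: "c \<in> katsura_ideal W \<Longrightarrow> c \<otimes>\<^bsub>coef W\<^esub> f = \<zero>\<^bsub>coef W\<^esub>"
  unfolding W.katsura_ideal_iff using lact_f by simp

text \<open>If d acts as 0 on W, its second entry is 0 because the left action on Y is faithful, and
  its first entry acts as 0 on X. The first entry of c vanishes at the sink, so it lies in the
  Katsura ideal of X and kills that of d.\<close>

lemma katsura_W:
  assumes c: "c \<in> carrier (coef W)" and cf: "c \<otimes>\<^bsub>coef W\<^esub> f = \<zero>\<^bsub>coef W\<^esub>"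
  shows "c \<in> katsura_ideal W"
  unfolding W.katsura_ideal_iff
proof (intro conjI ballI impI c)
  fix d assume d: "d \<in> carrier (coef W)" and ker: "\<forall>\<zeta>\<in>carrier W. lact W d \<zeta> = \<zero>\<^bsub>W\<^esub>"
  obtain a b a' b' where ab: "c = (a, b)" "d = (a', b')" by (cases c, cases d)
  then have cl: "a \<in> carrier (coef X)" "b \<in> carrier (coef Y)" "a' \<in> carrier (coef X)" "b' \<in> carrier (coef Y)"
    using c d by (simp_all add: W_simps)
  have k: "lact X a' (wf k) = \<zero>\<^bsub>X\<^esub>" "lact Y b' (Y.yf k) = \<zero>\<^bsub>Y\<^esub>" if "k \<in> set (widx n)" for k
    using bspec[OF ker W.frame_closed[OF that]] W_lact[OF that, of a' b'] by (simp_all add: ab W_simps)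
  have "b' = \<zero>\<^bsub>coef Y\<^esub>" by (rule Y.lact_faithful[OF cl(4) k(2)])
  moreover have "a \<otimes>\<^bsub>coef X\<^esub> a' = \<zero>\<^bsub>coef X\<^esub>"
  proof -
    interpret XF: framed_corr X "widx n" wf by (rule X_framed)
    have "a \<otimes>\<^bsub>coef X\<^esub> P i = \<zero>\<^bsub>coef X\<^esub>" if "n < i" "i \<le> n + 1" for i
    proof -
      have "i = n + 1" using that by simp
      then show ?thesis using cf cl by (simp add: ab f_def W_simps)
    qed
    then have aJ: "a \<in> katsura_ideal X" by (rule X.katsuraI[OF cl(1)])
    have "lact X a' \<xi> = \<zero>\<^bsub>X\<^esub>" if "\<xi> \<in> carrier X" for \<xi>
    proof -
      have "lact X a' \<xi> = lact X a' (vsum X (\<lambda>k. ract X (wf k) (ip X (wf k) \<xi>)) (widx n))"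
        using that by (simp add: XF.frame)
      also have "\<dots> = vsum X (\<lambda>k. lact X a' (ract X (wf k) (ip X (wf k) \<xi>))) (widx n)"
        using that cl by (intro linear_map_vsum[OF XF.adjointable_linear[OF XF.lact_adjointable]]
            X.complex_space_axioms) auto
      also have "\<dots> = \<zero>\<^bsub>X\<^esub>"
      proof (rule X.vsum_zero)
        fix k assume kk: "k \<in> set (widx n)"
        have "lact X a' (ract X (wf k) (ip X (wf k) \<xi>)) = ract X (lact X a' (wf k)) (ip X (wf k) \<xi>)"
          using that cl kk by (intro XF.adjointable_ract XF.lact_adjointable) auto
        also have "\<dots> = \<zero>\<^bsub>X\<^esub>"
          using k(1)[OF kk] that kk X.ract_scale_left[of "\<zero>\<^bsub>X\<^esub>" "ip X (wf k) \<xi>" 0]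
            X.ract_closed[of "\<zero>\<^bsub>X\<^esub>" "ip X (wf k) \<xi>"] by simp
        finally show "lact X a' (ract X (wf k) (ip X (wf k) \<xi>)) = \<zero>\<^bsub>X\<^esub>" .
      qed
      finally show ?thesis .
    qed
    then show ?thesis using aJ cl unfolding X.katsura_ideal_iff by blast
  qed
  ultimately show "c \<otimes>\<^bsub>coef W\<^esub> d = \<zero>\<^bsub>coef W\<^esub>" using cl by (simp add: ab W_simps)
qed

definition oneW :: "'a \<times> 'b" where "oneW = (X.A.one, Y.B.one)"

lemma oneW_closed [simp]: "oneW \<in> carrier (coef W)"
proof -
  have "\<psi>A X.A.one = Z.A.one"
    by (rule Z.A.eq_coords)
      (auto simp: \<psi>A_hom X.A.one_unit(1)[simplified] Z.A.one_unit(1) \<psi>A_coord X.coord_one[simplified] Z.coord_one)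
  moreover have "\<omega>B Y.B.one = Z.A.one"
  proof (rule Z.A.eq_coords)
    fix i assume i: "i \<in> set (nats n)"
    interpret B: unital_cstar "coef Y" Y.B.one by (rule Y.B.unital)
    have "S i \<otimes>\<^bsub>coef Z\<^esub> \<omega>B Y.B.one = \<omega>B (R i \<otimes>\<^bsub>coef Y\<^esub> Y.B.one)"
      using i by (simp add: \<omega>B_hom \<omega>_R del: B.mult_unit)
    also have "\<dots> = S i" using i by (simp add: \<omega>_R)
    finally have "coord (coef Z) S (\<omega>B Y.B.one) i = 1"
      using i by (intro Z.A.coord_eqI) (auto simp: \<omega>B_hom)
    then show "coord (coef Z) S (\<omega>B Y.B.one) i = coord (coef Z) S Z.A.one i"
      using i by (simp add: Z.coord_one)
  qed (auto simp: \<omega>B_hom Z.A.one_unit(1))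
  ultimately show ?thesis by (simp add: oneW_def W_simps X.A.one_unit(1)[simplified])
qed

lemma oneW_unit: "c \<in> carrier (coef W) \<Longrightarrow> oneW \<otimes>\<^bsub>coef W\<^esub> c = c \<and> c \<otimes>\<^bsub>coef W\<^esub> oneW = c"
proof -
  assume "c \<in> carrier (coef W)"
  interpret B: unital_cstar "coef Y" Y.B.one by (rule Y.B.unital)
  show ?thesis using \<open>c \<in> carrier (coef W)\<close>
    by (cases c) (simp add: oneW_def W_simps X.A.one_unit(2)[simplified])
qed

lemma oneW_lact: "k \<in> set (widx n) \<Longrightarrow> lact W oneW (wf k, Y.yf k) = (wf k, Y.yf k)"
proof -
  assume k: "k \<in> set (widx n)"
  interpret B: unital_cstar "coef Y" Y.B.one by (rule Y.B.unital)
  have x1: "lact Y Y.B.one (x i j) = x i j" if "1 \<le> i" "i < n" "i \<le> j" "j \<le> n + 1" for i j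
    using that Y.character_lact_x[OF Y.B.one_closed, of i j] Y.B.chr_one[of "Inl i"]
    by (simp add: Y.B.Ml_def image_iff)
  have Rc: "R n \<in> carrier (coef Y)" "R (n + 1) \<in> carrier (coef Y)" using X.n_pos by simp_all
  have lin: "linear_map Y Y (lact Y Y.B.one)"
    by (rule Y.adjointable_linear[OF Y.lact_adjointable]) simp
  \<comment> \<open>R_n and R_{n+1} cut y into y - y' and y'; the unit fixes both pieces.\<close>
  have ysplit: "y = lact Y (R n) y \<oplus>\<^bsub>Y\<^esub> lact Y (R (n + 1)) y"
    using X.n_pos by (simp add: Y.lact_R_y)
  have "lact Y Y.B.one (lact Y r y) = lact Y r y" if "r \<in> carrier (coef Y)" for r
    using that Y.lact_ops(2)[of Y.B.one y r] by simp
  then have "lact Y Y.B.one (lact Y (R n) y \<oplus>\<^bsub>Y\<^esub> lact Y (R (n + 1)) y)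
      = lact Y (R n) y \<oplus>\<^bsub>Y\<^esub> lact Y (R (n + 1)) y"
    using Rc by (simp add: linear_map_add[OF lin])
  then have y1: "lact Y Y.B.one y = y" by (simp only: ysplit[symmetric])
  have "lact Y Y.B.one (Y.yf k) = Y.yf k" using k x1 y1 by (auto simp: set_widx Y.yf_def)
  moreover have "lact X X.A.one (wf k) = wf k"
    using k by (auto simp: set_widx wf_def X.lact_one[simplified] X.A.one_unit(1)[simplified])
  ultimately show ?thesis using k by (simp add: oneW_def W_lact)
qed

end

section \<open>The Cuntz--Pimsner algebra of the restricted direct sum\<close>

context cstar_algebra
begin

text \<open>The sets used for induction on \<open>column\<close> have this shape: elements of S that
  every member of M moves into T.\<close>

lemma closed_transporter:
  assumes S: "closed_set S" "S \<subseteq> carrier A" and T: "closed_set T" and M: "M \<subseteq> carrier A"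
  shows "closed_set {a \<in> S. \<forall>x\<in>M. x \<otimes> a \<in> T}"
proof (rule closed_setI)
  fix s l assume *: "\<And>k. s k \<in> {a \<in> S. \<forall>x\<in>M. x \<otimes> a \<in> T}" "l \<in> carrier A" "conv s l"
  have sS: "s k \<in> S" "s k \<in> carrier A" for k using *(1) S(2) by blast+
  have "x \<otimes> l \<in> T" if x: "x \<in> M" for x
  proof -
    have xc: "x \<in> carrier A" using x M by blast
    show ?thesis
      by (rule closed_setD[OF T, of "\<lambda>k. x \<otimes> s k"])
        (use *(1) x xc *(2) conv_mult[OF xc sS(2) xc *(2) conv_const[OF xc] *(3)] in auto)
  qed
  moreover have "l \<in> S" by (rule closed_setD[OF S(1) sS(1) *(2,3)])
  ultimately show "l \<in> {a \<in> S. \<forall>x\<in>M. x \<otimes> a \<in> T}" by blast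
qed

lemma subspace_transporter:
  assumes "subspace_of S A" "subspace_of T A" "M \<subseteq> carrier A"
  shows "subspace_of {a \<in> S. \<forall>x\<in>M. x \<otimes> a \<in> T} A"
  using assms unfolding subspace_of_def
  by (auto simp: subset_iff mult_add_right mult_scale_right)

lemma subspace_carrier: "subspace_of (carrier A) A" "closed_set (carrier A)"
  "subspace_of {\<zero>} A" "closed_set {\<zero>}"
proof -
  show "closed_set {\<zero>}"
  proof (rule closed_setI)
    fix s l assume *: "\<And>k. s k \<in> {\<zero>}" "l \<in> carrier A" "conv s l"
    have "s = (\<lambda>_. \<zero>)" using *(1) by auto
    then have "conv (\<lambda>_. \<zero>) l" using *(3) by simp
    then have "l = \<zero>" using *(2) by (intro conv_unique[of "\<lambda>_. \<zero>"] conv_const) auto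
    then show "l \<in> {\<zero>}" by simp
  qed
qed (auto simp: subspace_of_def intro: closed_setI)

end

text \<open>An arbitrary covariant representation of W, so that the relations proved here hold in
  the universal algebra and in its quotients alike.\<close>

locale mirror_rep = mirror_setup n X P w Y R Q x xn y y' ys Z S z \<psi>X \<psi>A \<omega>Y \<omega>B + cstar_algebra D
    + R: framed_rep W "widx n" "\<lambda>k. (wf k, Y.yf k)" D \<pi>W E
  for n and X :: "('x, 'a) corr" and P w and Y :: "('y, 'b) corr" and R Q x xn y y' ys
    and Z :: "('z, 'c) corr" and S z \<psi>X \<psi>A \<omega>Y \<omega>B and D :: "'d cstar" (structure) and \<pi>W E
begin

abbreviation v :: "(nat \<times> nat) + nat \<Rightarrow> 'x \<times> 'y" where "v k \<equiv> (wf k, Y.yf k)"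

definition V :: "(nat \<times> nat) + nat \<Rightarrow> 'd" where "V k = \<pi>W (v k)"

abbreviation U :: 'd where "U \<equiv> V (Inl (n, n))"

lemma V_closed [simp]: "k \<in> set (widx n) \<Longrightarrow> V k \<in> carrier D"
  unfolding V_def by (intro R.\<rho>X_closed W.frame_closed)

lemma Inl_widx [simp]: "Inl (i, j) \<in> set (widx n) \<longleftrightarrow> 1 \<le> i \<and> i \<le> n \<and> i \<le> j \<and> j \<le> n + 1"
  and Inr_widx [simp]: "Inr i \<in> set (widx n) \<longleftrightarrow> 1 \<le> i \<and> i < n"
  by (auto simp: set_widx)

lemma U_closed [simp]: "U \<in> carrier D"
  using X.n_pos by simp

lemma E_lact_V: "\<lbrakk>c \<in> carrier (coef W); k \<in> set (widx n)\<rbrakk> \<Longrightarrow> E c \<otimes> V k = \<pi>W (lact W c (v k))"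
  unfolding V_def by (simp add: R.\<rho>X_lact W.frame_closed)

lemma V_ract_E: "\<lbrakk>c \<in> carrier (coef W); k \<in> set (widx n)\<rbrakk> \<Longrightarrow> V k \<otimes> E c = \<pi>W (ract W (v k) c)"
  unfolding V_def by (simp add: R.\<rho>X_ract W.frame_closed)

lemma V_star_V:
  assumes "k \<in> set (widx n)" "l \<in> set (widx n)"
  shows "star D (V k) \<otimes> V l = E (ip W (v k) (v l))"
  unfolding V_def using assms by (intro R.\<rho>X_ip W.frame_closed)

lemma V_orth:
  assumes kl: "k \<in> set (widx n)" "l \<in> set (widx n)" "k \<noteq> l"
  shows "star D (V k) \<otimes> V l = \<zero>"
proof -
  have "ip X (wf k) (wf l) = \<zero>\<^bsub>coef X\<^esub>"
    using kl by (auto simp: set_widx wf_def X.w_ip split: if_splits)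
  then have "ip W (v k) (v l) = \<zero>\<^bsub>coef W\<^esub>"
    using Y.yf_orth[OF kl] by (simp add: W_simps)
  then show ?thesis using kl by (simp add: V_star_V)
qed

lemma ip_v:
  "\<lbrakk>1 \<le> i; i \<le> n; i \<le> j; j \<le> n\<rbrakk> \<Longrightarrow> ip W (v (Inl (i, j))) (v (Inl (i, j))) = e j"
  "\<lbrakk>1 \<le> i; i \<le> n\<rbrakk> \<Longrightarrow> ip W (v (Inl (i, n + 1))) (v (Inl (i, n + 1))) = f"
  "\<lbrakk>1 \<le> i; i < n\<rbrakk> \<Longrightarrow> ip W (v (Inr i)) (v (Inr i)) = g"
proof -
  show "ip W (v (Inl (i, j))) (v (Inl (i, j))) = e j" if ij: "1 \<le> i" "i \<le> n" "i \<le> j" "j \<le> n"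
  proof (cases "i < n")
    case True
    then show ?thesis using ij by (simp add: W_simps wf_def Y.yf_def e_def X.w_ip Y.ip_x)
  next
    case False
    then have "i = n" "j = n" using ij by simp_all
    moreover have "ip W (v (Inl (n, n))) (v (Inl (n, n))) = e n"
      using X.n_pos by (simp add: W_simps wf_def Y.yf_def e_def X.w_ip Y.ip_y)
    ultimately show ?thesis by (simp only:)
  qed
  show "\<lbrakk>1 \<le> i; i \<le> n\<rbrakk> \<Longrightarrow> ip W (v (Inl (i, n + 1))) (v (Inl (i, n + 1))) = f"
    by (simp add: W_simps wf_def Y.yf_def f_def X.w_ip)
  show "\<lbrakk>1 \<le> i; i < n\<rbrakk> \<Longrightarrow> ip W (v (Inr i)) (v (Inr i)) = g"
    by (simp add: W_simps wf_def Y.yf_def g_def Y.ip_x)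
qed

lemma V_star_self:
  "\<lbrakk>1 \<le> i; i \<le> n; i \<le> j; j \<le> n\<rbrakk> \<Longrightarrow> star D (V (Inl (i, j))) \<otimes> V (Inl (i, j)) = E (e j)"
  "\<lbrakk>1 \<le> i; i \<le> n\<rbrakk> \<Longrightarrow> star D (V (Inl (i, n + 1))) \<otimes> V (Inl (i, n + 1)) = E f"
  "\<lbrakk>1 \<le> i; i < n\<rbrakk> \<Longrightarrow> star D (V (Inr i)) \<otimes> V (Inr i) = E g"
  using ip_v by (simp_all add: V_star_V)

lemma V_mult_self: "k \<in> set (widx n) \<Longrightarrow> V k \<otimes> (star D (V k) \<otimes> V k) = V k"
proof -
  assume k: "k \<in> set (widx n)"
  have "ract X (wf k) (ip X (wf k) (wf k)) = wf k"
    using k X.ract_zero by (auto simp: set_widx wf_def X.w_ip X.w_ract)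
  then have "ract W (v k) (ip W (v k) (v k)) = v k"
    using k by (simp add: W_simps Y.yf_ract)
  then show ?thesis
    using k W.ip_closed[OF W.frame_closed[OF k] W.frame_closed[OF k]] unfolding V_star_V[OF k k]
    by (simp add: V_ract_E) (simp add: V_def)
qed

lemma V_mult_source:
  "\<lbrakk>1 \<le> i; i \<le> n; i \<le> j; j \<le> n\<rbrakk> \<Longrightarrow> V (Inl (i, j)) \<otimes> E (e j) = V (Inl (i, j))"
  "\<lbrakk>1 \<le> i; i \<le> n\<rbrakk> \<Longrightarrow> V (Inl (i, n + 1)) \<otimes> E f = V (Inl (i, n + 1))"
  "\<lbrakk>1 \<le> i; i < n\<rbrakk> \<Longrightarrow> V (Inr i) \<otimes> E g = V (Inr i)"
  using V_mult_self[of "Inl (i, j)"] V_mult_self[of "Inl (i, n + 1)"] V_mult_self[of "Inr i"]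
  by (simp_all add: V_star_self[simplified])

lemma e_V: "\<lbrakk>1 \<le> i; i \<le> n; 1 \<le> i'; i' \<le> n; i' \<le> j; j \<le> n + 1; (i', j) \<noteq> (n, n)\<rbrakk>
    \<Longrightarrow> E (e i) \<otimes> V (Inl (i', j)) = (if i = i' then V (Inl (i', j)) else \<zero>)"
  and e_V_Inr: "\<lbrakk>1 \<le> i; i \<le> n; 1 \<le> i'; i' < n\<rbrakk> \<Longrightarrow> E (e i) \<otimes> V (Inr i') = (if i = i' then V (Inr i') else \<zero>)"
  and e_U: "\<lbrakk>1 \<le> i; i < n\<rbrakk> \<Longrightarrow> E (e i) \<otimes> U = \<zero>"
proof -
  show "E (e i) \<otimes> V (Inl (i', j)) = (if i = i' then V (Inl (i', j)) else \<zero>)"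
    if "1 \<le> i" "i \<le> n" "1 \<le> i'" "i' \<le> n" "i' \<le> j" "j \<le> n + 1" "(i', j) \<noteq> (n, n)"
  proof -
    have yf: "lact Y (R i) (Y.yf (Inl (i', j))) = (if i = i' then Y.yf (Inl (i', j)) else \<zero>\<^bsub>Y\<^esub>)"
      using that by (auto simp: Y.yf_def Y.lact_x)
    have "lact W (e i) (v (Inl (i', j))) = (if i = i' then v (Inl (i', j)) else \<zero>\<^bsub>W\<^esub>)"
      using that unfolding e_def by (subst W_lact) (simp_all add: yf wf_def X.w_lact W_simps)
    then show ?thesis using that by (subst E_lact_V) (simp_all add: V_def)
  qed
  show "E (e i) \<otimes> V (Inr i') = (if i = i' then V (Inr i') else \<zero>)"
    if "1 \<le> i" "i \<le> n" "1 \<le> i'" "i' < n"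
  proof -
    have "lact W (e i) (v (Inr i')) = (if i = i' then v (Inr i') else \<zero>\<^bsub>W\<^esub>)"
      using that unfolding e_def by (subst W_lact) (simp_all add: wf_def Y.yf_def Y.lact_x W_simps)
    then show ?thesis using that by (subst E_lact_V) (simp_all add: V_def)
  qed
  show "E (e i) \<otimes> U = \<zero>" if "1 \<le> i" "i < n"
  proof -
    have "lact W (e i) (v (Inl (n, n))) = \<zero>\<^bsub>W\<^esub>"
      using that unfolding e_def by (subst W_lact) (simp_all add: wf_def Y.yf_def X.w_lact Y.lact_R_y W_simps)
    then show ?thesis using that by (subst E_lact_V) (simp_all add: V_def)
  qed
qed

text \<open>R_n and R_{n+1} send y to y - y' and y'. This is the only frame vector whose left
  support is shared by two vertices.\<close>

lemma en_g_U: "E (e n) \<otimes> U \<oplus> E g \<otimes> U = U"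
proof -
  have n: "1 \<le> n" by (rule X.n_pos)
  have U: "Inl (n, n) \<in> set (widx n)" using n by simp
  have "lact W (e n) (v (Inl (n, n))) \<oplus>\<^bsub>W\<^esub> lact W g (v (Inl (n, n))) = v (Inl (n, n))"
    using n unfolding e_def g_def W_lact[OF U]
    by (simp add: wf_def Y.yf_def X.w_lact Y.lact_R_y W_simps)
  then have "\<pi>W (lact W (e n) (v (Inl (n, n)))) \<oplus> \<pi>W (lact W g (v (Inl (n, n)))) = U"
    using n U unfolding V_def by (subst linear_map_add[OF R.\<rho>X_linear, symmetric]) (auto simp: W.frame_closed)
  then show ?thesis using n U by (simp add: E_lact_V)
qed

lemma g_V: "\<lbrakk>k \<in> set (widx n); k \<noteq> Inl (n, n)\<rbrakk> \<Longrightarrow> E g \<otimes> V k = \<zero>"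
  and q_V: "\<lbrakk>k \<in> set (widx n); k \<noteq> Inl (n, n); 1 \<le> m\<rbrakk> \<Longrightarrow> E (q m) \<otimes> V k = \<zero>"
proof -
  assume k: "k \<in> set (widx n)" "k \<noteq> Inl (n, n)"
  consider i where "k = Inl (i, n + 1)" | i j where "k = Inl (i, j)" "1 \<le> i" "i < n" "i \<le> j" "j \<le> n"
    | i where "k = Inr i" "1 \<le> i" "i < n"
    using k(1) by (rule widx_exhaust) (use k(2) in blast)+
  then have "lact Y (R (n + 1)) (Y.yf k) = \<zero>\<^bsub>Y\<^esub> \<and> (1 \<le> m \<longrightarrow> lact Y (Q m) (Y.yf k) = \<zero>\<^bsub>Y\<^esub>)"
    by cases (simp_all add: Y.yf_def Y.lact_x Y.lact_Q_x)
  then have "lact W g (v k) = \<zero>\<^bsub>W\<^esub>" "1 \<le> m \<Longrightarrow> lact W (q m) (v k) = \<zero>\<^bsub>W\<^esub>"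
    using k by (simp_all add: g_def q_def W_lact W_simps)
  then show "E g \<otimes> V k = \<zero>" "1 \<le> m \<Longrightarrow> E (q m) \<otimes> V k = \<zero>"
    using k by (simp_all add: E_lact_V)
qed

text \<open>Moving a projection to the right past y advances it by one step of the shift; in the X
  coordinate both sides are 0.\<close>

lemma g_U: "E g \<otimes> U = U \<otimes> E (q 1)" and q_U: "1 \<le> m \<Longrightarrow> E (q m) \<otimes> U = U \<otimes> E (q (m + 1))"
proof -
  have n: "1 \<le> n" by (rule X.n_pos)
  have U: "Inl (n, n) \<in> set (widx n)" using n by simp
  have "lact W g (v (Inl (n, n))) = ract W (v (Inl (n, n))) (q 1)"
    "1 \<le> m \<Longrightarrow> lact W (q m) (v (Inl (n, n))) = ract W (v (Inl (n, n))) (q (m + 1))"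
    using n Y.ract_y(2) Y.ract_ys[of m] unfolding g_def q_def W_lact[OF U]
    by (simp_all add: wf_def Y.yf_def X.ract_zero Y.lact_R_y Y.lact_Q_y W_simps)
  then show "E g \<otimes> U = U \<otimes> E (q 1)" "1 \<le> m \<Longrightarrow> E (q m) \<otimes> U = U \<otimes> E (q (m + 1))"
    using U by (simp_all add: E_lact_V V_ract_E)
qed

text \<open>So the \<open>q k\<close> are words in \<open>U\<close>, its adjoint and
  \<open>E g\<close>, and homomorphisms that agree on \<open>U\<close> and \<open>E g\<close> agree
  on all of them.\<close>

lemma q_conj: "star D U \<otimes> E g \<otimes> U = E (q 1)"
  "1 \<le> m \<Longrightarrow> star D U \<otimes> E (q m) \<otimes> U = E (q (m + 1))"
proof -
  have n: "1 \<le> n" by (rule X.n_pos)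
  have UU: "star D U \<otimes> U = E (e n)" using V_star_self(1)[of n n] n by simp
  have eq: "E (e n) \<otimes> E (q m) = E (q m)" if "1 \<le> m" for m
    using that n by (subst R.\<rho>A(5)[symmetric]) (auto simp: coef_mult)
  show "star D U \<otimes> E g \<otimes> U = E (q 1)"
    using eq[of 1] g_U by (simp add: mult_assoc) (simp add: UU flip: mult_assoc)
  show "star D U \<otimes> E (q m) \<otimes> U = E (q (m + 1))" if "1 \<le> m"
    using eq[of "m + 1"] q_U[OF that] that by (simp add: mult_assoc) (simp add: UU flip: mult_assoc)
qed

lemma E_frame:
  assumes "c \<in> carrier (coef W)" "c \<otimes>\<^bsub>coef W\<^esub> f = \<zero>\<^bsub>coef W\<^esub>"
  shows "vsum D (\<lambda>k. E c \<otimes> (V k \<otimes> star D (V k))) (widx n) = E c"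
  using R.covariant[OF katsura_W[OF assms]] assms unfolding R.F_def V_def[symmetric]
  by (subst mult_vsum[symmetric]) auto

lemma e_row:
  assumes i: "1 \<le> i" "i \<le> n"
  shows "E (e i) = vsum D (\<lambda>j. E (e i) \<otimes> (V (Inl (i, j)) \<otimes> star D (V (Inl (i, j))))) (trow i n)
    \<oplus> (V (Inl (i, n + 1)) \<otimes> star D (V (Inl (i, n + 1)))
      \<oplus> (if i < n then V (Inr i) \<otimes> star D (V (Inr i)) else \<zero>))"
proof -
  let ?h = "\<lambda>k. E (e i) \<otimes> (V k \<otimes> star D (V k))"
  have "E (e i) = vsum D ?h (widx n)"
    using i by (intro E_frame[symmetric]) (auto simp: coef_mult)
  also have "\<dots> = vsum D (\<lambda>j. ?h (Inl (i, j))) (trow i n)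
      \<oplus> (?h (Inl (i, n + 1)) \<oplus> (if i < n then ?h (Inr i) else \<zero>))"
  proof (rule vsum_widx_row[OF _ i])
    show "?h k \<in> carrier D" if "k \<in> set (widx n)" for k using that i by simp
    show "?h (Inl (i', j)) = \<zero>" if "1 \<le> i'" "i' \<le> n" "i' \<le> j" "j \<le> n + 1" "i' \<noteq> i" for i' j
    proof -
      have "E (e i) \<otimes> V (Inl (i', j)) = \<zero>"
      proof (cases "(i', j) = (n, n)")
        case True
        then show ?thesis using e_U[of i] i that by simp
      next
        case False
        then show ?thesis using e_V[of i i' j] i that by simp
      qed
      then show ?thesis using that i by (simp flip: mult_assoc)
    qed
    show "?h (Inr i') = \<zero>" if "1 \<le> i'" "i' < n" "i' \<noteq> i" for i'
      using that i e_V_Inr[of i i'] by (simp flip: mult_assoc)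
  qed
  also have "?h (Inl (i, n + 1)) = V (Inl (i, n + 1)) \<otimes> star D (V (Inl (i, n + 1)))"
    using i e_V[of i i "n + 1"] by (simp flip: mult_assoc)
  also have "(if i < n then ?h (Inr i) else \<zero>) = (if i < n then V (Inr i) \<otimes> star D (V (Inr i)) else \<zero>)"
    using i e_V_Inr[of i i] by (simp flip: mult_assoc)
  finally show ?thesis .
qed

text \<open>Covariance at \<open>g\<close>, which kills every frame vector other than y.\<close>

lemma g_frame: "E g \<otimes> (U \<otimes> star D U) = E g"
proof -
  have "E g = vsum D (\<lambda>k. E g \<otimes> (V k \<otimes> star D (V k))) (widx n)"
    by (rule E_frame[symmetric]) (auto simp: coef_mult)
  also have "\<dots> = E g \<otimes> (U \<otimes> star D U)"
    using X.n_pos by (intro vsum_single) (auto simp: distinct_widx g_V simp flip: mult_assoc)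
  finally show ?thesis ..
qed

end

section \<open>The universal representation and the orthogonality of \<open>E g\<close> and
  \<open>E f\<close>\<close>

locale mirror_cp = mirror_setup n X P w Y R Q x xn y y' ys Z S z \<psi>X \<psi>A \<omega>Y \<omega>B + cstar_algebra D
    + C: cp_algebra W "widx n" "\<lambda>k. (wf k, Y.yf k)" D \<pi>W E
  for n and X :: "('x, 'a) corr" and P w and Y :: "('y, 'b) corr" and R Q x xn y y' ys
    and Z :: "('z, 'c) corr" and S z \<psi>X \<psi>A \<omega>Y \<omega>B and D :: "'d cstar" (structure) and \<pi>W E
begin

sublocale mirror_rep n X P w Y R Q x xn y y' ys Z S z \<psi>X \<psi>A \<omega>Y \<omega>B D \<pi>W E ..

lemma unital: "unital_cstar D (E oneW)"
  using oneW_unit oneW_lact by (intro C.unital[OF oneW_closed]) auto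

sublocale unital_cstar D "E oneW" by (rule unital)

lemma hom_eqI:
  assumes A: "cstar_algebra A" and F: "star_hom D A F" and G: "star_hom D A G"
    and V: "\<And>k. k \<in> set (widx n) \<Longrightarrow> F (V k) = G (V k)"
    and "\<And>i. \<lbrakk>1 \<le> i; i \<le> n\<rbrakk> \<Longrightarrow> F (E (e i)) = G (E (e i))"
    and "F (E f) = G (E f)" "F (E g) = G (E g)" and a: "a \<in> carrier D"
  shows "F a = G a"
proof (rule C.hom_eqI[OF unital A F G V[unfolded V_def] _ a])
  fix c assume c: "c \<in> carrier (coef W)"
  show "F (E c) = G (E c)"
  proof (rule coef_hom_eqI[OF A star_hom_comp[OF C.\<rho>A_hom F] star_hom_comp[OF C.\<rho>A_hom G] _ _ _ _ c])
    have U: "Inl (n, n) \<in> set (widx n)" using X.n_pos by simp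
    show "F (E (q k)) = G (E (q k))" if "1 \<le> k" for k
      using that
    proof (induction rule: dec_induct)
      case base
      have "H (E (q 1)) = star A (H U) \<otimes>\<^bsub>A\<^esub> H (E g) \<otimes>\<^bsub>A\<^esub> H U" if "star_hom D A H" for H
        by (subst q_conj(1)[symmetric]) (simp add: star_homD[OF that])
      from this[OF F] this[OF G] show ?case using V[OF U] assms(7) by simp
    next
      case (step m)
      have "H (star D U \<otimes> E (q m) \<otimes> U) = star A (H U) \<otimes>\<^bsub>A\<^esub> H (E (q m)) \<otimes>\<^bsub>A\<^esub> H U" if "star_hom D A H" for H
        using step(1) by (simp add: star_homD[OF that])
      from this[OF F] this[OF G] show ?case
        using V[OF U] step q_conj(2)[OF step(1)] by simp
    qed
  qed (use assms in auto)
qed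

text \<open>The closed left ideal generated by \<open>E f\<close>, obtained without using adjoints: \<open>E g\<close>
  annihilates it, because commuting past a generator turns \<open>E g\<close> or \<open>E (q k)\<close> into \<open>0\<close> or some \<open>E (q m)\<close>.\<close>

definition column :: "'d set" where
  "column = \<Inter>{C. subspace_of C D \<and> closed_set C \<and> E f \<in> C \<and>
     (\<forall>c\<in>carrier (coef W). \<forall>a\<in>C. E c \<otimes> a \<in> C) \<and> (\<forall>\<zeta>\<in>carrier W. \<forall>a\<in>C. \<pi>W \<zeta> \<otimes> a \<in> C)}"

lemma column_induct:
  assumes "a \<in> column" "subspace_of C D" "closed_set C" "E f \<in> C"
    "\<And>c a. \<lbrakk>c \<in> carrier (coef W); a \<in> C\<rbrakk> \<Longrightarrow> E c \<otimes> a \<in> C"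
    "\<And>\<zeta> a. \<lbrakk>\<zeta> \<in> carrier W; a \<in> C\<rbrakk> \<Longrightarrow> \<pi>W \<zeta> \<otimes> a \<in> C"
  shows "a \<in> C"
  using assms unfolding column_def by blast

lemma column_closed [simp]: "a \<in> column \<Longrightarrow> a \<in> carrier D"
  by (erule column_induct) (auto simp: subspace_of_def intro: closed_setI)

lemma column_invariant:
  "E f \<in> column" "\<lbrakk>c \<in> carrier (coef W); a \<in> column\<rbrakk> \<Longrightarrow> E c \<otimes> a \<in> column"
  "\<lbrakk>\<zeta> \<in> carrier W; a \<in> column\<rbrakk> \<Longrightarrow> \<pi>W \<zeta> \<otimes> a \<in> column"
  by (auto simp: column_def)

lemma column_subspace: "subspace_of column D"
  unfolding subspace_of_def
proof (intro conjI subsetI ballI allI)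
  show "\<zero> \<in> column" "\<And>a b. \<lbrakk>a \<in> column; b \<in> column\<rbrakk> \<Longrightarrow> a \<oplus> b \<in> column"
    "\<And>c a. a \<in> column \<Longrightarrow> c \<odot> a \<in> column"
    unfolding column_def subspace_of_def by blast+
qed simp

lemma column_closed_set: "closed_set column"
proof (rule closed_setI)
  fix s l assume *: "\<And>k. s k \<in> column" "l \<in> carrier D" "conv s l"
  show "l \<in> column" unfolding column_def
  proof (rule InterI)
    fix C assume "C \<in> {C. subspace_of C D \<and> closed_set C \<and> E f \<in> C \<and>
     (\<forall>c\<in>carrier (coef W). \<forall>a\<in>C. E c \<otimes> a \<in> C) \<and> (\<forall>\<zeta>\<in>carrier W. \<forall>a\<in>C. \<pi>W \<zeta> \<otimes> a \<in> C)}"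
    then have "closed_set C" "\<And>k. s k \<in> C" using *(1) unfolding column_def by blast+
    then show "l \<in> C" using *(2,3) by (rule closed_setD)
  qed
qed

text \<open>Adjoints of vectors kill \<open>E f\<close>, because \<open>f\<close> acts as 0 on W.
  They also pass the generators: \<open>star D (\<pi>W \<xi>) \<otimes> E c\<close> is the adjoint
  of another vector, and \<open>star D (\<pi>W \<xi>) \<otimes> \<pi>W \<eta>\<close> is a
  coefficient.\<close>

lemma column_star:
  assumes "a \<in> column" and \<zeta>: "\<zeta> \<in> carrier W"
  shows "star D (\<pi>W \<zeta>) \<otimes> a \<in> column"
proof -
  let ?M = "(\<lambda>\<zeta>. star D (\<pi>W \<zeta>)) ` carrier W"
  have M: "?M \<subseteq> carrier D" by auto
  have "a \<in> {a \<in> column. \<forall>x\<in>?M. x \<otimes> a \<in> column}"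
  proof (rule column_induct[OF assms(1)])
    show "subspace_of {a \<in> column. \<forall>x\<in>?M. x \<otimes> a \<in> column} D"
      by (rule subspace_transporter[OF column_subspace column_subspace M])
    show "closed_set {a \<in> column. \<forall>x\<in>?M. x \<otimes> a \<in> column}"
      by (rule closed_transporter[OF column_closed_set _ column_closed_set M]) auto
    have zero: "\<zero> \<in> column" using column_subspace by (simp add: subspace_of_def)
    have "star D (\<pi>W \<xi>) \<otimes> E f = \<zero>" if \<xi>: "\<xi> \<in> carrier W" for \<xi>
    proof -
      have "star D (\<pi>W \<xi>) \<otimes> E f = star D (E f \<otimes> \<pi>W \<xi>)"
        using \<xi> by (simp add: star_mult C.\<rho>A(6)[symmetric] coef_star)
      also have "\<dots> = \<zero>" using \<xi> by (simp add: C.\<rho>X_lact[symmetric] lact_f)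
      finally show ?thesis .
    qed
    then show "E f \<in> {a \<in> column. \<forall>x\<in>?M. x \<otimes> a \<in> column}"
      using zero column_invariant(1) by auto
    fix b assume b: "b \<in> {a \<in> column. \<forall>x\<in>?M. x \<otimes> a \<in> column}"
    show "E c \<otimes> b \<in> {a \<in> column. \<forall>x\<in>?M. x \<otimes> a \<in> column}" if c: "c \<in> carrier (coef W)" for c
    proof -
      have "star D (\<pi>W \<xi>) \<otimes> (E c \<otimes> b) \<in> column" if \<xi>: "\<xi> \<in> carrier W" for \<xi>
      proof -
        let ?\<eta> = "lact W (star (coef W) c) \<xi>"
        have \<eta>: "?\<eta> \<in> carrier W" using c \<xi> by simp
        have "star D (\<pi>W \<xi>) \<otimes> E c = star D (\<pi>W ?\<eta>)"
          using c \<xi> by (simp add: C.\<rho>X_lact star_mult C.\<rho>A(6)[symmetric])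
        then have "star D (\<pi>W \<xi>) \<otimes> (E c \<otimes> b) = star D (\<pi>W ?\<eta>) \<otimes> b"
          using c b \<xi> by (simp flip: mult_assoc)
        then show ?thesis using b \<eta> by auto
      qed
      then show ?thesis using b c column_invariant(2) by auto
    qed
    show "\<pi>W \<eta> \<otimes> b \<in> {a \<in> column. \<forall>x\<in>?M. x \<otimes> a \<in> column}" if \<eta>: "\<eta> \<in> carrier W" for \<eta>
    proof -
      have "star D (\<pi>W \<xi>) \<otimes> (\<pi>W \<eta> \<otimes> b) \<in> column" if \<xi>: "\<xi> \<in> carrier W" for \<xi>
      proof -
        have "star D (\<pi>W \<xi>) \<otimes> (\<pi>W \<eta> \<otimes> b) = E (ip W \<xi> \<eta>) \<otimes> b"
          using \<xi> \<eta> b by (simp add: C.\<rho>X_ip flip: mult_assoc)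
        then show ?thesis using b \<xi> \<eta> column_invariant(2) by simp
      qed
      then show ?thesis using b \<eta> column_invariant(3) by auto
    qed
  qed
  then show ?thesis using \<zeta> by blast
qed

lemma column_annihilated:
  assumes "a \<in> column"
  shows "E g \<otimes> a = \<zero>"
proof -
  \<comment> \<open>The \<open>q k\<close> have to be treated together with \<open>g\<close>:
    commuting \<open>g\<close> past \<open>U\<close> produces \<open>q 1\<close>, and each further
    \<open>U\<close> raises the index.\<close>
  let ?D = "insert g (q ` {1..})"
  let ?C = "{a \<in> carrier D. \<forall>x\<in>E ` ?D. x \<otimes> a \<in> {\<zero>}}"
  have D: "d \<in> carrier (coef W)" if "d \<in> ?D" for d using that by auto
  have M: "E ` ?D \<subseteq> carrier D" using D by auto
  have Ec: "E c \<otimes> b \<in> ?C" if c: "c \<in> carrier (coef W)" and b: "b \<in> ?C" for c b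
  proof -
    have "E d \<otimes> (E c \<otimes> b) = \<zero>" if d: "d \<in> ?D" for d
    proof -
      have "d \<otimes>\<^bsub>coef W\<^esub> c = c \<otimes>\<^bsub>coef W\<^esub> d" using d q_g_commute[OF c] by auto
      then have "E d \<otimes> E c = E c \<otimes> E d" using c D[OF d] by (simp add: C.\<rho>A(5)[symmetric])
      then have "E d \<otimes> (E c \<otimes> b) = E c \<otimes> (E d \<otimes> b)" using c D[OF d] b by (simp flip: mult_assoc)
      then show ?thesis using b d c by auto
    qed
    then show ?thesis using c b by auto
  qed
  have Vc: "E d \<otimes> (V k \<otimes> b) = \<zero>" if d: "d \<in> ?D" and k: "k \<in> set (widx n)" and b: "b \<in> ?C" for d k b
  proof (cases "k = Inl (n, n)")
    case True
    obtain m where m: "1 \<le> m" "E d \<otimes> U = U \<otimes> E (q m)"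
    proof (cases "d = g")
      case True
      then show ?thesis using g_U by (intro that[of 1]) auto
    next
      case False
      then obtain m where "1 \<le> m" "d = q m" using d by auto
      then show ?thesis using q_U by (intro that[of "m + 1"]) auto
    qed
    have "E d \<otimes> (U \<otimes> b) = (E d \<otimes> U) \<otimes> b" using b D[OF d] by (simp add: mult_assoc)
    also have "\<dots> = U \<otimes> (E (q m) \<otimes> b)" unfolding m(2) using m b by (simp only: mult_assoc U_closed C.\<rho>A_closed coef_closed mem_Collect_eq)
    also have "E (q m) \<otimes> b = \<zero>" using m b by auto
    finally show ?thesis using True by simp
  next
    case False
    then have "E d \<otimes> V k = \<zero>" using k d g_V q_V by auto
    then show ?thesis using D[OF d] k b by (simp flip: mult_assoc)
  qed
  have "a \<in> ?C"
  proof (rule column_induct[OF assms])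
    show "subspace_of ?C D"
      by (rule subspace_transporter[OF subspace_carrier(1,3) M])
    show "closed_set ?C"
      by (rule closed_transporter[OF subspace_carrier(2) _ subspace_carrier(4) M]) simp
    have "g \<otimes>\<^bsub>coef W\<^esub> f = \<zero>\<^bsub>coef W\<^esub>" "1 \<le> m \<Longrightarrow> q m \<otimes>\<^bsub>coef W\<^esub> f = \<zero>\<^bsub>coef W\<^esub>" for m
      by (simp_all add: coef_mult)
    then show "E f \<in> ?C" by (auto simp: C.\<rho>A(5)[symmetric])
    fix b \<zeta> assume \<zeta>: "\<zeta> \<in> carrier W" and b: "b \<in> ?C"
    have bc: "b \<in> carrier D" using b by simp
    let ?c = "\<lambda>k. ip W (v k) \<zeta>"
    have c: "?c k \<in> carrier (coef W)" if "k \<in> set (widx n)" for k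
      using \<zeta> W.frame_closed[OF that] by simp
    have "E d \<otimes> (\<pi>W \<zeta> \<otimes> b) = \<zero>" if d: "d \<in> ?D" for d
    proof -
      have "\<pi>W \<zeta> \<otimes> b = vsum D (\<lambda>k. V k \<otimes> E (?c k)) (widx n) \<otimes> b"
        using C.\<rho>X_expand[OF W.id_adjointable \<zeta>] \<zeta> by (simp add: V_def cong: vsum_cong)
      also have "\<dots> = vsum D (\<lambda>k. V k \<otimes> (E (?c k) \<otimes> b)) (widx n)"
        using c bc by (subst vsum_mult) (auto intro!: vsum_cong simp: mult_assoc)
      also have "E d \<otimes> \<dots> = vsum D (\<lambda>k. E d \<otimes> (V k \<otimes> (E (?c k) \<otimes> b))) (widx n)"
        using c bc D[OF d] by (intro mult_vsum) auto
      also have "\<dots> = \<zero>" using c b Vc[OF d _ Ec] by (intro vsum_zero) auto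
      finally show ?thesis .
    qed
    then show "\<pi>W \<zeta> \<otimes> b \<in> ?C" using \<zeta> bc by auto
  qed (rule Ec)
  then show ?thesis by auto
qed

text \<open>Elements that, together with their adjoints, map \<open>column\<close> into itself form
  a closed *-subalgebra containing the generators. So \<open>a \<otimes> E f\<close> lies in
  \<open>column\<close>, which \<open>E g\<close> kills.\<close>

lemma g_f_zero:
  assumes a: "a \<in> carrier D"
  shows "E g \<otimes> a \<otimes> E f = \<zero>"
proof -
  let ?T = "{a \<in> carrier D. (\<forall>b\<in>column. a \<otimes> b \<in> column) \<and> (\<forall>b\<in>column. star D a \<otimes> b \<in> column)}"
  have col: "\<zero> \<in> column" "\<And>a b. \<lbrakk>a \<in> column; b \<in> column\<rbrakk> \<Longrightarrow> a \<oplus> b \<in> column"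
    "\<And>t a. a \<in> column \<Longrightarrow> t \<odot> a \<in> column"
    using column_subspace by (auto simp: subspace_of_def)
  have T: "star_subalgebra ?T"
    unfolding star_subalgebra_def subspace_of_def
    by (auto simp: col mult_add_left mult_scale_left star_add star_scale star_mult mult_assoc)
  have cl: "closed_set ?T"
  proof (rule closed_setI)
    fix s l assume *: "\<And>k. s k \<in> ?T" "l \<in> carrier D" "conv s l"
    have sc: "s k \<in> carrier D" "star D (s k) \<in> carrier D" for k using *(1) by auto
    have "l \<otimes> b \<in> column" "star D l \<otimes> b \<in> column" if b: "b \<in> column" for b
    proof -
      have bc: "b \<in> carrier D" using b by simp
      have in_col: "s k \<otimes> b \<in> column" "star D (s k) \<otimes> b \<in> column" for k
        using *(1)[of k] b by simp_all
      show "l \<otimes> b \<in> column"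
        by (rule closed_setD[OF column_closed_set, of "\<lambda>k. s k \<otimes> b", OF in_col(1)
              mult_closed[OF *(2) bc] conv_mult[OF sc(1) bc *(2) bc *(3) conv_const[OF bc]]])
      show "star D l \<otimes> b \<in> column"
        by (rule closed_setD[OF column_closed_set, of "\<lambda>k. star D (s k) \<otimes> b", OF in_col(2)
              mult_closed[OF star_closed[OF *(2)] bc]
              conv_mult[OF sc(2) bc star_closed[OF *(2)] bc conv_star[OF sc(1) *(2,3)] conv_const[OF bc]]])
    qed
    then show "l \<in> ?T" using *(2) by simp
  qed
  have gens: "\<pi>W ` carrier W \<union> E ` carrier (coef W) \<subseteq> ?T"
    by (auto simp: column_invariant column_star C.\<rho>A(6)[symmetric])
  have "a \<in> cstar_generated D (\<pi>W ` carrier W \<union> E ` carrier (coef W))"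
    using a C.generated by simp
  from cstar_generated_induct[OF this T cl gens] have "a \<otimes> E f \<in> column" using column_invariant(1) by simp
  then show ?thesis using a column_annihilated[of "a \<otimes> E f"] by (simp add: mult_assoc)
qed

end

subsection \<open>A second family of generators of the disc algebra\<close>

locale disc_cp = triangular_cp n "n + 1" X P w Oo \<pi>X \<pi>A
  for n and X :: "('x, 'a) corr" and P w and Oo :: "'o cstar" (structure) and \<pi>X \<pi>A
begin

text \<open>In the corner of p_n + p_{n+1} this is an isometry with range p_n and defect p_{n+1}.
  Its adjoint therefore has the source projection R_n required of y.\<close>

definition t :: 'o where "t = T n n \<oplus> T n (n + 1)"

text \<open>The defect projection moved by powers of the isometry. Index 0 is p_{n+1} itself, in the
  role of R_{n+1}; the Q_k correspond to k \<ge> 1 and lie under p_n.\<close>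

primrec qq :: "nat \<Rightarrow> 'o" where
  "qq 0 = p (n + 1)"
| "qq (Suc k) = t \<otimes> qq k \<otimes> star Oo t"

lemma t_closed [simp]: "t \<in> carrier Oo"
  using X.n_pos by (simp add: t_def)

lemma qq_closed [simp]: "qq k \<in> carrier Oo"
  by (induction k) simp_all

lemma t_star_t: "star Oo t \<otimes> t = p n \<oplus> p (n + 1)"
  using X.n_pos by (simp add: t_def star_add mult_add_left mult_add_right T_star_T[simplified])

lemma t_p: "t \<otimes> p n = T n n" "t \<otimes> p (n + 1) = T n (n + 1)" "\<lbrakk>1 \<le> i; i < n\<rbrakk> \<Longrightarrow> t \<otimes> p i = \<zero>"
  using X.n_pos by (simp_all add: t_def mult_add_left T_p[simplified])

lemma p_t: "p n \<otimes> t = t" "\<lbrakk>1 \<le> i; i \<le> n + 1; i \<noteq> n\<rbrakk> \<Longrightarrow> p i \<otimes> t = \<zero>"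
  using X.n_pos by (simp_all add: t_def mult_add_right p_T[simplified])

lemma t_star_p: "star Oo t \<otimes> p n = star Oo t" "\<lbrakk>1 \<le> i; i \<le> n + 1; i \<noteq> n\<rbrakk> \<Longrightarrow> star Oo t \<otimes> p i = \<zero>"
  using X.n_pos p_t star_mult[of "p n" t] star_mult[of "p i" t] by simp_all

lemma p_t_star: "\<lbrakk>1 \<le> i; i < n\<rbrakk> \<Longrightarrow> p i \<otimes> star Oo t = \<zero>"
  using t_p(3)[of i] star_mult[of t "p i"] by simp

lemma T_t_star: "T n n \<otimes> star Oo t = T n n \<otimes> star Oo (T n n)"
  "T n (n + 1) \<otimes> star Oo t = T n (n + 1) \<otimes> star Oo (T n (n + 1))"
proof -
  have n: "1 \<le> n" by (rule X.n_pos)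
  have c: "T n n \<otimes> star Oo (T n (n + 1)) = \<zero>"
  proof -
    have "T n n \<otimes> star Oo (T n (n + 1)) = (T n n \<otimes> p n) \<otimes> star Oo (T n (n + 1) \<otimes> p (n + 1))"
      using n by (subst (1 2) T_p) simp_all
    also have "\<dots> = T n n \<otimes> (p n \<otimes> p (n + 1)) \<otimes> star Oo (T n (n + 1))"
      using n by (simp add: star_mult mult_assoc)
    finally show ?thesis using n by (simp add: p_mult)
  qed
  then have "star Oo (T n n \<otimes> star Oo (T n (n + 1))) = \<zero>" by simp
  then have "T n (n + 1) \<otimes> star Oo (T n n) = \<zero>" using n by (simp add: star_mult)
  then show "T n n \<otimes> star Oo t = T n n \<otimes> star Oo (T n n)"
    "T n (n + 1) \<otimes> star Oo t = T n (n + 1) \<otimes> star Oo (T n (n + 1))"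
    using n c by (simp_all add: t_def star_add mult_add_right)
qed

lemma t_t_star: "t \<otimes> star Oo t = p n"
proof -
  have n: "1 \<le> n" by (rule X.n_pos)
  have "t \<otimes> star Oo t = T n n \<otimes> star Oo t \<oplus> T n (n + 1) \<otimes> star Oo t"
    using n by (subst (1) t_def) (simp add: mult_add_left)
  also have "\<dots> = vsum Oo (\<lambda>j. T n j \<otimes> star Oo (T n j)) (trow n (n + 1))"
    using n by (simp add: T_t_star[simplified] trow_Suc[simplified] trow_self)
  finally show ?thesis using row_sum[of n] n by simp
qed

lemma p_qq: "p n \<otimes> qq (Suc k) = qq (Suc k)" "qq (Suc k) \<otimes> p n = qq (Suc k)"
proof -
  have n: "1 \<le> n" by (rule X.n_pos)
  show "qq (Suc k) \<otimes> p n = qq (Suc k)" using n by (simp add: mult_assoc t_star_p)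
  have "p n \<otimes> qq (Suc k) = (p n \<otimes> t) \<otimes> qq k \<otimes> star Oo t" using n by (simp add: mult_assoc)
  then show "p n \<otimes> qq (Suc k) = qq (Suc k)" by (simp add: p_t)
qed

lemma source_qq: "star Oo t \<otimes> t \<otimes> qq k = qq k"
proof -
  have n: "1 \<le> n" by (rule X.n_pos)
  have c: "p n \<in> carrier Oo" "p (n + 1) \<in> carrier Oo" using n by simp_all
  have "p (n + 1) \<otimes> qq (Suc k) = p (n + 1) \<otimes> (p n \<otimes> qq (Suc k))" for k by (simp only: p_qq)
  then have "p (n + 1) \<otimes> qq (Suc k) = \<zero>" for k
    using c n p_mult[of "n + 1" n] by (simp del: qq.simps flip: mult_assoc)
  moreover have "p n \<otimes> p (n + 1) = \<zero>" "p (n + 1) \<otimes> p (n + 1) = p (n + 1)"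
    using n p_mult[of n "n + 1"] p_mult[of "n + 1" "n + 1"] by simp_all
  ultimately show ?thesis
    using c p_qq(1) unfolding t_star_t by (cases k) (simp_all add: mult_add_left del: qq.simps(2))
qed

text \<open>The isometry lets factors t* t be cancelled until one index is 0; p_{n+1} is orthogonal
  to everything under p_n.\<close>

lemma qq_orth: "qq j \<otimes> qq k = (if j = k then qq j else \<zero>)"
proof (induction j arbitrary: k)
  case 0
  have n: "1 \<le> n" by (rule X.n_pos)
  have "p (n + 1) \<otimes> qq (Suc k) = p (n + 1) \<otimes> (p n \<otimes> qq (Suc k))" for k by (simp only: p_qq)
  then have "p (n + 1) \<otimes> qq (Suc k) = \<zero>" for k
    using n p_mult[of "n + 1" n] by (simp del: qq.simps flip: mult_assoc)
  then show ?case using n p_mult[of "n + 1" "n + 1"] by (cases k) (simp_all del: qq.simps(2))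
next
  case (Suc j)
  have n: "1 \<le> n" by (rule X.n_pos)
  show ?case
  proof (cases k)
    case 0
    have "qq (Suc j) \<otimes> p (n + 1) = qq (Suc j) \<otimes> p n \<otimes> p (n + 1)" by (simp only: p_qq)
    also have "\<dots> = \<zero>" using n p_mult[of n "n + 1"] by (simp add: mult_assoc del: qq.simps)
    finally show ?thesis using 0 by simp
  next
    case (Suc l)
    have "qq (Suc j) \<otimes> qq (Suc l) = t \<otimes> (qq j \<otimes> (star Oo t \<otimes> t \<otimes> qq l)) \<otimes> star Oo t"
      by (simp add: mult_assoc)
    also have "\<dots> = (if j = l then qq (Suc j) else \<zero>)" by (simp add: source_qq Suc.IH)
    finally show ?thesis using Suc by simp
  qed
qed

lemma qq_star: "star Oo (qq k) = qq k"
  by (induction k) (simp_all add: X.n_pos star_mult mult_assoc)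

lemma mirror_projections: "mirror_projections Oo n p qq"
proof unfold_locales
  show "orth_family Oo {1..n + 1} p" by (rule p_orth)
  show "orth_family Oo {1..} qq" by (simp add: orth_family_def qq_orth qq_star)
  show "qq k \<otimes> p n = qq k" if "1 \<le> k" for k
    using that p_qq(2)[of "k - 1"] by simp
qed (rule X.n_pos)

end

section \<open>The two homomorphisms to the disc algebra\<close>

locale mirror_disc = disc_cp n X P w OX \<pi>X \<pi>A + mirror_setup n X P w Y R Q x xn y y' ys Z S z \<psi>X \<psi>A \<omega>Y \<omega>B
  for n and X :: "('x, 'a) corr" and P w and Y :: "('y, 'b) corr" and R Q x xn y y' ys
    and Z :: "('z, 'c) corr" and S z \<psi>X \<psi>A \<omega>Y \<omega>B and OX :: "'o cstar" (structure) and \<pi>X \<pi>A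
begin

text \<open>The padding entries of the frame go to 0, so the frame sum of W is that of X. Covariance
  then follows because first entries of the Katsura ideal of W vanish at the sink.\<close>

lemma rep_fst: "W.rep OX (\<lambda>\<zeta>. \<pi>X (fst \<zeta>)) (\<lambda>c. \<pi>A (fst c))"
proof -
  interpret H: corr_rep W "widx n" "\<lambda>k. (wf k, Y.yf k)" OX "\<lambda>\<zeta>. \<pi>X (fst \<zeta>)" "\<lambda>c. \<pi>A (fst c)"
  proof unfold_locales
    show "linear_map W OX (\<lambda>\<zeta>. \<pi>X (fst \<zeta>))"
      unfolding linear_map_def
      by (auto simp: W_simps linear_map_add[OF \<rho>X_linear] linear_map_scale[OF \<rho>X_linear])
    show "star_hom (coef W) OX (\<lambda>c. \<pi>A (fst c))" by (rule star_homI) (auto simp: W_simps \<rho>A)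
    show "star OX (\<pi>X (fst \<xi>)) \<otimes> \<pi>X (fst \<eta>) = \<pi>A (fst (ip W \<xi> \<eta>))"
      if "\<xi> \<in> carrier W" "\<eta> \<in> carrier W" for \<xi> \<eta>
      using that by (cases \<xi>, cases \<eta>) (simp add: W_simps \<rho>X_ip)
  qed
  have "H.F = vsum OX (\<lambda>(i, j). T i j \<otimes> star OX (T i j)) (tri n (n + 1))"
    unfolding H.F_def by (subst vsum_wf[OF complex_space_axioms]) (auto simp: wf_def)
  then have HF: "H.F = F" unfolding F_def by (simp add: split_def)
  show ?thesis
  proof unfold_locales
    show "\<pi>X (fst (lact W c \<xi>)) = \<pi>A (fst c) \<otimes> \<pi>X (fst \<xi>)"
      if "c \<in> carrier (coef W)" "\<xi> \<in> carrier W" for c \<xi>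
      using that by (cases c, cases \<xi>) (simp add: restricted_sum_lact, simp add: W_simps \<rho>X_lact)
    fix c assume cJ: "c \<in> katsura_ideal W"
    obtain a b where c: "c = (a, b)" by (cases c)
    have "c \<in> carrier (coef W)" using cJ unfolding W.katsura_ideal_iff by blast
    then have a: "a \<in> carrier (coef X)" by (simp add: c W_simps)
    have "a \<in> katsura_ideal X"
    proof (rule X.katsuraI[OF a])
      fix i assume "n < i" "i \<le> n + 1"
      then have "i = n + 1" by simp
      then show "a \<otimes>\<^bsub>coef X\<^esub> P i = \<zero>\<^bsub>coef X\<^esub>"
        using katsura_W_f[OF cJ] by (simp add: c f_def W_simps)
    qed
    then show "\<pi>A (fst c) \<otimes> H.F = \<pi>A (fst c)" using covariant[of a] unfolding HF c by simp
  qed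
qed

definition \<rho> :: "'b \<Rightarrow> 'o" where
  "\<rho> = (SOME \<rho>. star_hom (coef Y) OX \<rho> \<and> (\<forall>i. 1 \<le> i \<and> i \<le> n + 1 \<longrightarrow> \<rho> (R i) = p i)
     \<and> (\<forall>k\<ge>1. \<rho> (Q k) = qq k))"

lemma \<rho>_hom: "star_hom (coef Y) OX \<rho>"
  and \<rho>_R: "\<lbrakk>1 \<le> i; i \<le> n + 1\<rbrakk> \<Longrightarrow> \<rho> (R i) = p i" and \<rho>_Q: "1 \<le> k \<Longrightarrow> \<rho> (Q k) = qq k"
proof -
  have "\<exists>\<rho>. star_hom (coef Y) OX \<rho> \<and> (\<forall>i. 1 \<le> i \<and> i \<le> n + 1 \<longrightarrow> \<rho> (R i) = p i)
     \<and> (\<forall>k\<ge>1. \<rho> (Q k) = qq k)"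
    by (rule Y.B.hom_exists[OF cstar_algebra_axioms mirror_projections]) blast
  from someI_ex[OF this, folded \<rho>_def]
  show "star_hom (coef Y) OX \<rho>" "\<lbrakk>1 \<le> i; i \<le> n + 1\<rbrakk> \<Longrightarrow> \<rho> (R i) = p i" "1 \<le> k \<Longrightarrow> \<rho> (Q k) = qq k"
    by blast+
qed

lemmas \<rho>' [simp] = star_homD[OF \<rho>_hom]

lemma \<rho>_zero: "\<rho> \<zero>\<^bsub>coef Y\<^esub> = \<zero>"
  by (rule star_hom_zero[OF \<rho>_hom Y.coef.complex_space_axioms complex_space_axioms])

lemma RY: "R n \<in> carrier (coef Y)" "R (n + 1) \<in> carrier (coef Y)"
  using X.n_pos by simp_all

abbreviation s :: 'o where "s \<equiv> star OX t \<otimes> t"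

text \<open>s is the image of R_n + R_{n+1} and B is commutative. This is what makes b -> t
  \<rho>(b) t* multiplicative.\<close>

lemma source_commute:
  assumes b: "b \<in> carrier (coef Y)"
  shows "s \<otimes> \<rho> b = \<rho> b \<otimes> s"
proof -
  have s: "s = \<rho> (R n \<oplus>\<^bsub>coef Y\<^esub> R (n + 1))"
    using X.n_pos RY \<rho>_R[of n] \<rho>_R[of "n + 1"] by (simp add: t_star_t)
  show ?thesis unfolding s using b RY Y.B.commutative[of b "R n \<oplus>\<^bsub>coef Y\<^esub> R (n + 1)"]
    by (simp only: \<rho>'(5)[symmetric] Y.coef.add_closed)
qed

lemma t_source:
  "t \<otimes> s = t" "s \<otimes> star OX t = star OX t"
proof -
  show *: "t \<otimes> s = t" by (simp add: t_t_star p_t flip: mult_assoc)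
  have "star OX (t \<otimes> s) = star OX t" by (simp only: *)
  then show "s \<otimes> star OX t = star OX t" by (simp add: star_mult)
qed

text \<open>The isometry t implements \<sigma>: both sides are homomorphisms of B, so it is enough
  to compare generators.\<close>

lemma \<rho>_\<sigma>:
  assumes b: "b \<in> carrier (coef Y)"
  shows "\<rho> (Y.\<sigma> b) = t \<otimes> \<rho> b \<otimes> star OX t"
proof (rule star_hom_eqI[OF Y.B.unital cstar_algebra_axioms star_hom_comp[OF Y.\<sigma>_star_hom \<rho>_hom] _
      Y.B.generated _ _ b])
  show "star_hom (coef Y) OX (\<lambda>b. t \<otimes> \<rho> b \<otimes> star OX t)"
  proof (rule star_homI)
    fix a b assume ab: "a \<in> carrier (coef Y)" "b \<in> carrier (coef Y)"
    have "t \<otimes> \<rho> a \<otimes> star OX t \<otimes> (t \<otimes> \<rho> b \<otimes> star OX t)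
        = t \<otimes> \<rho> a \<otimes> (s \<otimes> \<rho> b) \<otimes> star OX t"
      using ab by (simp add: mult_assoc)
    also have "\<dots> = t \<otimes> \<rho> a \<otimes> \<rho> b \<otimes> (s \<otimes> star OX t)"
      unfolding source_commute[OF ab(2)] using ab by (simp add: mult_assoc)
    finally show "t \<otimes> \<rho> (a \<otimes>\<^bsub>coef Y\<^esub> b) \<otimes> star OX t
        = t \<otimes> \<rho> a \<otimes> star OX t \<otimes> (t \<otimes> \<rho> b \<otimes> star OX t)"
      using ab unfolding t_source(2) by (simp add: mult_assoc)
  qed (simp_all add: ring_rules)
  show "R ` {1..n + 1} \<union> Q ` {1..} \<subseteq> carrier (coef Y)" by auto
  fix u assume "u \<in> R ` {1..n + 1} \<union> Q ` {1..}"
  then consider i where "1 \<le> i" "i < n" "u = R i" | "u = R n" | "u = R (n + 1)" | k where "1 \<le> k" "u = Q k"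
    by (fastforce simp: le_Suc_eq)
  then show "\<rho> (Y.\<sigma> u) = t \<otimes> \<rho> u \<otimes> star OX t"
  proof cases
    case (1 i)
    then show ?thesis using \<rho>_R[of i] by (simp add: Y.\<sigma>_values \<rho>_zero t_p)
  next
    case 2
    \<comment> \<open>The two terms add up to t t* = p_n, and the second one is \<open>qq 1\<close>;
      so the first is p_n - \<open>qq 1\<close>, matching \<sigma>(R_n) = R_n - Q_1.\<close>
    have "t \<otimes> p n \<otimes> star OX t \<oplus> t \<otimes> p (n + 1) \<otimes> star OX t = t \<otimes> s \<otimes> star OX t"
      using X.n_pos unfolding t_star_t by (simp add: mult_add_left mult_add_right)
    also have "\<dots> = p n" unfolding t_source t_t_star ..
    finally have sum: "t \<otimes> p n \<otimes> star OX t \<oplus> qq 1 = p n" by simp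
    have "\<rho> (Y.\<sigma> (R n)) = vdiff OX (p n) (qq 1)"
      unfolding Y.\<sigma>_values(4)
      using star_hom_vdiff[OF \<rho>_hom Y.coef.complex_space_axioms RY(1), of "Q 1"] \<rho>_R[of n] \<rho>_Q[of 1] X.n_pos by simp
    also have "\<dots> = t \<otimes> p n \<otimes> star OX t"
      using X.n_pos add_comm[of "qq 1" "t \<otimes> p n \<otimes> star OX t"] sum
      by (intro vdiff_eqI) simp_all
    finally show ?thesis using 2 X.n_pos \<rho>_R[of n] by simp
  next
    case 3
    then show ?thesis using \<rho>_R[of "n + 1"] \<rho>_Q[of 1] Y.\<sigma>_values(2) by simp
  next
    case (4 k)
    then show ?thesis using \<rho>_Q[of k] \<rho>_Q[of "k + 1"] Y.\<sigma>_values(1)[of k] by simp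
  qed
qed

text \<open>With y represented by the adjoint of t, this is the relation b y = y
  \<sigma>(b).\<close>

lemma t_star_\<rho>:
  assumes b: "b \<in> carrier (coef Y)"
  shows "star OX t \<otimes> \<rho> (Y.\<sigma> b) = \<rho> b \<otimes> star OX t"
proof -
  have "star OX t \<otimes> \<rho> (Y.\<sigma> b) = s \<otimes> \<rho> b \<otimes> star OX t"
    using b by (simp add: \<rho>_\<sigma> mult_assoc)
  also have "\<dots> = \<rho> b \<otimes> (s \<otimes> star OX t)"
    unfolding source_commute[OF b] using b by (simp add: mult_assoc)
  finally show ?thesis unfolding t_source .
qed

text \<open>The representation behind the second projection: the generator \<open>y\<close> acts as the adjoint of \<open>t\<close>.\<close>

definition tt :: "(nat \<times> nat) + nat \<Rightarrow> 'o" where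
  "tt k = (case k of
     Inl (i, j) \<Rightarrow> if j = n + 1 then \<zero> else if i < n then T i j else star OX t
   | Inr i \<Rightarrow> T i (n + 1))"

lemma widx_cases:
  assumes "k \<in> set (widx n)"
  obtains i where "k = Inl (i, n + 1)" "1 \<le> i" "i \<le> n"
  | i j where "1 \<le> i" "i < n" "i \<le> j" "j \<le> n + 1" "Y.yf k = x i j" "tt k = T i j" "k \<noteq> Inl (n, n)"
  | "k = Inl (n, n)"
proof -
  from assms show ?thesis
  proof (cases rule: widx_exhaust)
    case 1
    then show ?thesis by (rule that(1))
  next
    case (2 i j)
    then show ?thesis by (intro that(2)[of i j]) (simp_all add: Y.yf_def tt_def)
  next
    case 3
    then show ?thesis by (rule that(3))
  next
    case (4 i)
    then show ?thesis by (intro that(2)[of i "n + 1"]) (simp_all add: Y.yf_def tt_def)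
  qed
qed

lemma tt_sink: "tt (Inl (i, n + 1)) = \<zero>" "Y.yf (Inl (i, n + 1)) = \<zero>\<^bsub>Y\<^esub>"
  and tt_U: "tt (Inl (n, n)) = star OX t" "Y.yf (Inl (n, n)) = y"
  by (simp_all add: tt_def Y.yf_def)

lemma tt_closed [simp]: "k \<in> set (widx n) \<Longrightarrow> tt k \<in> carrier OX"
  by (erule widx_cases) (auto simp: tt_sink[simplified] tt_U)

lemma p_tt:
  assumes "k \<in> set (widx n)" "k \<noteq> Inl (n, n)" "n \<le> l" "l \<le> n + 1"
  shows "p l \<otimes> tt k = \<zero>"
proof -
  have l: "1 \<le> l" using assms X.n_pos by simp
  from assms(1) show ?thesis
    by (rule widx_cases) (use assms l in \<open>auto simp: tt_sink[simplified] p_T[simplified]\<close>)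
qed

text \<open>The source of t is p_n + p_{n+1}, while the other frame vectors are 0 or have range
  below some p_i with i < n.\<close>

lemma t_tt: "\<lbrakk>k \<in> set (widx n); k \<noteq> Inl (n, n)\<rbrakk> \<Longrightarrow> t \<otimes> tt k = \<zero>"
proof -
  assume k: "k \<in> set (widx n)" "k \<noteq> Inl (n, n)"
  have n: "1 \<le> n" by (rule X.n_pos)
  have "t = t \<otimes> p n \<oplus> t \<otimes> p (n + 1)"
    unfolding t_p by (rule t_def)
  moreover have "(t \<otimes> p n \<oplus> t \<otimes> p (n + 1)) \<otimes> tt k = \<zero>"
    using k n p_tt[OF k, of n] p_tt[OF k, of "n + 1"] by (simp add: mult_add_left mult_assoc)
  ultimately show ?thesis by simp
qed

lemma tt_ip:
  assumes k: "k \<in> set (widx n)" and l: "l \<in> set (widx n)"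
  shows "star OX (tt k) \<otimes> tt l = \<rho> (ip Y (Y.yf k) (Y.yf l))"
  using k
proof (rule widx_cases)
  fix i assume "k = Inl (i, n + 1)"
  then show ?thesis using l by (simp add: tt_sink[simplified] \<rho>_zero)
next
  fix i j assume k': "1 \<le> i" "i < n" "i \<le> j" "j \<le> n + 1" "Y.yf k = x i j" "tt k = T i j"
    "k \<noteq> Inl (n, n)"
  from l show ?thesis
  proof (rule widx_cases)
    fix i' assume "l = Inl (i', n + 1)"
    then show ?thesis using k' by (simp add: tt_sink[simplified] \<rho>_zero)
  next
    fix i' j' assume "1 \<le> i'" "i' < n" "i' \<le> j'" "j' \<le> n + 1" "Y.yf l = x i' j'" "tt l = T i' j'"
    then show ?thesis using k' \<rho>_R[of j'] by (simp add: T_star_T[simplified] Y.ip_x \<rho>_zero)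
  next
    assume l: "l = Inl (n, n)"
    have "star OX (t \<otimes> tt k) = \<zero>" using t_tt[OF k k'(7)] by simp
    then have "star OX (tt k) \<otimes> star OX t = \<zero>" using k by (simp add: star_mult)
    then show ?thesis unfolding l tt_U using k' by (simp add: Y.ip_xy \<rho>_zero)
  qed
next
  assume k': "k = Inl (n, n)"
  from l show ?thesis
  proof (rule widx_cases)
    fix i' assume "l = Inl (i', n + 1)"
    then show ?thesis using k by (simp add: tt_sink[simplified] \<rho>_zero)
  next
    fix i' j' assume "1 \<le> i'" "i' < n" "i' \<le> j'" "j' \<le> n + 1" "Y.yf l = x i' j'" "l \<noteq> Inl (n, n)"
    then show ?thesis unfolding k' tt_U using t_tt[OF l] by (simp add: Y.ip_yx \<rho>_zero)
  next
    assume "l = Inl (n, n)"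
    then show ?thesis unfolding k' using X.n_pos \<rho>_R[of n] by (simp add: tt_U Y.ip_y t_t_star)
  qed
qed

lemma tt_source:
  assumes l: "l \<in> set (widx n)"
  shows "tt l \<otimes> \<rho> (ip Y (Y.yf l) (Y.yf l)) = tt l"
  using l
proof (rule widx_cases)
  fix i assume "l = Inl (i, n + 1)"
  then show ?thesis by (simp add: tt_sink[simplified] \<rho>_zero)
next
  fix i j assume "1 \<le> i" "i < n" "i \<le> j" "j \<le> n + 1" "Y.yf l = x i j" "tt l = T i j"
  then show ?thesis using \<rho>_R[of j] by (simp add: T_p[simplified] Y.ip_x)
next
  assume "l = Inl (n, n)"
  then show ?thesis using X.n_pos \<rho>_R[of n] by (simp add: tt_U Y.ip_y t_star_p)
qed

lemma tt_ract:
  assumes l: "l \<in> set (widx n)" and d: "d \<in> carrier (coef Y)"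
  shows "vsum OX (\<lambda>k. tt k \<otimes> \<rho> (ip Y (Y.yf k) (ract Y (Y.yf l) d))) (widx n) = tt l \<otimes> \<rho> d"
proof -
  have "vsum OX (\<lambda>k. tt k \<otimes> \<rho> (ip Y (Y.yf k) (ract Y (Y.yf l) d))) (widx n)
      = tt l \<otimes> \<rho> (ip Y (Y.yf l) (ract Y (Y.yf l) d))"
    by (rule vsum_single) (use l d in \<open>auto simp: distinct_widx Y.ip_ract_right Y.yf_orth \<rho>_zero\<close>)
  also have "\<dots> = (tt l \<otimes> \<rho> (ip Y (Y.yf l) (Y.yf l))) \<otimes> \<rho> d"
    using l d by (simp add: Y.ip_ract_right mult_assoc)
  finally show ?thesis using l by (simp add: tt_source)
qed

text \<open>On \<open>x i j\<close> both sides multiply by the character of b at i; on y the claim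
  is \<open>t_star_\<rho>\<close>.\<close>

lemma tt_left:
  assumes l: "l \<in> set (widx n)" and b: "b \<in> carrier (coef Y)"
  shows "vsum OX (\<lambda>k. tt k \<otimes> \<rho> (ip Y (Y.yf k) (lact Y b (Y.yf l)))) (widx n) = \<rho> b \<otimes> tt l"
  using l
proof (rule widx_cases)
  fix i assume "l = Inl (i, n + 1)"
  then show ?thesis using b by (auto simp: tt_sink[simplified] \<rho>_zero intro!: vsum_zero)
next
  fix i j assume ij: "1 \<le> i" "i < n" "i \<le> j" "j \<le> n + 1" "Y.yf l = x i j" "tt l = T i j"
  let ?c = "Y.B.chr (Inl i) b"
  have Rj: "R j \<in> carrier (coef Y)" "R i \<in> carrier (coef Y)" using ij by simp_all
  have "lact Y b (x i j) = ract Y (x i j) (?c \<odot>\<^bsub>coef Y\<^esub> R j)"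
    using b ij Rj by (simp add: Y.character_lact_x Y.ract_scale_right Y.ract_x)
  then have "vsum OX (\<lambda>k. tt k \<otimes> \<rho> (ip Y (Y.yf k) (lact Y b (Y.yf l)))) (widx n)
      = tt l \<otimes> \<rho> (?c \<odot>\<^bsub>coef Y\<^esub> R j)"
    using tt_ract[OF l, of "?c \<odot>\<^bsub>coef Y\<^esub> R j"] Rj ij by simp
  also have "\<dots> = ?c \<odot> T i j"
    using ij Rj \<rho>_R[of j] by (simp add: mult_scale_right T_p[simplified])
  also have "\<dots> = \<rho> b \<otimes> tt l"
  proof -
    have "Inl i \<in> Y.B.Ml" using ij by (auto simp: Y.B.Ml_def)
    from Y.B.Mp_mult(2)[OF this b] have bR: "b \<otimes>\<^bsub>coef Y\<^esub> R i = ?c \<odot>\<^bsub>coef Y\<^esub> R i" by (simp add: Y.B.Mp_def)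
    have "\<rho> b \<otimes> T i j = \<rho> b \<otimes> p i \<otimes> T i j"
      using ij b by (simp add: p_T[simplified] mult_assoc)
    also have "\<rho> b \<otimes> p i = \<rho> (b \<otimes>\<^bsub>coef Y\<^esub> R i)" using b ij Rj \<rho>_R[of i] by simp
    also have "\<dots> = ?c \<odot> p i" unfolding bR using ij Rj \<rho>_R[of i] by simp
    also have "(?c \<odot> p i) \<otimes> T i j = ?c \<odot> T i j"
      using ij by (simp add: mult_scale_left p_T[simplified])
    finally show ?thesis using ij by simp
  qed
  finally show ?thesis .
next
  assume l': "l = Inl (n, n)"
  have "Y.\<sigma> b \<in> carrier (coef Y)" using b by (rule star_hom_closed[OF Y.\<sigma>_star_hom])
  then show ?thesis using tt_ract[OF l, of "Y.\<sigma> b"] b by (simp add: l' tt_U Y.lact_y t_star_\<rho>)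
qed

text \<open>Rows below n are complete by \<open>row_sum\<close>; at n and n + 1 the single term of y
  contributes t* t = p_n + p_{n+1}. The frame sum being the unit, covariance in
  \<open>rep_snd\<close> is immediate.\<close>

lemma tt_frame: "vsum OX (\<lambda>k. tt k \<otimes> star OX (tt k)) (widx n) = \<pi>A X.A.one" (is "?F = _")
proof (rule eq_unitI)
  fix l assume l: "1 \<le> l" "l \<le> n + 1"
  let ?h = "\<lambda>k. p l \<otimes> (tt k \<otimes> star OX (tt k))"
  have n: "1 \<le> n" by (rule X.n_pos)
  have hc: "?h k \<in> carrier OX" if "k \<in> set (widx n)" for k using that l by simp
  have pF: "p l \<otimes> ?F = vsum OX ?h (widx n)"
    using l by (intro mult_vsum) auto
  show "p l \<otimes> ?F = p l"
  proof (cases "l < n")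
    case True
    have "vsum OX ?h (widx n) = vsum OX (\<lambda>j. ?h (Inl (l, j))) (trow l n)
        \<oplus> (?h (Inl (l, n + 1)) \<oplus> (if l < n then ?h (Inr l) else \<zero>))"
    proof (rule vsum_widx_row[OF hc])
      fix i j assume ij: "1 \<le> i" "i \<le> n" "i \<le> j" "j \<le> n + 1" "i \<noteq> l"
      then consider "j = n + 1" | "i < n" "j \<le> n" | "i = n" "j = n" by fastforce
      then have "p l \<otimes> tt (Inl (i, j)) = \<zero>"
        by cases (use ij l True in \<open>simp_all add: tt_def p_T[simplified] p_t_star\<close>)
      then show "?h (Inl (i, j)) = \<zero>" using ij l by (simp add: set_widx flip: mult_assoc)
    next
      fix i assume ij: "1 \<le> i" "i < n" "i \<noteq> l"
      then have "p l \<otimes> tt (Inr i) = \<zero>"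
        using l True by (simp add: tt_def p_T[simplified])
      then show "?h (Inr i) = \<zero>" using ij l by (simp add: set_widx flip: mult_assoc)
    qed (use l True in auto)
    also have "\<dots> = vsum OX (\<lambda>j. T l j \<otimes> star OX (T l j)) (trow l n)
        \<oplus> T l (n + 1) \<otimes> star OX (T l (n + 1))"
    proof -
      have "vsum OX (\<lambda>j. ?h (Inl (l, j))) (trow l n)
          = vsum OX (\<lambda>j. T l j \<otimes> star OX (T l j)) (trow l n)"
        using l True by (intro vsum_cong) (auto simp: tt_def p_T[simplified] simp flip: mult_assoc)
      moreover have "?h (Inl (l, n + 1)) = \<zero>" using l by (simp add: tt_sink[simplified])
      moreover have "?h (Inr l) = T l (n + 1) \<otimes> star OX (T l (n + 1))"
        using l True by (auto simp: tt_def p_T[simplified] simp flip: mult_assoc)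
      ultimately show ?thesis using l True by simp
    qed
    also have "\<dots> = vsum OX (\<lambda>j. T l j \<otimes> star OX (T l j)) (trow l (n + 1))"
      using l True by (subst trow_Suc, simp, subst vsum_append) auto
    also have "\<dots> = p l" using l True by (intro row_sum) auto
    finally show ?thesis using pF by simp
  next
    case False
    have "vsum OX ?h (widx n) = ?h (Inl (n, n))"
    proof (rule vsum_single)
      fix k assume k: "k \<in> set (widx n)" "k \<noteq> Inl (n, n)"
      show "?h k = \<zero>" using k l False p_tt[OF k, of l] by (simp flip: mult_assoc)
    qed (use X.n_pos l in \<open>auto simp: distinct_widx set_widx\<close>)
    also have "\<dots> = p l \<otimes> s" by (simp add: tt_U)
    also have "\<dots> = p l"
      using n l False unfolding t_star_t
      by (simp add: mult_add_right p_mult le_Suc_eq) auto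
    finally show ?thesis using pF by simp
  qed
qed auto

sublocale snd: frame_data W "widx n" "\<lambda>k. (wf k, Y.yf k)" OX "\<lambda>c. \<rho> (snd c)" tt
proof unfold_locales
  show "star_hom (coef W) OX (\<lambda>c. \<rho> (snd c))" by (rule star_homI) (auto simp: W_simps)
qed (simp_all add: tt_ip W_simps)

lemma rep_snd: "W.rep OX snd.\<rho>X (\<lambda>c. \<rho> (snd c))"
proof (rule snd.framed_repI)
  fix c l assume "c \<in> carrier (coef W)" and l: "l \<in> set (widx n)"
  moreover obtain a b where c: "c = (a, b)" by (cases c)
  ultimately have "b \<in> carrier (coef Y)" by (simp add: W_simps)
  then show "snd.\<rho>X (lact W c (wf l, Y.yf l)) = \<rho> (snd c) \<otimes> tt l"
    using tt_left[OF l] l by (simp add: snd.\<rho>X_def c W_lact W_simps)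
next
  fix c assume "c \<in> katsura_ideal W"
  then have "\<rho> (snd c) \<in> carrier OX"
    by (intro star_hom_closed[OF snd.hom]) (simp add: katsura_ideal_def)
  then show "\<rho> (snd c) \<otimes> snd.F = \<rho> (snd c)" unfolding snd.F_frame tt_frame by (rule mult_unit)
qed

end

subsection \<open>Quotients\<close>

context mirror_rep
begin

lemma E_orth:
  "orth_family D {1..n + 1} (\<lambda>i. E (if i \<le> n then e i else f))"
  "orth_family D {1..n + 1} (\<lambda>i. E (if i \<le> n then e i else g))"
  "orth_family D {1..n} (\<lambda>i. E (e i))"
  by (rule orth_family_hom[OF R.\<rho>A_hom W.coef.complex_space_axioms complex_space_axioms];
      auto simp: orth_family_def coef_mult coef_star)+

lemma E_simps:
  "\<lbrakk>1 \<le> i; i \<le> n; 1 \<le> j; j \<le> n\<rbrakk> \<Longrightarrow> E (e i) \<otimes> E (e j) = (if i = j then E (e i) else \<zero>)"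
  "\<lbrakk>1 \<le> i; i \<le> n\<rbrakk> \<Longrightarrow> E (e i) \<otimes> E g = \<zero>" "\<lbrakk>1 \<le> i; i \<le> n\<rbrakk> \<Longrightarrow> E g \<otimes> E (e i) = \<zero>" "E g \<otimes> E g = E g"
  "\<lbrakk>1 \<le> i; i \<le> n\<rbrakk> \<Longrightarrow> star D (E (e i)) = E (e i)" "star D (E f) = E f" "star D (E g) = E g"
  by (simp_all add: R.\<rho>A(5,6)[symmetric] coef_mult coef_star)

lemma V_zero:
  "\<lbrakk>E f = \<zero>; 1 \<le> i; i \<le> n\<rbrakk> \<Longrightarrow> V (Inl (i, n + 1)) = \<zero>"
  "\<lbrakk>E g = \<zero>; 1 \<le> i; i < n\<rbrakk> \<Longrightarrow> V (Inr i) = \<zero>"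
  using V_mult_source(2,3)[of i] by simp_all

lemma e_V_fst:
  assumes g: "E g = \<zero>" and ij: "1 \<le> i" "i \<le> n" "i \<le> j" "j \<le> n + 1"
  shows "E (e i) \<otimes> V (Inl (i, j)) = V (Inl (i, j))"
proof (cases "(i, j) = (n, n)")
  case True
  then show ?thesis using en_g_U g ij by simp
next
  case False
  then show ?thesis using e_V[of i i j] ij by simp
qed

text \<open>When \<open>E g\<close> is 0, the \<open>Inr\<close> vectors vanish and \<open>U\<close>
  has its range below \<open>E (e n)\<close>, so \<open>e_row\<close> becomes the row relation of
  the disc.\<close>

lemma family_fst:
  assumes g: "E g = \<zero>"
  shows "triangular_family n (n + 1) X P w D (\<lambda>i. E (if i \<le> n then e i else f)) (\<lambda>i j. V (Inl (i, j)))"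
proof unfold_locales
  let ?p = "\<lambda>i. E (if i \<le> n then e i else f)" and ?t = "\<lambda>i j. V (Inl (i, j))"
  show "star D (?t i j) \<otimes> ?t k l = (if i = k \<and> j = l then ?p j else \<zero>)"
    if "1 \<le> i" "i \<le> n" "i \<le> j" "j \<le> n + 1" "1 \<le> k" "k \<le> n" "k \<le> l" "l \<le> n + 1" for i j k l
    using V_star_self(1)[of i j] V_star_self(2)[of i] V_orth[of "Inl (i, j)" "Inl (k, l)"] that
    by (cases "(i, j) = (k, l)") (auto simp: le_Suc_eq)
  show "?p i \<otimes> vsum D (\<lambda>j. ?t i j \<otimes> star D (?t i j)) (trow i (n + 1)) = ?p i"
    if i: "1 \<le> i" "i \<le> n" for i
  proof -
    let ?r = "\<lambda>m. vsum D (\<lambda>j. E (e i) \<otimes> (?t i j \<otimes> star D (?t i j))) (trow i m)"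
    have r: "?r n \<in> carrier D" using i by (intro vsum_closed) auto
    have "E (e i) \<otimes> vsum D (\<lambda>j. ?t i j \<otimes> star D (?t i j)) (trow i (n + 1)) = ?r (n + 1)"
      using i by (intro mult_vsum) auto
    also have "\<dots> = ?r n \<oplus> E (e i) \<otimes> (?t i (n + 1) \<otimes> star D (?t i (n + 1)))"
      using i by (subst trow_Suc, simp, subst vsum_append) auto
    also have "E (e i) \<otimes> (?t i (n + 1) \<otimes> star D (?t i (n + 1))) = ?t i (n + 1) \<otimes> star D (?t i (n + 1))"
      using i e_V_fst[OF g i, of "n + 1"] by (simp flip: mult_assoc)
    also have "?r n \<oplus> \<dots> = E (e i)"
      using i r V_zero(2)[OF g i(1)] e_row[OF i] by (cases "i < n") auto
    finally show ?thesis using i by simp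
  qed
qed (simp_all add: E_orth(1)[simplified] e_V_fst[OF g, simplified])

text \<open>When both \<open>E f\<close> and \<open>E g\<close> are 0, only the edges with j \<le> n
  survive, and \<open>e_row\<close> becomes the row relation of the sphere.\<close>

lemma family_both:
  assumes g: "E g = \<zero>" and f: "E f = \<zero>"
  shows "triangular_family n n Z S z D (\<lambda>i. E (e i)) (\<lambda>i j. V (Inl (i, j)))"
proof unfold_locales
  let ?t = "\<lambda>i j. V (Inl (i, j))"
  show "star D (?t i j) \<otimes> ?t k l = (if i = k \<and> j = l then E (e j) else \<zero>)"
    if "1 \<le> i" "i \<le> n" "i \<le> j" "j \<le> n" "1 \<le> k" "k \<le> n" "k \<le> l" "l \<le> n" for i j k l
    using V_star_self(1)[of i j] V_orth[of "Inl (i, j)" "Inl (k, l)"] that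
    by (cases "(i, j) = (k, l)") auto
  show "E (e i) \<otimes> vsum D (\<lambda>j. ?t i j \<otimes> star D (?t i j)) (trow i n) = E (e i)"
    if i: "1 \<le> i" "i \<le> n" for i
  proof -
    have "vsum D (\<lambda>j. E (e i) \<otimes> (?t i j \<otimes> star D (?t i j))) (trow i n) \<in> carrier D"
      using i by (intro vsum_closed) auto
    then have "E (e i) = vsum D (\<lambda>j. E (e i) \<otimes> (?t i j \<otimes> star D (?t i j))) (trow i n)"
      using e_row[OF i] V_zero(1)[OF f i] V_zero(2)[OF g i(1)] by (cases "i < n") simp_all
    also have "\<dots> = E (e i) \<otimes> vsum D (\<lambda>j. ?t i j \<otimes> star D (?t i j)) (trow i n)"
      using i by (intro mult_vsum[symmetric]) auto
    finally show ?thesis ..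
  qed
qed (simp_all add: E_orth(3)[simplified] e_V_fst[OF g])

text \<open>Undoes the passage to the adjoint. In the disc T n n = t p_n and T n (n+1) = t p_{n+1};
  as y represents the adjoint of t, the adjoint of \<open>U\<close> takes the place of t and
  \<open>E g\<close> that of p_{n+1}.\<close>

definition V2 :: "nat \<Rightarrow> nat \<Rightarrow> 'd" where
  "V2 i j = (if i < n then V (if j = n + 1 then Inr i else Inl (i, j))
    else star D U \<otimes> E (if j \<le> n then e n else g))"

lemma V2_simps:
  "\<lbrakk>i < n; j \<le> n\<rbrakk> \<Longrightarrow> V2 i j = V (Inl (i, j))" "i < n \<Longrightarrow> V2 i (n + 1) = V (Inr i)"
  "V2 n n = star D U \<otimes> E (e n)" "V2 n (n + 1) = star D U \<otimes> E g"
  by (simp_all add: V2_def)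

lemma U_V:
  assumes "k \<in> set (widx n)" "1 \<le> i" "i < n" "E (e i) \<otimes> V k = V k"
  shows "U \<otimes> V k = \<zero>"
proof -
  have "U \<otimes> V k = (U \<otimes> E (e n)) \<otimes> (E (e i) \<otimes> V k)"
    using V_mult_source(1)[of n n] assms(2-4) by simp
  also have "\<dots> = U \<otimes> ((E (e n) \<otimes> E (e i)) \<otimes> V k)"
    using assms(1-3) by (simp add: mult_assoc)
  finally show ?thesis using assms(1-3) by (simp add: E_simps)
qed

text \<open>When \<open>E f\<close> is 0, covariance makes U U* a unit on \<open>E (e n)\<close> and
  on \<open>E g\<close>, which gives the inner products in row n. The sum of that row is U* (e n +
  g) U, evaluated by \<open>en_g_U\<close>.\<close>

lemma family_snd:
  assumes f: "E f = \<zero>"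
  shows "triangular_family n (n + 1) X P w D (\<lambda>i. E (if i \<le> n then e i else g)) V2"
proof unfold_locales
  have n: "1 \<le> n" by (rule X.n_pos)
  let ?p = "\<lambda>i. E (if i \<le> n then e i else g)"
  define idx where "idx i k = (if k = n + 1 then Inr i else Inl (i, k))" for i k :: nat
  have idx: "idx i k \<in> set (widx n)" "V2 i k = V (idx i k)" "E (e i) \<otimes> V (idx i k) = V (idx i k)"
    if "1 \<le> i" "i < n" "i \<le> k" "k \<le> n + 1" for i k
    using that e_V[of i i k] e_V_Inr[of i i] by (auto simp: idx_def V2_def)
  have Un: "U \<otimes> V (idx i k) = \<zero>" if "1 \<le> i" "i < n" "i \<le> k" "k \<le> n + 1" for i k
    using idx[OF that] that by (intro U_V[of _ i])
  have Ec: "E (e n) \<in> carrier D" "E g \<in> carrier D" using n by simp_all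
  have V2n: "V2 n j = star D U \<otimes> ?p j" if "n \<le> j" for j
    using that by (cases "j = n") (simp_all add: V2_def)
  have pc: "?p j \<in> carrier D" "star D (?p j) = ?p j" if "1 \<le> j" for j
    using E_simps(5,7) that by simp_all
  show c: "V2 i j \<in> carrier D" if "1 \<le> i" "i \<le> n" "i \<le> j" "j \<le> n + 1" for i j
    using that idx[of i j] n V2n pc by (cases "i < n") simp_all
  have V2UV: "star D (V2 n k) \<otimes> V2 i j = \<zero>"
    if "1 \<le> i" "i < n" "i \<le> j" "j \<le> n + 1" "n \<le> k" for i j k
    using that n idx(1,2)[of i j] Un[of i j] pc[of k] by (simp add: V2n star_mult mult_assoc)
  have pUU: "?p j \<otimes> (U \<otimes> star D U) = ?p j" if "j = n \<or> j = n + 1" for j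
  proof -
    have "E (e n) = E (e n) \<otimes> (U \<otimes> star D U)"
      using e_row[OF n le_refl] V_zero(1)[OF f n le_refl] n by (simp add: trow_self)
    then show ?thesis using g_frame that by auto
  qed
  show "star D (V2 i j) \<otimes> V2 k l = (if i = k \<and> j = l then ?p j else \<zero>)"
    if ij: "1 \<le> i" "i \<le> n" "i \<le> j" "j \<le> n + 1" and kl: "1 \<le> k" "k \<le> n" "k \<le> l" "l \<le> n + 1" for i j k l
  proof -
    consider "i < n" "k < n" | "i < n" "k = n" | "i = n" "k < n" | "i = n" "k = n" using ij kl by fastforce
    then show ?thesis
    proof cases
      case 1
      have "star D (V (idx i j)) \<otimes> V (idx i j) = ?p j"
        using V_star_self(1)[of i j] V_star_self(3)[of i] ij 1 by (auto simp: idx_def le_Suc_eq)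
      moreover have "idx i j \<noteq> idx k l" if "(i, j) \<noteq> (k, l)" using that by (auto simp: idx_def)
      ultimately show ?thesis
        using ij kl 1 idx[of i j] idx[of k l] V_orth[of "idx i j" "idx k l"] by (cases "(i, j) = (k, l)") auto
    next
      case 2
      have "star D (star D (V2 n l) \<otimes> V2 i j) = \<zero>" using V2UV[of i j l] ij kl 2 by simp
      then show ?thesis using c ij kl 2 by (simp add: star_mult)
    next
      case 3
      then show ?thesis using V2UV[of k l j] ij kl by simp
    next
      case 4
      have jl: "j = n \<or> j = n + 1" "l = n \<or> l = n + 1" using 4 ij kl by auto
      have "star D (V2 i j) \<otimes> V2 k l = (?p j \<otimes> (U \<otimes> star D U)) \<otimes> ?p l"
        using 4 ij kl pc[of j] pc[of l] by (simp add: V2n star_mult mult_assoc)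
      also have "\<dots> = ?p j \<otimes> ?p l" unfolding pUU[OF jl(1)] ..
      also have "\<dots> = (if j = l then ?p j else \<zero>)" using jl n by (auto simp: E_simps)
      finally show ?thesis using 4 by simp
    qed
  qed
  show pV: "?p i \<otimes> V2 i j = V2 i j" if ij: "1 \<le> i" "i \<le> n" "i \<le> j" "j \<le> n + 1" for i j
  proof (cases "i < n")
    case True
    then show ?thesis using idx[of i j] ij by simp
  next
    case False
    have "star D (U \<otimes> E (e n)) = star D U" using V_mult_source(1)[of n n] n by simp
    then have "E (e n) \<otimes> star D U = star D U" using n Ec by (simp add: star_mult E_simps)
    then show ?thesis using False ij pc[of j] n by (simp add: V2n flip: mult_assoc)
  qed
  show "?p i \<otimes> vsum D (\<lambda>j. V2 i j \<otimes> star D (V2 i j)) (trow i (n + 1)) = ?p i"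
    if i: "1 \<le> i" "i \<le> n" for i
  proof -
    let ?q = "\<lambda>j. V2 i j \<otimes> star D (V2 i j)"
    have qc: "?q j \<in> carrier D" if "i \<le> j" "j \<le> n + 1" for j using c[OF i that] by simp
    have "?p i \<otimes> vsum D ?q (trow i (n + 1)) = vsum D ?q (trow i (n + 1))"
    proof -
      have "?p i \<otimes> vsum D ?q (trow i (n + 1)) = vsum D (\<lambda>j. ?p i \<otimes> ?q j) (trow i (n + 1))"
        using i qc by (intro mult_vsum) auto
      also have "\<dots> = vsum D ?q (trow i (n + 1))"
        using i c[OF i] pV[OF i] by (intro vsum_cong) (auto simp flip: mult_assoc)
      finally show ?thesis .
    qed
    also have "\<dots> = vsum D ?q (trow i n) \<oplus> ?q (n + 1)"
      using i qc by (subst trow_Suc, simp, subst vsum_append) auto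
    also have "\<dots> = ?p i"
    proof (cases "i < n")
      case True
      have "vsum D ?q (trow i n) = vsum D (\<lambda>j. E (e i) \<otimes> (V (Inl (i, j)) \<otimes> star D (V (Inl (i, j))))) (trow i n)"
        using True i e_V[of i i] by (intro vsum_cong) (auto simp: V2_simps simp flip: mult_assoc)
      then show ?thesis
        using e_row[OF i] V_zero(1)[OF f i] True i V2_simps(2) by simp
    next
      case False
      then have i': "i = n" using i by simp
      have q: "?q j = star D U \<otimes> (?p j \<otimes> U)" if "j = n \<or> j = n + 1" for j
      proof -
        have j: "1 \<le> j" "n \<le> j" using that n by auto
        have "star D U \<otimes> a \<otimes> star D (star D U \<otimes> a) = star D U \<otimes> ((a \<otimes> a) \<otimes> U)"
          if "a \<in> carrier D" "star D a = a" for a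
          using that by (simp add: star_mult mult_assoc)
        from this[OF pc[OF j(1)]] have "?q j = star D U \<otimes> ((?p j \<otimes> ?p j) \<otimes> U)"
          unfolding i' V2n[OF j(2)] .
        also have "?p j \<otimes> ?p j = ?p j" using that n by (auto simp: E_simps)
        finally show ?thesis .
      qed
      have "?q n \<oplus> ?q (n + 1) = star D U \<otimes> (E (e n) \<otimes> U \<oplus> E g \<otimes> U)"
        using q[of n] q[of "n + 1"] Ec by (simp add: mult_add_right)
      also have "\<dots> = E (e n)" using V_star_self(1)[of n n] n by (simp add: en_g_U)
      finally show ?thesis using i' n qc[of n] by (simp add: trow_self)
    qed
    finally show ?thesis .
  qed
qed (simp_all add: E_orth(2)[simplified])

end

text \<open>Only the source is required to be an algebra, so the inverse exists without checking the
  axioms of the pullback.\<close>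

lemma star_iso_sym:
  assumes A: "star_algebra A" and f: "star_iso A B f"
  shows "star_iso B A (inv_into (carrier A) f)"
proof -
  interpret A: star_algebra A by fact
  note h = star_homD[of A B f]
  have hom: "star_hom A B f" and bij: "bij_betw f (carrier A) (carrier B)"
    using f by (simp_all add: star_iso_def)
  let ?g = "inv_into (carrier A) f"
  have inj: "inj_on f (carrier A)" using bij by (simp add: bij_betw_def)
  have gf: "?g (f a) = a" if "a \<in> carrier A" for a using inj that by simp
  have ex: "\<exists>a\<in>carrier A. b = f a" if "b \<in> carrier B" for b
    using bij that unfolding bij_betw_def by blast
  have "star_hom B A ?g"
  proof (rule star_homI)
    fix b assume "b \<in> carrier B"
    then obtain a where a: "a \<in> carrier A" "b = f a" using ex by blast
    show "?g b \<in> carrier A" using a gf by simp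
    show "?g (c \<odot>\<^bsub>B\<^esub> b) = c \<odot>\<^bsub>A\<^esub> ?g b" for c
      using a gf[of "c \<odot>\<^bsub>A\<^esub> a"] gf[of a] by (simp add: h(4)[OF hom])
    show "?g (star B b) = star A (?g b)"
      using a gf[of "star A a"] gf[of a] by (simp add: h(6)[OF hom])
    fix b' assume "b' \<in> carrier B"
    then obtain a' where a': "a' \<in> carrier A" "b' = f a'" using ex by blast
    show "?g (b \<oplus>\<^bsub>B\<^esub> b') = ?g b \<oplus>\<^bsub>A\<^esub> ?g b'"
      using a a' gf[of "a \<oplus>\<^bsub>A\<^esub> a'"] gf[of a] gf[of a'] by (simp add: h(3)[OF hom])
    show "?g (b \<otimes>\<^bsub>B\<^esub> b') = ?g b \<otimes>\<^bsub>A\<^esub> ?g b'"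
      using a a' gf[of "a \<otimes>\<^bsub>A\<^esub> a'"] gf[of a] gf[of a'] by (simp add: h(5)[OF hom])
  qed
  then show ?thesis using bij_betw_inv_into[OF bij] by (simp add: star_iso_def)
qed

lemma star_hom_id: "star_hom A A (\<lambda>a. a)"
  by (rule star_homI) simp_all

section \<open>Assembling the isomorphism\<close>

locale mirror_discs = mirror_cp n X P w Y R Q x xn y y' ys Z S z \<psi>X \<psi>A \<omega>Y \<omega>B D \<pi>W E
    + OX: mirror_disc n X P w Y R Q x xn y y' ys Z S z \<psi>X \<psi>A \<omega>Y \<omega>B OX \<pi>X \<pi>A
    + OZ: triangular_cp n n Z S z OZ \<pi>Z \<pi>C
  for n and X :: "('x, 'a) corr" and P w and Y :: "('y, 'b) corr" and R Q x xn y y' ys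
    and Z :: "('z, 'c) corr" and S z \<psi>X \<psi>A \<omega>Y \<omega>B and D :: "'d cstar" (structure) and \<pi>W E
    and OX :: "'o cstar" and \<pi>X \<pi>A and OZ :: "'p cstar" and \<pi>Z \<pi>C
begin

lemma mirror_sphere_isomorphic:
  assumes \<pi>: "star_hom OX OZ \<pi>"
    and \<pi>_w: "\<And>i j. \<lbrakk>1 \<le> i; i \<le> n; i \<le> j; j \<le> n\<rbrakk> \<Longrightarrow> \<pi> (\<pi>X (w i j)) = \<pi>Z (z i j)"
    and \<pi>_w_sink: "\<And>i. \<lbrakk>1 \<le> i; i \<le> n\<rbrakk> \<Longrightarrow> \<pi> (\<pi>X (w i (n + 1))) = \<zero>\<^bsub>OZ\<^esub>"
    and \<pi>_P: "\<And>i. \<lbrakk>1 \<le> i; i \<le> n\<rbrakk> \<Longrightarrow> \<pi> (\<pi>A (P i)) = \<pi>C (S i)"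
    and \<pi>_P_sink: "\<pi> (\<pi>A (P (n + 1))) = \<zero>\<^bsub>OZ\<^esub>"
    and \<beta>: "star_hom OZ OZ \<beta>" and \<beta>_zn: "\<beta> (\<pi>Z (z n n)) = star OZ (\<pi>Z (z n n))"
    and \<beta>_z: "\<And>i j. \<lbrakk>1 \<le> i; i \<le> n; i \<le> j; j \<le> n; (i, j) \<noteq> (n, n)\<rbrakk> \<Longrightarrow> \<beta> (\<pi>Z (z i j)) = \<pi>Z (z i j)"
    and \<beta>_S: "\<And>i. \<lbrakk>1 \<le> i; i \<le> n\<rbrakk> \<Longrightarrow> \<beta> (\<pi>C (S i)) = \<pi>C (S i)"
  shows "mirror_sphere OX \<pi> \<beta> \<cong>\<^sub>C D"
proof -
  have n: "1 \<le> n" by (rule X.n_pos)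
  obtain h1 where h1: "star_hom D OX h1" and h1_W: "\<And>\<zeta>. \<zeta> \<in> carrier W \<Longrightarrow> h1 (\<pi>W \<zeta>) = \<pi>X (fst \<zeta>)"
    and h1_E: "\<And>c. c \<in> carrier (coef W) \<Longrightarrow> h1 (E c) = \<pi>A (fst c)"
    by (rule C.universal[OF OX.unital OX.rep_fst]) (rule that)
  obtain h2 where h2: "star_hom D OX h2" and h2_W: "\<And>\<zeta>. \<zeta> \<in> carrier W \<Longrightarrow> h2 (\<pi>W \<zeta>) = OX.snd.\<rho>X \<zeta>"
    and h2_E: "\<And>c. c \<in> carrier (coef W) \<Longrightarrow> h2 (E c) = OX.\<rho> (snd c)"
    by (rule C.universal[OF OX.unital OX.rep_snd]) (rule that)
  have h1_V: "h1 (V (Inl (i, j))) = \<pi>X (w i j)" if "1 \<le> i" "i \<le> n" "i \<le> j" "j \<le> n + 1" for i j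
    using that W.frame_closed[of "Inl (i, j)"] by (simp add: V_def h1_W wf_def)
  have h1_Inr: "h1 (V (Inr i)) = \<zero>\<^bsub>OX\<^esub>" if "1 \<le> i" "i < n" for i
    using that W.frame_closed[of "Inr i"] by (simp add: V_def h1_W wf_def)
  have h2_V: "h2 (V k) = OX.tt k" if "k \<in> set (widx n)" for k
    using that by (simp add: V_def h2_W W.frame_closed OX.snd.ext_frame)
  have h1_e: "h1 (E (e i)) = \<pi>A (P i)" and h2_e: "h2 (E (e i)) = \<pi>A (P i)" if "1 \<le> i" "i \<le> n" for i
    using h1_E[OF coef_closed(1)[OF that]] h2_E[OF coef_closed(1)[OF that]] OX.\<rho>_R[of i] that by (simp_all add: e_def)
  have h1_f: "h1 (E f) = \<pi>A (P (n + 1))" and h1_g: "h1 (E g) = \<zero>\<^bsub>OX\<^esub>"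
    and h2_f: "h2 (E f) = \<zero>\<^bsub>OX\<^esub>" and h2_g: "h2 (E g) = \<pi>A (P (n + 1))"
    using h1_E[OF coef_closed(2)] h1_E[OF coef_closed(3)] h2_E[OF coef_closed(2)] h2_E[OF coef_closed(3)]
      OX.\<rho>_R[of "n + 1"] by (simp_all add: f_def g_def OX.\<rho>_zero)
  note h1' = star_homD[OF h1] and h2' = star_homD[OF h2] and \<pi>' = star_homD[OF \<pi>] and \<beta>' = star_homD[OF \<beta>]
  have \<pi>0: "\<pi> \<zero>\<^bsub>OX\<^esub> = \<zero>\<^bsub>OZ\<^esub>" and \<beta>0: "\<beta> \<zero>\<^bsub>OZ\<^esub> = \<zero>\<^bsub>OZ\<^esub>"
    using star_hom_zero[OF \<pi> OX.complex_space_axioms OZ.complex_space_axioms]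
      star_hom_zero[OF \<beta> OZ.complex_space_axioms OZ.complex_space_axioms] .
  let ?J = "ideal_generated {E g}" and ?K = "ideal_generated {E f}"
  have Ec: "E g \<in> carrier D" "E f \<in> carrier D" "star D (E g) = E g" "star D (E f) = E f"
    by (simp_all add: E_simps)
  have J: "closed_ideal ?J" and K: "closed_ideal ?K" using Ec by (simp_all add: closed_ideal_generated)
  have gJ: "E g \<in> ?J" and fK: "E f \<in> ?K" using ideal_generated_superset by auto
  have JK: "i \<otimes> j = \<zero>" if "i \<in> ?J" "j \<in> ?K" for i j
    by (rule ideal_generated_orthogonal[OF Ec(2,4,1,3) g_f_zero that])
  let ?L = "{i \<oplus> j | i j. i \<in> ?J \<and> j \<in> ?K}"
  have L: "closed_ideal ?L" by (rule closed_ideal_sum[OF J K JK])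
  have sub: "?J \<subseteq> carrier D" "?K \<subseteq> carrier D" and zero: "\<zero> \<in> ?J" "\<zero> \<in> ?K"
    using J K by (simp_all add: closed_ideal_def subspace_of_def)
  have gL: "E g \<in> ?L" and fL: "E f \<in> ?L"
    using gJ fK zero Ec add_zero[of "E g"] zero_add[of "E f"] by (metis (mono_tags, lifting) mem_Collect_eq)+
  interpret QJ: cstar_ideal D "E oneW" ?J by unfold_locales (rule J)
  interpret QK: cstar_ideal D "E oneW" ?K by unfold_locales (rule K)
  interpret QL: cstar_ideal D "E oneW" ?L by unfold_locales (rule L)
  have h1J: "h1 a = \<zero>\<^bsub>OX\<^esub>" if "a \<in> ?J" for a
    by (rule star_hom_ideal_generated[OF unital OX.cstar_algebra_axioms h1 _ _ that]) (use Ec h1_g in auto)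
  have h2K: "h2 a = \<zero>\<^bsub>OX\<^esub>" if "a \<in> ?K" for a
    by (rule star_hom_ideal_generated[OF unital OX.cstar_algebra_axioms h2 _ _ that]) (use Ec h2_f in auto)
  have q1: "\<And>a. a \<in> carrier D \<Longrightarrow> h1 (QJ.rep a) = h1 a" "star_hom QJ.quotient OX h1"
    using QJ.star_hom_quotient[OF h1 OX.cstar_algebra_axioms] h1J by auto
  have q2: "\<And>a. a \<in> carrier D \<Longrightarrow> h2 (QK.rep a) = h2 a" "star_hom QK.quotient OX h2"
    using QK.star_hom_quotient[OF h2 OX.cstar_algebra_axioms] h2K by auto
  have rJg: "QJ.rep (E g) = \<zero>\<^bsub>QJ.quotient\<^esub>" and rKf: "QK.rep (E f) = \<zero>\<^bsub>QK.quotient\<^esub>"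
    and rLf: "QL.rep (E f) = \<zero>\<^bsub>QL.quotient\<^esub>" and rLg: "QL.rep (E g) = \<zero>\<^bsub>QL.quotient\<^esub>"
    using QJ.rep_eq_zero_iff[OF Ec(1)] gJ QK.rep_eq_zero_iff[OF Ec(2)] fK
      QL.rep_eq_zero_iff[OF Ec(2)] fL QL.rep_eq_zero_iff[OF Ec(1)] gL by blast+
  interpret QJc: cstar_algebra QJ.quotient by (rule QJ.quotient_cstar)
  interpret QKc: cstar_algebra QK.quotient by (rule QK.quotient_cstar)
  interpret QLc: cstar_algebra QL.quotient by (rule QL.quotient_cstar)
  \<comment> \<open>A quotient map composed with the universal representation is again covariant, so
    the relations of \<open>mirror_rep\<close> are available in all three quotients.\<close>
  note mirror_repI = mirror_rep.intro[OF mirror_setup_axioms _ C.framed_rep_comp]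
  interpret RJ: mirror_rep n X P w Y R Q x xn y y' ys Z S z \<psi>X \<psi>A \<omega>Y \<omega>B QJ.quotient
      "\<lambda>\<zeta>. QJ.rep (\<pi>W \<zeta>)" "\<lambda>c. QJ.rep (E c)"
    by (rule mirror_repI[OF QJ.quotient_cstar QJ.quotient_star_hom QJ.quotient_cstar])
  interpret RK: mirror_rep n X P w Y R Q x xn y y' ys Z S z \<psi>X \<psi>A \<omega>Y \<omega>B QK.quotient
      "\<lambda>\<zeta>. QK.rep (\<pi>W \<zeta>)" "\<lambda>c. QK.rep (E c)"
    by (rule mirror_repI[OF QK.quotient_cstar QK.quotient_star_hom QK.quotient_cstar])
  interpret RL: mirror_rep n X P w Y R Q x xn y y' ys Z S z \<psi>X \<psi>A \<omega>Y \<omega>B QL.quotient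
      "\<lambda>\<zeta>. QL.rep (\<pi>W \<zeta>)" "\<lambda>c. QL.rep (E c)"
    by (rule mirror_repI[OF QL.quotient_cstar QL.quotient_star_hom QL.quotient_cstar])
  have RV: "RJ.V k = QJ.rep (V k)" "RK.V k = QK.rep (V k)" "RL.V k = QL.rep (V k)" for k
    by (simp_all add: RJ.V_def RK.V_def RL.V_def V_def)
  obtain j1 where j1: "star_hom OX QJ.quotient j1"
    and j1_w: "\<And>i k. \<lbrakk>1 \<le> i; i \<le> n; i \<le> k; k \<le> n + 1\<rbrakk> \<Longrightarrow> j1 (\<pi>X (w i k)) = QJ.rep (V (Inl (i, k)))"
    and j1_P: "\<And>i. \<lbrakk>1 \<le> i; i \<le> n + 1\<rbrakk> \<Longrightarrow> j1 (\<pi>A (P i)) = QJ.rep (E (if i \<le> n then e i else f))"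
    by (rule OX.hom_of_family[OF RJ.family_fst[OF rJg] QJ.quotient_unital]) (rule that, unfold RV)
  obtain j2 where j2: "star_hom OX QK.quotient j2"
    and j2_w: "\<And>i k. \<lbrakk>1 \<le> i; i \<le> n; i \<le> k; k \<le> n + 1\<rbrakk> \<Longrightarrow> j2 (\<pi>X (w i k)) = RK.V2 i k"
    and j2_P: "\<And>i. \<lbrakk>1 \<le> i; i \<le> n + 1\<rbrakk> \<Longrightarrow> j2 (\<pi>A (P i)) = QK.rep (E (if i \<le> n then e i else g))"
    by (rule OX.hom_of_family[OF RK.family_snd[OF rKf] QK.quotient_unital]) (rule that)
  obtain j3 where j3: "star_hom OZ QL.quotient j3"
    and j3_z: "\<And>i k. \<lbrakk>1 \<le> i; i \<le> n; i \<le> k; k \<le> n\<rbrakk> \<Longrightarrow> j3 (\<pi>Z (z i k)) = QL.rep (V (Inl (i, k)))"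
    and j3_S: "\<And>i. \<lbrakk>1 \<le> i; i \<le> n\<rbrakk> \<Longrightarrow> j3 (\<pi>C (S i)) = QL.rep (E (e i))"
    by (rule OZ.hom_of_family[OF RL.family_both[OF rLg rLf] QL.quotient_unital]) (rule that, unfold RV)
  have j0: "j1 \<zero>\<^bsub>OX\<^esub> = \<zero>\<^bsub>QJ.quotient\<^esub>" "j2 \<zero>\<^bsub>OX\<^esub> = \<zero>\<^bsub>QK.quotient\<^esub>" "j3 \<zero>\<^bsub>OZ\<^esub> = \<zero>\<^bsub>QL.quotient\<^esub>"
    using star_hom_zero[OF j1 OX.complex_space_axioms QJc.complex_space_axioms]
      star_hom_zero[OF j2 OX.complex_space_axioms QKc.complex_space_axioms]
      star_hom_zero[OF j3 OZ.complex_space_axioms QLc.complex_space_axioms] .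
  have Vz: "QJ.rep (V (Inr i)) = \<zero>\<^bsub>QJ.quotient\<^esub>" "QL.rep (V (Inr i)) = \<zero>\<^bsub>QL.quotient\<^esub>" if "1 \<le> i" "i < n" for i
    using RJ.V_zero(2)[OF rJg that] RL.V_zero(2)[OF rLg that] unfolding RV .
  have Vz': "QK.rep (V (Inl (i, n + 1))) = \<zero>\<^bsub>QK.quotient\<^esub>" "QL.rep (V (Inl (i, n + 1))) = \<zero>\<^bsub>QL.quotient\<^esub>"
    if "1 \<le> i" "i \<le> n" for i
    using RK.V_zero(1)[OF rKf that] RL.V_zero(1)[OF rLf that] unfolding RV .
  have Uc: "star D U \<in> carrier D" "E (e n) \<in> carrier D" using n by simp_all
  have h2_U: "h2 U = star OX OX.t" using n by (simp add: h2_V OX.tt_U)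
  \<comment> \<open>The quotient map factors through \<open>h1\<close>, so the kernel of
    \<open>h1\<close> is no larger than \<open>?J\<close>.\<close>
  have rep1: "QJ.rep a = j1 (h1 a)" if a: "a \<in> carrier D" for a
  proof (rule hom_eqI[OF QJ.quotient_cstar QJ.quotient_star_hom star_hom_comp[OF h1 j1] _ _ _ _ a])
    show "QJ.rep (V k) = j1 (h1 (V k))" if "k \<in> set (widx n)" for k
      using that by (cases rule: widx_exhaust) (use n in \<open>auto simp: h1_V h1_V[of _ "n + 1", simplified] h1_Inr j1_w j1_w[of _ "n + 1", simplified] Vz j0\<close>)
  qed (use n in \<open>auto simp: h1_e h1_f[simplified] h1_g j1_P j1_P[of "n + 1", simplified] j0 rJg\<close>)
  have rep2: "QK.rep a = j2 (h2 a)" if a: "a \<in> carrier D" for a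
  proof (rule hom_eqI[OF QK.quotient_cstar QK.quotient_star_hom star_hom_comp[OF h2 j2] _ _ _ _ a])
    \<comment> \<open>\<open>j2\<close> is known on T n n and T n (n+1), whose sum is t;
      \<open>en_g_U\<close> puts the two images together again.\<close>
    have jt: "j2 (star OX OX.t) = QK.rep U"
    proof -
      have "j2 OX.t = QK.rep (star D U \<otimes> E (e n) \<oplus> star D U \<otimes> E g)"
        using Uc Ec n j2_w(1)[of n n] j2_w(1)[of n "n + 1"] RK.V2_simps(3,4)
        by (simp add: OX.t_def star_homD[OF j2] RV star_homD[OF QK.quotient_star_hom])
      also have "star D U \<otimes> E (e n) \<oplus> star D U \<otimes> E g = star D (E (e n) \<otimes> U \<oplus> E g \<otimes> U)"
        using Uc Ec n by (simp add: star_add star_mult E_simps)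
      finally show ?thesis by (simp add: en_g_U star_homD[OF j2] star_homD[OF QK.quotient_star_hom])
    qed
    show "QK.rep (V k) = j2 (h2 (V k))" if "k \<in> set (widx n)" for k
      using that by (cases rule: widx_exhaust) (use n jt in \<open>auto simp: h2_V OX.tt_def j2_w j2_w[of _ "n + 1", simplified] RK.V2_simps(1) RK.V2_simps(2)[simplified] RV Vz'[simplified] j0\<close>)
  qed (use n in \<open>auto simp: h2_e h2_f h2_g[simplified] j2_P j2_P[of "n + 1", simplified] j0 rKf\<close>)
  have rep3: "QL.rep a = j3 (\<pi> (h1 a))" if a: "a \<in> carrier D" for a
  proof (rule hom_eqI[OF QL.quotient_cstar QL.quotient_star_hom star_hom_comp[OF star_hom_comp[OF h1 \<pi>] j3] _ _ _ _ a])
    show "QL.rep (V k) = j3 (\<pi> (h1 (V k)))" if "k \<in> set (widx n)" for k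
      using that by (cases rule: widx_exhaust)
        (use n in \<open>auto simp: h1_V h1_V[of _ "n + 1", simplified] h1_Inr \<pi>_w \<pi>_w_sink[simplified] j3_z Vz Vz'[simplified] j0 \<pi>0\<close>)
  qed (use n in \<open>auto simp: h1_e h1_f[simplified] h1_g \<pi>_P \<pi>_P_sink[simplified] \<pi>0 j3_S j0 rLf rLg\<close>)
  have onto1: "\<exists>a\<in>carrier D. h1 a = b" if b: "b \<in> carrier OX" for b
  proof -
    \<comment> \<open>\<open>h1\<close> descends to the quotient, and the composite fixes the
      generators of the disc algebra.\<close>
    have hj: "h1 (j1 b) = b"
    proof (rule OX.hom_eqI_generators[OF OX.cstar_algebra_axioms star_hom_comp[OF j1 q1(2)] star_hom_id _ _ b])
      show "h1 (j1 (\<pi>X (w i k))) = \<pi>X (w i k)" if "1 \<le> i" "i \<le> n" "i \<le> k" "k \<le> n + 1" for i k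
        using that by (simp add: j1_w q1(1) h1_V)
      show "h1 (j1 (\<pi>A (P i))) = \<pi>A (P i)" if "1 \<le> i" "i \<le> n + 1" for i
        using that Ec h1_f by (cases "i = n + 1") (simp_all add: j1_P q1(1) h1_e)
    qed
    have "j1 b \<in> carrier QJ.quotient" using b by (rule star_hom_closed[OF j1])
    then obtain a where a: "a \<in> carrier D" "j1 b = QJ.rep a" unfolding QJ.quotient_simps by blast
    then have "h1 a = b" using hj q1(1)[OF a(1)] by simp
    then show ?thesis using a by blast
  qed
  have onto2: "\<exists>a\<in>carrier D. h2 a = b" if b: "b \<in> carrier OX" for b
  proof -
    have hj: "h2 (j2 b) = b"
    proof (rule OX.hom_eqI_generators[OF OX.cstar_algebra_axioms star_hom_comp[OF j2 q2(2)] star_hom_id _ _ b])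
      show "h2 (j2 (\<pi>X (w i k))) = \<pi>X (w i k)" if ik: "1 \<le> i" "i \<le> n" "i \<le> k" "k \<le> n + 1" for i k
      proof -
        consider "i < n" "k \<le> n" | "i < n" "k = n + 1" | "i = n" "k = n" | "i = n" "k = n + 1"
          using ik by fastforce
        then show ?thesis
        proof cases
          case 1
          then show ?thesis using ik by (simp add: j2_w RK.V2_simps RV q2(1) h2_V OX.tt_def)
        next
          case 2
          then show ?thesis using ik j2_w[of i "n + 1"] RK.V2_simps(2) by (simp add: RV q2(1) h2_V OX.tt_def)
        next
          case 3
          then show ?thesis
            using n Uc OX.t_p(1) by (simp add: j2_w RK.V2_simps(3) RV q2(1) h2_U h2_e h2'(5,6)
                flip: star_homD(5,6)[OF QK.quotient_star_hom])
        next
          case 4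
          then show ?thesis
            using n Uc Ec OX.t_p(2) j2_w[of n "n + 1"] RK.V2_simps(4) by (simp add: RV q2(1) h2_U h2_g h2'(5,6)
                flip: star_homD(5,6)[OF QK.quotient_star_hom])
        qed
      qed
      show "h2 (j2 (\<pi>A (P i))) = \<pi>A (P i)" if "1 \<le> i" "i \<le> n + 1" for i
        using that Ec h2_g by (cases "i = n + 1") (simp_all add: j2_P q2(1) h2_e)
    qed
    have "j2 b \<in> carrier QK.quotient" using b by (rule star_hom_closed[OF j2])
    then obtain a where a: "a \<in> carrier D" "j2 b = QK.rep a" unfolding QK.quotient_simps by blast
    then have "h2 a = b" using hj q2(1)[OF a(1)] by simp
    then show ?thesis using a by blast
  qed
  \<comment> \<open>The flip enters at y: \<open>\<pi>\<close> maps \<open>h1 U\<close> to z_nn and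
    \<open>h2 U\<close> to its adjoint, and \<beta> exchanges the two.\<close>
  have match: "\<pi> (h1 a) = \<beta> (\<pi> (h2 a))" if a: "a \<in> carrier D" for a
  proof (rule hom_eqI[OF OZ.cstar_algebra_axioms star_hom_comp[OF h1 \<pi>] star_hom_comp[OF star_hom_comp[OF h2 \<pi>] \<beta>] _ _ _ _ a])
    have "\<pi> OX.t = \<pi>Z (z n n)"
      using n \<pi>_w_sink[of n] unfolding OX.t_def by (simp add: \<pi>' \<pi>_w OZ.add_zero)
    then have t: "\<beta> (\<pi> (star OX OX.t)) = \<pi>Z (z n n)"
      using n by (simp add: \<pi>' \<beta>' \<beta>_zn)
    show "\<pi> (h1 (V k)) = \<beta> (\<pi> (h2 (V k)))" if "k \<in> set (widx n)" for k
      using that by (cases rule: widx_exhaust)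
        (use n t in \<open>auto simp: h1_V h1_V[of _ "n + 1", simplified] h1_Inr h2_V OX.tt_def \<pi>_w \<pi>_w_sink[simplified] \<beta>_z \<pi>0 \<beta>0\<close>)
  qed (use n in \<open>auto simp: h1_e h1_f[simplified] h1_g h2_e h2_f h2_g[simplified] \<pi>_P \<pi>_P_sink[simplified] \<beta>_S \<pi>0 \<beta>0\<close>)
  let ?M = "mirror_sphere OX \<pi> \<beta>" and ?h = "\<lambda>a. (h1 a, h2 a)"
  note M = mirror_sphere_def pullback_simps
  have hom: "star_hom D ?M ?h"
    by (rule star_homI) (simp_all add: M match h1' h2')
  have inj: "a = b" if ab: "a \<in> carrier D" "b \<in> carrier D" "?h a = ?h b" for a b
  proof -
    let ?d = "vdiff D a b"
    have d: "?d \<in> carrier D" using ab by simp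
    have "h1 ?d = \<zero>\<^bsub>OX\<^esub>" "h2 ?d = \<zero>\<^bsub>OX\<^esub>"
      using star_hom_vdiff[OF h1 complex_space_axioms ab(1,2)] star_hom_vdiff[OF h2 complex_space_axioms ab(1,2)]
        ab h1'(2)[OF ab(1)] h2'(2)[OF ab(1)] h1'(2)[OF ab(2)] h2'(2)[OF ab(2)] by simp_all
    then have "?d \<in> ?J" "?d \<in> ?K"
      using QJ.rep_eq_zero_iff[OF d] rep1[OF d] QK.rep_eq_zero_iff[OF d] rep2[OF d] j0 by simp_all
    \<comment> \<open>\<open>?d\<close> lies in both ideals, so d* d is a product of elements of two
      orthogonal ideals.\<close>
    moreover from \<open>?d \<in> ?J\<close> have "star D ?d \<in> ?J" using J by (simp add: closed_ideal_def)
    ultimately have "star D ?d \<otimes> ?d = \<zero>" using JK by blast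
    then have "?d = \<zero>" by (rule star_mult_self_zero[OF d])
    then show ?thesis using ab by (simp add: vdiff_eq_zero_iff)
  qed
  have surj: "\<exists>a\<in>carrier D. ?h a = (b, c)" if "(b, c) \<in> carrier ?M" for b c
  proof -
    have bc: "b \<in> carrier OX" "c \<in> carrier OX" "\<pi> b = \<beta> (\<pi> c)" using that by (simp_all add: M)
    obtain a where a: "a \<in> carrier D" "h2 a = c" using onto2[OF bc(2)] by blast
    have h1a: "h1 a \<in> carrier OX" using a by (simp add: h1')
    \<comment> \<open>The defect of \<open>a\<close> in the first coordinate is killed by
      \<open>\<pi>\<close>, so a preimage under \<open>h1\<close> lies in the sum of the two ideals.
      Its part in \<open>?K\<close> repairs the first coordinate and leaves \<open>h2\<close>
      unchanged.\<close>
    let ?d = "vdiff OX b (h1 a)"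
    obtain x where x: "x \<in> carrier D" "h1 x = ?d" using onto1[of ?d] bc h1a by auto
    have "\<pi> (h1 x) = vdiff OZ (\<pi> b) (\<pi> (h1 a))"
      unfolding x(2) by (rule star_hom_vdiff[OF \<pi> OX.complex_space_axioms bc(1) h1a])
    also have "\<dots> = \<zero>\<^bsub>OZ\<^esub>" using match[OF a(1)] bc a h1a \<beta>'(2)[OF \<pi>'(2)[OF bc(2)]] by simp
    finally have "QL.rep x = \<zero>\<^bsub>QL.quotient\<^esub>" using rep3[OF x(1)] j0 by simp
    then have "x \<in> ?L" using QL.rep_eq_zero_iff[OF x(1)] by blast
    then obtain i j where ij: "x = i \<oplus> j" "i \<in> ?J" "j \<in> ?K" by blast
    have c: "i \<in> carrier D" "j \<in> carrier D" using ij sub by blast+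
    have "h1 j = ?d" using x ij c h1J[OF ij(2)] h1'(2)[OF c(2)] by (simp add: h1'(3))
    then have "?h (a \<oplus> j) = (b, c)"
      using a c bc h1a h2K[OF ij(3)] by (simp add: h1'(3) h2'(3))
    then show ?thesis using a c by (intro bexI[of _ "a \<oplus> j"]) auto
  qed
  have "bij_betw ?h (carrier D) (carrier ?M)"
    unfolding bij_betw_def
  proof
    show "inj_on ?h (carrier D)" by (rule inj_onI) (rule inj)
    show "?h ` carrier D = carrier ?M"
    proof
      show "?h ` carrier D \<subseteq> carrier ?M" using star_hom_closed[OF hom] by blast
      show "carrier ?M \<subseteq> ?h ` carrier D"
      proof
        fix p assume p: "p \<in> carrier ?M"
        obtain b c where "p = (b, c)" by (cases p)
        then show "p \<in> ?h ` carrier D" using surj[of b c] p by force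
      qed
    qed
  qed
  then have "star_iso D ?M ?h" using hom by (simp add: star_iso_def)
  then show ?thesis
    unfolding cstar_isomorphic_def using star_iso_sym[OF star_algebra_axioms] by blast
qed

end

theorem mainTheorem5:
  fixes n :: nat and q :: real
    and X :: "('x, 'a) corr" and Y :: "('y, 'b) corr" and Z :: "('z, 'c) corr"
    and OX :: "'o cstar" and OZ :: "'p cstar" and OXY :: "'r cstar"
  assumes "n \<ge> 1" and "0 < q" and "q < 1"
    \<comment> \<open>the three correspondences\<close>
    and "triangular_corr n (n + 1) X P w"
    and "mirror_corr n Y R Q x xn y y' ys"
    and "triangular_corr n n Z S z"
    \<comment> \<open>the two morphisms\<close>
    and "corr_morphism X Z \<psi>X \<psi>A"
    and "\<forall>i\<in>{1..n}. \<forall>j\<in>{i..n}. \<psi>X (w i j) = z i j"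
    and "\<forall>i\<in>{1..n}. \<psi>X (w i (n + 1)) = \<zero>\<^bsub>Z\<^esub>"
    and "\<forall>i\<in>{1..n}. \<psi>A (P i) = S i"
    and "\<psi>A (P (n + 1)) = \<zero>\<^bsub>coef Z\<^esub>"
    and "corr_morphism Y Z \<omega>Y \<omega>B"
    and "\<forall>i\<in>{1..<n}. \<forall>j\<in>{i..n}. \<omega>Y (x i j) = z i j"
    and "\<forall>i\<in>{1..<n}. \<omega>Y (x i (n + 1)) = \<zero>\<^bsub>Z\<^esub>"
    and "\<forall>i\<in>{1..<n}. \<forall>j\<ge>1. \<omega>Y (xn i j) = \<zero>\<^bsub>Z\<^esub>"
    and "\<omega>Y y = z n n" and "\<omega>Y y' = \<zero>\<^bsub>Z\<^esub>"
    and "\<forall>i\<ge>1. \<omega>Y (ys i) = \<zero>\<^bsub>Z\<^esub>"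
    and "\<forall>i\<in>{1..n}. \<omega>B (R i) = S i"
    and "\<omega>B (R (n + 1)) = \<zero>\<^bsub>coef Z\<^esub>"
    and "\<forall>j\<ge>1. \<omega>B (Q j) = \<zero>\<^bsub>coef Z\<^esub>"
    \<comment> \<open>the quantum disc and the quantum sphere\<close>
    and "cuntz_pimsner X OX \<pi>X \<pi>A"
    and "cuntz_pimsner Z OZ \<pi>Z \<pi>C"
    \<comment> \<open>the natural surjection\<close>
    and "star_hom OX OZ \<pi>"
    and "\<forall>i\<in>{1..n}. \<forall>j\<in>{i..n}. \<pi> (\<pi>X (w i j)) = \<pi>Z (z i j)"
    and "\<forall>i\<in>{1..n}. \<pi> (\<pi>X (w i (n + 1))) = \<zero>\<^bsub>OZ\<^esub>"
    and "\<forall>i\<in>{1..n}. \<pi> (\<pi>A (P i)) = \<pi>C (S i)"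
    and "\<pi> (\<pi>A (P (n + 1))) = \<zero>\<^bsub>OZ\<^esub>"
    \<comment> \<open>the flip\<close>
    and "star_iso OZ OZ \<beta>"
    and "\<beta> (\<pi>Z (z n n)) = star OZ (\<pi>Z (z n n))"
    and "\<forall>i\<in>{1..n}. \<forall>j\<in>{i..n}. (i, j) \<noteq> (n, n) \<longrightarrow> \<beta> (\<pi>Z (z i j)) = \<pi>Z (z i j)"
    and "\<forall>i\<in>{1..n}. \<beta> (\<pi>C (S i)) = \<pi>C (S i)"
    \<comment> \<open>the Cuntz--Pimsner algebra of the restricted direct sum\<close>
    and "cuntz_pimsner (restricted_sum X Y \<psi>X \<psi>A \<omega>Y \<omega>B) OXY \<pi>XY \<pi>AB"
  shows "mirror_sphere OX \<pi> \<beta> \<cong>\<^sub>C OXY"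
proof -
  interpret mirror_setup n X P w Y R Q x xn y y' ys Z S z \<psi>X \<psi>A \<omega>Y \<omega>B
    by unfold_locales (use assms in simp_all)
  interpret C: cp_algebra W "widx n" "\<lambda>k. (wf k, Y.yf k)" OXY \<pi>XY \<pi>AB
    by unfold_locales (use assms in simp_all)
  interpret OX: cp_algebra X "tri n (n + 1)" "\<lambda>(i, j). w i j" OX \<pi>X \<pi>A
    by unfold_locales (use assms in simp_all)
  interpret OZ: cp_algebra Z "tri n n" "\<lambda>(i, j). z i j" OZ \<pi>Z \<pi>C
    by unfold_locales (use assms in simp_all)
  interpret mirror_discs n X P w Y R Q x xn y y' ys Z S z \<psi>X \<psi>A \<omega>Y \<omega>B OXY \<pi>XY \<pi>AB OX \<pi>X \<pi>A OZ \<pi>Z \<pi>C ..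
  show ?thesis
    by (rule mirror_sphere_isomorphic) (use assms in \<open>simp_all add: star_iso_def\<close>)
qed

end
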